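(* (a) The category of $2$-Segal semi-simplicial sets is equivalent to the category $\mu\mathcal{SC}at$ of $\mu$-semicategories and their functors. (b) The category of unital $2$-Segal simplicial sets is equivalent to the category $\mu\mathcal{C}at$ of $\mu$-categories and their functors.
   Context: 2-Segal sets. A (semi-)simplicial set $Y$ is $2$-Segal if for every $n\ge2$ and every triangulation $\mathcal{T}$ of a convex $(n+1)$-gon with vertices labelled $0,\dots,n$ counterclockwise, the map $Y_n\to Y_{\mathcal{T}}=\lim_{\{\Delta^p\hookrightarrow\Delta^{\mathcal{T}}\}}Y_p$ is a bijection, where $\Delta^{\mathcal{T}}\subset\Delta^n$ is the union of the faces $\Delta^J$ over vertex sets $J\subset[n]$ of triangles of $\mathcal{T}$ and the limit is over nondegenerate simplices. A $2$-Segal simplicial set $X$ is unital if for all $n\ge2$, $0\le i\le n-1$ the square with top $X_{n-1}\to X_{\{i\}}$, bottom $X_n\to X_{\{i,i+1\}}$, left vertical map the degeneracy $s_i$ (induced by $\sigma_i:[n]\to[n-1]$ with $\sigma_i^{-1}(i)=\{i,i+1\}$) and right vertical map the degeneracy $X_0\to X_1$, is Cartesian. Morphisms are maps of (semi-)simplicial sets. Spans. A span $\sigma:Z\rightsquigarrow Z'$ of sets is a diagram $Z\xleftarrow{s}W\xrightarrow{p}Z'$; morphisms of spans are maps $W_1\to W_2$ commuting with the maps to $Z$ and $Z'$; spans are composed by fiber product. Sets, spans and morphisms of spans form a bicategory $\mathrm{Span}_{\mathrm{Set}}$. A $\mu$-category $\mathfrak{C}$ is a weak category object in $\mathrm{Span}_{\mathrm{Set}}$,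 i.e. consists of: ($\mu$C1) sets $\mathfrak{C}_0,\mathfrak{C}_1$ and maps $s,t:\mathfrak{C}_1\to\mathfrak{C}_0$; ($\mu$C2) a span $\mu:\mathfrak{C}_1\times_{\mathfrak{C}_0}\mathfrak{C}_1\rightsquigarrow\mathfrak{C}_1$ (where $\mathfrak{C}_1\times_{\mathfrak{C}_0}\mathfrak{C}_1$ is the set of pairs $(f,g)$ with $s(f)=t(g)$), compatible with source and target, i.e. an element over $(f,g)$ is sent to an element of $\mathfrak C_1$ with source $s(g)$ and target $t(f)$; ($\mu$C3) an isomorphism of spans $\alpha:\mu\circ(\mu\times\mathrm{Id})\to\mu\circ(\mathrm{Id}\times\mu)$ in $\mathrm{Span}_{\mathrm{Set}}(\mathfrak{C}_1\times_{\mathfrak{C}_0}\mathfrak{C}_1\times_{\mathfrak{C}_0}\mathfrak{C}_1,\mathfrak{C}_1)$; ($\mu$C4) a map $e:\mathfrak{C}_0\to\mathfrak{C}_1$ with $se=te=\mathrm{Id}$ and isomorphisms of spans $\lambda:\mu\circ(et,\mathrm{Id})\to\mathrm{Id}$, $\rho:\mu\circ(\mathrm{Id},es)\to\mathrm{Id}$ in $\mathrm{Span}_{\mathrm{Set}}(\mathfrak{C}_1,\mathfrak{C}_1)$; such that ($\mu$C5) $\alpha$ satisfies the Mac Lane pentagon identity for the five bracketings of the fourfold composition (in spans $\mathfrak{C}_1\times_{\mathfrak{C}_0}\mathfrak{C}_1\times_{\mathfrak{C}_0}\mathfrak{C}_1\times_{\mathfrak{C}_0}\mathfrak{C}_1\rightsquigarrow\mathfrak{C}_1$);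 ($\mu$C6) (unit coherence) the triangle formed by $\alpha:\mu\circ(\mu\circ(\mathrm{Id},es)\times\mathrm{Id})\to\mu\circ(\mathrm{Id}\times\mu\circ(et,\mathrm{Id}))$, $\mu(\rho\times\mathrm{Id})$ and $\mu(\mathrm{Id}\times\lambda)$, with values in $\mu$, commutes. A $\mu$-semicategory consists of the data ($\mu$C1)--($\mu$C3) satisfying ($\mu$C5). A functor $F:\mathfrak{C}\to\mathfrak{D}$ of $\mu$-categories consists of maps $F_i:\mathfrak{C}_i\to\mathfrak{D}_i$, $i=0,1$, commuting with $s,t,e$, and a morphism of spans $\widetilde F_2:F_1\circ\mu_{\mathfrak{C}}\to\mu_{\mathfrak{D}}\circ(F_1\times_{F_0}F_1)$ in $\mathrm{Span}_{\mathrm{Set}}(\mathfrak{C}_1\times_{\mathfrak{C}_0}\mathfrak{C}_1,\mathfrak{D}_1)$ commuting with $\alpha,\lambda,\rho$. A functor of $\mu$-semicategories consists of $F_0,F_1$ commuting with $s,t$, and $\widetilde F_2$ commuting with $\alpha$. *)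

theory Defs
  imports Main "HOL-Library.FuncSet"
begin

section \<open>Categories and equivalences\<close>

text \<open>Hom-sets of different pairs of objects need not be disjoint (the same function may be a map
  into two different codomains), so identities, composition and the action of functors on morphisms
  carry the objects as arguments.\<close>

record ('o, 'm) cat =
  Ob :: "'o set"
  Hom :: "'o \<Rightarrow> 'o \<Rightarrow> 'm set"
  Idm :: "'o \<Rightarrow> 'm"
  Cmp :: "'o \<Rightarrow> 'o \<Rightarrow> 'o \<Rightarrow> 'm \<Rightarrow> 'm \<Rightarrow> 'm"  \<comment> \<open>\<open>Cmp C X Y Z g f\<close> is \<open>g \<circ> f\<close> for \<open>f: X \<rightarrow> Y\<close>, \<open>g: Y \<rightarrow> Z\<close>\<close>

definition is_category :: "('o, 'm) cat \<Rightarrow> bool" where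
  "is_category C \<longleftrightarrow>
     (\<forall>X\<in>Ob C. Idm C X \<in> Hom C X X) \<and>
     (\<forall>X\<in>Ob C. \<forall>Y\<in>Ob C. \<forall>Z\<in>Ob C. \<forall>f\<in>Hom C X Y. \<forall>g\<in>Hom C Y Z. Cmp C X Y Z g f \<in> Hom C X Z) \<and>
     (\<forall>X\<in>Ob C. \<forall>Y\<in>Ob C. \<forall>f\<in>Hom C X Y. Cmp C X X Y f (Idm C X) = f \<and> Cmp C X Y Y (Idm C Y) f = f) \<and>
     (\<forall>W\<in>Ob C. \<forall>X\<in>Ob C. \<forall>Y\<in>Ob C. \<forall>Z\<in>Ob C. \<forall>f\<in>Hom C W X. \<forall>g\<in>Hom C X Y. \<forall>h\<in>Hom C Y Z.
        Cmp C W Y Z h (Cmp C W X Y g f) = Cmp C W X Z (Cmp C X Y Z h g) f)"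

definition is_functor ::
  "('o, 'm) cat \<Rightarrow> ('p, 'n) cat \<Rightarrow> ('o \<Rightarrow> 'p) \<Rightarrow> ('o \<Rightarrow> 'o \<Rightarrow> 'm \<Rightarrow> 'n) \<Rightarrow> bool" where
  "is_functor C D Fo Fm \<longleftrightarrow>
     (\<forall>X\<in>Ob C. Fo X \<in> Ob D) \<and>
     (\<forall>X\<in>Ob C. \<forall>Y\<in>Ob C. \<forall>f\<in>Hom C X Y. Fm X Y f \<in> Hom D (Fo X) (Fo Y)) \<and>
     (\<forall>X\<in>Ob C. Fm X X (Idm C X) = Idm D (Fo X)) \<and>
     (\<forall>X\<in>Ob C. \<forall>Y\<in>Ob C. \<forall>Z\<in>Ob C. \<forall>f\<in>Hom C X Y. \<forall>g\<in>Hom C Y Z.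
        Fm X Z (Cmp C X Y Z g f) = Cmp D (Fo X) (Fo Y) (Fo Z) (Fm Y Z g) (Fm X Y f))"

definition is_iso :: "('o, 'm) cat \<Rightarrow> 'o \<Rightarrow> 'o \<Rightarrow> 'm \<Rightarrow> bool" where
  "is_iso C X Y f \<longleftrightarrow> f \<in> Hom C X Y \<and>
     (\<exists>g\<in>Hom C Y X. Cmp C X Y X g f = Idm C X \<and> Cmp C Y X Y f g = Idm C Y)"

definition naturally_isomorphic ::
  "('o, 'm) cat \<Rightarrow> ('p, 'n) cat \<Rightarrow> ('o \<Rightarrow> 'p) \<Rightarrow> ('o \<Rightarrow> 'o \<Rightarrow> 'm \<Rightarrow> 'n) \<Rightarrow>
    ('o \<Rightarrow> 'p) \<Rightarrow> ('o \<Rightarrow> 'o \<Rightarrow> 'm \<Rightarrow> 'n) \<Rightarrow> bool" where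
  "naturally_isomorphic C D Fo Fm Go Gm \<longleftrightarrow>
     (\<exists>\<eta>. (\<forall>X\<in>Ob C. is_iso D (Fo X) (Go X) (\<eta> X)) \<and>
          (\<forall>X\<in>Ob C. \<forall>Y\<in>Ob C. \<forall>f\<in>Hom C X Y.
             Cmp D (Fo X) (Fo Y) (Go Y) (\<eta> Y) (Fm X Y f) =
             Cmp D (Fo X) (Go X) (Go Y) (Gm X Y f) (\<eta> X)))"

definition equivalent_categories :: "('o, 'm) cat \<Rightarrow> ('p, 'n) cat \<Rightarrow> bool" where
  "equivalent_categories C D \<longleftrightarrow> is_category C \<and> is_category D \<and>
     (\<exists>Fo Fm Go Gm. is_functor C D Fo Fm \<and> is_functor D C Go Gm \<and>
        naturally_isomorphic C C (\<lambda>X. Go (Fo X)) (\<lambda>X Y f. Gm (Fo X) (Fo Y) (Fm X Y f)) (\<lambda>X. X) (\<lambda>X Y f. f) \<and>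
        naturally_isomorphic D D (\<lambda>X. Fo (Go X)) (\<lambda>X Y f. Fm (Go X) (Go Y) (Gm X Y f)) (\<lambda>X. X) (\<lambda>X Y f. f))"

section \<open>Simplicial and semi-simplicial sets\<close>

text \<open>Sets are sets of elements of a type \<open>'u\<close> serving as a universe, and maps of sets are
  extensional functions (\<open>\<rightarrow>\<^sub>E\<close>), so that equality of maps is equality on the domain.
  The ordinal \<open>[n]\<close> is \<open>{..n}\<close>.\<close>

definition Delta :: "nat \<Rightarrow> nat \<Rightarrow> (nat \<Rightarrow> nat) set" where
  "Delta m n = {\<theta> \<in> {..m} \<rightarrow>\<^sub>E {..n}. mono_on {..m} \<theta>}"

definition Delta_inj :: "nat \<Rightarrow> nat \<Rightarrow> (nat \<Rightarrow> nat) set" where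
  "Delta_inj m n = {\<theta> \<in> Delta m n. inj_on \<theta> {..m}}"

text \<open>For \<open>\<theta> : [m] \<rightarrow> [n]\<close>, \<open>act X m n \<theta>\<close> is the induced map \<open>X\<^sub>n \<rightarrow> X\<^sub>m\<close>.\<close>

record 'u simp_data =
  simp :: "nat \<Rightarrow> 'u set"
  act :: "nat \<Rightarrow> nat \<Rightarrow> (nat \<Rightarrow> nat) \<Rightarrow> 'u \<Rightarrow> 'u"

definition is_presheaf :: "(nat \<Rightarrow> nat \<Rightarrow> (nat \<Rightarrow> nat) set) \<Rightarrow> 'u simp_data \<Rightarrow> bool" where
  "is_presheaf \<Theta> X \<longleftrightarrow>
     (\<forall>m n. act X m n \<in> (\<Theta> m n \<rightarrow>\<^sub>E (simp X n \<rightarrow>\<^sub>E simp X m))) \<and>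
     (\<forall>n. \<forall>x\<in>simp X n. act X n n (\<lambda>i\<in>{..n}. i) x = x) \<and>
     (\<forall>l m n. \<forall>\<theta>\<in>\<Theta> l m. \<forall>\<psi>\<in>\<Theta> m n. \<forall>x\<in>simp X n.
        act X l n (compose {..l} \<psi> \<theta>) x = act X l m \<theta> (act X m n \<psi> x))"

definition presheaf_hom ::
  "(nat \<Rightarrow> nat \<Rightarrow> (nat \<Rightarrow> nat) set) \<Rightarrow> 'u simp_data \<Rightarrow> 'u simp_data \<Rightarrow> (nat \<Rightarrow> 'u \<Rightarrow> 'u) set" where
  "presheaf_hom \<Theta> X Y = {f. (\<forall>n. f n \<in> simp X n \<rightarrow>\<^sub>E simp Y n) \<and>
     (\<forall>m n. \<forall>\<theta>\<in>\<Theta> m n. \<forall>x\<in>simp X n. f m (act X m n \<theta> x) = act Y m n \<theta> (f n x))}"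

abbreviation is_simplicial_set :: "'u simp_data \<Rightarrow> bool" where
  "is_simplicial_set \<equiv> is_presheaf Delta"

abbreviation is_semisimplicial_set :: "'u simp_data \<Rightarrow> bool" where
  "is_semisimplicial_set \<equiv> is_presheaf Delta_inj"

section \<open>The 2-Segal and unitality conditions\<close>

text \<open>A triangulation of the convex polygon with vertices \<open>0, \<dots>, n\<close> in cyclic order is given by a
  maximal set of pairwise non-crossing diagonals; an edge between \<open>i < j\<close> is the pair \<open>(i, j)\<close>.\<close>

definition polygon_sides :: "nat \<Rightarrow> (nat \<times> nat) set" where
  "polygon_sides n = {(i, Suc i) | i. i < n} \<union> {(0, n)}"

definition polygon_diagonals :: "nat \<Rightarrow> (nat \<times> nat) set" where
  "polygon_diagonals n = {(i, j). i < j \<and> j \<le> n} - polygon_sides n"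

definition crossing :: "nat \<times> nat \<Rightarrow> nat \<times> nat \<Rightarrow> bool" where
  "crossing d d' \<longleftrightarrow>
     (fst d < fst d' \<and> fst d' < snd d \<and> snd d < snd d') \<or>
     (fst d' < fst d \<and> fst d < snd d' \<and> snd d' < snd d)"

definition triangulating_diagonals :: "nat \<Rightarrow> (nat \<times> nat) set \<Rightarrow> bool" where
  "triangulating_diagonals n D \<longleftrightarrow> D \<subseteq> polygon_diagonals n \<and>
     (\<forall>d\<in>D. \<forall>d'\<in>D. \<not> crossing d d') \<and>
     (\<forall>d\<in>polygon_diagonals n - D. \<exists>d'\<in>D. crossing d d')"

definition triangles :: "nat \<Rightarrow> (nat \<times> nat) set \<Rightarrow> nat set set" where
  "triangles n D = {{i, j, k} | i j k. i < j \<and> j < k \<and> k \<le> n \<and>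
     {(i, j), (j, k), (i, k)} \<subseteq> polygon_sides n \<union> D}"

definition triangulations :: "nat \<Rightarrow> nat set set set" where
  "triangulations n = {triangles n D | D. triangulating_diagonals n D}"

text \<open>The nondegenerate simplices \<open>\<Delta>\<^sup>p \<hookrightarrow> \<Delta>\<^sup>T \<subseteq> \<Delta>\<^sup>n\<close>.\<close>

definition faces :: "nat \<Rightarrow> nat set set \<Rightarrow> (nat \<times> (nat \<Rightarrow> nat)) set" where
  "faces n T = {(p, \<theta>). \<theta> \<in> Delta_inj p n \<and> (\<exists>J\<in>T. \<theta> ` {..p} \<subseteq> J)}"

definition triangulation_limit ::
  "'u simp_data \<Rightarrow> nat \<Rightarrow> nat set set \<Rightarrow> (nat \<times> (nat \<Rightarrow> nat) \<Rightarrow> 'u) set" where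
  "triangulation_limit Y n T = {y \<in> (\<Pi>\<^sub>E (p, \<theta>)\<in>faces n T. simp Y p).
     \<forall>(p, \<theta>)\<in>faces n T. \<forall>q. \<forall>\<phi>\<in>Delta_inj q p.
       act Y q p \<phi> (y (p, \<theta>)) = y (q, compose {..q} \<theta> \<phi>)}"

definition triangulation_map ::
  "'u simp_data \<Rightarrow> nat \<Rightarrow> nat set set \<Rightarrow> 'u \<Rightarrow> (nat \<times> (nat \<Rightarrow> nat) \<Rightarrow> 'u)" where
  "triangulation_map Y n T x = (\<lambda>(p, \<theta>)\<in>faces n T. act Y p n \<theta> x)"

definition is_2_Segal :: "'u simp_data \<Rightarrow> bool" where
  "is_2_Segal Y \<longleftrightarrow> (\<forall>n\<ge>2. \<forall>T\<in>triangulations n.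
     bij_betw (triangulation_map Y n T) (simp Y n) (triangulation_limit Y n T))"

text \<open>The square with top \<open>f : A \<rightarrow> B\<close>, left \<open>g : A \<rightarrow> C\<close>, right \<open>h : B \<rightarrow> D\<close> and bottom \<open>k : C \<rightarrow> D\<close>.\<close>

definition cartesian_square ::
  "'a set \<Rightarrow> 'b set \<Rightarrow> 'c set \<Rightarrow> ('a \<Rightarrow> 'b) \<Rightarrow> ('a \<Rightarrow> 'c) \<Rightarrow> ('b \<Rightarrow> 'd) \<Rightarrow> ('c \<Rightarrow> 'd) \<Rightarrow> bool" where
  "cartesian_square A B C f g h k \<longleftrightarrow>
     bij_betw (\<lambda>a. (f a, g a)) A {(b, c). b \<in> B \<and> c \<in> C \<and> h b = k c}"

definition sigma :: "nat \<Rightarrow> nat \<Rightarrow> nat \<Rightarrow> nat" where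
  "sigma n i = (\<lambda>j\<in>{..n}. if j \<le> i then j else j - 1)"

definition is_unital :: "'u simp_data \<Rightarrow> bool" where
  "is_unital X \<longleftrightarrow> (\<forall>n\<ge>2. \<forall>i<n.
     cartesian_square (simp X (n - 1)) (simp X 0) (simp X n)
       (act X 0 (n - 1) (\<lambda>j\<in>{..0}. i))
       (act X n (n - 1) (sigma n i))
       (act X 1 0 (sigma 1 0))
       (act X 1 n (\<lambda>j\<in>{..1}. i + j)))"

definition presheaf_cat ::
  "(nat \<Rightarrow> nat \<Rightarrow> (nat \<Rightarrow> nat) set) \<Rightarrow> 'u simp_data set \<Rightarrow> ('u simp_data, nat \<Rightarrow> 'u \<Rightarrow> 'u) cat" where
  "presheaf_cat \<Theta> \<X> = \<lparr> Ob = \<X>, Hom = presheaf_hom \<Theta>,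
     Idm = (\<lambda>X n. \<lambda>x\<in>simp X n. x),
     Cmp = (\<lambda>X Y Z g f n. compose (simp X n) (g n) (f n)) \<rparr>"

definition two_Segal_semisimplicial_sets :: "('u simp_data, nat \<Rightarrow> 'u \<Rightarrow> 'u) cat" where
  "two_Segal_semisimplicial_sets =
     presheaf_cat Delta_inj {Y. is_semisimplicial_set Y \<and> is_2_Segal Y}"

definition unital_two_Segal_simplicial_sets :: "('u simp_data, nat \<Rightarrow> 'u \<Rightarrow> 'u) cat" where
  "unital_two_Segal_simplicial_sets =
     presheaf_cat Delta {X. is_simplicial_set X \<and> is_2_Segal X \<and> is_unital X}"

section \<open>Spans of sets\<close>

record ('z, 'w, 'y) span =
  apex :: "'w set"
  lleg :: "'w \<Rightarrow> 'z"
  rleg :: "'w \<Rightarrow> 'y"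

definition is_span :: "'z set \<Rightarrow> 'y set \<Rightarrow> ('z, 'w, 'y) span \<Rightarrow> bool" where
  "is_span Z Z' \<sigma> \<longleftrightarrow> lleg \<sigma> \<in> apex \<sigma> \<rightarrow>\<^sub>E Z \<and> rleg \<sigma> \<in> apex \<sigma> \<rightarrow>\<^sub>E Z'"

definition span_hom :: "('z, 'v, 'y) span \<Rightarrow> ('z, 'w, 'y) span \<Rightarrow> ('v \<Rightarrow> 'w) \<Rightarrow> bool" where
  "span_hom \<sigma> \<tau> \<phi> \<longleftrightarrow> \<phi> \<in> apex \<sigma> \<rightarrow>\<^sub>E apex \<tau> \<and>
     (\<forall>w\<in>apex \<sigma>. lleg \<tau> (\<phi> w) = lleg \<sigma> w \<and> rleg \<tau> (\<phi> w) = rleg \<sigma> w)"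

definition span_iso :: "('z, 'v, 'y) span \<Rightarrow> ('z, 'w, 'y) span \<Rightarrow> ('v \<Rightarrow> 'w) \<Rightarrow> bool" where
  "span_iso \<sigma> \<tau> \<phi> \<longleftrightarrow> span_hom \<sigma> \<tau> \<phi> \<and>
     (\<exists>\<psi>. span_hom \<tau> \<sigma> \<psi> \<and> (\<forall>w\<in>apex \<sigma>. \<psi> (\<phi> w) = w) \<and> (\<forall>w\<in>apex \<tau>. \<phi> (\<psi> w) = w))"

text \<open>\<open>span_comp \<tau> \<sigma>\<close> is \<open>\<tau> \<circ> \<sigma>\<close>; elements of its apex list the element of \<open>\<sigma>\<close> first.\<close>

definition span_comp :: "('y, 'v, 'x) span \<Rightarrow> ('z, 'w, 'y) span \<Rightarrow> ('z, 'w \<times> 'v, 'x) span" where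
  "span_comp \<tau> \<sigma> = \<lparr> apex = {(w, v). w \<in> apex \<sigma> \<and> v \<in> apex \<tau> \<and> rleg \<sigma> w = lleg \<tau> v},
     lleg = lleg \<sigma> \<circ> fst, rleg = rleg \<tau> \<circ> snd \<rparr>"

definition map_span :: "'z set \<Rightarrow> ('z \<Rightarrow> 'y) \<Rightarrow> ('z, 'z, 'y) span" where
  "map_span Z f = \<lparr> apex = Z, lleg = (\<lambda>z. z), rleg = f \<rparr>"

abbreviation id_span :: "'z set \<Rightarrow> ('z, 'z, 'z) span" where
  "id_span Z \<equiv> map_span Z (\<lambda>z. z)"

text \<open>Fiber product of spans over a base set, the targets mapping to the base by \<open>a\<close> and \<open>b\<close>.\<close>

definition span_prod :: "('y \<Rightarrow> 'c) \<Rightarrow> ('y' \<Rightarrow> 'c) \<Rightarrow>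
    ('z, 'w, 'y) span \<Rightarrow> ('z', 'w', 'y') span \<Rightarrow> ('z \<times> 'z', 'w \<times> 'w', 'y \<times> 'y') span" where
  "span_prod a b \<sigma> \<sigma>' =
     \<lparr> apex = {(w, w'). w \<in> apex \<sigma> \<and> w' \<in> apex \<sigma>' \<and> a (rleg \<sigma> w) = b (rleg \<sigma>' w')},
       lleg = map_prod (lleg \<sigma>) (lleg \<sigma>'), rleg = map_prod (rleg \<sigma>) (rleg \<sigma>') \<rparr>"

text \<open>Change of the source of a span along a bijection, used to identify \<open>(A \<times> B) \<times> C\<close> with
  \<open>A \<times> (B \<times> C)\<close>.\<close>

definition span_resource :: "('z \<Rightarrow> 'z') \<Rightarrow> ('z, 'w, 'y) span \<Rightarrow> ('z', 'w, 'y) span" where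
  "span_resource k \<sigma> = \<lparr> apex = apex \<sigma>, lleg = k \<circ> lleg \<sigma>, rleg = rleg \<sigma> \<rparr>"

definition reassoc :: "('a \<times> 'b) \<times> 'c \<Rightarrow> 'a \<times> 'b \<times> 'c" where
  "reassoc = (\<lambda>((a, b), c). (a, (b, c)))"

section \<open>\<open>\<mu>\<close>-semicategories\<close>

record 'u musemicat =
  Ob0 :: "'u set"
  Ar1 :: "'u set"
  src :: "'u \<Rightarrow> 'u"
  tgt :: "'u \<Rightarrow> 'u"
  mu :: "('u \<times> 'u, 'u, 'u) span"
  assoc :: "('u \<times> 'u) \<times> 'u \<Rightarrow> ('u \<times> 'u) \<times> 'u"

definition composable :: "('u, 'b) musemicat_scheme \<Rightarrow> ('u \<times> 'u) set" where
  "composable C = {(f, g). f \<in> Ar1 C \<and> g \<in> Ar1 C \<and> src C f = tgt C g}"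

abbreviation ar_prod :: "('u, 'b) musemicat_scheme \<Rightarrow>
    ('z, 'w, 'u) span \<Rightarrow> ('z', 'w', 'u) span \<Rightarrow> ('z \<times> 'z', 'w \<times> 'w', 'u \<times> 'u) span" where
  "ar_prod C \<equiv> span_prod (src C) (tgt C)"

abbreviation id_ar :: "('u, 'b) musemicat_scheme \<Rightarrow> ('u, 'u, 'u) span" where
  "id_ar C \<equiv> id_span (Ar1 C)"

text \<open>\<open>\<mu> \<circ> (\<mu> \<times> Id)\<close>, with elements \<open>((m, h), m')\<close> where \<open>m\<close> lies over \<open>(f, g)\<close> and \<open>m'\<close> over
  \<open>(rleg m, h)\<close>; and \<open>\<mu> \<circ> (Id \<times> \<mu>)\<close>, with elements \<open>((f, n), n')\<close> where \<open>n\<close> lies over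
  \<open>(g, h)\<close> and \<open>n'\<close> over \<open>(f, rleg n)\<close>.\<close>

definition mu_left :: "('u, 'b) musemicat_scheme \<Rightarrow> (('u \<times> 'u) \<times> 'u, ('u \<times> 'u) \<times> 'u, 'u) span" where
  "mu_left C = span_comp (mu C) (ar_prod C (mu C) (id_ar C))"

definition mu_right :: "('u, 'b) musemicat_scheme \<Rightarrow> ('u \<times> 'u \<times> 'u, ('u \<times> 'u) \<times> 'u, 'u) span" where
  "mu_right C = span_comp (mu C) (ar_prod C (id_ar C) (mu C))"

text \<open>The edges of the pentagon, as maps between the apices of the spans given by the five
  bracketings of a fourfold composition.\<close>

definition pent1 where  \<comment> \<open>\<open>((fg)h)k \<rightarrow> (f(gh))k\<close>\<close>
  "pent1 C = map_prod (map_prod (assoc C) id) id"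

definition pent2 where  \<comment> \<open>\<open>(f(gh))k \<rightarrow> f((gh)k)\<close>\<close>
  "pent2 C = (\<lambda>((((f, n), n'), k), m).
     case assoc C ((n', k), m) of ((f', l), l') \<Rightarrow> ((f', ((n, k), l)), l'))"

definition pent3 where  \<comment> \<open>\<open>f((gh)k) \<rightarrow> f(g(hk))\<close>\<close>
  "pent3 C = map_prod (map_prod id (assoc C)) id"

definition pent4 where  \<comment> \<open>\<open>((fg)h)k \<rightarrow> (fg)(hk)\<close>\<close>
  "pent4 C = (\<lambda>((((m, h), m'), k), m'').
     case assoc C ((m', k), m'') of ((fg, r), r') \<Rightarrow> ((m, r), r'))"

definition pent5 where  \<comment> \<open>\<open>(fg)(hk) \<rightarrow> f(g(hk))\<close>\<close>
  "pent5 C = (\<lambda>((m, r), r').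
     case assoc C ((m, rleg (mu C) r), r') of
       ((f, u), u') \<Rightarrow> ((f, ((snd (lleg (mu C) m), r), u)), u'))"

definition pentagon :: "('u, 'b) musemicat_scheme \<Rightarrow> bool" where
  "pentagon C \<longleftrightarrow>
     (\<forall>w \<in> apex (span_comp (mu C) (ar_prod C (mu_left C) (id_ar C))).
        pent3 C (pent2 C (pent1 C w)) = pent5 C (pent4 C w))"

definition is_musemicat :: "('u, 'b) musemicat_scheme \<Rightarrow> bool" where
  "is_musemicat C \<longleftrightarrow>
     src C \<in> Ar1 C \<rightarrow>\<^sub>E Ob0 C \<and> tgt C \<in> Ar1 C \<rightarrow>\<^sub>E Ob0 C \<and>
     is_span (composable C) (Ar1 C) (mu C) \<and>
     (\<forall>m \<in> apex (mu C). src C (rleg (mu C) m) = src C (snd (lleg (mu C) m)) \<and>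
                        tgt C (rleg (mu C) m) = tgt C (fst (lleg (mu C) m))) \<and>
     span_iso (span_resource reassoc (mu_left C)) (mu_right C) (assoc C) \<and>
     pentagon C"

record 'u mufun =
  F0 :: "'u \<Rightarrow> 'u"
  F1 :: "'u \<Rightarrow> 'u"
  F2 :: "'u \<times> 'u \<Rightarrow> ('u \<times> 'u) \<times> 'u"

text \<open>\<open>F\<^sub>1 \<circ> \<mu>\<^sub>C\<close>, with elements \<open>(m, rleg m)\<close>, and \<open>\<mu>\<^sub>D \<circ> (F\<^sub>1 \<times> F\<^sub>1)\<close>, with elements \<open>((f, g), n)\<close>
  where \<open>n\<close> lies over \<open>(F\<^sub>1 f, F\<^sub>1 g)\<close>.\<close>

definition map_mu :: "('u, 'b) musemicat_scheme \<Rightarrow> ('u \<Rightarrow> 'u) \<Rightarrow> ('u \<times> 'u, 'u \<times> 'u, 'u) span" where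
  "map_mu C F = span_comp (map_span (Ar1 C) F) (mu C)"

definition mu_map :: "('u, 'b) musemicat_scheme \<Rightarrow> ('u, 'b) musemicat_scheme \<Rightarrow> ('u \<Rightarrow> 'u) \<Rightarrow>
    ('u \<times> 'u, ('u \<times> 'u) \<times> 'u, 'u) span" where
  "mu_map C D F = span_comp (mu D) (map_span (composable C) (map_prod F F))"

text \<open>The map from the apex of \<open>\<mu>\<^sub>C\<close> to the apex of \<open>\<mu>\<^sub>D\<close> underlying \<open>F2\<close>.\<close>

definition mu_action :: "('u, 'b) musemicat_scheme \<Rightarrow> 'u mufun \<Rightarrow> 'u \<Rightarrow> 'u" where
  "mu_action C F m = snd (F2 F (m, rleg (mu C) m))"

definition semifunctors ::
  "('u, 'b) musemicat_scheme \<Rightarrow> ('u, 'b) musemicat_scheme \<Rightarrow> 'u mufun set" where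
  "semifunctors C D = {F.
     F0 F \<in> Ob0 C \<rightarrow>\<^sub>E Ob0 D \<and> F1 F \<in> Ar1 C \<rightarrow>\<^sub>E Ar1 D \<and>
     (\<forall>f\<in>Ar1 C. F0 F (src C f) = src D (F1 F f) \<and> F0 F (tgt C f) = tgt D (F1 F f)) \<and>
     span_hom (map_mu C (F1 F)) (mu_map C D (F1 F)) (F2 F) \<and>
     (let G = mu_action C F in
      \<forall>w \<in> apex (mu_left C).
        assoc D (map_prod (map_prod G (F1 F)) G w) = map_prod (map_prod (F1 F) G) G (assoc C w))}"

definition mufun_id :: "('u, 'b) musemicat_scheme \<Rightarrow> 'u mufun" where
  "mufun_id C = \<lparr> F0 = (\<lambda>x\<in>Ob0 C. x), F1 = (\<lambda>f\<in>Ar1 C. f),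
     F2 = (\<lambda>(m, x)\<in>apex (map_mu C (\<lambda>f. f)). (lleg (mu C) m, m)) \<rparr>"

definition mufun_comp :: "('u, 'b) musemicat_scheme \<Rightarrow> 'u mufun \<Rightarrow> 'u mufun \<Rightarrow> 'u mufun" where
  "mufun_comp C G F = \<lparr> F0 = compose (Ob0 C) (F0 G) (F0 F), F1 = compose (Ar1 C) (F1 G) (F1 F),
     F2 = (\<lambda>(m, x)\<in>apex (map_mu C (\<lambda>f. f)).
       case F2 F (m, x) of (fg, n) \<Rightarrow> (fg, snd (F2 G (n, F1 F x)))) \<rparr>"

definition muSCat :: "('u musemicat, 'u mufun) cat" where
  "muSCat = \<lparr> Ob = {C. is_musemicat C}, Hom = semifunctors, Idm = mufun_id,
     Cmp = (\<lambda>X Y Z. mufun_comp X) \<rparr>"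

section \<open>\<open>\<mu>\<close>-categories\<close>

record 'u mucat = "'u musemicat" +
  unit :: "'u \<Rightarrow> 'u"
  lam :: "'u \<times> 'u \<Rightarrow> 'u"
  rho :: "'u \<times> 'u \<Rightarrow> 'u"

text \<open>\<open>\<mu> \<circ> (et, Id)\<close> and \<open>\<mu> \<circ> (Id, es)\<close>.\<close>

definition mu_unit_left :: "'u mucat \<Rightarrow> ('u, 'u \<times> 'u, 'u) span" where
  "mu_unit_left C = span_comp (mu C) (map_span (Ar1 C) (\<lambda>f. (unit C (tgt C f), f)))"

definition mu_unit_right :: "'u mucat \<Rightarrow> ('u, 'u \<times> 'u, 'u) span" where
  "mu_unit_right C = span_comp (mu C) (map_span (Ar1 C) (\<lambda>f. (f, unit C (src C f))))"

text \<open>The edge \<open>\<alpha> : \<mu> \<circ> (\<mu> \<circ> (Id, es) \<times> Id) \<rightarrow> \<mu> \<circ> (Id \<times> \<mu> \<circ> (et, Id))\<close> of the unit triangle. The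
  other two edges take values in \<open>\<mu> \<circ> (Id \<times> Id)\<close>, whose projection to \<open>\<mu>\<close> is a bijection.\<close>

definition unit_assoc where
  "unit_assoc C = (\<lambda>(((f, m), g), m').
     case assoc C ((m, g), m') of ((f', n), n') \<Rightarrow> ((f', (g, n)), n'))"

definition unit_triangle :: "'u mucat \<Rightarrow> bool" where
  "unit_triangle C \<longleftrightarrow>
     (\<forall>w \<in> apex (span_comp (mu C) (ar_prod C (mu_unit_right C) (id_ar C))).
        map_prod (map_prod id (lam C)) id (unit_assoc C w) = map_prod (map_prod (rho C) id) id w)"

definition is_mucat :: "'u mucat \<Rightarrow> bool" where
  "is_mucat C \<longleftrightarrow> is_musemicat C \<and>
     unit C \<in> Ob0 C \<rightarrow>\<^sub>E Ar1 C \<and>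
     (\<forall>x\<in>Ob0 C. src C (unit C x) = x \<and> tgt C (unit C x) = x) \<and>
     span_iso (mu_unit_left C) (id_ar C) (lam C) \<and>
     span_iso (mu_unit_right C) (id_ar C) (rho C) \<and>
     unit_triangle C"

definition mufunctors :: "'u mucat \<Rightarrow> 'u mucat \<Rightarrow> 'u mufun set" where
  "mufunctors C D = {F \<in> semifunctors C D.
     (\<forall>x\<in>Ob0 C. F1 F (unit C x) = unit D (F0 F x)) \<and>
     (\<forall>w \<in> apex (mu_unit_left C). lam D (map_prod (F1 F) (mu_action C F) w) = F1 F (lam C w)) \<and>
     (\<forall>w \<in> apex (mu_unit_right C). rho D (map_prod (F1 F) (mu_action C F) w) = F1 F (rho C w))}"

definition muCat :: "('u mucat, 'u mufun) cat" where
  "muCat = \<lparr> Ob = {C. is_mucat C}, Hom = mufunctors, Idm = mufun_id,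
     Cmp = (\<lambda>X Y Z. mufun_comp X) \<rparr>"

end

theory Submission
  imports Defs
begin

text \<open>A 2-simplex with vertices \<open>0, 1, 2\<close> is an element of the span \<open>\<mu>\<close> over the pair of its edges
  \<open>01\<close> and \<open>12\<close>, a 3-simplex is an instance of \<open>\<alpha>\<close>, and a 4-simplex witnesses the pentagon. Every
  triangulation is built up by attaching ears (triangles \<open>i - 1, i, i + 1\<close>), so the 2-Segal
  condition says that attaching an ear to an \<open>n\<close>-simplex gives a unique \<open>(n + 1)\<close>-simplex.
  Conversely, a \<open>\<mu>\<close>-semicategory has a nerve: an \<open>n\<close>-simplex is a family of objects, arrows and
  elements of \<open>\<mu>\<close> indexed by the chains of length at most three in \<open>[n]\<close>, such that \<open>\<alpha>\<close> relates the
  four faces of each tetrahedron. Ears can be attached to it because elements of \<open>\<mu>\<close> with a common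
  vertex \<open>0\<close> compose associatively by the pentagon, and because \<open>\<alpha>\<close>, being bijective, allows flips of
  quadrilaterals. For units, unitality need only be checked on triangles, where it gives \<open>\<lambda>\<close> and
  \<open>\<rho>\<close>; degenerate simplices of the nerve are supplied by Kelly's coherence of \<open>\<lambda>\<close> and \<open>\<rho>\<close> with
  \<open>\<alpha>\<close>.\<close>

section \<open>Semi-simplicial structure in terms of increasing lists\<close>

text \<open>Every simplex has to be an element of the one type \<open>'u\<close>, whereas a simplex
  of the nerve is a family indexed by chains. Such a family is a finite tuple, and over an infinite
  \<open>'u\<close> iterated pairing codes it by a single element; this is where infinity enters.
  The nerve is studied uncoded as \<open>Cosk\<close> and transported afterwards. Both equivalences
  use one nerve, with two parameters: the admissible morphisms \<open>\<Theta>\<close>, and a rule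
  \<open>w\<close> for the values of a family on lists with repetitions. Comparing \<open>X\<close>
  with its nerve takes work only up to dimension 2: both sides have ears, so bijectivity propagates
  upwards. \<open>assoc\<close> acts on nested tuples and is replaced by the relation
  \<open>tet\<close> between four faces. The pentagon then says that the four tetrahedra of a
  4-simplex through the vertex 0 force the fifth; most computations with \<open>\<alpha>\<close> are
  applications of this. A map of spans into an identity span is its left leg. Hence \<lambda> and
  \<rho> are first projections, their invertibility is a unique-existence statement for triangles
  with a unit edge, and functors of \<mu>-categories are semifunctors preserving units.\<close>

definition semisimp :: "'u simp_data \<Rightarrow> bool" where
  "semisimp X \<longleftrightarrow>
     (\<forall>m n. \<forall>\<theta>\<in>Delta_inj m n. \<forall>x\<in>simp X n. act X m n \<theta> x \<in> simp X m) \<and>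
     (\<forall>n. \<forall>x\<in>simp X n. act X n n (\<lambda>i\<in>{..n}. i) x = x) \<and>
     (\<forall>l m n. \<forall>\<theta>\<in>Delta_inj l m. \<forall>\<psi>\<in>Delta_inj m n. \<forall>x\<in>simp X n.
        act X l n (compose {..l} \<psi> \<theta>) x = act X l m \<theta> (act X m n \<psi> x))"

text \<open>Restricting \<open>g\<close> here lets any function with the right values on
  \<open>{..m}\<close> stand for a morphism, so that list access, \<open>skip\<close> and
  compositions can be used without tracking extensionality.\<close>

definition ap :: "'u simp_data \<Rightarrow> nat \<Rightarrow> nat \<Rightarrow> (nat \<Rightarrow> nat) \<Rightarrow> 'u \<Rightarrow> 'u" where
  "ap X m n g x = act X m n (restrict g {..m}) x"

text \<open>The list is read as a map into \<open>[n]\<close>. In a simplicial set it may repeat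
  entries, so that the same notation covers degenerate simplices such as
  \<open>[0, 0, 1]\<close>.\<close>

definition face :: "'u simp_data \<Rightarrow> nat \<Rightarrow> nat list \<Rightarrow> 'u \<Rightarrow> 'u" where
  "face X n l x = ap X (length l - 1) n (nth l) x"

text \<open>The coface map whose image misses \<open>i\<close>; \<open>bd X n i\<close> below is the
  corresponding face operator, opposite to the vertex \<open>i\<close>.\<close>

definition skip :: "nat \<Rightarrow> nat \<Rightarrow> nat" where
  "skip i j = (if j < i then j else Suc j)"

definition bd :: "'u simp_data \<Rightarrow> nat \<Rightarrow> nat \<Rightarrow> 'u \<Rightarrow> 'u" where
  "bd X n i x = ap X n (Suc n) (skip i) x"

definition smap :: "nat \<Rightarrow> nat \<Rightarrow> (nat \<Rightarrow> nat) \<Rightarrow> bool" where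
  "smap m n g \<longleftrightarrow> (\<forall>i\<le>m. g i \<le> n) \<and> (\<forall>i j. i < j \<and> j \<le> m \<longrightarrow> g i < g j)"

definition incr :: "nat \<Rightarrow> nat list \<Rightarrow> bool" where
  "incr n l \<longleftrightarrow> l \<noteq> [] \<and> sorted_wrt (<) l \<and> (\<forall>i\<in>set l. i \<le> n)"

lemma Delta_inj_iff: "\<theta> \<in> Delta_inj m n \<longleftrightarrow> \<theta> \<in> extensional {..m} \<and> smap m n \<theta>"
proof
  assume "\<theta> \<in> Delta_inj m n"
  then have th: "\<theta> \<in> {..m} \<rightarrow>\<^sub>E {..n}" "mono_on {..m} \<theta>" "inj_on \<theta> {..m}"
    by (auto simp: Delta_inj_def Delta_def)
  have "\<theta> i < \<theta> j" if "i < j" "j \<le> m" for i j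
  proof -
    have "\<theta> i \<le> \<theta> j" using th(2) that by (auto simp: monotone_on_def)
    moreover have "\<theta> i \<noteq> \<theta> j" using th(3) that by (auto simp: inj_on_def)
    ultimately show ?thesis by simp
  qed
  then show "\<theta> \<in> extensional {..m} \<and> smap m n \<theta>" using th(1) by (auto simp: smap_def PiE_def Pi_def)
next
  assume a: "\<theta> \<in> extensional {..m} \<and> smap m n \<theta>"
  then have s: "\<And>i j. i < j \<Longrightarrow> j \<le> m \<Longrightarrow> \<theta> i < \<theta> j" by (auto simp: smap_def)
  have "mono_on {..m} \<theta>"
    unfolding monotone_on_def using s by (metis atMost_iff nat_less_le nle_le order.order_iff_strict)
  moreover have "inj_on \<theta> {..m}"
    unfolding inj_on_def using s by (metis atMost_iff nat_neq_iff less_irrefl)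
  ultimately show "\<theta> \<in> Delta_inj m n" using a by (auto simp: Delta_inj_def Delta_def smap_def PiE_def)
qed

lemma restrict_in_Delta_inj: "restrict g {..m} \<in> Delta_inj m n \<longleftrightarrow> smap m n g"
  by (auto simp: Delta_inj_iff smap_def)

lemma Delta_inj_smap: "\<theta> \<in> Delta_inj m n \<Longrightarrow> smap m n \<theta>"
  by (simp add: Delta_inj_iff)

lemma Delta_inj_restrict: "\<theta> \<in> Delta_inj m n \<Longrightarrow> restrict \<theta> {..m} = \<theta>"
  by (auto simp: Delta_inj_iff extensional_def fun_eq_iff)

lemma act_eq_ap: "\<theta> \<in> Delta_inj m n \<Longrightarrow> act X m n \<theta> x = ap X m n \<theta> x"
  by (simp add: ap_def Delta_inj_restrict)

lemma smap_nth: "incr n l \<Longrightarrow> length l = Suc p \<Longrightarrow> smap p n (nth l)"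
  by (auto simp: smap_def incr_def sorted_wrt_iff_nth_less)

lemma incr_map: "smap m n g \<Longrightarrow> incr m l \<Longrightarrow> incr n (map g l)"
  unfolding smap_def incr_def sorted_wrt_map
  by (auto intro: sorted_wrt_mono_rel[of l "(<)"])

lemma smap_comp: "smap l m h \<Longrightarrow> smap m n g \<Longrightarrow> smap l n (g \<circ> h)"
  by (auto simp: smap_def)

lemma smap_skip: "i \<le> Suc n \<Longrightarrow> smap n (Suc n) (skip i)"
  by (auto simp: smap_def skip_def)

lemma ap_in: "semisimp X \<Longrightarrow> smap m n g \<Longrightarrow> x \<in> simp X n \<Longrightarrow> ap X m n g x \<in> simp X m"
  by (auto simp: semisimp_def ap_def restrict_in_Delta_inj)

lemma ap_id: "semisimp X \<Longrightarrow> x \<in> simp X n \<Longrightarrow> (\<And>i. i \<le> n \<Longrightarrow> g i = i) \<Longrightarrow> ap X n n g x = x"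
proof -
  assume a: "semisimp X" "x \<in> simp X n" "\<And>i. i \<le> n \<Longrightarrow> g i = i"
  have "restrict g {..n} = (\<lambda>i\<in>{..n}. i)" using a(3) by auto
  then show ?thesis using a by (auto simp: semisimp_def ap_def)
qed

lemma ap_cong: "(\<And>i. i \<le> m \<Longrightarrow> g i = h i) \<Longrightarrow> ap X m n g x = ap X m n h x"
proof -
  assume "\<And>i. i \<le> m \<Longrightarrow> g i = h i"
  then have "restrict g {..m} = restrict h {..m}" by auto
  then show ?thesis by (simp add: ap_def)
qed

lemma ap_ap:
  assumes "semisimp X" "smap l m h" "smap m n g" "x \<in> simp X n"
  shows "ap X l m h (ap X m n g x) = ap X l n (g \<circ> h) x"
proof -
  have "compose {..l} (restrict g {..m}) (restrict h {..l}) = restrict (g \<circ> h) {..l}"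
    using assms(2) by (auto simp: compose_def smap_def)
  moreover have "act X l n (compose {..l} (restrict g {..m}) (restrict h {..l})) x
      = act X l m (restrict h {..l}) (act X m n (restrict g {..m}) x)"
    using assms by (simp add: semisimp_def restrict_in_Delta_inj)
  ultimately show ?thesis by (simp add: ap_def)
qed

lemma incr_length: "incr n l \<Longrightarrow> length l = Suc (length l - 1)"
  by (cases l) (auto simp: incr_def)

lemma face_in: "semisimp X \<Longrightarrow> incr n l \<Longrightarrow> length l = Suc p \<Longrightarrow> x \<in> simp X n \<Longrightarrow> face X n l x \<in> simp X p"
  by (simp add: face_def ap_in smap_nth)

lemma face_ap:
  assumes "semisimp X" "smap m n g" "incr m l" "x \<in> simp X n"
  shows "face X m l (ap X m n g x) = face X n (map g l) x"
proof -
  have "face X m l (ap X m n g x) = ap X (length l - 1) n (g \<circ> nth l) x"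
    unfolding face_def using assms incr_length by (intro ap_ap) (auto intro!: smap_nth)
  also have "\<dots> = face X n (map g l) x"
    unfolding face_def using incr_length[OF assms(3)] by (auto intro!: ap_cong)
  finally show ?thesis .
qed

lemma face_act:
  assumes "semisimp X" "\<theta> \<in> Delta_inj m n" "incr m l" "x \<in> simp X n"
  shows "face X m l (act X m n \<theta> x) = face X n (map \<theta> l) x"
  using assms by (simp add: act_eq_ap face_ap Delta_inj_smap)

lemma ap_face:
  assumes "semisimp X" "incr n l" "length l = Suc p" "smap m p g" "x \<in> simp X n"
  shows "ap X m p g (face X n l x) = ap X m n (nth l \<circ> g) x"
  unfolding face_def using assms by (simp add: ap_ap smap_nth)

lemma face_face:
  assumes "semisimp X" "incr n l" "length l = Suc p" "incr p k" "x \<in> simp X n"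
  shows "face X p k (face X n l x) = face X n (map (nth l) k) x"
proof -
  have "face X n l x = ap X p n (nth l) x" using assms by (simp add: face_def)
  then show ?thesis using face_ap[OF assms(1) smap_nth[OF assms(2,3)] assms(4,5)] by simp
qed

lemma bd_in: "semisimp X \<Longrightarrow> i \<le> Suc n \<Longrightarrow> x \<in> simp X (Suc n) \<Longrightarrow> bd X n i x \<in> simp X n"
  by (simp add: bd_def ap_in smap_skip)

lemma face_bd:
  assumes "semisimp X" "i \<le> Suc n" "incr n l" "x \<in> simp X (Suc n)"
  shows "face X n l (bd X n i x) = face X (Suc n) (map (skip i) l) x"
  unfolding bd_def using assms by (intro face_ap smap_skip) auto

lemma ap_bd:
  assumes "semisimp X" "i \<le> Suc n" "smap m n g" "x \<in> simp X (Suc n)"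
  shows "ap X m n g (bd X n i x) = ap X m (Suc n) (skip i \<circ> g) x"
  unfolding bd_def using assms by (intro ap_ap smap_skip) auto

lemma bd_bd:
  assumes "semisimp X" "i < j" "j \<le> Suc (Suc n)" "x \<in> simp X (Suc (Suc n))"
  shows "bd X n i (bd X (Suc n) j x) = bd X n (j - 1) (bd X (Suc n) i x)"
proof -
  have "bd X n i (bd X (Suc n) j x) = ap X n (Suc (Suc n)) (skip j \<circ> skip i) x"
    using assms ap_bd[OF assms(1,3) smap_skip] by (simp add: bd_def)
  also have "\<dots> = ap X n (Suc (Suc n)) (skip i \<circ> skip (j - 1)) x"
    using assms by (intro ap_cong) (auto simp: skip_def)
  also have "\<dots> = bd X n (j - 1) (bd X (Suc n) i x)"
    using assms ap_bd[of X i "Suc n" n "skip (j - 1)"] smap_skip[of "j - 1" n] by (simp add: bd_def)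
  finally show ?thesis .
qed

lemma face_all:
  assumes "semisimp X" "x \<in> simp X n"
  shows "face X n [0..<Suc n] x = x"
  unfolding face_def using assms by (auto intro!: ap_id simp del: upt_Suc)

lemma incr_simps [simp]:
  "incr n [a] \<longleftrightarrow> a \<le> n"
  "incr n [a,b] \<longleftrightarrow> a < b \<and> b \<le> n"
  "incr n [a,b,c] \<longleftrightarrow> a < b \<and> b < c \<and> c \<le> n"
  "incr n [a,b,c,d] \<longleftrightarrow> a < b \<and> b < c \<and> c < d \<and> d \<le> n"
  by (auto simp: incr_def)

lemma bd_last_face:
  assumes "semisimp X" "x \<in> simp X 3"
  shows "bd X 2 0 x = face X 3 [1,2,3] x" "bd X 2 1 x = face X 3 [0,2,3] x"
    "bd X 2 2 x = face X 3 [0,1,3] x" "bd X 2 3 x = face X 3 [0,1,2] x"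
  unfolding bd_def face_def
  by (auto intro!: ap_cong simp: skip_def numeral_3_eq_3 numeral_2_eq_2 le_Suc_eq)

text \<open>For \<open>\<Theta> = Delta\<close> this forgets the degeneracies, so that every
  argument about ears applies to simplicial sets as well.\<close>

lemma presheaf_semisimp:
  assumes "is_presheaf \<Theta> X" "\<And>m n. Delta_inj m n \<subseteq> \<Theta> m n"
  shows "semisimp X"
proof -
  have 1: "act X m n \<theta> x \<in> simp X m" if "\<theta> \<in> Delta_inj m n" "x \<in> simp X n" for m n \<theta> x
  proof -
    have "act X m n \<in> (\<Theta> m n \<rightarrow>\<^sub>E (simp X n \<rightarrow>\<^sub>E simp X m))"
      using assms(1) by (auto simp: is_presheaf_def)
    moreover have "\<theta> \<in> \<Theta> m n" using that assms(2) by auto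
    ultimately have "act X m n \<theta> \<in> simp X n \<rightarrow>\<^sub>E simp X m" by (rule PiE_mem)
    then show ?thesis using that(2) by (rule PiE_mem)
  qed
  show ?thesis
    unfolding semisimp_def using assms 1 unfolding is_presheaf_def by (meson subsetD)
qed

lemma semisimplicial_semisimp: "is_semisimplicial_set X \<Longrightarrow> semisimp X"
  by (erule presheaf_semisimp) auto

lemma simplicial_semisimp: "is_simplicial_set X \<Longrightarrow> semisimp X"
  by (erule presheaf_semisimp) (auto simp: Delta_inj_def)

section \<open>Ears of polygons\<close>

text \<open>Cutting off the ear \<open>i - 1, i, i + 1\<close> leaves the polygon without the vertex \<open>i\<close>; the ears at the
  last vertex are cut off along the diagonal \<open>0, n\<close>.\<close>

definition ears :: "'u simp_data \<Rightarrow> bool" where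
  "ears X \<longleftrightarrow> (\<forall>n i. 1 \<le> i \<and> i \<le> n \<longrightarrow> (\<forall>a\<in>simp X n. \<forall>b\<in>simp X 2.
     face X n [i - 1, i] a = face X 2 [0, 2] b \<longrightarrow>
     (\<exists>!x. x \<in> simp X (Suc n) \<and> bd X n i x = a \<and> face X (Suc n) [i - 1, i, Suc i] x = b)))"

definition last_ears :: "'u simp_data \<Rightarrow> bool" where
  "last_ears X \<longleftrightarrow> (\<forall>n\<ge>2. \<forall>a\<in>simp X n. \<forall>b\<in>simp X 2.
     face X n [0, n] a = face X 2 [0, 1] b \<longrightarrow>
     (\<exists>!x. x \<in> simp X (Suc n) \<and> bd X n (Suc n) x = a \<and> face X (Suc n) [0, n, Suc n] x = b))"

text \<open>The triangulation of the quadrilateral by the diagonal 13; the case \<open>n = 2\<close>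
  of \<open>last_ears\<close> is the one by the diagonal 02. Together they make the passage from one
  diagonal to the other a bijection.\<close>

definition flip :: "'u simp_data \<Rightarrow> bool" where
  "flip X \<longleftrightarrow> (\<forall>a\<in>simp X 2. \<forall>b\<in>simp X 2. face X 2 [1, 2] a = face X 2 [0, 2] b \<longrightarrow>
     (\<exists>!x. x \<in> simp X 3 \<and> face X 3 [0, 1, 3] x = a \<and> face X 3 [1, 2, 3] x = b))"

lemma last_ears_unique:
  assumes "last_ears X" "semisimp X" "2 \<le> n" "x \<in> simp X (Suc n)" "y \<in> simp X (Suc n)"
    "bd X n (Suc n) x = bd X n (Suc n) y" "face X (Suc n) [0, n, Suc n] x = face X (Suc n) [0, n, Suc n] y"
  shows "x = y"
proof -
  let ?a = "bd X n (Suc n) x" and ?b = "face X (Suc n) [0, n, Suc n] x"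
  have "face X n [0, n] ?a = face X 2 [0, 1] ?b"
    using assms by (simp add: face_bd face_face skip_def)
  moreover have "?a \<in> simp X n" "?b \<in> simp X 2" using assms by (auto intro: bd_in face_in)
  ultimately have "\<exists>!x. x \<in> simp X (Suc n) \<and> bd X n (Suc n) x = ?a \<and> face X (Suc n) [0, n, Suc n] x = ?b"
    using assms by (simp add: last_ears_def)
  then show ?thesis using assms by metis
qed

lemma flip_unique:
  assumes "flip X" "semisimp X" "x \<in> simp X 3" "y \<in> simp X 3"
    "face X 3 [0,1,3] x = face X 3 [0,1,3] y" "face X 3 [1,2,3] x = face X 3 [1,2,3] y"
  shows "x = y"
proof -
  let ?a = "face X 3 [0,1,3] x" and ?b = "face X 3 [1,2,3] x"
  have "face X 2 [1,2] ?a = face X 2 [0, 2] ?b"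
    using assms by (simp add: face_face)
  moreover have "?a \<in> simp X 2" "?b \<in> simp X 2" using assms by (auto intro: face_in)
  ultimately have "\<exists>!x. x \<in> simp X 3 \<and> face X 3 [0,1,3] x = ?a \<and> face X 3 [1,2,3] x = ?b"
    using assms(1) by (simp add: flip_def)
  then show ?thesis using assms by metis
qed

lemma ears_unique:
  assumes "ears X" "semisimp X" "1 \<le> i" "i \<le> n" "x \<in> simp X (Suc n)" "y \<in> simp X (Suc n)"
    "bd X n i x = bd X n i y" "face X (Suc n) [i - 1, i, Suc i] x = face X (Suc n) [i - 1, i, Suc i] y"
  shows "x = y"
proof -
  let ?a = "bd X n i x" and ?b = "face X (Suc n) [i - 1, i, Suc i] x"
  have "face X n [i - 1, i] ?a = face X 2 [0, 2] ?b"
    using assms by (simp add: face_bd face_face skip_def)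
  moreover have "?a \<in> simp X n" "?b \<in> simp X 2" using assms by (auto intro: bd_in face_in)
  ultimately have "\<exists>!x. x \<in> simp X (Suc n) \<and> bd X n i x = ?a \<and> face X (Suc n) [i - 1, i, Suc i] x = ?b"
    using assms by (simp add: ears_def)
  then show ?thesis using assms by metis
qed

text \<open>Two triangulations of a polygon are related by flips of diagonals, so it suffices to treat one
  triangulation (the fan at the vertex \<open>0\<close>) and the flip of a quadrilateral.\<close>

lemma ears_from_last_ears:
  assumes X: "semisimp X" and L: "last_ears X" and F: "flip X"
  shows "ears X"
proof -
  have Lex: "\<exists>x. x \<in> simp X (Suc n) \<and> bd X n (Suc n) x = a \<and> face X (Suc n) [0, n, Suc n] x = b"
    if "2 \<le> n" "a \<in> simp X n" "b \<in> simp X 2" "face X n [0, n] a = face X 2 [0, 1] b" for n a b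
    using L that unfolding last_ears_def by blast
  have Fex: "\<exists>x. x \<in> simp X 3 \<and> face X 3 [0, 1, 3] x = a \<and> face X 3 [1, 2, 3] x = b"
    if "a \<in> simp X 2" "b \<in> simp X 2" "face X 2 [1, 2] a = face X 2 [0, 2] b" for a b
    using F that unfolding flip_def by blast
  note LU = last_ears_unique[OF L X] and FU = flip_unique[OF F X]
  have "1 \<le> i \<Longrightarrow> i \<le> n \<Longrightarrow> a \<in> simp X n \<Longrightarrow> b \<in> simp X 2 \<Longrightarrow>
     face X n [i - 1, i] a = face X 2 [0, 2] b \<Longrightarrow>
     (\<exists>!x. x \<in> simp X (Suc n) \<and> bd X n i x = a \<and> face X (Suc n) [i - 1, i, Suc i] x = b)" for n i a b
  proof (induction n arbitrary: i a b)
    case 0 then show ?case by simp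
  next
    case (Suc m)
    note IH = Suc.IH and pr = Suc.prems
    consider (zero) "m = 0" | (one1) "m = 1" "i = 1" | (one2) "m = 1" "i = 2"
      | (inner) "2 \<le> m" "i \<le> m" | (last) "2 \<le> m" "i = Suc m" using pr(1,2) by linarith
    then show ?case
    proof cases
      \<comment> \<open>The polygon consists of the ear alone, so \<open>b\<close> is the filler and
        \<open>a\<close> its long edge.\<close>
      case zero
      have all: "face X 2 [0,1,2] x = x" if "x \<in> simp X 2" for x
        using face_all[OF X that] by (simp add: upt_rec numeral_2_eq_2)
      have 1: "bd X 1 1 b = a"
      proof -
        have "bd X 1 1 b = face X 2 [0,2] b"
          unfolding bd_def face_def by (auto intro!: ap_cong simp: skip_def le_Suc_eq numeral_2_eq_2)
        also have "\<dots> = face X 1 [0,1] a" using pr zero by simp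
        also have "\<dots> = a" using face_all[OF X, of a 1] pr zero by simp
        finally show ?thesis .
      qed
      have 2: "i = 1" using zero pr by simp
      have all': "face X (Suc (Suc 0)) [1 - 1, 1, Suc 1] x = x" if "x \<in> simp X (Suc (Suc 0))" for x
        using all[of x] that by (simp add: numeral_2_eq_2)
      have 1: "b \<in> simp X (Suc (Suc 0))" "bd X (Suc 0) 1 b = a"
        using 1 pr(4) by (simp_all add: numeral_2_eq_2)
      show ?thesis unfolding zero 2
      proof (rule ex1I[of _ b], intro conjI)
        fix x assume "x \<in> simp X (Suc (Suc 0)) \<and> bd X (Suc 0) 1 x = a \<and> face X (Suc (Suc 0)) [1 - 1, 1, Suc 1] x = b"
        then show "x = b" using all'[of x] by metis
      qed (use 1 all'[of b] in auto)
    next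
      \<comment> \<open>In a quadrilateral the ears at 1 and at 3 are separated by the same diagonal
        02: this is \<open>last_ears\<close> with \<open>a\<close> and \<open>b\<close>
        exchanged.\<close>
      case one1
      have n2: "Suc 1 = 2" "Suc 2 = 3" by simp_all
      have S: "Suc m = 2" "Suc (Suc m) = 3" using one1 by simp_all
      have m: "face X 2 [0,2] b = face X 2 [0,1] a" using pr(5) unfolding one1 by (simp add: numeral_2_eq_2)
      have s3: "Suc (2::nat) = 3" by simp
      show ?thesis unfolding S(1) s3 one1(2)
      proof (rule ex_ex1I)
        obtain x where x: "x \<in> simp X 3" "bd X 2 3 x = b" "face X 3 [0,2,3] x = a"
          using Lex[of 2 b a, OF order_refl pr(4) _ m] pr(3) unfolding S n2 by blast
        then show "\<exists>x. x \<in> simp X 3 \<and> bd X 2 1 x = a \<and> face X 3 [1 - 1, 1, Suc 1] x = b"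
          using bd_last_face[OF X x(1)] by (intro exI[of _ x]) (simp add: numeral_2_eq_2 numeral_3_eq_3)
      next
        fix x y assume xy: "x \<in> simp X 3 \<and> bd X 2 1 x = a \<and> face X 3 [1 - 1, 1, Suc 1] x = b"
          "y \<in> simp X 3 \<and> bd X 2 1 y = a \<and> face X 3 [1 - 1, 1, Suc 1] y = b"
        show "x = y" using LU[of 2 x y] xy bd_last_face[OF X, of x] bd_last_face[OF X, of y]
          by (simp add: numeral_2_eq_2 numeral_3_eq_3)
      qed
    next
      \<comment> \<open>The ear at 2 is cut off by the diagonal 13, which is the situation of
        \<open>flip\<close>.\<close>
      case one2
      have S: "Suc m = 2" "Suc (Suc m) = 3" using one2 by simp_all
      have l: "[2 - 1, 2, Suc 2] = [1,2,3::nat]" "[2 - 1, 2] = [1,2::nat]" by simp_all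
      have s3: "Suc (2::nat) = 3" by simp
      show ?thesis unfolding S(1) one2(2) l unfolding s3
      proof (rule ex_ex1I)
        obtain x where x: "x \<in> simp X 3" "face X 3 [0,1,3] x = a" "face X 3 [1,2,3] x = b"
          using Fex[of a b] pr S one2 l by metis
        then show "\<exists>x. x \<in> simp X 3 \<and> bd X 2 2 x = a \<and> face X 3 [1,2,3] x = b"
          using bd_last_face[OF X x(1)] by (intro exI[of _ x]) simp
      next
        fix x y assume "x \<in> simp X 3 \<and> bd X 2 2 x = a \<and> face X 3 [1,2,3] x = b"
          "y \<in> simp X 3 \<and> bd X 2 2 y = a \<and> face X 3 [1,2,3] y = b"
        then show "x = y" using FU[of x y] bd_last_face[OF X, of x] bd_last_face[OF X, of y] by simp
      qed
    next
      \<comment> \<open>The ear at \<open>i\<close> and the triangle \<open>0, m+1, m+2\<close> do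
        not overlap. The last vertex is removed from \<open>a\<close>, the ear is attached by the
        induction hypothesis, and the triangle is put back with \<open>last_ears\<close>.\<close>
      case inner
      let ?n = "Suc (Suc m)"
      have com: "bd X m i (bd X (Suc m) ?n x) = bd X m (Suc m) (bd X (Suc m) i x)" 
        "face X (Suc m) [0, m, Suc m] (bd X (Suc m) i x) = face X ?n [0, Suc m, ?n] x"
        "face X (Suc m) [i - 1, i, Suc i] (bd X (Suc m) ?n x) = face X ?n [i - 1, i, Suc i] x"
        if "x \<in> simp X ?n" for x
        using that inner pr(1) less_imp_diff_less[of i "Suc (Suc m)" "Suc 0"]
        by (simp_all add: bd_bd X face_bd skip_def)
      show ?thesis
      proof (rule ex_ex1I)
        have a1: "bd X m (Suc m) a \<in> simp X m" by (simp add: X bd_in pr)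
        have "face X m [i - 1, i] (bd X m (Suc m) a) = face X 2 [0,2] b"
          using pr inner less_imp_diff_less[of i "Suc m" "Suc 0"] by (simp add: face_bd X skip_def)
        then obtain z where z: "z \<in> simp X (Suc m)" "bd X m i z = bd X m (Suc m) a"
          "face X (Suc m) [i - 1, i, Suc i] z = b"
          using IH[OF pr(1) inner(2) a1 pr(4)] by blast
        have c: "face X (Suc m) [0,m,Suc m] a \<in> simp X 2" using pr X inner by (auto intro!: face_in)
        have "face X (Suc m) [0, Suc m] z = face X m [0, m] (bd X m i z)"
          using z(1) pr inner by (simp add: face_bd X skip_def)
        also have "\<dots> = face X m [0, m] (bd X m (Suc m) a)" by (simp only: z(2))
        also have "\<dots> = face X 2 [0,1] (face X (Suc m) [0,m,Suc m] a)"
          using pr inner by (simp add: face_bd X skip_def face_face)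
        finally obtain x where x: "x \<in> simp X ?n" "bd X (Suc m) ?n x = z"
          "face X ?n [0, Suc m, ?n] x = face X (Suc m) [0,m,Suc m] a"
          using Lex[of "Suc m" z, OF _ z(1) c] inner by auto
        have "bd X (Suc m) i x = a"
        proof (rule LU[of m])
          show "2 \<le> m" "bd X (Suc m) i x \<in> simp X (Suc m)" "a \<in> simp X (Suc m)"
            using inner x pr X by (auto intro: bd_in)
          show "bd X m (Suc m) (bd X (Suc m) i x) = bd X m (Suc m) a"
            using com(1)[OF x(1)] x z by simp
          show "face X (Suc m) [0, m, Suc m] (bd X (Suc m) i x) = face X (Suc m) [0, m, Suc m] a"
            using com(2)[OF x(1)] x by simp
        qed
        then show "\<exists>x. x \<in> simp X ?n \<and> bd X (Suc m) i x = a \<and> face X ?n [i - 1, i, Suc i] x = b"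
          using x z com(3)[OF x(1)] by auto
      next
        fix x y assume xy: "x \<in> simp X ?n \<and> bd X (Suc m) i x = a \<and> face X ?n [i - 1, i, Suc i] x = b"
          "y \<in> simp X ?n \<and> bd X (Suc m) i y = a \<and> face X ?n [i - 1, i, Suc i] y = b"
        have ba: "bd X m (Suc m) a \<in> simp X m" by (simp add: X bd_in pr)
        have "face X m [i - 1, i] (bd X m (Suc m) a) = face X 2 [0,2] b"
          using pr inner less_imp_diff_less[of i "Suc m" "Suc 0"] by (simp add: face_bd X skip_def)
        then have "\<exists>!z. z \<in> simp X (Suc m) \<and> bd X m i z = bd X m (Suc m) a \<and> face X (Suc m) [i - 1, i, Suc i] z = b"
          using IH[OF pr(1) inner(2) ba pr(4)] by blast
        moreover have "bd X (Suc m) ?n x \<in> simp X (Suc m)" "bd X (Suc m) ?n y \<in> simp X (Suc m)"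
          using xy X by (auto intro: bd_in)
        ultimately have "bd X (Suc m) ?n x = bd X (Suc m) ?n y"
          using xy com(1,3) by metis
        moreover have "face X ?n [0, Suc m, ?n] x = face X ?n [0, Suc m, ?n] y"
          using xy com(2) by metis
        ultimately show "x = y" using xy LU[of "Suc m" x y] inner by simp
      qed
    next
      \<comment> \<open>The ear \<open>m, m+1, m+2\<close> overlaps the last triangle of the fan.
        Inside the tetrahedron \<open>0, m, m+1, m+2\<close> it is flipped, together with the
        triangle \<open>0, m, m+2\<close> of \<open>a\<close>, into the triangles
        \<open>0, m, m+1\<close> and \<open>0, m+1, m+2\<close>; these can be attached one after the
        other by \<open>last_ears\<close>.\<close>
      case last
      let ?n = "Suc (Suc m)"
      have l: "[Suc m - 1, Suc m, ?n] = [m, Suc m, ?n]" "[Suc m - 1, Suc m] = [m, Suc m]" by simp_all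
      let ?w = "face X ?n [0, m, Suc m, ?n]"
      have com: "bd X m (Suc m) (bd X (Suc m) (Suc m) x) = bd X m (Suc m) (bd X (Suc m) ?n x)" 
        "face X (Suc m) [0, m, Suc m] (bd X (Suc m) (Suc m) x) = face X 3 [0,1,3] (?w x)"
        "face X (Suc m) [0, m, Suc m] (bd X (Suc m) ?n x) = face X 3 [0,1,2] (?w x)"
        "face X ?n [m, Suc m, ?n] x = face X 3 [1,2,3] (?w x)"
        "face X ?n [0, Suc m, ?n] x = face X 3 [0,2,3] (?w x)"
        "?w x \<in> simp X 3"
        if "x \<in> simp X ?n" for x
        using that last pr(1) bd_bd[OF X, of "Suc m" ?n m x]
        by (simp_all add: X face_bd face_face face_in skip_def)
      show ?thesis unfolding last(2) l
      proof (rule ex_ex1I)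
        have a: "a \<in> simp X (Suc m)" "face X (Suc m) [m, Suc m] a = face X 2 [0,2] b"
          using pr last by simp_all
        have "face X 2 [1,2] (face X (Suc m) [0,m,Suc m] a) = face X 2 [0,2] b"
          using a last by (simp add: X face_face)
        moreover have "face X (Suc m) [0,m,Suc m] a \<in> simp X 2" using pr X last by (auto intro!: face_in)
        ultimately obtain y where y: "y \<in> simp X 3" "face X 3 [0,1,3] y = face X (Suc m) [0,m,Suc m] a"
          "face X 3 [1,2,3] y = b" using Fex pr by metis
        have "face X m [0, m] (bd X m (Suc m) a) = face X 2 [0,1] (face X (Suc m) [0,m,Suc m] a)"
          using a last by (simp add: X face_face face_bd skip_def)
        also have "\<dots> = face X 2 [0,1] (face X 3 [0,1,2] y)"
          unfolding y(2)[symmetric] using y(1) by (simp add: X face_face)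
        finally obtain z where z: "z \<in> simp X (Suc m)" "bd X m (Suc m) z = bd X m (Suc m) a"
          "face X (Suc m) [0, m, Suc m] z = face X 3 [0,1,2] y"
          using Lex[OF last(1), of "bd X m (Suc m) a" "face X 3 [0,1,2] y"]
            bd_in[OF X _ a(1), of "Suc m"] face_in[OF X _ _ y(1), of "[0,1,2]" 2] by auto
        have "face X (Suc m) [0, Suc m] z = face X 2 [0,2] (face X (Suc m) [0, m, Suc m] z)"
          using z(1) last by (simp add: X face_face)
        also have "\<dots> = face X 2 [0,1] (face X 3 [0,2,3] y)"
          unfolding z(3) using y(1) by (simp add: X face_face)
        finally obtain x where x: "x \<in> simp X ?n" "bd X (Suc m) ?n x = z" 
          "face X ?n [0, Suc m, ?n] x = face X 3 [0,2,3] y"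
          using Lex[of "Suc m" z "face X 3 [0,2,3] y"] last z(1)
            face_in[OF X _ _ y(1), of "[0,2,3]" 2] by auto
        have w: "?w x = y"
          by (rule LU[of 2]) (use com[OF x(1)] x z y bd_last_face[OF X] in \<open>simp_all add: numeral_3_eq_3\<close>)
        have "bd X (Suc m) (Suc m) x = a"
          by (rule LU[of m]) (use com[OF x(1)] x z y w a X last in \<open>auto intro: bd_in\<close>)
        then show "\<exists>x. x \<in> simp X ?n \<and> bd X (Suc m) (Suc m) x = a \<and> face X ?n [m, Suc m, ?n] x = b"
          using x y com[OF x(1)] w by auto
      next
        fix x y assume xy: "x \<in> simp X ?n \<and> bd X (Suc m) (Suc m) x = a \<and> face X ?n [m, Suc m, ?n] x = b"
          "y \<in> simp X ?n \<and> bd X (Suc m) (Suc m) y = a \<and> face X ?n [m, Suc m, ?n] y = b"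
        then have w: "?w x = ?w y" using com[of x] com[of y] FU[of "?w x" "?w y"] by auto
        have "bd X (Suc m) ?n x = bd X (Suc m) ?n y"
          by (rule LU[of m]) (use xy com[of x] com[of y] w X last in \<open>auto intro: bd_in\<close>)
        then show "x = y" using xy com[of x] com[of y] w last LU[of "Suc m" x y] by auto
      qed
    qed
  qed
  then show ?thesis unfolding ears_def by blast
qed

section \<open>Comparison maps between semi-simplicial sets with ears, possibly over different
  universes\<close>

definition natural_map :: "'u simp_data \<Rightarrow> 'v simp_data \<Rightarrow> (nat \<Rightarrow> 'u \<Rightarrow> 'v) \<Rightarrow> bool" where
  "natural_map X Y f \<longleftrightarrow> (\<forall>n. \<forall>x\<in>simp X n. f n x \<in> simp Y n) \<and>
     (\<forall>m n. \<forall>\<theta>\<in>Delta_inj m n. \<forall>x\<in>simp X n. f m (act X m n \<theta> x) = act Y m n \<theta> (f n x))"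

lemma natural_map_ap:
  "natural_map X Y f \<Longrightarrow> smap m n g \<Longrightarrow> x \<in> simp X n \<Longrightarrow> f m (ap X m n g x) = ap Y m n g (f n x)"
  by (simp add: natural_map_def ap_def restrict_in_Delta_inj)

lemma natural_map_face:
  "natural_map X Y f \<Longrightarrow> incr n l \<Longrightarrow> length l = Suc p \<Longrightarrow> x \<in> simp X n \<Longrightarrow>
    f p (face X n l x) = face Y n l (f n x)"
  by (simp add: face_def natural_map_ap smap_nth)

lemma natural_map_bd:
  "natural_map X Y f \<Longrightarrow> i \<le> Suc n \<Longrightarrow> x \<in> simp X (Suc n) \<Longrightarrow> f n (bd X n i x) = bd Y n i (f (Suc n) x)"
  by (simp add: bd_def natural_map_ap smap_skip)

text \<open>On both sides an \<open>(n+1)\<close>-simplex is the same as its face opposite to the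
  vertex 1 together with the ear \<open>0, 1, 2\<close> and a matching condition on one edge.
  Bijectivity in dimensions \<open>n\<close>, 2 and 1 therefore gives it in dimension
  \<open>n + 1\<close>.\<close>

lemma natural_map_bij:
  assumes X: "semisimp X" "ears X" and Y: "semisimp Y" "ears Y" and f: "natural_map X Y f"
    and low: "\<And>n. n \<le> 2 \<Longrightarrow> bij_betw (f n) (simp X n) (simp Y n)"
  shows "bij_betw (f n) (simp X n) (simp Y n)"
proof (induction n)
  case 0 show ?case using low by simp
next
  case (Suc n)
  show ?case
  proof (cases "n \<le> 1")
    case True then show ?thesis using low[of "Suc n"] by simp
  next
    case False
    then have n: "1 \<le> n" by simp
    have fin: "f k x \<in> simp Y k" if "x \<in> simp X k" for k x using f that by (auto simp: natural_map_def)
    have inj: "x = y" if "x \<in> simp X k" "y \<in> simp X k" "f k x = f k y" "k = n \<or> k \<le> 2" for k x y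
      using that low Suc.IH by (auto simp: bij_betw_def inj_on_def)
    note nat = natural_map_bd[OF f, of 1] natural_map_face[OF f, of _ "[0,1,2]" 2]
    show ?thesis
    proof (rule bij_betw_imageI)
      show "inj_on (f (Suc n)) (simp X (Suc n))"
      proof (rule inj_onI)
        fix x y assume xy: "x \<in> simp X (Suc n)" "y \<in> simp X (Suc n)" "f (Suc n) x = f (Suc n) y"
        have "bd X n 1 x = bd X n 1 y" by (rule inj[of _ n]) (use xy X n nat(1)[of n x] nat(1)[of n y] in \<open>auto intro: bd_in\<close>)
        moreover have "face X (Suc n) [1 - 1,1,Suc 1] x = face X (Suc n) [1 - 1,1,Suc 1] y"
          by (rule inj[of _ 2]) (use xy X n nat(2)[of "Suc n" x] nat(2)[of "Suc n" y] in \<open>auto simp: numeral_2_eq_2 intro!: face_in\<close>)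
        ultimately show "x = y" using ears_unique[of X 1 n, OF X(2,1)] xy n by auto
      qed
    next
      have "y \<in> f (Suc n) ` simp X (Suc n)" if y: "y \<in> simp Y (Suc n)" for y
      proof -
        obtain a where a: "a \<in> simp X n" "f n a = bd Y n 1 y"
          using bij_betw_imp_surj_on[OF Suc.IH] bd_in[OF Y(1) _ y, of 1] by force
        have "face Y (Suc n) [0,1,2] y \<in> simp Y 2" using y n by (auto intro!: face_in Y)
        then obtain b where b: "b \<in> simp X 2" "f 2 b = face Y (Suc n) [0,1,2] y"
          using bij_betw_imp_surj_on[OF low[of 2, OF order_refl]] by (metis imageE)
        have "face X n [0,1] a = face X 2 [0,2] b"
        proof (rule inj[of _ 1])
          show "face X n [0,1] a \<in> simp X 1" "face X 2 [0,2] b \<in> simp X 1"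
            using a b n X by (auto intro!: face_in)
          have "f 1 (face X n [0,1] a) = face Y n [0,1] (bd Y n 1 y)"
            using a n by (simp add: natural_map_face[OF f])
          also have "\<dots> = face Y 2 [0,2] (face Y (Suc n) [0,1,2] y)"
            using y n by (simp add: Y face_bd face_face skip_def numeral_2_eq_2)
          also have "\<dots> = f 1 (face X 2 [0,2] b)" using b by (simp add: natural_map_face[OF f])
          finally show "f 1 (face X n [0,1] a) = f 1 (face X 2 [0,2] b)" .
        qed auto
        then obtain x where x: "x \<in> simp X (Suc n)" "bd X n 1 x = a" "face X (Suc n) [0,1,2] x = b"
          using X(2) n a b unfolding ears_def by (metis diff_self_eq_0 one_add_one order_refl plus_1_eq_Suc)
        have "f (Suc n) x = y"
          by (rule ears_unique[of Y 1 n]) (use nat(1)[of n x] nat(2)[of "Suc n" x] x a b y n fin[OF x(1)] Y in \<open>auto simp: numeral_2_eq_2\<close>)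
        then show ?thesis using x by blast
      qed
      then show "f (Suc n) ` simp X (Suc n) = simp Y (Suc n)" using fin by blast
    qed
  qed
qed

text \<open>Serves to carry ears from \<open>Cosk\<close> over to its coded copy inside
  \<open>'u\<close>: each gluing problem is pulled back, solved and pushed forward.\<close>

lemma natural_bij_ears:
  assumes X: "semisimp X" "ears X" and Y: "semisimp Y" and f: "natural_map X Y f"
    and bij: "\<And>n. bij_betw (f n) (simp X n) (simp Y n)"
  shows "ears Y"
  unfolding ears_def
proof (intro allI impI ballI)
  fix n i a b assume i: "1 \<le> i \<and> i \<le> n" and a: "a \<in> simp Y n" and b: "b \<in> simp Y 2"
    and m: "face Y n [i - 1, i] a = face Y 2 [0, 2] b"
  have inj: "x = y" if "x \<in> simp X k" "y \<in> simp X k" "f k x = f k y" for k x y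
    using that bij by (auto simp: bij_betw_def inj_on_def)
  obtain a' where a': "a' \<in> simp X n" "f n a' = a" using a bij by (metis bij_betw_imp_surj_on imageE)
  obtain b' where b': "b' \<in> simp X 2" "f 2 b' = b" using b bij by (metis bij_betw_imp_surj_on imageE)
  have "face X n [i - 1, i] a' = face X 2 [0,2] b'"
    by (rule inj[of _ 1]) (use a' b' i X m natural_map_face[OF f, of n "[i-1,i]" 1 a'] natural_map_face[OF f, of 2 "[0,2]" 1 b'] in \<open>auto intro!: face_in\<close>)
  then have ex: "\<exists>!x. x \<in> simp X (Suc n) \<and> bd X n i x = a' \<and> face X (Suc n) [i - 1, i, Suc i] x = b'"
    using X(2) i a' b' unfolding ears_def by blast
  show "\<exists>!y. y \<in> simp Y (Suc n) \<and> bd Y n i y = a \<and> face Y (Suc n) [i - 1, i, Suc i] y = b"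
  proof (rule ex_ex1I)
    obtain x where x: "x \<in> simp X (Suc n)" "bd X n i x = a'" "face X (Suc n) [i - 1, i, Suc i] x = b'"
      using ex by blast
    have "f (Suc n) x \<in> simp Y (Suc n)" using x f by (auto simp: natural_map_def)
    moreover have "bd Y n i (f (Suc n) x) = a"
      using natural_map_bd[OF f, of i n x] x i a' by simp
    moreover have "face Y (Suc n) [i - 1, i, Suc i] (f (Suc n) x) = b"
      using natural_map_face[OF f, of "Suc n" "[i - 1, i, Suc i]" 2 x] x i b' by simp
    ultimately show "\<exists>y. y \<in> simp Y (Suc n) \<and> bd Y n i y = a \<and> face Y (Suc n) [i - 1, i, Suc i] y = b" by blast
  next
    have key: "\<exists>x. x \<in> simp X (Suc n) \<and> bd X n i x = a' \<and> face X (Suc n) [i - 1, i, Suc i] x = b' \<and> f (Suc n) x = y"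
      if y: "y \<in> simp Y (Suc n)" "bd Y n i y = a" "face Y (Suc n) [i - 1, i, Suc i] y = b" for y
    proof -
      obtain x where x: "x \<in> simp X (Suc n)" "f (Suc n) x = y"
        using y(1) bij_betw_imp_surj_on[OF bij[of "Suc n"]] by force
      have "bd X n i x = a'"
      proof (rule inj[of _ n])
        show "bd X n i x \<in> simp X n" "a' \<in> simp X n"
          using x(1) i a'(1) by (simp_all add: bd_in[OF X(1)])
        have "f n (bd X n i x) = bd Y n i y"
          using natural_map_bd[OF f, of i n x] x i by simp
        then show "f n (bd X n i x) = f n a'" using that a' by simp
      qed
      moreover have "face X (Suc n) [i - 1, i, Suc i] x = b'"
      proof (rule inj[of _ 2])
        show "face X (Suc n) [i - 1, i, Suc i] x \<in> simp X 2" "b' \<in> simp X 2"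
          using x(1) i b'(1) by (simp_all add: face_in[OF X(1)])
        have "f 2 (face X (Suc n) [i - 1, i, Suc i] x) = face Y (Suc n) [i - 1, i, Suc i] y"
          using natural_map_face[OF f, of "Suc n" "[i - 1, i, Suc i]" 2 x] x i by simp
        then show "f 2 (face X (Suc n) [i - 1, i, Suc i] x) = f 2 b'" using that b' by simp
      qed
      ultimately show ?thesis using x by blast
    qed
    fix y z assume "y \<in> simp Y (Suc n) \<and> bd Y n i y = a \<and> face Y (Suc n) [i - 1, i, Suc i] y = b"
      "z \<in> simp Y (Suc n) \<and> bd Y n i z = a \<and> face Y (Suc n) [i - 1, i, Suc i] z = b"
    then show "y = z" using key[of y] key[of z] ex by metis
  qed
qed

section \<open>Triangulations and ears\<close>

definition unskip :: "nat \<Rightarrow> nat \<Rightarrow> nat" where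
  "unskip i j = (if j < i then j else j - 1)"

text \<open>The remaining diagonals after cutting off the triangle \<open>i - 1, i, i + 1\<close>
  and renumbering the vertices above \<open>i\<close>. The diagonal \<open>(i - 1, i + 1)\<close>
  has become a side of the smaller polygon and is dropped.\<close>

definition cut_ear :: "nat \<Rightarrow> (nat \<times> nat) set \<Rightarrow> (nat \<times> nat) set" where
  "cut_ear i D = {(a, b). (skip i a, skip i b) \<in> D - {(i - 1, Suc i)}}"

lemma skip_less [simp]: "skip i a < skip i b \<longleftrightarrow> a < b"
  by (auto simp: skip_def)

lemma skip_neq [simp]: "skip i a \<noteq> i" "i \<noteq> skip i a"
  by (auto simp: skip_def)

lemma unskip_skip [simp]: "unskip i (skip i a) = a"
  by (auto simp: skip_def unskip_def)

lemma skip_unskip: "j \<noteq> i \<Longrightarrow> skip i (unskip i j) = j"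
  by (auto simp: skip_def unskip_def)

lemma unskip_less: "j \<noteq> i \<Longrightarrow> k \<noteq> i \<Longrightarrow> j < k \<Longrightarrow> unskip i j < unskip i k"
  by (metis skip_less skip_unskip)

lemma skip_le: "i \<le> n \<Longrightarrow> skip i a \<le> Suc n \<longleftrightarrow> a \<le> n"
  by (auto simp: skip_def)

lemma mem_sides: "(a, b) \<in> polygon_sides n \<longleftrightarrow> (b = Suc a \<and> a < n) \<or> (a = 0 \<and> b = n)"
  by (auto simp: polygon_sides_def)

lemma mem_diagonals: "(a, b) \<in> polygon_diagonals n \<longleftrightarrow> a < b \<and> b \<le> n \<and> b \<noteq> Suc a \<and> (a \<noteq> 0 \<or> b \<noteq> n)"
  by (auto simp: polygon_diagonals_def mem_sides)

lemma finite_diagonals: "finite (polygon_diagonals n)"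
  by (rule finite_subset[of _ "{..n} \<times> {..n}"]) (auto simp: polygon_diagonals_def)

lemma skip_sides:
  assumes "1 \<le> i" "i \<le> n" "2 \<le> n"
  shows "(skip i a, skip i b) \<in> polygon_sides (Suc n) \<or> (skip i a, skip i b) = (i - 1, Suc i)
    \<longleftrightarrow> (a, b) \<in> polygon_sides n"
  using assms unfolding mem_sides skip_def by (auto split: if_splits)

lemma skip_diagonals:
  assumes "1 \<le> i" "i \<le> n" "2 \<le> n"
  shows "(skip i a, skip i b) \<in> polygon_diagonals (Suc n) - {(i - 1, Suc i)} \<longleftrightarrow> (a, b) \<in> polygon_diagonals n"
  using skip_sides[OF assms, of a b] skip_le[OF assms(2), of b] by (auto simp: polygon_diagonals_def)

lemma crossing_skip [simp]: "crossing (skip i a, skip i b) (skip i c, skip i d) = crossing (a, b) (c, d)"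
  by (simp add: crossing_def)

lemma crossing_sym: "crossing d e = crossing e d"
  by (auto simp: crossing_def)

lemma crossing_ear:
  assumes "(a, b) \<in> polygon_diagonals (Suc n)" "1 \<le> i" "i \<le> n"
  shows "crossing (i - 1, Suc i) (a, b) \<longleftrightarrow> a = i \<or> b = i"
  using assms by (auto simp: crossing_def mem_diagonals)

text \<open>Maximality descends because a diagonal of \<open>D\<close> crossing the lift of a given
  one cannot end at \<open>i\<close>, where it would cross the diagonal of the ear, and cannot be
  that diagonal itself, which is crossed only by diagonals ending at \<open>i\<close>. So it
  survives the cut.\<close>

lemma cut_ear_triangulating:
  assumes n: "2 \<le> n" "1 \<le> i" "i \<le> n" and D: "triangulating_diagonals (Suc n) D" "(i - 1, Suc i) \<in> D"
  shows "triangulating_diagonals n (cut_ear i D)"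
  unfolding triangulating_diagonals_def
proof (intro conjI ballI)
  have sub: "D \<subseteq> polygon_diagonals (Suc n)" using D by (simp add: triangulating_diagonals_def)
  show "cut_ear i D \<subseteq> polygon_diagonals n"
    unfolding cut_ear_def using sub skip_diagonals[OF n(2,3,1)] by blast
  show "\<not> crossing d d'" if dd: "d \<in> cut_ear i D" "d' \<in> cut_ear i D" for d d'
  proof -
    obtain a b c e where "d = (a, b)" "d' = (c, e)" by fastforce
    moreover have "\<not> crossing (skip i a, skip i b) (skip i c, skip i e)"
      using dd D(1) calculation unfolding cut_ear_def triangulating_diagonals_def by blast
    ultimately show ?thesis by simp
  qed
  show "\<exists>d'\<in>cut_ear i D. crossing d d'" if d: "d \<in> polygon_diagonals n - cut_ear i D" for d
  proof -
    obtain a b where ab: "d = (a, b)" by fastforce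
    have "(skip i a, skip i b) \<in> polygon_diagonals (Suc n) - {(i - 1, Suc i)}"
      using d ab skip_diagonals[OF n(2,3,1)] by blast
    moreover then have "(skip i a, skip i b) \<notin> D" using d ab by (auto simp: cut_ear_def)
    ultimately obtain d' where d': "d' \<in> D" "crossing (skip i a, skip i b) d'"
      using D(1) unfolding triangulating_diagonals_def by blast
    obtain c e where ce: "d' = (c, e)" by fastforce
    have "\<not> crossing (i - 1, Suc i) (c, e)" using D d' ce by (auto simp: triangulating_diagonals_def)
    then have ne: "c \<noteq> i" "e \<noteq> i" using crossing_ear[of c e n i] n d' ce sub by auto
    then have sk: "c = skip i (unskip i c)" "e = skip i (unskip i e)" by (simp_all add: skip_unskip)
    have "(c, e) \<noteq> (i - 1, Suc i)"
      using d'(2) ce by (auto simp: crossing_def skip_def split: if_splits)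
    then have "(unskip i c, unskip i e) \<in> cut_ear i D" using d' ce sk by (simp add: cut_ear_def)
    moreover have "crossing d (unskip i c, unskip i e)"
      using d'(2) ce ab sk crossing_skip by metis
    ultimately show ?thesis by blast
  qed
qed

lemma cut_ear_edges:
  assumes n: "2 \<le> n" "1 \<le> i" "i \<le> n" and D: "triangulating_diagonals (Suc n) D" "(i - 1, Suc i) \<in> D"
  shows "(a, b) \<in> polygon_sides n \<union> cut_ear i D \<longleftrightarrow> (skip i a, skip i b) \<in> polygon_sides (Suc n) \<union> D"
    (is "?l \<longleftrightarrow> ?r")
    "(a, i) \<in> polygon_sides (Suc n) \<union> D \<longleftrightarrow> a = i - 1"
    "(i, a) \<in> polygon_sides (Suc n) \<union> D \<longleftrightarrow> a = Suc i"
proof -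
  show "?l \<longleftrightarrow> ?r" using skip_sides[OF n(2,3,1), of a b] D(2) by (auto simp: cut_ear_def)
  have no: "(a, b) \<notin> D" if "a = i \<or> b = i" for a b
  proof
    assume ab: "(a, b) \<in> D"
    then have "\<not> crossing (i - 1, Suc i) (a, b)" "(a, b) \<in> polygon_diagonals (Suc n)"
      using D by (auto simp: triangulating_diagonals_def)
    then show False using crossing_ear[of a b n i] n that by auto
  qed
  show "(a, i) \<in> polygon_sides (Suc n) \<union> D \<longleftrightarrow> a = i - 1" "(i, a) \<in> polygon_sides (Suc n) \<union> D \<longleftrightarrow> a = Suc i"
    using n no by (auto simp: mem_sides)
qed

text \<open>The only edges at \<open>i\<close> are its two sides, hence the ear is the only triangle
  containing \<open>i\<close>; all others avoid \<open>i\<close> and come from the smaller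
  polygon.\<close>

lemma cut_ear_triangles:
  assumes n: "2 \<le> n" "1 \<le> i" "i \<le> n" and D: "triangulating_diagonals (Suc n) D" "(i - 1, Suc i) \<in> D"
  shows "triangles (Suc n) D = insert {i - 1, i, Suc i} ((`) (skip i) ` triangles n (cut_ear i D))"
proof -
  note E = cut_ear_edges[OF assms]
  let ?T = "(`) (skip i) ` triangles n (cut_ear i D)"
  have 1: "{j, k, l} \<in> insert {i - 1, i, Suc i} ?T"
    if jkl: "j < k" "k < l" "l \<le> Suc n" "(j, k) \<in> polygon_sides (Suc n) \<union> D" "(k, l) \<in> polygon_sides (Suc n) \<union> D"
      "(j, l) \<in> polygon_sides (Suc n) \<union> D" for j k l
  proof (cases "i \<in> {j, k, l}")
    case True
    have "j = i \<Longrightarrow> False" using jkl E(3)[of k] E(3)[of l] by auto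
    moreover have "l = i \<Longrightarrow> False" using jkl E(2)[of k] E(2)[of j] by auto
    ultimately have "k = i" using True by auto
    then show ?thesis using jkl E(2)[of j] E(3)[of l] by auto
  next
    case False
    define j' k' l' where "j' = unskip i j" "k' = unskip i k" "l' = unskip i l"
    then have s: "j = skip i j'" "k = skip i k'" "l = skip i l'" using False by (auto simp: skip_unskip)
    have "j' < k'" "k' < l'" "l' \<le> n" using jkl s skip_le[OF n(3)] by auto
    moreover have "{(j', k'), (k', l'), (j', l')} \<subseteq> polygon_sides n \<union> cut_ear i D"
      using jkl(4-6) E(1)[of j' k'] E(1)[of j' l'] E(1)[of k' l'] unfolding s by blast
    ultimately have "{j', k', l'} \<in> triangles n (cut_ear i D)" unfolding triangles_def by blast
    then have "skip i ` {j', k', l'} \<in> ?T" by blast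
    then show ?thesis using s by simp
  qed
  have 2: "{i - 1, i, Suc i} \<in> triangles (Suc n) D"
    unfolding triangles_def
    by (intro CollectI exI[of _ "i - 1"] exI[of _ i] exI[of _ "Suc i"]) (use n D(2) in \<open>auto simp: mem_sides\<close>)
  have 3: "skip i ` J \<in> triangles (Suc n) D" if J: "J \<in> triangles n (cut_ear i D)" for J
  proof -
    obtain j k l where jkl: "J = {j, k, l}" "j < k" "k < l" "l \<le> n"
      "{(j, k), (k, l), (j, l)} \<subseteq> polygon_sides n \<union> cut_ear i D"
      using J unfolding triangles_def by blast
    have "{(skip i j, skip i k), (skip i k, skip i l), (skip i j, skip i l)} \<subseteq> polygon_sides (Suc n) \<union> D"
      using jkl(5) E(1)[of j k] E(1)[of j l] E(1)[of k l] by blast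
    then show ?thesis unfolding triangles_def jkl(1) using jkl(2-4) skip_le[OF n(3)]
      by (intro CollectI exI[of _ "skip i j"] exI[of _ "skip i k"] exI[of _ "skip i l"]) auto
  qed
  show ?thesis
  proof (intro equalityI subsetI)
    fix J assume "J \<in> triangles (Suc n) D"
    then obtain j k l where "J = {j, k, l}" "j < k" "k < l" "l \<le> Suc n"
      "{(j, k), (k, l), (j, l)} \<subseteq> polygon_sides (Suc n) \<union> D" unfolding triangles_def by blast
    then show "J \<in> insert {i - 1, i, Suc i} ?T" using 1[of j k l] by blast
  next
    fix J assume "J \<in> insert {i - 1, i, Suc i} ?T"
    then show "J \<in> triangles (Suc n) D" using 2 3 by blast
  qed
qed

text \<open>A diagonal with least difference of its end points cuts off an ear. Measuring the
  difference of labels, not the cyclic distance, keeps the tip of the ear away from the vertices 0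
  and \<open>n + 1\<close>, where \<open>ears\<close> says nothing.\<close>

lemma ear_exists:
  assumes "2 \<le> n" "triangulating_diagonals (Suc n) D"
  shows "\<exists>i. 1 \<le> i \<and> i \<le> n \<and> (i - 1, Suc i) \<in> D"
proof -
  have sub: "D \<subseteq> polygon_diagonals (Suc n)" and nc: "\<And>d d'. d \<in> D \<Longrightarrow> d' \<in> D \<Longrightarrow> \<not> crossing d d'"
    and mx: "\<And>d. d \<in> polygon_diagonals (Suc n) \<Longrightarrow> d \<notin> D \<Longrightarrow> \<exists>d'\<in>D. crossing d d'"
    using assms(2) by (auto simp: triangulating_diagonals_def)
  have "(0, 2) \<in> polygon_diagonals (Suc n)" using assms(1) by (simp add: mem_diagonals)
  then have "D \<noteq> {}" using mx[of "(0,2)"] by blast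
  then obtain d where d: "d \<in> D" and min: "\<And>e. e \<in> D \<Longrightarrow> snd d - fst d \<le> snd e - fst e"
    using ex_has_least_nat[of "\<lambda>e. e \<in> D" _ "\<lambda>e. snd e - fst e"] by blast
  obtain i j where ij: "d = (i, j)" by fastforce
  have ij': "i < j" "j \<le> Suc n" "j \<noteq> Suc i" "i \<noteq> 0 \<or> j \<noteq> Suc n"
    using sub d ij by (auto simp: mem_diagonals)
  have "j = i + 2"
  proof (rule ccontr)
    \<comment> \<open>Otherwise \<open>(i, i + 2)\<close> is too short to be in \<open>D\<close>, so
      some member of \<open>D\<close> crosses it and ends at \<open>i + 1\<close>. Being at least as
      long as \<open>(i, j)\<close>, or starting before \<open>i\<close>, that member crosses
      \<open>(i, j)\<close> too.\<close>
    assume "j \<noteq> i + 2"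
    then have lt: "i + 2 < j" using ij' by simp
    have "(i, i + 2) \<in> polygon_diagonals (Suc n)" using lt ij' by (simp add: mem_diagonals)
    moreover have "(i, i + 2) \<notin> D" using min[of "(i, i + 2)"] ij lt by auto
    ultimately obtain a b where ab: "(a, b) \<in> D" "crossing (i, i + 2) (a, b)" using mx by fast
    have "\<not> crossing (i, j) (a, b)" using nc d ij ab by blast
    moreover have "j - i \<le> b - a" using min[OF ab(1)] ij by simp
    ultimately show False using ab(2) lt by (auto simp: crossing_def)
  qed
  then show ?thesis using d ij ij' by (intro exI[of _ "Suc i"]) auto
qed

text \<open>To extract the ear property at a prescribed \<open>i\<close> from the 2-Segal condition,
  some triangulation must contain that ear; a maximal non-crossing set above the single diagonal
  provides one.\<close>

lemma triangulation_with_ear: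
  assumes "2 \<le> n" "1 \<le> i" "i \<le> n"
  shows "\<exists>D. triangulating_diagonals (Suc n) D \<and> (i - 1, Suc i) \<in> D"
proof -
  let ?P = "polygon_diagonals (Suc n)"
  define A where "A = {D. D \<subseteq> ?P \<and> (\<forall>d\<in>D. \<forall>d'\<in>D. \<not> crossing d d')}"
  have fin: "finite A" unfolding A_def by (rule finite_subset[of _ "Pow ?P"]) (auto simp: finite_diagonals)
  have "{(i - 1, Suc i)} \<in> A" using assms by (auto simp: A_def mem_diagonals crossing_def)
  then obtain D where D: "D \<in> A" "{(i - 1, Suc i)} \<subseteq> D" "\<And>E. E \<in> A \<Longrightarrow> D \<subseteq> E \<Longrightarrow> D = E"
    using finite_has_maximal2[OF fin] by metis
  have "\<exists>d'\<in>D. crossing d d'" if d: "d \<in> ?P - D" for d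
  proof (rule ccontr)
    assume "\<not> (\<exists>d'\<in>D. crossing d d')"
    then have "insert d D \<in> A" using D(1) d unfolding A_def by (auto simp: crossing_sym crossing_def)
    then show False using D(3)[of "insert d D"] d by auto
  qed
  moreover have "D \<subseteq> ?P" "\<forall>d\<in>D. \<forall>d'\<in>D. \<not> crossing d d'" "(i - 1, Suc i) \<in> D"
    using D(1,2) by (simp_all add: A_def)
  ultimately show ?thesis unfolding triangulating_diagonals_def by blast
qed

lemma triangles_2: "triangulating_diagonals 2 D \<Longrightarrow> triangles 2 D = {{0, 1, 2}}"
proof -
  assume D: "triangulating_diagonals 2 D"
  have "polygon_diagonals 2 = {}" by (auto simp: mem_diagonals)
  then have D: "D = {}" using D by (auto simp: triangulating_diagonals_def)
  have "J = {0,1,2}" if J: "J \<in> triangles 2 D" for J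
  proof -
    obtain i j k where "J = {i, j, k}" "i < j" "j < k" "k \<le> (2::nat)" using J by (auto simp: triangles_def)
    moreover then have "i = 0" "j = 1" "k = 2" by auto
    ultimately show ?thesis by simp
  qed
  moreover have "{0,1,2} \<in> triangles 2 D"
    unfolding triangles_def by (intro CollectI exI[of _ 0] exI[of _ 1] exI[of _ 2]) (auto simp: mem_sides)
  ultimately show ?thesis by blast
qed

lemma triangles_bound: "J \<in> triangles n D \<Longrightarrow> J \<subseteq> {..n}"
  by (auto simp: triangles_def)

text \<open>Ensures that the edge along which an ear is glued occurs among the faces over which the
  limit of the smaller polygon is taken.\<close>

lemma side_in_triangle:
  "2 \<le> n \<Longrightarrow> triangulating_diagonals n D \<Longrightarrow> (a, b) \<in> polygon_sides n \<Longrightarrow> \<exists>J\<in>triangles n D. {a, b} \<subseteq> J"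
proof (induction n arbitrary: D a b rule: nat_induct_at_least)
  case base
  then show ?case using triangles_2[OF base(1)] by (auto simp: mem_sides numeral_2_eq_2 less_Suc_eq)
next
  case (Suc n)
  obtain i where i: "1 \<le> i" "i \<le> n" "(i - 1, Suc i) \<in> D" using ear_exists[OF Suc.hyps Suc.prems(1)] by blast
  note T = cut_ear_triangles[OF Suc.hyps i(1,2) Suc.prems(1) i(3)]
  show ?case
  proof (cases "a = i \<or> b = i")
    case True
    then have "{a, b} \<subseteq> {i - 1, i, Suc i}" using Suc.prems(2) i by (auto simp: mem_sides)
    then show ?thesis using T by blast
  next
    case False
    define a' b' where "a' = unskip i a" "b' = unskip i b"
    then have s: "a = skip i a'" "b = skip i b'" using False by (auto simp: skip_unskip)
    have "(a', b') \<in> polygon_sides n" using Suc.prems(2) skip_sides[OF i(1,2) Suc.hyps] s by blast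
    then obtain J where "J \<in> triangles n (cut_ear i D)" "{a', b'} \<subseteq> J"
      using Suc.IH[OF cut_ear_triangulating[OF Suc.hyps i(1,2) Suc.prems(1) i(3)]] by blast
    then have "skip i ` J \<in> triangles (Suc n) D" "{a, b} \<subseteq> skip i ` J" using T s by auto
    then show ?thesis by blast
  qed
qed

section \<open>The 2-Segal condition in terms of ears\<close>

definition segal_at :: "'u simp_data \<Rightarrow> nat \<Rightarrow> nat set set \<Rightarrow> bool" where
  "segal_at X n T \<longleftrightarrow> bij_betw (triangulation_map X n T) (simp X n) (triangulation_limit X n T)"

lemma facesI: "smap p n g \<Longrightarrow> J \<in> T \<Longrightarrow> g ` {..p} \<subseteq> J \<Longrightarrow> (p, restrict g {..p}) \<in> faces n T"
  by (auto simp: faces_def restrict_in_Delta_inj)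

lemma facesE:
  assumes "(p, \<theta>) \<in> faces n T"
  obtains J where "smap p n \<theta>" "restrict \<theta> {..p} = \<theta>" "J \<in> T" "\<theta> ` {..p} \<subseteq> J"
  using assms by (auto simp: faces_def Delta_inj_restrict Delta_inj_smap)

lemma limit_in: "y \<in> triangulation_limit X n T \<Longrightarrow> (p, \<theta>) \<in> faces n T \<Longrightarrow> y (p, \<theta>) \<in> simp X p"
  unfolding triangulation_limit_def by (auto dest: PiE_mem)

lemma limit_ap:
  assumes "y \<in> triangulation_limit X n T" "(p, \<theta>) \<in> faces n T" "smap q p g"
  shows "ap X q p g (y (p, \<theta>)) = y (q, restrict (\<theta> \<circ> g) {..q})"
proof -
  have "act X q p (restrict g {..q}) (y (p, \<theta>)) = y (q, compose {..q} \<theta> (restrict g {..q}))"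
    using assms unfolding triangulation_limit_def by (auto simp: restrict_in_Delta_inj)
  moreover have "compose {..q} \<theta> (restrict g {..q}) = restrict (\<theta> \<circ> g) {..q}"
    by (auto simp: compose_def)
  ultimately show ?thesis by (simp add: ap_def)
qed

lemma limitI:
  assumes "y \<in> extensional (faces n T)" "\<And>p \<theta>. (p, \<theta>) \<in> faces n T \<Longrightarrow> y (p, \<theta>) \<in> simp X p"
    "\<And>p \<theta> q \<phi>. (p, \<theta>) \<in> faces n T \<Longrightarrow> smap q p \<phi> \<Longrightarrow> restrict \<phi> {..q} = \<phi> \<Longrightarrow>
       ap X q p \<phi> (y (p, \<theta>)) = y (q, restrict (\<theta> \<circ> \<phi>) {..q})"
  shows "y \<in> triangulation_limit X n T"
proof -
  have "act X q p \<phi> (y (p, \<theta>)) = y (q, compose {..q} \<theta> \<phi>)"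
    if "(p, \<theta>) \<in> faces n T" "\<phi> \<in> Delta_inj q p" for p \<theta> q \<phi>
  proof -
    have "compose {..q} \<theta> \<phi> = restrict (\<theta> \<circ> \<phi>) {..q}" by (auto simp: compose_def)
    then show ?thesis
      using assms(3)[OF that(1) Delta_inj_smap[OF that(2)] Delta_inj_restrict[OF that(2)]] that(2)
      by (simp add: act_eq_ap)
  qed
  then show ?thesis using assms(1,2) unfolding triangulation_limit_def by (auto simp: PiE_def)
qed

lemma triangulation_map_eq:
  "triangulation_map X n T x = restrict (\<lambda>(p, \<theta>). ap X p n \<theta> x) (faces n T)"
  unfolding triangulation_map_def
  by (auto simp: fun_eq_iff restrict_def faces_def act_eq_ap)

lemma triangulation_map_in_limit:
  assumes "semisimp X" "x \<in> simp X n"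
  shows "triangulation_map X n T x \<in> triangulation_limit X n T"
proof (rule limitI)
  show "triangulation_map X n T x \<in> extensional (faces n T)" by (simp add: triangulation_map_eq)
next
  fix p \<theta> assume "(p, \<theta>) \<in> faces n T"
  then show "triangulation_map X n T x (p, \<theta>) \<in> simp X p"
    using assms by (auto simp: triangulation_map_eq ap_in elim: facesE)
next
  fix p \<theta> q \<phi> assume a: "(p, \<theta>) \<in> faces n T" "smap q p \<phi>"
  obtain J where J: "smap p n \<theta>" "J \<in> T" "\<theta> ` {..p} \<subseteq> J" using a(1) by (elim facesE)
  have "(q, restrict (\<theta> \<circ> \<phi>) {..q}) \<in> faces n T"
    by (rule facesI[OF smap_comp[OF a(2) J(1)] J(2)]) (use a(2) J(3) in \<open>auto simp: smap_def\<close>)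
  moreover have "ap X q p \<phi> (ap X p n \<theta> x) = ap X q n (restrict (\<theta> \<circ> \<phi>) {..q}) x"
    using ap_ap[OF assms(1) a(2) J(1) assms(2)] by (simp add: ap_def)
  ultimately show "ap X q p \<phi> (triangulation_map X n T x (p, \<theta>)) =
      triangulation_map X n T x (q, restrict (\<theta> \<circ> \<phi>) {..q})"
    using a(1) by (simp add: triangulation_map_eq)
qed

lemma segal_at_iff:
  assumes "semisimp X"
  shows "segal_at X n T \<longleftrightarrow>
    (\<forall>x\<in>simp X n. \<forall>y\<in>simp X n. (\<forall>(p, \<theta>)\<in>faces n T. ap X p n \<theta> x = ap X p n \<theta> y) \<longrightarrow> x = y) \<and>
    (\<forall>y\<in>triangulation_limit X n T. \<exists>x\<in>simp X n. \<forall>(p, \<theta>)\<in>faces n T. ap X p n \<theta> x = y (p, \<theta>))"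
    (is "_ \<longleftrightarrow> ?inj \<and> ?surj")
proof -
  have eq: "triangulation_map X n T x = y \<longleftrightarrow> (\<forall>(p, \<theta>)\<in>faces n T. ap X p n \<theta> x = y (p, \<theta>))"
    if "y \<in> triangulation_limit X n T" for x y
  proof -
    have "y \<in> extensional (faces n T)" using that by (auto simp: triangulation_limit_def PiE_def)
    then show ?thesis by (auto simp: triangulation_map_eq fun_eq_iff restrict_def extensional_def)
  qed
  have "inj_on (triangulation_map X n T) (simp X n) \<longleftrightarrow> ?inj"
    unfolding inj_on_def
  proof (intro ball_cong refl iff_exI arg_cong2[of _ _ _ _ "(\<longrightarrow>)"])
    fix x y assume "x \<in> simp X n" "y \<in> simp X n"
    then show "(triangulation_map X n T x = triangulation_map X n T y) =
        (\<forall>(p, \<theta>)\<in>faces n T. ap X p n \<theta> x = ap X p n \<theta> y)"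
      using eq[OF triangulation_map_in_limit[OF assms], of y x] by (auto simp: triangulation_map_eq)
  qed
  moreover have "triangulation_map X n T ` simp X n = triangulation_limit X n T \<longleftrightarrow>
      (\<forall>y\<in>triangulation_limit X n T. \<exists>x\<in>simp X n. triangulation_map X n T x = y)"
  proof -
    have "triangulation_map X n T ` simp X n \<subseteq> triangulation_limit X n T"
      using triangulation_map_in_limit[OF assms] by blast
    then have "triangulation_map X n T ` simp X n = triangulation_limit X n T \<longleftrightarrow>
        triangulation_limit X n T \<subseteq> triangulation_map X n T ` simp X n" by blast
    then show ?thesis unfolding subset_iff image_iff by metis
  qed
  moreover have "\<dots> \<longleftrightarrow> ?surj" by (intro ball_cong bex_cong refl eq)
  ultimately show ?thesis by (simp add: segal_at_def bij_betw_def)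
qed

text \<open>A face of \<open>T\<close> lies in the ear or in the rest, and the two parts meet in the
  edge \<open>i - 1, i + 1\<close>. A compatible family on \<open>T\<close> thus amounts to one on
  \<open>T'\<close> and a 2-simplex agreeing with it on this edge; since families on
  \<open>T'\<close> are \<open>n\<close>-simplices by \<open>seg\<close>, the Segal condition for
  \<open>T\<close> becomes the ear property at \<open>i\<close>.\<close>

lemma segal_at_ear:
  assumes X: "semisimp X" and i: "1 \<le> i" "i \<le> n"
    and T: "T = insert {i - 1, i, Suc i} ((`) (skip i) ` T')" and bnd: "\<And>J. J \<in> T' \<Longrightarrow> J \<subseteq> {..n}"
    and seg: "segal_at X n T'"
  shows "ears X \<Longrightarrow> \<exists>J\<in>T'. {i - 1, i} \<subseteq> J \<Longrightarrow> segal_at X (Suc n) T"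
    and "segal_at X (Suc n) T \<Longrightarrow> a \<in> simp X n \<Longrightarrow> b \<in> simp X 2 \<Longrightarrow>
      face X n [i - 1, i] a = face X 2 [0, 2] b \<Longrightarrow>
      \<exists>!x. x \<in> simp X (Suc n) \<and> bd X n i x = a \<and> face X (Suc n) [i - 1, i, Suc i] x = b"
proof -
  let ?F = "face X (Suc n) [i - 1, i, Suc i]" and ?t = "nth [i - 1, i, Suc i]"
  let ?s = "\<lambda>p \<theta>. restrict (skip i \<circ> \<theta>) {..p}" and ?u = "\<lambda>p g. restrict (?t \<circ> g) {..p}"
  have inc: "incr (Suc n) [i - 1, i, Suc i]" "length [i - 1, i, Suc i] = Suc 2" using i by auto
  note st = smap_nth[OF inc]
  have in_t: "?t ` {..2} = {i - 1, i, Suc i}" by (auto simp: numeral_2_eq_2 atMost_Suc)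
  have fA: "(p, ?s p \<theta>) \<in> faces (Suc n) T" if t: "(p, \<theta>) \<in> faces n T'" for p \<theta>
  proof -
    obtain J where J: "smap p n \<theta>" "J \<in> T'" "\<theta> ` {..p} \<subseteq> J" using t by (elim facesE)
    show ?thesis
      by (rule facesI[of _ _ _ "skip i ` J"]) (use J smap_comp[OF J(1) smap_skip, of i] i T in \<open>auto simp: image_comp[symmetric]\<close>)
  qed
  have fB: "(p, ?u p g) \<in> faces (Suc n) T" if g: "smap p 2 g" for p g
  proof (rule facesI[of _ _ _ "{i - 1, i, Suc i}"])
    show "(?t \<circ> g) ` {..p} \<subseteq> {i - 1, i, Suc i}" using g in_t by (auto simp: smap_def)
  qed (use g smap_comp[OF g st] T in auto)
  \<comment> \<open>The two kinds of faces: \<open>?s\<close> moves a face of the smaller polygon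
    past the vertex \<open>i\<close>, and \<open>?u\<close> embeds a face of the standard triangle
    as a face of the ear.\<close>
  have fC: "(\<exists>\<theta>'. (p, \<theta>') \<in> faces n T' \<and> \<theta> = ?s p \<theta>') \<or> (\<exists>g. smap p 2 g \<and> \<theta> = ?u p g)"
    if t: "(p, \<theta>) \<in> faces (Suc n) T" for p \<theta>
  proof -
    obtain J where J: "smap p (Suc n) \<theta>" "restrict \<theta> {..p} = \<theta>" "J \<in> T" "\<theta> ` {..p} \<subseteq> J"
      using t by (elim facesE)
    show ?thesis
    proof (cases "J = {i - 1, i, Suc i}")
      case True
      have v: "\<theta> k = i - 1 \<or> \<theta> k = i \<or> \<theta> k = Suc i" if "k \<le> p" for k using J(4) True that by auto
      \<comment> \<open>The position of a vertex within the ear: \<open>i - 1\<close>,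
        \<open>i\<close>, \<open>i + 1\<close> become 0, 1, 2. Adding before subtracting avoids
        truncation.\<close>
      define g where "g k = \<theta> k + 1 - i" for k
      have "smap p 2 g" unfolding smap_def g_def
      proof (intro conjI allI impI)
        fix k assume "k \<le> p" then show "\<theta> k + 1 - i \<le> 2" using v[of k] i by auto
      next
        fix j k assume jk: "j < k \<and> k \<le> p"
        then have "\<theta> j < \<theta> k" using J(1) by (simp add: smap_def)
        then show "\<theta> j + 1 - i < \<theta> k + 1 - i" using v[of j] v[of k] jk i by auto
      qed
      moreover have "?t (g k) = \<theta> k" if "k \<le> p" for k
        using v[OF that] i unfolding g_def by (auto simp: Suc_diff_le)
      then have "\<theta> = ?u p g" by (subst J(2)[symmetric]) (auto simp: fun_eq_iff restrict_def)
      ultimately show ?thesis by blast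
    next
      case False
      then obtain J' where J': "J' \<in> T'" "J = skip i ` J'" using J(3) T by blast
      then have v: "\<theta> k \<noteq> i \<and> unskip i (\<theta> k) \<in> J'" if "k \<le> p" for k using J(4) that by force
      let ?g = "restrict (unskip i \<circ> \<theta>) {..p}"
      have "smap p n (unskip i \<circ> \<theta>)"
        unfolding smap_def comp_def
      proof (intro conjI allI impI)
        fix k assume "k \<le> p" then show "unskip i (\<theta> k) \<le> n" using v bnd[OF J'(1)] by auto
      next
        fix j k assume jk: "j < k \<and> k \<le> p"
        then have "\<theta> j < \<theta> k" using J(1) by (simp add: smap_def)
        then show "unskip i (\<theta> j) < unskip i (\<theta> k)" using v[of j] v[of k] jk by (intro unskip_less) auto
      qed
      then have "(p, ?g) \<in> faces n T'" using J'(1) v by (intro facesI) auto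
      moreover have "\<theta> = ?s p ?g" 
        by (subst J(2)[symmetric]) (use v in \<open>auto simp: fun_eq_iff restrict_def skip_unskip\<close>)
      ultimately show ?thesis by blast
    qed
  qed
  have aA: "ap X p (Suc n) (?s p \<theta>) x = ap X p n \<theta> (bd X n i x)" if "smap p n \<theta>" "x \<in> simp X (Suc n)" for p \<theta> x
    using ap_bd[OF X _ that(1) that(2), of i] i by (simp add: ap_def)
  have aB: "ap X p (Suc n) (?u p g) x = ap X p 2 g (?F x)" if "smap p 2 g" "x \<in> simp X (Suc n)" for p g x
    using ap_face[OF X inc that] by (simp add: ap_def)
  have sm: "smap p m \<theta>" if "(p, \<theta>) \<in> faces m S" for p \<theta> m S using that by (elim facesE)
  have id2: "ap X 2 2 (\<lambda>k. k) z = z" if "z \<in> simp X 2" for z using that by (simp add: ap_id[OF X])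
  have sid: "smap 2 2 (\<lambda>k. k)" by (simp add: smap_def)
  note S' = seg[unfolded segal_at_iff[OF X]]
  have bdeq: "x = y" if "x \<in> simp X n" "y \<in> simp X n" "\<And>p \<theta>. (p, \<theta>) \<in> faces n T' \<Longrightarrow> ap X p n \<theta> x = ap X p n \<theta> y" for x y
    using S' that by blast
  have ufold: "(\<forall>(p, \<theta>)\<in>faces (Suc n) T. ap X p (Suc n) \<theta> x = ap X p (Suc n) \<theta> y) \<longleftrightarrow>
      bd X n i x = bd X n i y \<and> ?F x = ?F y" if xy: "x \<in> simp X (Suc n)" "y \<in> simp X (Suc n)" for x y
  proof
    assume a: "\<forall>(p, \<theta>)\<in>faces (Suc n) T. ap X p (Suc n) \<theta> x = ap X p (Suc n) \<theta> y"
    have "bd X n i x = bd X n i y"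
    proof (rule bdeq)
      show "bd X n i x \<in> simp X n" "bd X n i y \<in> simp X n" using xy i by (auto intro!: bd_in X)
      fix p \<theta> assume t: "(p, \<theta>) \<in> faces n T'"
      show "ap X p n \<theta> (bd X n i x) = ap X p n \<theta> (bd X n i y)"
        using bspec[OF a fA[OF t]] aA[OF sm[OF t] xy(1)] aA[OF sm[OF t] xy(2)] by simp
    qed
    moreover have "?F x = ?F y"
    proof -
      have "ap X 2 (Suc n) (?u 2 (\<lambda>k. k)) x = ap X 2 (Suc n) (?u 2 (\<lambda>k. k)) y" using a fB[OF sid] by blast
      then have "ap X 2 2 (\<lambda>k. k) (?F x) = ap X 2 2 (\<lambda>k. k) (?F y)"
        using aB[OF sid xy(1)] aB[OF sid xy(2)] by metis
      then show ?thesis using id2 face_in[OF X inc] xy by metis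
    qed
    ultimately show "bd X n i x = bd X n i y \<and> ?F x = ?F y" by blast
  next
    assume a: "bd X n i x = bd X n i y \<and> ?F x = ?F y"
    have "ap X p (Suc n) \<theta> x = ap X p (Suc n) \<theta> y" if "(p, \<theta>) \<in> faces (Suc n) T" for p \<theta>
      using fC[OF that] aA sm aB xy a by metis
    then show "\<forall>(p, \<theta>)\<in>faces (Suc n) T. ap X p (Suc n) \<theta> x = ap X p (Suc n) \<theta> y" by blast
  qed
  show "segal_at X (Suc n) T" if E: "ears X" and edge: "\<exists>J\<in>T'. {i - 1, i} \<subseteq> J"
    unfolding segal_at_iff[OF X]
  proof (intro conjI ballI impI)
    fix x y assume "x \<in> simp X (Suc n)" "y \<in> simp X (Suc n)"
      "\<forall>(p, \<theta>)\<in>faces (Suc n) T. ap X p (Suc n) \<theta> x = ap X p (Suc n) \<theta> y"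
    then show "x = y" using ufold ears_unique[OF E X i] by blast
  next
    fix y assume y: "y \<in> triangulation_limit X (Suc n) T"
    define y' where "y' = restrict (\<lambda>(p, \<theta>). y (p, ?s p \<theta>)) (faces n T')"
    have y': "y' \<in> triangulation_limit X n T'"
    proof (rule limitI)
      show "y' \<in> extensional (faces n T')" by (simp add: y'_def)
    next
      fix p \<theta> assume "(p, \<theta>) \<in> faces n T'"
      then show "y' (p, \<theta>) \<in> simp X p" using limit_in[OF y fA] by (simp add: y'_def)
    next
      fix p \<theta> q \<phi> assume a: "(p, \<theta>) \<in> faces n T'" "smap q p \<phi>"
      obtain J where J: "smap p n \<theta>" "J \<in> T'" "\<theta> ` {..p} \<subseteq> J" using a(1) by (elim facesE)
      have f: "(q, restrict (\<theta> \<circ> \<phi>) {..q}) \<in> faces n T'"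
        by (rule facesI[OF smap_comp[OF a(2) J(1)] J(2)]) (use a(2) J(3) in \<open>auto simp: smap_def\<close>)
      have "restrict (?s p \<theta> \<circ> \<phi>) {..q} = ?s q (restrict (\<theta> \<circ> \<phi>) {..q})"
        using a(2) by (auto simp: fun_eq_iff restrict_def smap_def)
      then show "ap X q p \<phi> (y' (p, \<theta>)) = y' (q, restrict (\<theta> \<circ> \<phi>) {..q})"
        using limit_ap[OF y fA[OF a(1)] a(2)] a(1) f by (simp add: y'_def)
    qed
    obtain a where a: "a \<in> simp X n" "\<And>p \<theta>. (p, \<theta>) \<in> faces n T' \<Longrightarrow> ap X p n \<theta> a = y (p, ?s p \<theta>)"
    proof -
      obtain a where a: "a \<in> simp X n" "\<forall>(p, \<theta>)\<in>faces n T'. ap X p n \<theta> a = y' (p, \<theta>)"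
        using S' y' by blast
      have "ap X p n \<theta> a = y (p, ?s p \<theta>)" if "(p, \<theta>) \<in> faces n T'" for p \<theta>
        using bspec[OF a(2) that] that by (simp add: y'_def)
      then show ?thesis using a(1) by (rule that[rotated])
    qed
    define b where "b = y (2, ?u 2 (\<lambda>k. k))"
    have b: "b \<in> simp X 2" unfolding b_def by (rule limit_in[OF y fB[OF sid]])
    have yb: "y (p, ?u p g) = ap X p 2 g b" if "smap p 2 g" for p g
    proof -
      have "restrict (?u 2 (\<lambda>k. k) \<circ> g) {..p} = ?u p g" using that by (auto simp: fun_eq_iff restrict_def smap_def)
      then show ?thesis using limit_ap[OF y fB[OF sid] that] by (simp add: b_def)
    qed
    \<comment> \<open>Both sides are the value of \<open>y\<close> at the edge
      \<open>i - 1, i + 1\<close>; by \<open>edge\<close> it is a face of \<open>T'\<close>, where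
      \<open>a\<close> is described by \<open>y\<close>.\<close>
    have "face X n [i - 1, i] a = face X 2 [0, 2] b"
    proof -
      obtain J where J: "J \<in> T'" "{i - 1, i} \<subseteq> J" using edge by blast
      let ?e = "restrict (nth [i - 1, i]) {..1}"
      have "(1, ?e) \<in> faces n T'"
        by (rule facesI[OF _ J(1)]) (use J(2) i in \<open>auto simp: atMost_Suc smap_def le_Suc_eq\<close>)
      then have "face X n [i - 1, i] a = y (1, ?s 1 ?e)" using a(2)[of 1 ?e] by (simp add: face_def ap_def)
      also have "?s 1 ?e = ?u 1 (nth [0,2])"
        using i by (auto simp: fun_eq_iff restrict_def skip_def le_Suc_eq)
      also have "y (1, \<dots>) = face X 2 [0, 2] b"
        by (subst yb) (auto simp: face_def smap_def le_Suc_eq less_Suc_eq)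
      finally show ?thesis .
    qed
    then obtain x where x: "x \<in> simp X (Suc n)" "bd X n i x = a" "?F x = b"
      using E a b i unfolding ears_def by metis
    have "ap X p (Suc n) \<theta> x = y (p, \<theta>)" if "(p, \<theta>) \<in> faces (Suc n) T" for p \<theta>
      using fC[OF that]
    proof (elim disjE exE conjE)
      fix \<theta>' assume "(p, \<theta>') \<in> faces n T'" "\<theta> = ?s p \<theta>'"
      then show ?thesis using aA[OF sm x(1)] a(2) x(2) by metis
    next
      fix g assume "smap p 2 g" "\<theta> = ?u p g"
      then show ?thesis using aB[OF _ x(1)] yb x(3) by metis
    qed
    then show "\<exists>x\<in>simp X (Suc n). \<forall>(p, \<theta>)\<in>faces (Suc n) T. ap X p (Suc n) \<theta> x = y (p, \<theta>)"
      using x(1) by blast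
  qed
  show "\<exists>!x. x \<in> simp X (Suc n) \<and> bd X n i x = a \<and> ?F x = b"
    if S: "segal_at X (Suc n) T" and a: "a \<in> simp X n" and b: "b \<in> simp X 2"
      and m: "face X n [i - 1, i] a = face X 2 [0, 2] b"
  proof (rule ex_ex1I)
    note S = S[unfolded segal_at_iff[OF X]]
    fix x y assume "x \<in> simp X (Suc n) \<and> bd X n i x = a \<and> ?F x = b" "y \<in> simp X (Suc n) \<and> bd X n i y = a \<and> ?F y = b"
    then have "(\<forall>(p, \<theta>)\<in>faces (Suc n) T. ap X p (Suc n) \<theta> x = ap X p (Suc n) \<theta> y)" "x \<in> simp X (Suc n)" "y \<in> simp X (Suc n)"
      using ufold[of x y] by simp_all
    then show "x = y" using S by blast
  next
    note S = S[unfolded segal_at_iff[OF X]]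
    let ?v = "\<lambda>\<theta> k. \<theta> k + 1 - i"
    \<comment> \<open>The glued family: faces through \<open>i\<close> belong to the ear and are
      taken from \<open>b\<close>, all others from \<open>a\<close>. Only the faces of the edge
      \<open>i - 1, i + 1\<close> belong to both parts, and there the hypothesis \<open>m\<close>
      identifies the two readings.\<close>
    define y where "y = restrict (\<lambda>(p, \<theta>). if i \<in> \<theta> ` {..p} then ap X p 2 (?v \<theta>) b
      else ap X p n (unskip i \<circ> \<theta>) a) (faces (Suc n) T)"
    have tv: "?t k + 1 - i = k" if "k \<le> 2" for k
      using that i by (auto simp: numeral_2_eq_2 le_Suc_eq)
    have yA: "y (p, ?s p \<theta>) = ap X p n \<theta> a" if "(p, \<theta>) \<in> faces n T'" for p \<theta>
    proof -
      have "i \<notin> ?s p \<theta> ` {..p}" by (auto simp: image_iff)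
      then show ?thesis using fA[OF that] by (auto simp: y_def intro!: ap_cong)
    qed
    have yB: "y (p, ?u p g) = ap X p 2 g b" if g: "smap p 2 g" for p g
    proof (cases "i \<in> ?u p g ` {..p}")
      case True
      then show ?thesis using fB[OF g] g tv by (auto simp: y_def smap_def intro!: ap_cong)
    next
      case False
      then have g02: "g k = 0 \<or> g k = 2" if "k \<le> p" for k
      proof -
        have "g k \<le> 2" "?t (g k) \<noteq> i" using g False that by (force simp: smap_def image_iff)+
        then show ?thesis by (auto simp: numeral_2_eq_2 le_Suc_eq)
      qed
      \<comment> \<open>A face of the ear that avoids \<open>i\<close> uses only the positions 0 and
        2; halving them exhibits it as a face of the edge \<open>i - 1, i + 1\<close>.\<close>
      define h where "h k = g k div 2" for k
      have h: "smap p 1 h"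
        unfolding smap_def h_def
      proof (intro conjI allI impI)
        fix k assume "k \<le> p" then show "g k div 2 \<le> 1" using g02[of k] by auto
      next
        fix j k assume jk: "j < k \<and> k \<le> p"
        then have "g j < g k" using g by (simp add: smap_def)
        then show "g j div 2 < g k div 2" using g02[of j] g02[of k] jk by auto
      qed
      have gh: "nth [0, 2] (h k) = g k" if "k \<le> p" for k using g02[OF that] by (auto simp: h_def)
      have uh: "nth [i - 1, i] (h k) = unskip i (?t (g k))" if "k \<le> p" for k
        using g02[OF that] i by (auto simp: h_def unskip_def)
      have "y (p, ?u p g) = ap X p n (unskip i \<circ> ?u p g) a" using False fB[OF g] by (simp add: y_def)
      also have "\<dots> = ap X p n (nth [i - 1, i] \<circ> h) a" using uh by (intro ap_cong) simp
      also have "\<dots> = ap X p 1 h (face X n [i - 1, i] a)"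
        using i a by (intro ap_face[symmetric] X h) auto
      also have "\<dots> = ap X p 1 h (face X 2 [0, 2] b)" by (simp only: m)
      also have "\<dots> = ap X p 2 (nth [0, 2] \<circ> h) b" using b by (intro ap_face X h) auto
      also have "\<dots> = ap X p 2 g b" using gh by (intro ap_cong) simp
      finally show ?thesis .
    qed
    have "y \<in> triangulation_limit X (Suc n) T"
    proof (rule limitI)
      show "y \<in> extensional (faces (Suc n) T)" by (simp add: y_def)
    next
      fix p \<theta> assume "(p, \<theta>) \<in> faces (Suc n) T"
      from fC[OF this] show "y (p, \<theta>) \<in> simp X p" using yA yB sm ap_in[OF X] a b by metis
    next
      fix p \<theta> q \<phi> assume f: "(p, \<theta>) \<in> faces (Suc n) T" and \<phi>: "smap q p \<phi>"
      from fC[OF f] show "ap X q p \<phi> (y (p, \<theta>)) = y (q, restrict (\<theta> \<circ> \<phi>) {..q})"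
      proof (elim disjE exE conjE)
        fix \<theta>' assume t: "(p, \<theta>') \<in> faces n T'" "\<theta> = ?s p \<theta>'"
        obtain J where J: "smap p n \<theta>'" "J \<in> T'" "\<theta>' ` {..p} \<subseteq> J" using t(1) by (elim facesE)
        have f': "(q, restrict (\<theta>' \<circ> \<phi>) {..q}) \<in> faces n T'"
          by (rule facesI[OF smap_comp[OF \<phi> J(1)] J(2)]) (use \<phi> J(3) in \<open>auto simp: smap_def\<close>)
        have "restrict (\<theta> \<circ> \<phi>) {..q} = ?s q (restrict (\<theta>' \<circ> \<phi>) {..q})"
          using \<phi> t(2) by (auto simp: fun_eq_iff restrict_def smap_def)
        then have "y (q, restrict (\<theta> \<circ> \<phi>) {..q}) = ap X q n (\<theta>' \<circ> \<phi>) a" using yA[OF f'] by (simp add: ap_def)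
        also have "\<dots> = ap X q p \<phi> (y (p, \<theta>))" using yA[OF t(1)] t(2) ap_ap[OF X \<phi> J(1) a] by simp
        finally show ?thesis by simp
      next
        fix g assume g: "smap p 2 g" "\<theta> = ?u p g"
        have "restrict (\<theta> \<circ> \<phi>) {..q} = ?u q (g \<circ> \<phi>)"
          using \<phi> g(2) by (auto simp: fun_eq_iff restrict_def smap_def)
        then show ?thesis using yB[OF smap_comp[OF \<phi> g(1)]] yB[OF g(1)] g(2) ap_ap[OF X \<phi> g(1) b] by simp
      qed
    qed
    then obtain x where x: "x \<in> simp X (Suc n)" "\<And>p \<theta>. (p, \<theta>) \<in> faces (Suc n) T \<Longrightarrow> ap X p (Suc n) \<theta> x = y (p, \<theta>)"
      using S by blast
    have "bd X n i x = a"
    proof (rule bdeq)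
      show "bd X n i x \<in> simp X n" "a \<in> simp X n" using x i a by (auto intro!: bd_in X)
      fix p \<theta> assume t: "(p, \<theta>) \<in> faces n T'"
      show "ap X p n \<theta> (bd X n i x) = ap X p n \<theta> a"
        using aA[OF sm[OF t] x(1)] x(2)[OF fA[OF t]] yA[OF t] by simp
    qed
    moreover have "?F x = b"
      using aB[OF sid x(1)] x(2)[OF fB[OF sid]] yB[OF sid] id2[OF b] id2[OF face_in[OF X inc x(1)]] by simp
    ultimately show "\<exists>x. x \<in> simp X (Suc n) \<and> bd X n i x = a \<and> ?F x = b" using x(1) by blast
  qed
qed

lemma segal_at_2:
  assumes X: "semisimp X"
  shows "segal_at X 2 {{0, 1, 2}}"
  unfolding segal_at_iff[OF X]
proof (intro conjI ballI impI)
  have id: "(2, restrict (\<lambda>k. k) {..2}) \<in> faces 2 {{0, 1, 2::nat}}"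
    by (rule facesI[of _ _ _ "{0,1,2}"]) (auto simp: smap_def)
  have id2: "ap X 2 2 (restrict (\<lambda>k. k) {..2}) z = z" if "z \<in> simp X 2" for z using that by (simp add: ap_id[OF X])
  fix x y assume "x \<in> simp X 2" "y \<in> simp X 2"
    "\<forall>(p, \<theta>)\<in>faces 2 {{0, 1, 2}}. ap X p 2 \<theta> x = ap X p 2 \<theta> y"
  then have "ap X 2 2 (restrict (\<lambda>k. k) {..2}) x = ap X 2 2 (restrict (\<lambda>k. k) {..2}) y" using id by blast
  then show "x = y" using id2[OF \<open>x \<in> simp X 2\<close>] id2[OF \<open>y \<in> simp X 2\<close>] by argo
next
  have id: "(2, restrict (\<lambda>k. k) {..2}) \<in> faces 2 {{0, 1, 2::nat}}"
    by (rule facesI[of _ _ _ "{0,1,2}"]) (auto simp: smap_def)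
  fix y assume y: "y \<in> triangulation_limit X 2 {{0, 1, 2}}"
  have "ap X p 2 \<theta> (y (2, restrict (\<lambda>k. k) {..2})) = y (p, \<theta>)" if "(p, \<theta>) \<in> faces 2 {{0, 1, 2}}" for p \<theta>
  proof -
    have t: "smap p 2 \<theta>" "restrict \<theta> {..p} = \<theta>" using that by (auto elim: facesE)
    have "restrict (restrict (\<lambda>k. k) {..2} \<circ> \<theta>) {..p} = restrict \<theta> {..p}"
      using t(1) by (auto simp: fun_eq_iff restrict_def smap_def)
    then show ?thesis using limit_ap[OF y id t(1)] t(2) by simp
  qed
  then show "\<exists>x\<in>simp X 2. \<forall>(p, \<theta>)\<in>faces 2 {{0, 1, 2}}. ap X p 2 \<theta> x = y (p, \<theta>)"
    using limit_in[OF y id] by blast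
qed

lemma two_Segal_iff: "is_2_Segal X \<longleftrightarrow> (\<forall>n\<ge>2. \<forall>D. triangulating_diagonals n D \<longrightarrow> segal_at X n (triangles n D))"
  unfolding is_2_Segal_def triangulations_def segal_at_def by blast

lemma ears_imp_2_Segal:
  assumes X: "semisimp X" and E: "ears X"
  shows "is_2_Segal X"
proof -
  have "2 \<le> n \<Longrightarrow> triangulating_diagonals n D \<Longrightarrow> segal_at X n (triangles n D)" for n D
  proof (induction n arbitrary: D rule: nat_induct_at_least)
    case base then show ?case using segal_at_2[OF X] triangles_2 by simp
  next
    case (Suc n)
    obtain i where i: "1 \<le> i" "i \<le> n" "(i - 1, Suc i) \<in> D" using ear_exists[OF Suc.hyps Suc.prems(1)] by blast
    note D' = cut_ear_triangulating[OF Suc.hyps i(1,2) Suc.prems(1) i(3)]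
    have "(i - 1, i) \<in> polygon_sides n" using i by (auto simp: mem_sides)
    then have "\<exists>J\<in>triangles n (cut_ear i D). {i - 1, i} \<subseteq> J" by (rule side_in_triangle[OF Suc.hyps D'])
    with Suc.IH[OF D'] E show ?case
      by (intro segal_at_ear(1)[OF X i(1,2) cut_ear_triangles[OF Suc.hyps i(1,2) Suc.prems(1) i(3)] triangles_bound])
  qed
  then show ?thesis by (simp add: two_Segal_iff)
qed

lemma two_Segal_imp_ears:
  assumes X: "semisimp X" and S: "is_2_Segal X"
  shows "ears X"
  unfolding ears_def
proof (intro allI impI ballI)
  fix n i a b assume i: "1 \<le> i \<and> i \<le> n" and a: "a \<in> simp X n" and b: "b \<in> simp X 2"
    and m: "face X n [i - 1, i] a = face X 2 [0, 2] b"
  show "\<exists>!x. x \<in> simp X (Suc n) \<and> bd X n i x = a \<and> face X (Suc n) [i - 1, i, Suc i] x = b"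
  proof (cases "2 \<le> n")
    case True
    then obtain D where D: "triangulating_diagonals (Suc n) D" "(i - 1, Suc i) \<in> D"
      using triangulation_with_ear i by blast
    note D' = cut_ear_triangulating[OF True _ _ D] and T = cut_ear_triangles[OF True _ _ D]
    show ?thesis
      using segal_at_ear(2)[OF X _ _ T triangles_bound _ _ a b m] D D' S True i
      by (simp add: two_Segal_iff)
  next
    \<comment> \<open>Only \<open>n = 1\<close> is left, to which the polygon condition does not
      speak; the triangle \<open>b\<close> is its own unique filler.\<close>
    case False
    then have n: "n = 1" "i = 1" using i by auto
    have all: "face X (Suc 1) [0, 1, Suc 1] x = x" if "x \<in> simp X (Suc 1)" for x
      using face_all[OF X that] by (simp add: upt_rec)
    have all1: "face X 1 [0, 1] x = x" if "x \<in> simp X 1" for x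
      using face_all[OF X that] by (simp add: upt_rec)
    have bd: "bd X 1 1 x = face X 2 [0, 2] x" for x
      unfolding bd_def face_def by (auto intro!: ap_cong simp: skip_def le_Suc_eq numeral_2_eq_2)
    have b': "b \<in> simp X (Suc 1)" using b by (simp add: numeral_2_eq_2)
    have "face X 1 [0, 1] a = face X 2 [0, 2] b" using m n by simp
    then have "bd X 1 1 b = a" using bd[of b] all1[of a] a n by simp
    show ?thesis unfolding n
    proof (rule ex1I[of _ b], intro conjI)
      show "face X (Suc 1) [1 - 1, 1, Suc 1] b = b" using all[OF b'] by simp
      fix x assume x: "x \<in> simp X (Suc 1) \<and> bd X 1 1 x = a \<and> face X (Suc 1) [1 - 1, 1, Suc 1] x = b"
      then show "x = b" using all[of x] by simp
    qed fact+
  qed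
qed

section \<open>Tetrahedra in a \<open>\<mu>\<close>-semicategory\<close>

abbreviation Mu :: "('u, 'b) musemicat_scheme \<Rightarrow> 'u set" where "Mu C \<equiv> apex (mu C)"
abbreviation e1 :: "('u, 'b) musemicat_scheme \<Rightarrow> 'u \<Rightarrow> 'u" where "e1 C m \<equiv> fst (lleg (mu C) m)"
abbreviation e2 :: "('u, 'b) musemicat_scheme \<Rightarrow> 'u \<Rightarrow> 'u" where "e2 C m \<equiv> snd (lleg (mu C) m)"
abbreviation e3 :: "('u, 'b) musemicat_scheme \<Rightarrow> 'u \<Rightarrow> 'u" where "e3 C m \<equiv> rleg (mu C) m"

text \<open>\<open>tet C a b c d\<close> says that \<open>a, b, c, d\<close> are the faces \<open>012\<close>, \<open>023\<close>, \<open>123\<close> and \<open>013\<close> of a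
  tetrahedron; an element \<open>m\<close> of \<open>\<mu>\<close> is a triangle with edges \<open>e1 m = 01\<close>, \<open>e2 m = 12\<close> and
  \<open>e3 m = 02\<close>.\<close>

definition tet :: "('u, 'b) musemicat_scheme \<Rightarrow> 'u \<Rightarrow> 'u \<Rightarrow> 'u \<Rightarrow> 'u \<Rightarrow> bool" where
  "tet C a b c d \<longleftrightarrow> a \<in> Mu C \<and> b \<in> Mu C \<and> c \<in> Mu C \<and> d \<in> Mu C \<and> e3 C a = e1 C b \<and> e3 C c = e2 C d \<and>
     assoc C ((a, e2 C b), b) = ((e1 C d, c), d)"

text \<open>The axioms not involving \<open>assoc\<close>, separated so that the spans
  \<open>mu_left\<close> and \<open>mu_right\<close> can be computed while
  \<open>is_musemicat\<close> is still to be proved.\<close>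

definition premu :: "('u, 'b) musemicat_scheme \<Rightarrow> bool" where
  "premu C \<longleftrightarrow> src C \<in> Ar1 C \<rightarrow>\<^sub>E Ob0 C \<and> tgt C \<in> Ar1 C \<rightarrow>\<^sub>E Ob0 C \<and>
     is_span (composable C) (Ar1 C) (mu C) \<and>
     (\<forall>m \<in> Mu C. src C (rleg (mu C) m) = src C (snd (lleg (mu C) m)) \<and>
                 tgt C (rleg (mu C) m) = tgt C (fst (lleg (mu C) m)))"

lemma musemicat_premu: "is_musemicat C \<Longrightarrow> premu C"
  by (simp add: is_musemicat_def premu_def)

lemma premu_mu:
  assumes "premu C" "m \<in> Mu C"
  shows "e1 C m \<in> Ar1 C" "e2 C m \<in> Ar1 C" "e3 C m \<in> Ar1 C" "src C (e1 C m) = tgt C (e2 C m)"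
    "src C (e3 C m) = src C (e2 C m)" "tgt C (e3 C m) = tgt C (e1 C m)"
proof -
  have "lleg (mu C) m \<in> composable C" "rleg (mu C) m \<in> Ar1 C"
    using assms unfolding premu_def is_span_def by (auto dest: PiE_mem)
  then show "e1 C m \<in> Ar1 C" "e2 C m \<in> Ar1 C" "e3 C m \<in> Ar1 C" "src C (e1 C m) = tgt C (e2 C m)"
    by (auto simp: composable_def)
  show "src C (e3 C m) = src C (e2 C m)" "tgt C (e3 C m) = tgt C (e1 C m)"
    using assms by (simp_all add: premu_def)
qed

lemma premu_ar: "premu C \<Longrightarrow> f \<in> Ar1 C \<Longrightarrow> src C f \<in> Ob0 C" "premu C \<Longrightarrow> f \<in> Ar1 C \<Longrightarrow> tgt C f \<in> Ob0 C"
  by (auto simp: premu_def)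

text \<open>The middle component is determined by \<open>b\<close>, which is why \<open>tet\<close>
  mentions only triangles.\<close>

lemma mem_mu_left:
  assumes "premu C"
  shows "((a, h), b) \<in> apex (mu_left C) \<longleftrightarrow> a \<in> Mu C \<and> b \<in> Mu C \<and> e3 C a = e1 C b \<and> h = e2 C b"
proof
  assume "((a, h), b) \<in> apex (mu_left C)"
  then have "a \<in> Mu C" "b \<in> Mu C" "(e3 C a, h) = lleg (mu C) b"
    by (auto simp: mu_left_def span_comp_def span_prod_def map_span_def)
  then show "a \<in> Mu C \<and> b \<in> Mu C \<and> e3 C a = e1 C b \<and> h = e2 C b" by (metis fst_conv snd_conv)
next
  assume a: "a \<in> Mu C \<and> b \<in> Mu C \<and> e3 C a = e1 C b \<and> h = e2 C b"
  then have "(e3 C a, h) = lleg (mu C) b" by simp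
  then show "((a, h), b) \<in> apex (mu_left C)"
    using a premu_mu[OF assms, of a] premu_mu[OF assms, of b]
    by (auto simp: mu_left_def span_comp_def span_prod_def map_span_def)
qed

lemma mem_mu_right:
  assumes "premu C"
  shows "((f, c), d) \<in> apex (mu_right C) \<longleftrightarrow> c \<in> Mu C \<and> d \<in> Mu C \<and> f = e1 C d \<and> e3 C c = e2 C d"
proof
  assume "((f, c), d) \<in> apex (mu_right C)"
  then have "c \<in> Mu C" "d \<in> Mu C" "(f, e3 C c) = lleg (mu C) d"
    by (auto simp: mu_right_def span_comp_def span_prod_def map_span_def)
  then show "c \<in> Mu C \<and> d \<in> Mu C \<and> f = e1 C d \<and> e3 C c = e2 C d" by (metis fst_conv snd_conv)
next
  assume a: "c \<in> Mu C \<and> d \<in> Mu C \<and> f = e1 C d \<and> e3 C c = e2 C d"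
  then have "(f, e3 C c) = lleg (mu C) d" by simp
  then show "((f, c), d) \<in> apex (mu_right C)"
    using a premu_mu[OF assms, of c] premu_mu[OF assms, of d]
    by (auto simp: mu_right_def span_comp_def span_prod_def map_span_def)
qed

lemma mu_left_legs:
  "lleg (span_resource reassoc (mu_left C)) ((a, h), b) = (e1 C a, e2 C a, h)"
  "rleg (span_resource reassoc (mu_left C)) ((a, h), b) = e3 C b"
  "apex (span_resource reassoc (mu_left C)) = apex (mu_left C)"
  by (simp_all add: span_resource_def reassoc_def mu_left_def span_comp_def span_prod_def map_span_def split: prod.split)

lemma mu_right_legs:
  "lleg (mu_right C) ((f, c), d) = (f, e1 C c, e2 C c)"
  "rleg (mu_right C) ((f, c), d) = e3 C d"
  by (simp_all add: mu_right_def span_comp_def span_prod_def map_span_def)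

lemma tet_assoc: "tet C a b c d \<Longrightarrow> assoc C ((a, e2 C b), b) = ((e1 C d, c), d)"
  by (simp add: tet_def)

lemma tet_mem:
  assumes "tet C a b c d"
  shows "a \<in> Mu C" "b \<in> Mu C" "c \<in> Mu C" "d \<in> Mu C" "e3 C a = e1 C b" "e3 C c = e2 C d"
  using assms by (auto simp: tet_def)

text \<open>These equations express that \<open>assoc\<close> commutes with the legs of the two
  spans.\<close>

lemma tet_edges:
  assumes C: "is_musemicat C" and t: "tet C a b c d"
  shows "e1 C a = e1 C d" "e2 C a = e1 C c" "e2 C b = e2 C c" "e3 C b = e3 C d"
proof -
  have "((a, e2 C b), b) \<in> apex (mu_left C)"
    using t mem_mu_left[OF musemicat_premu[OF C]] by (simp add: tet_def)
  moreover have "span_hom (span_resource reassoc (mu_left C)) (mu_right C) (assoc C)"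
    using C by (simp add: is_musemicat_def span_iso_def)
  ultimately have
    "lleg (mu_right C) ((e1 C d, c), d) = lleg (span_resource reassoc (mu_left C)) ((a, e2 C b), b)"
    "rleg (mu_right C) ((e1 C d, c), d) = rleg (span_resource reassoc (mu_left C)) ((a, e2 C b), b)"
    using tet_assoc[OF t] by (auto simp: span_hom_def mu_left_legs(3))
  then show "e1 C a = e1 C d" "e2 C a = e1 C c" "e2 C b = e2 C c" "e3 C b = e3 C d"
    by (simp_all add: mu_left_legs mu_right_legs)
qed

lemma tet_exists:
  assumes C: "is_musemicat C" and "a \<in> Mu C" "b \<in> Mu C" "e3 C a = e1 C b"
  shows "\<exists>c d. tet C a b c d"
proof -
  note p = musemicat_premu[OF C]
  have m: "((a, e2 C b), b) \<in> apex (mu_left C)" using assms mem_mu_left[OF p] by simp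
  moreover have "span_hom (span_resource reassoc (mu_left C)) (mu_right C) (assoc C)"
    using C by (simp add: is_musemicat_def span_iso_def)
  ultimately have "assoc C ((a, e2 C b), b) \<in> apex (mu_right C)"
    by (auto simp: span_hom_def mu_left_legs(3))
  moreover obtain f c d where fcd: "assoc C ((a, e2 C b), b) = ((f, c), d)" by (metis prod.exhaust)
  ultimately show ?thesis using mem_mu_right[OF p, of f c d] assms(2-4) unfolding tet_def by auto
qed

lemma tet_unique:
  assumes "tet C a b c d" "tet C a b c' d'"
  shows "c' = c" "d' = d"
  using assms by (auto simp: tet_def)

lemma tet_flip_exists:
  assumes C: "is_musemicat C" and "c \<in> Mu C" "d \<in> Mu C" "e3 C c = e2 C d"
  shows "\<exists>a b. tet C a b c d"
proof -
  note p = musemicat_premu[OF C]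
  have m: "((e1 C d, c), d) \<in> apex (mu_right C)" using assms mem_mu_right[OF p] by simp
  obtain \<psi> where \<psi>: "span_hom (mu_right C) (span_resource reassoc (mu_left C)) \<psi>"
    "\<forall>w\<in>apex (mu_right C). assoc C (\<psi> w) = w"
    using C by (auto simp: is_musemicat_def span_iso_def)
  have "\<psi> ((e1 C d, c), d) \<in> apex (mu_left C)"
    using \<psi>(1) m by (auto simp: span_hom_def mu_left_legs(3))
  moreover obtain a h b where ahb: "\<psi> ((e1 C d, c), d) = ((a, h), b)" by (metis prod.exhaust)
  moreover have "assoc C ((a, h), b) = ((e1 C d, c), d)" using \<psi>(2) m ahb by metis
  ultimately show ?thesis using mem_mu_left[OF p, of a h b] assms(2-4) unfolding tet_def by auto
qed

lemma tet_flip_unique: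
  assumes C: "is_musemicat C" and t: "tet C a b c d" "tet C a' b' c d"
  shows "a' = a" "b' = b"
proof -
  obtain \<psi> where "\<forall>w\<in>apex (mu_left C). \<psi> (assoc C w) = w"
    using C by (auto simp: is_musemicat_def span_iso_def mu_left_legs(3))
  moreover have "((a, e2 C b), b) \<in> apex (mu_left C)" "((a', e2 C b'), b') \<in> apex (mu_left C)"
    using t mem_mu_left[OF musemicat_premu[OF C]] by (simp_all add: tet_def)
  ultimately have "((a, e2 C b), b) = ((a', e2 C b'), b')"
    using tet_assoc[OF t(1)] tet_assoc[OF t(2)] by metis
  then show "a' = a" "b' = b" by auto
qed

lemma mem_span_comp:
  "(w, v) \<in> apex (span_comp \<tau> \<sigma>) \<longleftrightarrow> w \<in> apex \<sigma> \<and> v \<in> apex \<tau> \<and> rleg \<sigma> w = lleg \<tau> v"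
  by (simp add: span_comp_def)

lemma mem_span_prod:
  "(w, v) \<in> apex (span_prod a b \<sigma> \<tau>) \<longleftrightarrow> w \<in> apex \<sigma> \<and> v \<in> apex \<tau> \<and> a (rleg \<sigma> w) = b (rleg \<tau> v)"
  by (simp add: span_prod_def)

lemma mem_pentagon:
  "w \<in> apex (span_comp (mu C) (ar_prod C (mu_left C) (id_ar C))) \<longleftrightarrow>
    (\<exists>m h m' k m''. w = ((((m, h), m'), k), m'') \<and> ((m, h), m') \<in> apex (mu_left C) \<and> k \<in> Ar1 C \<and>
      src C (e3 C m') = tgt C k \<and> m'' \<in> Mu C \<and> (e3 C m', k) = lleg (mu C) m'')"
proof -
  have "rleg (mu_left C) ((m, h), m') = e3 C m'" for m h m' using mu_left_legs(2)[of C m h m'] by (simp add: span_resource_def)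
  then show ?thesis
    by (cases w) (auto simp: mem_span_comp mem_span_prod span_prod_def[of "src C" "tgt C" "mu_left C"] map_span_def)
qed

text \<open>The indices name the faces of a 4-simplex. One side of the pentagon passes through the
  tetrahedra 0123, 0134 and 1234, the other through 0234 and 0124. So \<open>y014\<close>, computed
  from 0124, equals \<open>x014\<close>, computed from 0134, and the tetrahedron 1234 comes as a
  conclusion.\<close>

lemma tet_pentagon:
  assumes C: "is_musemicat C"
    and t: "tet C x012 x023 x123 x013" "tet C x013 x034 x134 x014" "tet C x023 x034 x234 x024"
      "tet C x012 x024 x124 y014"
  shows "y014 = x014" "tet C x123 x134 x234 x124"
proof -
  note p = musemicat_premu[OF C]
  note E = tet_edges[OF C]
  let ?w = "((((x012, e2 C x023), x023), e2 C x034), x034)"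
  have "?w \<in> apex (span_comp (mu C) (ar_prod C (mu_left C) (id_ar C)))"
    unfolding mem_pentagon using mem_mu_left[OF p] tet_mem[OF t(1)] tet_mem[OF t(3)]
      premu_mu[OF p, of x034] premu_mu[OF p, of x023] by auto
  then have P: "pent3 C (pent2 C (pent1 C ?w)) = pent5 C (pent4 C ?w)"
    using C by (simp add: is_musemicat_def pentagon_def)
  have p1: "pent1 C ?w = ((((e1 C x013, x123), x013), e2 C x034), x034)"
    using tet_assoc[OF t(1)] by (simp add: pent1_def)
  have p2: "pent2 C \<dots> = ((e1 C x014, ((x123, e2 C x034), x134)), x014)"
    using tet_assoc[OF t(2)] by (simp add: pent2_def)
  have p4: "pent4 C ?w = ((x012, x234), x024)"
    using tet_assoc[OF t(3)] by (simp add: pent4_def)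
  have p5: "pent5 C \<dots> = ((e1 C y014, ((e2 C x012, x234), x124)), y014)"
    using tet_assoc[OF t(4)] tet_mem(6)[OF t(3)] by (simp add: pent5_def)
  \<comment> \<open>\<open>assoc\<close> is left unevaluated: its value on \<open>x123\<close> and
    \<open>x134\<close> is what the pentagon is about to give.\<close>
  have p3: "pent3 C ((e1 C x014, ((x123, e2 C x034), x134)), x014) = ((e1 C x014, assoc C ((x123, e2 C x034), x134)), x014)"
    by (simp add: pent3_def)
  have eq: "assoc C ((x123, e2 C x034), x134) = ((e2 C x012, x234), x124)" "y014 = x014"
    using P p1 p2 p3 p4 p5 by auto
  then show "y014 = x014" by simp
  have "e3 C x123 = e1 C x134" using tet_mem(6)[OF t(1)] E(2)[OF t(2)] by simp
  moreover have "e3 C x234 = e2 C x124" using tet_mem(6)[OF t(3)] E(3)[OF t(4)] by simp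
  moreover have "e2 C x034 = e2 C x134" using E(3)[OF t(2)] .
  moreover have "e2 C x012 = e1 C x124" using E(2)[OF t(4)] .
  ultimately show "tet C x123 x134 x234 x124"
    using eq(1) tet_mem[OF t(1)] tet_mem[OF t(2)] tet_mem[OF t(3)] tet_mem[OF t(4)] by (simp add: tet_def)
qed

text \<open>\<open>T\<close> is what \<open>tet C\<close> is meant to be. Existence and uniqueness
  on either side of a relation replace an explicit inverse of \<open>assoc\<close>, and the
  description operator used to define \<open>assoc\<close> in \<open>mu_of\<close> has to be
  evaluated only for the hypothesis on \<open>T\<close>.\<close>

lemma musemicatI:
  assumes p: "premu C" and ext: "assoc C \<in> extensional (apex (mu_left C))"
    and T: "\<And>a b c d. T a b c d \<Longrightarrow> a \<in> Mu C \<and> b \<in> Mu C \<and> c \<in> Mu C \<and> d \<in> Mu C \<and> e3 C a = e1 C b \<and> e3 C c = e2 C d \<and>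
      e1 C a = e1 C d \<and> e2 C a = e1 C c \<and> e2 C b = e2 C c \<and> e3 C b = e3 C d \<and> assoc C ((a, e2 C b), b) = ((e1 C d, c), d)"
    and ex: "\<And>a b. a \<in> Mu C \<Longrightarrow> b \<in> Mu C \<Longrightarrow> e3 C a = e1 C b \<Longrightarrow> \<exists>c d. T a b c d"
    and fex: "\<And>c d. c \<in> Mu C \<Longrightarrow> d \<in> Mu C \<Longrightarrow> e3 C c = e2 C d \<Longrightarrow> \<exists>a b. T a b c d"
    and func: "\<And>a b c d a' b'. T a b c d \<Longrightarrow> T a' b' c d \<Longrightarrow> a' = a \<and> b' = b"
    and pent: "\<And>x012 x023 x123 x013 x034 x134 x014 x234 x024 x124 y014.
      T x012 x023 x123 x013 \<Longrightarrow> T x013 x034 x134 x014 \<Longrightarrow> T x023 x034 x234 x024 \<Longrightarrow>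
      T x012 x024 x124 y014 \<Longrightarrow> y014 = x014 \<and> T x123 x134 x234 x124"
  shows "is_musemicat C"
proof -
  have hom: "span_hom (span_resource reassoc (mu_left C)) (mu_right C) (assoc C)"
    unfolding span_hom_def mu_left_legs(3)
  proof (intro conjI ballI)
    have key: "assoc C w \<in> apex (mu_right C) \<and> lleg (mu_right C) (assoc C w) = lleg (span_resource reassoc (mu_left C)) w \<and>
       rleg (mu_right C) (assoc C w) = rleg (span_resource reassoc (mu_left C)) w" if w: "w \<in> apex (mu_left C)" for w
    proof -
      obtain a h b where ahb: "w = ((a, h), b)" by (metis prod.exhaust)
      then have ab: "a \<in> Mu C" "b \<in> Mu C" "e3 C a = e1 C b" "h = e2 C b" using w mem_mu_left[OF p] by auto
      obtain c d where t: "T a b c d" using ex[OF ab(1-3)] by blast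
      have w': "w = ((a, e2 C b), b)" using ahb ab by simp
      have aw: "assoc C w = ((e1 C d, c), d)" using T[OF t] unfolding w' by blast
      show ?thesis using T[OF t] unfolding aw unfolding w'
        by (simp add: mem_mu_right[OF p] mu_left_legs mu_right_legs)
    qed
    show "assoc C \<in> apex (mu_left C) \<rightarrow>\<^sub>E apex (mu_right C)" using key ext by (auto simp: PiE_def)
    show "lleg (mu_right C) (assoc C w) = lleg (span_resource reassoc (mu_left C)) w"
      "rleg (mu_right C) (assoc C w) = rleg (span_resource reassoc (mu_left C)) w" if "w \<in> apex (mu_left C)" for w
      using key[OF that] by simp_all
  qed
  have bij: "bij_betw (assoc C) (apex (mu_left C)) (apex (mu_right C))"
  proof (rule bij_betw_imageI)
    show "inj_on (assoc C) (apex (mu_left C))"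
    proof (rule inj_onI)
      fix w w' assume w: "w \<in> apex (mu_left C)" "w' \<in> apex (mu_left C)" "assoc C w = assoc C w'"
      obtain a h b a' h' b' where ahb: "w = ((a, h), b)" "w' = ((a', h'), b')" by (metis prod.exhaust)
      then have ab: "a \<in> Mu C" "b \<in> Mu C" "e3 C a = e1 C b" "h = e2 C b"
        "a' \<in> Mu C" "b' \<in> Mu C" "e3 C a' = e1 C b'" "h' = e2 C b'" using w mem_mu_left[OF p] by auto
      obtain c d where t: "T a b c d" using ex[OF ab(1-3)] by blast
      obtain c' d' where t': "T a' b' c' d'" using ex[OF ab(5-7)] by blast
      have "c' = c" "d' = d" using T[OF t] T[OF t'] w(3) ahb ab by auto
      then show "w = w'" using func[OF t] t' ahb ab by auto
    qed
    have "v \<in> assoc C ` apex (mu_left C)" if v: "v \<in> apex (mu_right C)" for v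
    proof -
      obtain f c d where fcd: "v = ((f, c), d)" by (metis prod.exhaust)
      then have cd: "c \<in> Mu C" "d \<in> Mu C" "f = e1 C d" "e3 C c = e2 C d" using v mem_mu_right[OF p] by auto
      obtain a b where t: "T a b c d" using fex[OF cd(1,2,4)] by blast
      have "((a, e2 C b), b) \<in> apex (mu_left C)" using T[OF t] mem_mu_left[OF p] by simp
      moreover have "assoc C ((a, e2 C b), b) = v" using T[OF t] unfolding fcd cd(3) by blast
      ultimately show ?thesis by blast
    qed
    then show "assoc C ` apex (mu_left C) = apex (mu_right C)"
      using hom by (auto simp: span_hom_def mu_left_legs(3))
  qed
  have iso: "span_iso (span_resource reassoc (mu_left C)) (mu_right C) (assoc C)"
    unfolding span_iso_def
  proof (intro conjI hom exI)
    let ?\<psi> = "restrict (inv_into (apex (mu_left C)) (assoc C)) (apex (mu_right C))"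
    have inv: "inv_into (apex (mu_left C)) (assoc C) v \<in> apex (mu_left C)"
      "assoc C (inv_into (apex (mu_left C)) (assoc C) v) = v" if "v \<in> apex (mu_right C)" for v
      using bij that by (auto simp: bij_betw_def inv_into_into f_inv_into_f)
    show "span_hom (mu_right C) (span_resource reassoc (mu_left C)) ?\<psi>"
      using hom inv unfolding span_hom_def mu_left_legs(3) by (auto simp: PiE_def) metis+
    show "\<forall>w\<in>apex (span_resource reassoc (mu_left C)). ?\<psi> (assoc C w) = w"
      using hom bij unfolding mu_left_legs(3) span_hom_def by (auto simp: bij_betw_def PiE_def)
    show "\<forall>w\<in>apex (mu_right C). assoc C (?\<psi> w) = w" using inv by simp
  qed
  have "pentagon C"
    unfolding pentagon_def
  proof
    fix w assume "w \<in> apex (span_comp (mu C) (ar_prod C (mu_left C) (id_ar C)))"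
    then obtain x012 h x023 k x034 where w: "w = ((((x012, h), x023), k), x034)"
      and l: "((x012, h), x023) \<in> apex (mu_left C)" and k: "x034 \<in> Mu C" "(e3 C x023, k) = lleg (mu C) x034"
      unfolding mem_pentagon by blast
    have hk: "x012 \<in> Mu C" "x023 \<in> Mu C" "e3 C x012 = e1 C x023" "h = e2 C x023" "e3 C x023 = e1 C x034" "k = e2 C x034"
      using l mem_mu_left[OF p] k(2) by (auto dest: arg_cong[of _ _ fst] arg_cong[of _ _ snd])
    obtain x123 x013 where t1: "T x012 x023 x123 x013" using ex hk by blast
    obtain x134 x014 where t2: "T x013 x034 x134 x014" using ex T[OF t1] k hk by metis
    obtain x234 x024 where t3: "T x023 x034 x234 x024" using ex k hk by blast
    obtain x124 y014 where t4: "T x012 x024 x124 y014" using ex T[OF t3] hk by metis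
    note t5 = pent[OF t1 t2 t3 t4]
    have A: "assoc C ((x012, e2 C x023), x023) = ((e1 C x013, x123), x013)"
      "assoc C ((x013, e2 C x034), x034) = ((e1 C x014, x134), x014)"
      "assoc C ((x023, e2 C x034), x034) = ((e1 C x024, x234), x024)"
      "assoc C ((x012, e2 C x024), x024) = ((e1 C x014, x124), x014)"
      "assoc C ((x123, e2 C x034), x134) = ((e1 C x124, x234), x124)"
      using T[OF t1] T[OF t2] T[OF t3] T[OF t4] T[OF conjunct2[OF t5]] t5 by auto
    have B: "e3 C x234 = e2 C x024" "e1 C x124 = e2 C x012" using T[OF t3] T[OF t4] by auto
    have w': "w = ((((x012, e2 C x023), x023), e2 C x034), x034)" using w hk by simp
    show "pent3 C (pent2 C (pent1 C w)) = pent5 C (pent4 C w)"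
      unfolding w' by (simp add: pent1_def pent2_def pent3_def pent4_def pent5_def A B)
  qed
  then show ?thesis using p iso by (simp add: is_musemicat_def premu_def)
qed

section \<open>The 2-Segal set of a \<open>\<mu>\<close>-semicategory\<close>

definition chains :: "nat \<Rightarrow> nat list set" where
  "chains n = {l. incr n l \<and> length l \<le> 3}"

text \<open>Nothing is stored for four vertices: a tetrahedron is determined by its faces, so it
  enters as the condition \<open>tet\<close>. Extensionality makes a family equal to its values on
  the finite set \<open>chains n\<close>.\<close>

definition cosk :: "('u, 'b) musemicat_scheme \<Rightarrow> nat \<Rightarrow> (nat list \<Rightarrow> 'u) set" where
  "cosk C n = {d \<in> extensional (chains n).
     (\<forall>i\<le>n. d [i] \<in> Ob0 C) \<and>
     (\<forall>i j. i < j \<and> j \<le> n \<longrightarrow> d [i, j] \<in> Ar1 C \<and> tgt C (d [i, j]) = d [i] \<and> src C (d [i, j]) = d [j]) \<and>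
     (\<forall>i j k. i < j \<and> j < k \<and> k \<le> n \<longrightarrow> d [i, j, k] \<in> Mu C \<and>
        e1 C (d [i, j, k]) = d [i, j] \<and> e2 C (d [i, j, k]) = d [j, k] \<and> e3 C (d [i, j, k]) = d [i, k]) \<and>
     (\<forall>i j k l. i < j \<and> j < k \<and> k < l \<and> l \<le> n \<longrightarrow>
        tet C (d [i, j, k]) (d [i, k, l]) (d [j, k, l]) (d [i, j, l]))}"

text \<open>The simplices are functions, not elements of \<open>'u\<close>, and the action is not
  restricted to its domain. This is enough for \<open>semisimp\<close> and hence for the whole
  theory of ears.\<close>

definition Cosk :: "('u, 'b) musemicat_scheme \<Rightarrow> (nat list \<Rightarrow> 'u) simp_data" where
  "Cosk C = \<lparr>simp = cosk C, act = (\<lambda>m n \<theta> d. \<lambda>l\<in>chains m. d (map \<theta> l))\<rparr>"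

lemma Cosk_simps [simp]: "simp (Cosk C) = cosk C" "act (Cosk C) m n \<theta> d = (\<lambda>l\<in>chains m. d (map \<theta> l))"
  by (simp_all add: Cosk_def)

lemma chains_cases:
  assumes "l \<in> chains n"
  obtains i where "l = [i]" "i \<le> n" | i j where "l = [i, j]" "i < j" "j \<le> n"
    | i j k where "l = [i, j, k]" "i < j" "j < k" "k \<le> n"
proof -
  consider "l = []" | i where "l = [i]" | i j where "l = [i, j]" | i j k where "l = [i, j, k]" | "4 \<le> length l"
    by (cases l rule: list.exhaust, simp, rename_tac a l', case_tac l', simp, rename_tac b l'', case_tac l'', simp,
        rename_tac c l''', case_tac l''') auto
  then show ?thesis using assms that by cases (auto simp: chains_def incr_def)
qed

lemma chains_simps [simp]: "[i] \<in> chains n \<longleftrightarrow> i \<le> n" "[i, j] \<in> chains n \<longleftrightarrow> i < j \<and> j \<le> n"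
  "[i, j, k] \<in> chains n \<longleftrightarrow> i < j \<and> j < k \<and> k \<le> n"
  by (auto simp: chains_def)

lemma map_chains: "smap m n g \<Longrightarrow> l \<in> chains m \<Longrightarrow> map g l \<in> chains n"
  by (simp add: chains_def incr_map)

lemma finite_chains: "finite (chains n)"
  by (rule finite_subset[OF _ finite_lists_length_le[of "{..n}" 3]]) (auto simp: chains_def incr_def)

lemma cosk_ext: "d \<in> cosk C n \<Longrightarrow> d' \<in> cosk C n \<Longrightarrow> (\<And>l. l \<in> chains n \<Longrightarrow> d l = d' l) \<Longrightarrow> d = d'"
  by (rule extensionalityI) (auto simp: cosk_def)

lemma coskD:
  assumes "d \<in> cosk C n"
  shows "d \<in> extensional (chains n)"
    "i \<le> n \<Longrightarrow> d [i] \<in> Ob0 C"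
    "i < j \<Longrightarrow> j \<le> n \<Longrightarrow> d [i, j] \<in> Ar1 C" "i < j \<Longrightarrow> j \<le> n \<Longrightarrow> tgt C (d [i, j]) = d [i]"
    "i < j \<Longrightarrow> j \<le> n \<Longrightarrow> src C (d [i, j]) = d [j]"
    "i < j \<Longrightarrow> j < k \<Longrightarrow> k \<le> n \<Longrightarrow> d [i, j, k] \<in> Mu C"
    "i < j \<Longrightarrow> j < k \<Longrightarrow> k \<le> n \<Longrightarrow> e1 C (d [i, j, k]) = d [i, j]"
    "i < j \<Longrightarrow> j < k \<Longrightarrow> k \<le> n \<Longrightarrow> e2 C (d [i, j, k]) = d [j, k]"
    "i < j \<Longrightarrow> j < k \<Longrightarrow> k \<le> n \<Longrightarrow> e3 C (d [i, j, k]) = d [i, k]"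
    "i < j \<Longrightarrow> j < k \<Longrightarrow> k < l \<Longrightarrow> l \<le> n \<Longrightarrow> tet C (d [i, j, k]) (d [i, k, l]) (d [j, k, l]) (d [i, j, l])"
  using assms by (simp_all add: cosk_def)

lemma coskI:
  assumes "d \<in> extensional (chains n)" "\<And>i. i \<le> n \<Longrightarrow> d [i] \<in> Ob0 C"
    "\<And>i j. i < j \<Longrightarrow> j \<le> n \<Longrightarrow> d [i, j] \<in> Ar1 C \<and> tgt C (d [i, j]) = d [i] \<and> src C (d [i, j]) = d [j]"
    "\<And>i j k. i < j \<Longrightarrow> j < k \<Longrightarrow> k \<le> n \<Longrightarrow> d [i, j, k] \<in> Mu C \<and>
        e1 C (d [i, j, k]) = d [i, j] \<and> e2 C (d [i, j, k]) = d [j, k] \<and> e3 C (d [i, j, k]) = d [i, k]"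
    "\<And>i j k l. i < j \<Longrightarrow> j < k \<Longrightarrow> k < l \<Longrightarrow> l \<le> n \<Longrightarrow>
        tet C (d [i, j, k]) (d [i, k, l]) (d [j, k, l]) (d [i, j, l])"
  shows "d \<in> cosk C n"
proof -
  have 1: "\<forall>i\<le>n. d [i] \<in> Ob0 C" using assms(2) by simp
  have 2: "\<forall>i j. i < j \<and> j \<le> n \<longrightarrow> d [i, j] \<in> Ar1 C \<and> tgt C (d [i, j]) = d [i] \<and> src C (d [i, j]) = d [j]"
    using assms(3) by simp
  have 3: "\<forall>i j k. i < j \<and> j < k \<and> k \<le> n \<longrightarrow> d [i, j, k] \<in> Mu C \<and>
        e1 C (d [i, j, k]) = d [i, j] \<and> e2 C (d [i, j, k]) = d [j, k] \<and> e3 C (d [i, j, k]) = d [i, k]"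
    using assms(4) by simp
  have 4: "\<forall>i j k l. i < j \<and> j < k \<and> k < l \<and> l \<le> n \<longrightarrow>
        tet C (d [i, j, k]) (d [i, k, l]) (d [j, k, l]) (d [i, j, l])"
    using assms(5) by simp
  show ?thesis unfolding cosk_def by (rule CollectI, intro conjI[OF assms(1)] conjI[OF 1] conjI[OF 2] conjI[OF 3] 4)
qed

lemma cosk_reindex:
  assumes "d \<in> cosk C n" "smap m n g"
  shows "(\<lambda>l\<in>chains m. d (map g l)) \<in> cosk C m"
proof -
  have g: "\<And>i. i \<le> m \<Longrightarrow> g i \<le> n" "\<And>i j. i < j \<Longrightarrow> j \<le> m \<Longrightarrow> g i < g j" using assms(2) by (auto simp: smap_def)
  note D = coskD[OF assms(1)]
  show ?thesis
    by (rule coskI) (simp_all add: g D(2-10))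
qed

lemma Cosk_semisimp: "semisimp (Cosk C)"
  unfolding semisimp_def
proof (intro conjI allI ballI)
  fix m n \<theta> x assume t: "\<theta> \<in> Delta_inj m n" "x \<in> simp (Cosk C) n"
  show "act (Cosk C) m n \<theta> x \<in> simp (Cosk C) m" using cosk_reindex[of x C n m \<theta>] t by (simp add: Delta_inj_smap)
next
  fix n x assume "x \<in> simp (Cosk C) n"
  then have "x \<in> extensional (chains n)" by (simp add: cosk_def)
  moreover have "map (\<lambda>i\<in>{..n}. i) l = l" if "l \<in> chains n" for l
    using that by (auto simp: chains_def incr_def intro!: map_idI)
  ultimately show "act (Cosk C) n n (\<lambda>i\<in>{..n}. i) x = x" by (auto simp: fun_eq_iff extensional_def restrict_def)
next
  fix l m n \<theta> \<psi> x assume a: "\<theta> \<in> Delta_inj l m" "\<psi> \<in> Delta_inj m n"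
  have "map (compose {..l} \<psi> \<theta>) k = map (\<psi> \<circ> \<theta>) k" if "k \<in> chains l" for k
    using that by (auto simp: chains_def incr_def compose_def)
  then show "act (Cosk C) l n (compose {..l} \<psi> \<theta>) x = act (Cosk C) l m \<theta> (act (Cosk C) m n \<psi> x)"
    using map_chains[OF Delta_inj_smap[OF a(1)]] by (simp add: restrict_def fun_eq_iff del: map_eq_conv)
qed

lemma ap_Cosk: "ap (Cosk C) m n g d = (\<lambda>l\<in>chains m. d (map g l))"
  by (auto simp: ap_def fun_eq_iff chains_def incr_def intro!: arg_cong[of _ _ d])

lemma face_Cosk: "face (Cosk C) n l d = (\<lambda>k\<in>chains (length l - 1). d (map (nth l) k))"
  by (simp add: face_def ap_Cosk)

lemma bd_Cosk: "bd (Cosk C) n i d = (\<lambda>l\<in>chains n. d (map (skip i) l))"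
  by (simp add: bd_def ap_Cosk)

lemma bd_Cosk_last: "bd (Cosk C) n (Suc n) d = (\<lambda>l\<in>chains n. d l)"
  unfolding bd_Cosk by (auto simp: fun_eq_iff chains_def incr_def skip_def intro!: arg_cong[of _ _ d] map_idI)

text \<open>The edges are the legs of the triangle and the vertices are sources and targets of the
  edges, so a 2-simplex carries no more than one element of \<open>\<mu>\<close>.\<close>

lemma cosk2_eqI:
  assumes "premu C" "x \<in> cosk C 2" "y \<in> cosk C 2" "x [0, 1, 2] = y [0, 1, 2]"
  shows "x = y"
proof (rule cosk_ext[OF assms(2,3)])
  note X = coskD[OF assms(2)] and Y = coskD[OF assms(3)]
  have e: "x [0, 1] = y [0, 1]" "x [1, 2] = y [1, 2]" "x [0, 2] = y [0, 2]"
    using X(7-9)[of 0 1 2] Y(7-9)[of 0 1 2] assms(4) by simp_all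
  have v: "x [0] = y [0]" "x [1] = y [1]" "x [2] = y [2]"
    using X(4,5)[of 0 1] Y(4,5)[of 0 1] X(5)[of 1 2] Y(5)[of 1 2] e by simp_all
  fix l assume "l \<in> chains 2"
  then show "x l = y l"
  proof (cases rule: chains_cases)
    case (1 i) then show ?thesis using v by (auto simp: numeral_2_eq_2 le_Suc_eq)
  next
    case (2 i j) then have "(i, j) \<in> {(0, 1), (1, 2), (0, 2)}" by (auto simp: numeral_2_eq_2 le_Suc_eq less_Suc_eq)
    then show ?thesis using e 2 by auto
  next
    case (3 i j k) then have "i = 0" "j = 1" "k = 2" by auto
    with 3 assms(4) show ?thesis by simp
  qed
qed

section \<open>Building coskeletal simplices and attaching last ears to them\<close>

definition make :: "nat \<Rightarrow> (nat \<Rightarrow> 'u) \<Rightarrow> (nat \<Rightarrow> nat \<Rightarrow> 'u) \<Rightarrow> (nat \<Rightarrow> nat \<Rightarrow> nat \<Rightarrow> 'u) \<Rightarrow> nat list \<Rightarrow> 'u" where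
  "make n v e m = (\<lambda>l\<in>chains n. case l of [i] \<Rightarrow> v i | [i, j] \<Rightarrow> e i j | [i, j, k] \<Rightarrow> m i j k)"

lemma make_simps [simp]: "i \<le> n \<Longrightarrow> make n v e m [i] = v i"
  "i < j \<Longrightarrow> j \<le> n \<Longrightarrow> make n v e m [i, j] = e i j"
  "i < j \<Longrightarrow> j < k \<Longrightarrow> k \<le> n \<Longrightarrow> make n v e m [i, j, k] = m i j k"
  "make n v e m \<in> extensional (chains n)"
  by (simp_all add: make_def)

lemma cosk2_exists:
  assumes p: "premu C" and m: "m \<in> Mu C"
  shows "\<exists>x\<in>cosk C 2. x [0, 1, 2] = m"
proof -
  note P = premu_mu[OF p m]
  let ?v = "\<lambda>i. if i = 0 then tgt C (e1 C m) else if i = 1 then src C (e1 C m) else src C (e2 C m)"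
  let ?e = "\<lambda>i j. if i = 0 then if j = 1 then e1 C m else e3 C m else e2 C m"
  let ?x = "make 2 ?v ?e (\<lambda>i j k. m)"
  have O: "?x [i] \<in> Ob0 C" if "i \<le> 2" for i using that P premu_ar[OF p] by simp
  have A: "?x [i, j] \<in> Ar1 C \<and> tgt C (?x [i, j]) = ?x [i] \<and> src C (?x [i, j]) = ?x [j]" if "i < j" "j \<le> 2" for i j
  proof -
    have "(i, j) \<in> {(0, 1), (1, 2), (0, 2)}" using that by (auto simp: numeral_2_eq_2 le_Suc_eq less_Suc_eq)
    then show ?thesis using P by auto
  qed
  have M: "?x [i, j, k] \<in> Mu C \<and> e1 C (?x [i, j, k]) = ?x [i, j] \<and> e2 C (?x [i, j, k]) = ?x [j, k] \<and>
      e3 C (?x [i, j, k]) = ?x [i, k]" if "i < j" "j < k" "k \<le> 2" for i j k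
  proof -
    have "i = 0" "j = 1" "k = 2" using that by auto
    then show ?thesis using m by simp
  qed
  have T: "tet C (?x [i, j, k]) (?x [i, k, l]) (?x [j, k, l]) (?x [i, j, l])"
    if "i < j" "j < k" "k < l" "l \<le> 2" for i j k l using that by simp
  have "?x \<in> cosk C 2" by (rule coskI[OF make_simps(4) O A M T])
  then show ?thesis by (intro bexI[of _ ?x]) auto
qed

text \<open>The tetrahedra \<open>0, j, n, n+1\<close> determine the new triangles at the vertex 0,
  and then the tetrahedra \<open>0, i, j, n+1\<close> determine the remaining ones. New edges and
  the new vertex are read off from these triangles.\<close>

lemma Cosk_last_ears_unique:
  assumes C: "is_musemicat C" and n: "2 \<le> n" and x: "x \<in> cosk C (Suc n)" and y: "y \<in> cosk C (Suc n)"
    and old: "\<And>l. l \<in> chains n \<Longrightarrow> x l = y l" and new: "x [0, n, Suc n] = y [0, n, Suc n]"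
  shows "x = y"
proof -
  note X = coskD[OF x] and Y = coskD[OF y]
  have p: "x [0, j, Suc n] = y [0, j, Suc n]" if "0 < j" "j \<le> n" for j
  proof (cases "j = n")
    case False
    then have "tet C (x [0, j, n]) (x [0, n, Suc n]) (x [j, n, Suc n]) (x [0, j, Suc n])"
      "tet C (x [0, j, n]) (x [0, n, Suc n]) (y [j, n, Suc n]) (y [0, j, Suc n])"
      using X(10)[of 0 j n "Suc n"] Y(10)[of 0 j n "Suc n"] that old[of "[0, j, n]"] new by auto
    then show ?thesis using tet_unique(2) by metis
  qed (use new in simp)
  have q: "x [i, j, Suc n] = y [i, j, Suc n]" if "0 < i" "i < j" "j \<le> n" for i j
  proof -
    have "tet C (x [0, i, j]) (x [0, j, Suc n]) (x [i, j, Suc n]) (x [0, i, Suc n])"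
      "tet C (x [0, i, j]) (x [0, j, Suc n]) (y [i, j, Suc n]) (x [0, i, Suc n])"
      using X(10)[of 0 i j "Suc n"] Y(10)[of 0 i j "Suc n"] that old[of "[0, i, j]"] p[of i] p[of j] by auto
    then show ?thesis using tet_unique(1) by metis
  qed
  have e: "x [i, Suc n] = y [i, Suc n]" if "i \<le> n" for i
  proof (cases "i = 0")
    case True
    then show ?thesis using X(9)[of 0 n "Suc n"] Y(9)[of 0 n "Suc n"] new n by simp
  next
    case False
    then show ?thesis using X(8)[of 0 i "Suc n"] Y(8)[of 0 i "Suc n"] p[of i] that by simp
  qed
  have v: "x [Suc n] = y [Suc n]" using X(5)[of 0 "Suc n"] Y(5)[of 0 "Suc n"] e[of 0] by simp
  show ?thesis
  proof (rule cosk_ext[OF x y])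
    fix l assume "l \<in> chains (Suc n)"
    then show "x l = y l"
    proof (cases rule: chains_cases)
      case (1 i) then show ?thesis using v old[of l] by (cases "i = Suc n") auto
    next
      case (2 i j) then show ?thesis using e old[of l] by (cases "j = Suc n") auto
    next
      case (3 i j k) then show ?thesis using p q old[of l] by (cases "k = Suc n"; cases "i = 0") auto
    qed
  qed
qed

text \<open>Triangles with first vertex \<open>0\<close> compose like the morphisms of a category (the composite of
  \<open>012\<close> and \<open>023\<close> is \<open>013\<close>, associativity is the pentagon), so that gluing a triangle \<open>0, n, n+1\<close>
  to an \<open>n\<close>-simplex forces and defines all the other new triangles.\<close>

lemma Cosk_last_ears_exists:
  assumes C: "is_musemicat C" and n: "2 \<le> n" and a: "a \<in> cosk C n" and b: "b \<in> cosk C 2"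
    and m: "a [0] = b [0]" "a [n] = b [1]" "a [0, n] = b [0, 1]"
  shows "\<exists>x\<in>cosk C (Suc n). (\<forall>l\<in>chains n. x l = a l) \<and> x [0, n, Suc n] = b [0, 1, 2]"
proof -
  note p = musemicat_premu[OF C] and A = coskD[OF a] and B = coskD[OF b] and E = tet_edges[OF C]
  let ?t = "b [0, 1, 2]"
  have t: "?t \<in> Mu C" "e1 C ?t = a [0, n]" "e2 C ?t = b [1, 2]" "e3 C ?t = b [0, 2]"
    using B(6-9)[of 0 1 2] m by simp_all
  \<comment> \<open>The tetrahedron \<open>0, i, n, n+1\<close>, two of whose faces are given; the
    others are \<open>r i\<close> on \<open>i, n, n+1\<close> and \<open>s i\<close> on
    \<open>0, i, n+1\<close>.\<close>
  have "\<exists>c d. tet C (a [0, i, n]) ?t c d" if "0 < i" "i < n" for i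
    using tet_exists[OF C] A(6,9)[of 0 i n] t that by simp
  then obtain r s where rs: "\<And>i. 0 < i \<Longrightarrow> i < n \<Longrightarrow> tet C (a [0, i, n]) ?t (r i) (s i)" by metis
  \<comment> \<open>\<open>u i\<close> is the triangle \<open>0, i, n+1\<close>, the given one if
    \<open>i = n\<close>. The \<open>q i j\<close> obtained below is the triangle
    \<open>i, j, n+1\<close>.\<close>
  define u where "u i = (if i = n then ?t else s i)" for i
  have "\<exists>c. tet C (a [0, i, j]) (u j) c (u i)" if "0 < i" "i < j" "j \<le> n" for i j
  proof (cases "j = n")
    case True then show ?thesis using rs[of i] that by (auto simp: u_def)
  next
    case False
    then have j: "tet C (a [0, j, n]) ?t (r j) (s j)" "u j = s j" using rs[of j] that by (auto simp: u_def)
    have i: "tet C (a [0, i, n]) ?t (r i) (s i)" "u i = s i" using rs[of i] that by (auto simp: u_def)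
    have "e3 C (a [0, i, j]) = e1 C (s j)"
      using A(9)[of 0 i j] A(7)[of 0 j n] E(1)[OF j(1)] that False by simp
    moreover have "a [0, i, j] \<in> Mu C" using A(6)[of 0 i j] that by simp
    ultimately obtain c d where cd: "tet C (a [0, i, j]) (s j) c d"
      using tet_exists[OF C _ tet_mem(4)[OF j(1)]] by blast
    have "tet C (a [0, i, j]) (a [0, j, n]) (a [i, j, n]) (a [0, i, n])" using A(10)[of 0 i j n] that False by simp
    \<comment> \<open>The pentagon on \<open>0, i, j, n, n+1\<close>: attaching the last triangle in
      two ways produces the same triangle on \<open>0, i, n+1\<close>.\<close>
    then have "d = s i" using tet_pentagon(1)[OF C _ i(1) j(1) cd] by blast
    then show ?thesis using cd i j by auto
  qed
  then obtain q where q: "\<And>i j. 0 < i \<Longrightarrow> i < j \<Longrightarrow> j \<le> n \<Longrightarrow> tet C (a [0, i, j]) (u j) (q i j) (u i)" by metis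
  have u: "u i \<in> Mu C" "e1 C (u i) = a [0, i]" "e3 C (u i) = b [0, 2]" if "0 < i" "i \<le> n" for i
  proof -
    have "u i \<in> Mu C \<and> e1 C (u i) = a [0, i] \<and> e3 C (u i) = b [0, 2]"
    proof (cases "i = n")
      case True then show ?thesis using t by (simp add: u_def)
    next
      case False
      then show ?thesis using q[of i n] that tet_mem(4)[of C] E(1,4)[OF q[of i n]] A(7)[of 0 i n] t by (auto simp: u_def)
    qed
    then show "u i \<in> Mu C" "e1 C (u i) = a [0, i]" "e3 C (u i) = b [0, 2]" by simp_all
  qed
  let ?N = "Suc n"
  let ?v = "\<lambda>i. if i = ?N then b [2] else a [i]"
  let ?e = "\<lambda>i j. if j = ?N then if i = 0 then b [0, 2] else e2 C (u i) else a [i, j]"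
  let ?m = "\<lambda>i j k. if k = ?N then if i = 0 then u j else q i j else a [i, j, k]"
  let ?x = "make ?N ?v ?e ?m"
  have xO: "?x [i] \<in> Ob0 C" if "i \<le> ?N" for i using that A(2)[of i] B(2)[of 2] by simp
  have xA: "?x [i, j] \<in> Ar1 C \<and> tgt C (?x [i, j]) = ?x [i] \<and> src C (?x [i, j]) = ?x [j]" if ij: "i < j" "j \<le> ?N" for i j
  proof (cases "j = ?N")
    case False then show ?thesis using that A(3-5)[of i j] by simp
  next
    case True
    show ?thesis
    proof (cases "i = 0")
      case True then show ?thesis using \<open>j = ?N\<close> B(3-5)[of 0 2] m(1) by simp
    next
      case False
      then have i: "0 < i" "i \<le> n" using \<open>j = ?N\<close> ij by auto
      note M = premu_mu[OF p u(1)[OF i]]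
      have "src C (e1 C (u i)) = a [i]" using A(5)[of 0 i] u(2)[OF i] i by simp
      moreover have "src C (e3 C (u i)) = b [2]" using B(5)[of 0 2] u(3)[OF i] by simp
      ultimately show ?thesis using M \<open>j = ?N\<close> i by simp
    qed
  qed
  have xM: "?x [i, j, k] \<in> Mu C \<and> e1 C (?x [i, j, k]) = ?x [i, j] \<and> e2 C (?x [i, j, k]) = ?x [j, k] \<and>
      e3 C (?x [i, j, k]) = ?x [i, k]" if ijk: "i < j" "j < k" "k \<le> ?N" for i j k
  proof (cases "k = ?N")
    case False then show ?thesis using that A(6-9)[of i j k] by simp
  next
    case True
    show ?thesis
    proof (cases "i = 0")
      case True then show ?thesis using \<open>k = ?N\<close> ijk u[of j] by simp
    next
      case False
      then have i: "0 < i" "i < j" "j \<le> n" using \<open>k = ?N\<close> ijk by auto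
      note Q = q[OF i]
      show ?thesis using tet_mem[OF Q] E[OF Q] A(8)[of 0 i j] \<open>k = ?N\<close> i by simp
    qed
  qed
  have xT: "tet C (?x [i, j, k]) (?x [i, k, l]) (?x [j, k, l]) (?x [i, j, l])"
    if ijkl: "i < j" "j < k" "k < l" "l \<le> ?N" for i j k l
  proof (cases "l = ?N")
    case False then show ?thesis using that A(10)[of i j k l] by simp
  next
    case True
    show ?thesis
    proof (cases "i = 0")
      case True then show ?thesis using \<open>l = ?N\<close> ijkl q[of j k] by simp
    next
      case False
      \<comment> \<open>The second conclusion of the pentagon, on \<open>0, i, j, k, n+1\<close>:
        the four tetrahedra through 0 force the one avoiding it.\<close>
      then have "tet C (a [i, j, k]) (q i k) (q j k) (q i j)"
        using tet_pentagon(2)[OF C A(10)[of 0 i j k] q[of i k] q[of j k] q[of i j]] ijkl \<open>l = ?N\<close> by simp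
      then show ?thesis using \<open>l = ?N\<close> ijkl False by simp
    qed
  qed
  have x: "?x \<in> cosk C ?N" by (rule coskI[OF make_simps(4) xO xA xM xT])
  show ?thesis
  proof (intro bexI[OF _ x] conjI ballI)
    show "?x [0, n, ?N] = b [0, 1, 2]" using n by (simp add: u_def)
    fix l assume "l \<in> chains n" then show "?x l = a l" by (cases rule: chains_cases) auto
  qed
qed

lemma Cosk_last_ears:
  assumes C: "is_musemicat C"
  shows "last_ears (Cosk C)"
  unfolding last_ears_def Cosk_simps
proof (intro allI impI ballI)
  fix n a b assume n: "2 \<le> n" and a: "a \<in> cosk C n" and b: "b \<in> cosk C 2"
    and m: "face (Cosk C) n [0, n] a = face (Cosk C) 2 [0, 1] b"
  note p = musemicat_premu[OF C]
  have m': "a [0] = b [0]" "a [n] = b [1]" "a [0, n] = b [0, 1]"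
    using fun_cong[OF m, of "[0]"] fun_cong[OF m, of "[1]"] fun_cong[OF m, of "[0,1]"] by (simp_all add: face_Cosk)
  have f: "face (Cosk C) (Suc n) [0, n, Suc n] x \<in> cosk C 2" "face (Cosk C) (Suc n) [0, n, Suc n] x [0, 1, 2] = x [0, n, Suc n]"
    if "x \<in> cosk C (Suc n)" for x
    using face_in[OF Cosk_semisimp, of "Suc n" "[0, n, Suc n]" 2 x C] that n by (simp_all add: face_Cosk)
  have ext: "a \<in> extensional (chains n)" using coskD(1)[OF a] .
  show "\<exists>!x. x \<in> cosk C (Suc n) \<and> bd (Cosk C) n (Suc n) x = a \<and> face (Cosk C) (Suc n) [0, n, Suc n] x = b"
  proof (rule ex_ex1I)
    obtain x where x: "x \<in> cosk C (Suc n)" "\<forall>l\<in>chains n. x l = a l" "x [0, n, Suc n] = b [0, 1, 2]"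
      using Cosk_last_ears_exists[OF C n a b m'] by blast
    have "bd (Cosk C) n (Suc n) x = a"
      using x(2) ext by (auto simp: bd_Cosk_last fun_eq_iff extensional_def)
    moreover have "face (Cosk C) (Suc n) [0, n, Suc n] x = b"
      using f[OF x(1)] x(3) b by (intro cosk2_eqI[OF p]) auto
    ultimately show "\<exists>x. x \<in> cosk C (Suc n) \<and> bd (Cosk C) n (Suc n) x = a \<and> face (Cosk C) (Suc n) [0, n, Suc n] x = b"
      using x(1) by blast
  next
    fix x y assume xy: "x \<in> cosk C (Suc n) \<and> bd (Cosk C) n (Suc n) x = a \<and> face (Cosk C) (Suc n) [0, n, Suc n] x = b"
      "y \<in> cosk C (Suc n) \<and> bd (Cosk C) n (Suc n) y = a \<and> face (Cosk C) (Suc n) [0, n, Suc n] y = b"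
    have "x l = y l" if "l \<in> chains n" for l
      using xy that unfolding bd_Cosk_last by (metis restrict_apply')
    moreover have "x [0, n, Suc n] = y [0, n, Suc n]" using xy f(2) by metis
    ultimately show "x = y" using Cosk_last_ears_unique[OF C n] xy by blast
  qed
qed

text \<open>The inverse of \<open>\<alpha>\<close> turns the triangles 123 and 013 into 012 and 023,
  which \<open>last_ears\<close> assembles to a 3-simplex. Its remaining faces are the original
  ones, since \<open>tet\<close> is functional.\<close>

lemma Cosk_flip:
  assumes C: "is_musemicat C"
  shows "flip (Cosk C)"
  unfolding flip_def Cosk_simps
proof (intro allI impI ballI)
  fix a b assume a: "a \<in> cosk C 2" and b: "b \<in> cosk C 2"
    and m: "face (Cosk C) 2 [1, 2] a = face (Cosk C) 2 [0, 2] b"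
  note p = musemicat_premu[OF C] and S = Cosk_semisimp[of C] and L = Cosk_last_ears[OF C]
  have m': "a [1, 2] = b [0, 2]" using fun_cong[OF m, of "[0,1]"] by (simp add: face_Cosk)
  have f: "face (Cosk C) 3 [i, j, k] x \<in> cosk C 2" "face (Cosk C) 3 [i, j, k] x [0, 1, 2] = x [i, j, k]"
    if "x \<in> cosk C 3" "i < j" "j < k" "k \<le> 3" for x i j k
    using face_in[OF S, of 3 "[i, j, k]" 2 x] that by (simp_all add: face_Cosk)
  have bd: "bd (Cosk C) 2 3 x = face (Cosk C) 3 [0, 1, 2] x" if "x \<in> cosk C 3" for x
    using bd_last_face(4)[OF S] that by simp
  have s3: "Suc 2 = 3" by simp
  show "\<exists>!x. x \<in> cosk C 3 \<and> face (Cosk C) 3 [0, 1, 3] x = a \<and> face (Cosk C) 3 [1, 2, 3] x = b"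
  proof (rule ex_ex1I)
    have "e3 C (b [0, 1, 2]) = e2 C (a [0, 1, 2])" using coskD(8)[OF a, of 0 1 2] coskD(9)[OF b, of 0 1 2] m' by simp
    then obtain s t where st: "tet C s t (b [0, 1, 2]) (a [0, 1, 2])"
      using tet_flip_exists[OF C] coskD(6)[OF a, of 0 1 2] coskD(6)[OF b, of 0 1 2] by force
    obtain s' where s': "s' \<in> cosk C 2" "s' [0, 1, 2] = s" using cosk2_exists[OF p] tet_mem(1)[OF st] by blast
    obtain t' where t': "t' \<in> cosk C 2" "t' [0, 1, 2] = t" using cosk2_exists[OF p] tet_mem(2)[OF st] by blast
    note S' = coskD[OF s'(1)] and T' = coskD[OF t'(1)]
    have e: "s' [0, 2] = t' [0, 1]" using tet_mem(5)[OF st] S'(9)[of 0 1 2] T'(7)[of 0 1 2] s' t' by simp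
    then have "s' [0] = t' [0]" "s' [2] = t' [1]" using S'(4,5)[of 0 2] T'(4,5)[of 0 1] by simp_all
    then obtain x where x: "x \<in> cosk C 3" "\<forall>l\<in>chains 2. x l = s' l" "x [0, 2, 3] = t"
      using Cosk_last_ears_exists[OF C order_refl s'(1) t'(1)] e t' unfolding s3 by metis
    have "tet C s t (x [1, 2, 3]) (x [0, 1, 3])"
      using coskD(10)[OF x(1), of 0 1 2 3] x s' by simp
    then have "x [1, 2, 3] = b [0, 1, 2]" "x [0, 1, 3] = a [0, 1, 2]" using tet_unique[OF st] by blast+
    then have "face (Cosk C) 3 [0, 1, 3] x = a" "face (Cosk C) 3 [1, 2, 3] x = b"
      using f[OF x(1)] a b by (auto intro!: cosk2_eqI[OF p])
    then show "\<exists>x. x \<in> cosk C 3 \<and> face (Cosk C) 3 [0, 1, 3] x = a \<and> face (Cosk C) 3 [1, 2, 3] x = b"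
      using x(1) by blast
  next
    fix x y assume xy: "x \<in> cosk C 3 \<and> face (Cosk C) 3 [0, 1, 3] x = a \<and> face (Cosk C) 3 [1, 2, 3] x = b"
      "y \<in> cosk C 3 \<and> face (Cosk C) 3 [0, 1, 3] y = a \<and> face (Cosk C) 3 [1, 2, 3] y = b"
    then have x: "x \<in> cosk C 3" and y: "y \<in> cosk C 3" by auto
    have e: "x [0, 1, 3] = y [0, 1, 3]" "x [1, 2, 3] = y [1, 2, 3]"
      using xy f(2)[OF x, of 0 1 3] f(2)[OF y, of 0 1 3] f(2)[OF x, of 1 2 3] f(2)[OF y, of 1 2 3] by simp_all
    have "x [0, 1, 2] = y [0, 1, 2]" "x [0, 2, 3] = y [0, 2, 3]"
      using tet_flip_unique[OF C] coskD(10)[OF x, of 0 1 2 3] coskD(10)[OF y, of 0 1 2 3] e by auto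
    then have "face (Cosk C) 3 [0, 1, 2] x = face (Cosk C) 3 [0, 1, 2] y"
      "face (Cosk C) 3 [0, 2, 3] x = face (Cosk C) 3 [0, 2, 3] y"
      using f[OF x] f[OF y] by (auto intro!: cosk2_eqI[OF p])
    then show "x = y" using last_ears_unique[OF L S order_refl, of x y] x y bd unfolding s3 by simp
  qed
qed

lemma Cosk_ears: "is_musemicat C \<Longrightarrow> ears (Cosk C)"
  by (intro ears_from_last_ears Cosk_semisimp Cosk_last_ears Cosk_flip)

section \<open>Functors of \<open>\<mu>\<close>-semicategories\<close>

text \<open>A functor in unpacked form. \<open>g\<close> is the map on 2-simplices contained in
  \<open>F2\<close>, whose other component is forced to be the left leg; \<open>mkfun\<close>
  repacks the three maps and makes them extensional.\<close>

definition sfun :: "('u, 'b) musemicat_scheme \<Rightarrow> ('u, 'b) musemicat_scheme \<Rightarrow>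
    ('u \<Rightarrow> 'u) \<Rightarrow> ('u \<Rightarrow> 'u) \<Rightarrow> ('u \<Rightarrow> 'u) \<Rightarrow> bool" where
  "sfun C D f0 f1 g \<longleftrightarrow> (\<forall>x\<in>Ob0 C. f0 x \<in> Ob0 D) \<and> (\<forall>f\<in>Ar1 C. f1 f \<in> Ar1 D) \<and>
     (\<forall>f\<in>Ar1 C. f0 (src C f) = src D (f1 f) \<and> f0 (tgt C f) = tgt D (f1 f)) \<and>
     (\<forall>m\<in>Mu C. g m \<in> Mu D \<and> e1 D (g m) = f1 (e1 C m) \<and> e2 D (g m) = f1 (e2 C m) \<and> e3 D (g m) = f1 (e3 C m)) \<and>
     (\<forall>a b c d. tet C a b c d \<longrightarrow> tet D (g a) (g b) (g c) (g d))"

definition mkfun :: "('u, 'b) musemicat_scheme \<Rightarrow> ('u \<Rightarrow> 'u) \<Rightarrow> ('u \<Rightarrow> 'u) \<Rightarrow> ('u \<Rightarrow> 'u) \<Rightarrow> 'u mufun" where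
  "mkfun C f0 f1 g = \<lparr>F0 = restrict f0 (Ob0 C), F1 = restrict f1 (Ar1 C),
     F2 = (\<lambda>(m, x)\<in>apex (map_mu C (\<lambda>f. f)). (lleg (mu C) m, g m))\<rparr>"

lemma mem_map_mu: "premu C \<Longrightarrow> (m, x) \<in> apex (map_mu C F) \<longleftrightarrow> m \<in> Mu C \<and> x = e3 C m"
  using premu_mu(3)[of C m] by (auto simp: map_mu_def mem_span_comp map_span_def)

lemma mkfun_simps [simp]:
  "x \<in> Ob0 C \<Longrightarrow> F0 (mkfun C f0 f1 g) x = f0 x" "f \<in> Ar1 C \<Longrightarrow> F1 (mkfun C f0 f1 g) f = f1 f"
  by (simp_all add: mkfun_def)

lemma mkfun_F2: "premu C \<Longrightarrow> m \<in> Mu C \<Longrightarrow> F2 (mkfun C f0 f1 g) (m, e3 C m) = (lleg (mu C) m, g m)"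
  by (simp add: mkfun_def mem_map_mu)

lemma mu_action_mkfun: "premu C \<Longrightarrow> m \<in> Mu C \<Longrightarrow> mu_action C (mkfun C f0 f1 g) m = g m"
  by (simp add: mu_action_def mkfun_F2)

lemma mkfun_cong:
  assumes "premu C" "\<And>x. x \<in> Ob0 C \<Longrightarrow> f0 x = f0' x" "\<And>f. f \<in> Ar1 C \<Longrightarrow> f1 f = f1' f" "\<And>m. m \<in> Mu C \<Longrightarrow> g m = g' m"
  shows "mkfun C f0 f1 g = mkfun C f0' f1' g'"
  unfolding mkfun_def using assms by (auto simp: fun_eq_iff restrict_def mem_map_mu)

lemma map_mu_legs: "lleg (map_mu C F) (m, x) = lleg (mu C) m" "rleg (map_mu C F) (m, x) = F x"
  by (simp_all add: map_mu_def span_comp_def map_span_def)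

lemma mem_mu_map:
  "(fg, n) \<in> apex (mu_map C D F) \<longleftrightarrow> fg \<in> composable C \<and> n \<in> Mu D \<and> map_prod F F fg = lleg (mu D) n"
  "lleg (mu_map C D F) (fg, n) = fg" "rleg (mu_map C D F) (fg, n) = e3 D n"
  by (simp_all add: mu_map_def span_comp_def map_span_def)

lemma lleg_composable: "premu C \<Longrightarrow> m \<in> Mu C \<Longrightarrow> lleg (mu C) m \<in> composable C"
  by (auto simp: premu_def is_span_def dest: PiE_mem)

lemma semifunctorD:
  assumes C: "is_musemicat C" and D: "is_musemicat D" and F: "F \<in> semifunctors C D"
  shows "F = mkfun C (F0 F) (F1 F) (mu_action C F)" "sfun C D (F0 F) (F1 F) (mu_action C F)"
proof -
  let ?G = "mu_action C F"
  note p = musemicat_premu[OF C] and q = musemicat_premu[OF D]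
  have f0: "F0 F \<in> Ob0 C \<rightarrow>\<^sub>E Ob0 D" and f1: "F1 F \<in> Ar1 C \<rightarrow>\<^sub>E Ar1 D"
    and st: "\<forall>f\<in>Ar1 C. F0 F (src C f) = src D (F1 F f) \<and> F0 F (tgt C f) = tgt D (F1 F f)"
    and sh: "span_hom (map_mu C (F1 F)) (mu_map C D (F1 F)) (F2 F)"
    and as: "\<forall>w \<in> apex (mu_left C).
        assoc D (map_prod (map_prod ?G (F1 F)) ?G w) = map_prod (map_prod (F1 F) ?G) ?G (assoc C w)"
    using F by (auto simp: semifunctors_def Let_def)
  have m: "F2 F (m, e3 C m) = (lleg (mu C) m, ?G m) \<and> ?G m \<in> Mu D \<and> e1 D (?G m) = F1 F (e1 C m) \<and>
      e2 D (?G m) = F1 F (e2 C m) \<and> e3 D (?G m) = F1 F (e3 C m)" if m: "m \<in> Mu C" for m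
  proof -
    have mm: "(m, e3 C m) \<in> apex (map_mu C (F1 F))" using m mem_map_mu[OF p] by simp
    obtain fg n where fn: "F2 F (m, e3 C m) = (fg, n)" by fastforce
    have "F2 F (m, e3 C m) \<in> apex (mu_map C D (F1 F))" using sh mm by (auto simp: span_hom_def)
    then have 1: "n \<in> Mu D" "map_prod (F1 F) (F1 F) fg = lleg (mu D) n" unfolding fn mem_mu_map by auto
    have "lleg (mu_map C D (F1 F)) (F2 F (m, e3 C m)) = lleg (map_mu C (F1 F)) (m, e3 C m)"
      "rleg (mu_map C D (F1 F)) (F2 F (m, e3 C m)) = rleg (map_mu C (F1 F)) (m, e3 C m)"
      using sh mm by (auto simp: span_hom_def)
    then have 2: "fg = lleg (mu C) m" "e3 D n = F1 F (e3 C m)" unfolding fn mem_mu_map map_mu_legs by auto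
    have "?G m = n" by (simp add: mu_action_def fn)
    then show ?thesis using 1 2 fn by (auto simp: map_prod_def split: prod.splits dest: sym)
  qed
  have ext: "F2 F \<in> extensional (apex (map_mu C (\<lambda>f. f)))"
  proof -
    have "apex (map_mu C (F1 F)) = apex (map_mu C (\<lambda>f. f))" using mem_map_mu[OF p] by auto
    then show ?thesis using sh by (auto simp: span_hom_def PiE_def)
  qed
  have "F2 F = (\<lambda>(m, x)\<in>apex (map_mu C (\<lambda>f. f)). (lleg (mu C) m, ?G m))"
  proof (rule extensionalityI[OF ext restrict_extensional])
    fix w assume w: "w \<in> apex (map_mu C (\<lambda>f. f))"
    obtain m' x where "w = (m', x)" by fastforce
    then show "F2 F w = (\<lambda>(m, x)\<in>apex (map_mu C (\<lambda>f. f)). (lleg (mu C) m, ?G m)) w"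
      using w m[of m'] mem_map_mu[OF p, of m' x "\<lambda>f. f"] by auto
  qed
  then show "F = mkfun C (F0 F) (F1 F) ?G"
    unfolding mkfun_def using f0 f1 by (auto simp: PiE_def extensional_restrict intro!: mufun.equality)
  have "tet D (?G a) (?G b) (?G c) (?G d)" if t: "tet C a b c d" for a b c d
  proof -
    note M = tet_mem[OF t]
    have "((a, e2 C b), b) \<in> apex (mu_left C)" using M mem_mu_left[OF p] by simp
    from bspec[OF as this]
    have "assoc D ((?G a, F1 F (e2 C b)), ?G b) = ((F1 F (e1 C d), ?G c), ?G d)" by (simp add: tet_assoc[OF t])
    then show ?thesis unfolding tet_def using m[OF M(1)] m[OF M(2)] m[OF M(3)] m[OF M(4)] M by simp
  qed
  then show "sfun C D (F0 F) (F1 F) ?G"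
    unfolding sfun_def using f0 f1 st m by auto
qed

lemma mkfun_semifunctor:
  assumes C: "is_musemicat C" and D: "is_musemicat D" and F: "sfun C D f0 f1 g"
  shows "mkfun C f0 f1 g \<in> semifunctors C D"
proof -
  let ?F = "mkfun C f0 f1 g"
  note p = musemicat_premu[OF C] and q = musemicat_premu[OF D]
  have f: "\<forall>x\<in>Ob0 C. f0 x \<in> Ob0 D" "\<forall>f\<in>Ar1 C. f1 f \<in> Ar1 D"
     "\<forall>f\<in>Ar1 C. f0 (src C f) = src D (f1 f) \<and> f0 (tgt C f) = tgt D (f1 f)"
     "\<forall>m\<in>Mu C. g m \<in> Mu D \<and> e1 D (g m) = f1 (e1 C m) \<and> e2 D (g m) = f1 (e2 C m) \<and> e3 D (g m) = f1 (e3 C m)"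
     "\<And>a b c d. tet C a b c d \<Longrightarrow> tet D (g a) (g b) (g c) (g d)"
    using F by (auto simp: sfun_def)
  note P = premu_mu[OF p] and G = mu_action_mkfun[OF p, of _ f0 f1 g]
  have s: "F2 ?F w \<in> apex (mu_map C D (F1 ?F)) \<and> lleg (mu_map C D (F1 ?F)) (F2 ?F w) = lleg (map_mu C (F1 ?F)) w \<and>
      rleg (mu_map C D (F1 ?F)) (F2 ?F w) = rleg (map_mu C (F1 ?F)) w" if w: "w \<in> apex (map_mu C (F1 ?F))" for w
  proof -
    obtain m x where "w = (m, x)" by fastforce
    then have m: "w = (m, e3 C m)" "m \<in> Mu C" using w mem_map_mu[OF p] by auto
    have "map_prod (F1 ?F) (F1 ?F) (lleg (mu C) m) = lleg (mu D) (g m)"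
      using f(4) m P[OF m(2)] by (simp add: prod_eq_iff)
    then show ?thesis using f(4) m P[OF m(2)] lleg_composable[OF p m(2)]
      by (simp add: mkfun_F2[OF p m(2)] mem_mu_map map_mu_legs)
  qed
  have ap: "apex (map_mu C (F1 ?F)) = apex (map_mu C (\<lambda>f. f))" using mem_map_mu[OF p] by auto
  have "F2 ?F \<in> extensional (apex (map_mu C (F1 ?F)))" unfolding ap by (simp add: mkfun_def)
  then have sh: "span_hom (map_mu C (F1 ?F)) (mu_map C D (F1 ?F)) (F2 ?F)"
    unfolding span_hom_def using s by (auto simp: PiE_def)
  have as: "assoc D (map_prod (map_prod (mu_action C ?F) (F1 ?F)) (mu_action C ?F) w) =
      map_prod (map_prod (F1 ?F) (mu_action C ?F)) (mu_action C ?F) (assoc C w)" if w: "w \<in> apex (mu_left C)" for w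
  proof -
    obtain a h b where "w = ((a, h), b)" by (metis prod.exhaust)
    then have ab: "w = ((a, e2 C b), b)" "a \<in> Mu C" "b \<in> Mu C" "e3 C a = e1 C b" using w mem_mu_left[OF p] by auto
    obtain c d where t: "tet C a b c d" using tet_exists[OF C ab(2-4)] by blast
    have "e2 D (g b) = f1 (e2 C b)" "e1 D (g d) = f1 (e1 C d)" using f(4) tet_mem[OF t] by auto
    then show ?thesis using tet_assoc[OF f(5)[OF t]] tet_assoc[OF t] tet_mem[OF t] ab(1) P
      by (simp add: G)
  qed
  have "F0 ?F \<in> Ob0 C \<rightarrow>\<^sub>E Ob0 D" "F1 ?F \<in> Ar1 C \<rightarrow>\<^sub>E Ar1 D" using f(1,2) by (auto simp: mkfun_def)
  moreover have "\<forall>f\<in>Ar1 C. F0 ?F (src C f) = src D (F1 ?F f) \<and> F0 ?F (tgt C f) = tgt D (F1 ?F f)"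
    using f(3) premu_ar[OF p] by simp
  ultimately show ?thesis unfolding semifunctors_def Let_def using sh as by blast
qed

lemma mkfun_comp:
  assumes p: "premu C" and q: "premu D" and F: "sfun C D f0 f1 g"
  shows "mufun_comp C (mkfun D f0' f1' g') (mkfun C f0 f1 g) = mkfun C (f0' \<circ> f0) (f1' \<circ> f1) (g' \<circ> g)"
proof -
  have f: "\<forall>x\<in>Ob0 C. f0 x \<in> Ob0 D" "\<forall>f\<in>Ar1 C. f1 f \<in> Ar1 D"
     "\<forall>m\<in>Mu C. g m \<in> Mu D \<and> e3 D (g m) = f1 (e3 C m)" using F by (auto simp: sfun_def)
  have "(\<lambda>(m, x)\<in>apex (map_mu C (\<lambda>f. f)). case F2 (mkfun C f0 f1 g) (m, x) of
         (fg, n) \<Rightarrow> (fg, snd (F2 (mkfun D f0' f1' g') (n, F1 (mkfun C f0 f1 g) x)))) =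
      (\<lambda>(m, x)\<in>apex (map_mu C (\<lambda>f. f)). (lleg (mu C) m, (g' \<circ> g) m))"
  proof (rule restrict_ext)
    fix w assume w: "w \<in> apex (map_mu C (\<lambda>f. f))"
    obtain m x where "w = (m, x)" by fastforce
    then have m: "w = (m, e3 C m)" "m \<in> Mu C" using w mem_map_mu[OF p] by auto
    have "F1 (mkfun C f0 f1 g) (e3 C m) = e3 D (g m)" using f m premu_mu(3)[OF p m(2)] by simp
    moreover have "F2 (mkfun D f0' f1' g') (g m, f1 (e3 C m)) = (lleg (mu D) (g m), g' (g m))"
      using mkfun_F2[OF q, of "g m" f0' f1' g'] f m by simp
    ultimately show "(case w of (m, x) \<Rightarrow> case F2 (mkfun C f0 f1 g) (m, x) of
         (fg, n) \<Rightarrow> (fg, snd (F2 (mkfun D f0' f1' g') (n, F1 (mkfun C f0 f1 g) x)))) =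
       (case w of (m, x) \<Rightarrow> (lleg (mu C) m, (g' \<circ> g) m))"
      using f m by (simp add: mkfun_F2[OF p] mkfun_F2[OF q])
  qed
  moreover have "compose (Ob0 C) (F0 (mkfun D f0' f1' g')) (F0 (mkfun C f0 f1 g)) = restrict (f0' \<circ> f0) (Ob0 C)"
    "compose (Ar1 C) (F1 (mkfun D f0' f1' g')) (F1 (mkfun C f0 f1 g)) = restrict (f1' \<circ> f1) (Ar1 C)"
    using f by (auto simp: compose_def fun_eq_iff restrict_def)
  ultimately show ?thesis unfolding mufun_comp_def by (simp add: mkfun_def)
qed

lemma mufun_id_mkfun: "mufun_id C = mkfun C (\<lambda>x. x) (\<lambda>x. x) (\<lambda>x. x)"
  by (simp add: mufun_id_def mkfun_def)

lemma sfun_id: "sfun C C (\<lambda>x. x) (\<lambda>x. x) (\<lambda>x. x)"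
  by (simp add: sfun_def)

lemma sfun_comp:
  assumes p: "premu C" and F: "sfun C D f0 f1 g" and G: "sfun D E f0' f1' g'"
  shows "sfun C E (f0' \<circ> f0) (f1' \<circ> f1) (g' \<circ> g)"
  using F G premu_mu[OF p] premu_ar[OF p] unfolding sfun_def by simp

section \<open>The category of \<mu>-semicategories and its isomorphisms\<close>

lemma muSCat_simps [simp]: "Ob muSCat = {C. is_musemicat C}" "Hom muSCat = semifunctors" "Idm muSCat = mufun_id"
  "Cmp muSCat X Y Z = mufun_comp X"
  by (simp_all add: muSCat_def)

lemma semifunctorE:
  assumes "is_musemicat C" "is_musemicat D" "F \<in> semifunctors C D"
  obtains f0 f1 g where "F = mkfun C f0 f1 g" "sfun C D f0 f1 g"
  using semifunctorD[OF assms] by blast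

lemma semifunctor_id: "is_musemicat C \<Longrightarrow> mufun_id C \<in> semifunctors C C"
  unfolding mufun_id_mkfun by (intro mkfun_semifunctor sfun_id)

lemma semifunctor_comp:
  assumes "is_musemicat C" "is_musemicat D" "is_musemicat E" "F \<in> semifunctors C D" "G \<in> semifunctors D E"
  shows "mufun_comp C G F \<in> semifunctors C E"
proof -
  obtain f0 f1 f2 where F: "F = mkfun C f0 f1 f2" "sfun C D f0 f1 f2" using semifunctorE[OF assms(1,2,4)] .
  obtain g0 g1 g2 where G: "G = mkfun D g0 g1 g2" "sfun D E g0 g1 g2" using semifunctorE[OF assms(2,3,5)] .
  note p = musemicat_premu[OF assms(1)] musemicat_premu[OF assms(2)]
  show ?thesis unfolding F(1) G(1) mkfun_comp[OF p F(2)]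
    by (rule mkfun_semifunctor[OF assms(1,3) sfun_comp[OF p(1) F(2) G(2)]])
qed

lemma mufun_comp_id:
  assumes "is_musemicat C" "is_musemicat D" "F \<in> semifunctors C D"
  shows "mufun_comp C F (mufun_id C) = F" "mufun_comp C (mufun_id D) F = F"
proof -
  obtain f0 f1 g where F: "F = mkfun C f0 f1 g" "sfun C D f0 f1 g" using semifunctorE[OF assms] .
  note p = musemicat_premu[OF assms(1)] musemicat_premu[OF assms(2)]
  show "mufun_comp C F (mufun_id C) = F" "mufun_comp C (mufun_id D) F = F"
    unfolding mufun_id_mkfun F(1) mkfun_comp[OF p(1) p(1) sfun_id] mkfun_comp[OF p F(2)]
    by (auto intro!: mkfun_cong p)
qed

lemma mufun_comp_assoc:
  assumes "is_musemicat B" "is_musemicat C" "is_musemicat D" "is_musemicat E"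
    and "F \<in> semifunctors B C" "G \<in> semifunctors C D" "H \<in> semifunctors D E"
  shows "mufun_comp B H (mufun_comp B G F) = mufun_comp B (mufun_comp C H G) F"
proof -
  obtain f0 f1 f2 where F: "F = mkfun B f0 f1 f2" "sfun B C f0 f1 f2" using semifunctorE[OF assms(1,2,5)] .
  obtain g0 g1 g2 where G: "G = mkfun C g0 g1 g2" "sfun C D g0 g1 g2" using semifunctorE[OF assms(2,3,6)] .
  obtain h0 h1 h2 where H: "H = mkfun D h0 h1 h2" "sfun D E h0 h1 h2" using semifunctorE[OF assms(3,4,7)] .
  note p = musemicat_premu[OF assms(1)] musemicat_premu[OF assms(2)] musemicat_premu[OF assms(3)]
  show ?thesis
    unfolding F(1) G(1) H(1) mkfun_comp[OF p(1,2) F(2)] mkfun_comp[OF p(2,3) G(2)]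
      mkfun_comp[OF p(1,3) sfun_comp[OF p(1) F(2) G(2)]]
    by (simp add: comp_assoc)
qed

lemma muSCat_category: "is_category muSCat"
  unfolding is_category_def muSCat_simps
  by (auto intro: semifunctor_id semifunctor_comp mufun_comp_id mufun_comp_assoc)

text \<open>Unlike the preservation of edges, the preservation of tetrahedra by the inverse uses that a
  tetrahedron is determined by two of its faces.\<close>

lemma sfun_inverse:
  assumes C: "is_musemicat C" and D: "is_musemicat D" and F: "sfun C D f0 f1 g"
    and bij: "bij_betw f0 (Ob0 C) (Ob0 D)" "bij_betw f1 (Ar1 C) (Ar1 D)" "bij_betw g (Mu C) (Mu D)"
  shows "sfun D C (inv_into (Ob0 C) f0) (inv_into (Ar1 C) f1) (inv_into (Mu C) g)"
proof -
  let ?h0 = "inv_into (Ob0 C) f0" and ?h1 = "inv_into (Ar1 C) f1" and ?k = "inv_into (Mu C) g"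
  note p = musemicat_premu[OF C] and q = musemicat_premu[OF D]
  have f: "\<And>x. x \<in> Ob0 C \<Longrightarrow> f0 x \<in> Ob0 D" "\<And>f. f \<in> Ar1 C \<Longrightarrow> f1 f \<in> Ar1 D"
     "\<And>f. f \<in> Ar1 C \<Longrightarrow> f0 (src C f) = src D (f1 f)" "\<And>f. f \<in> Ar1 C \<Longrightarrow> f0 (tgt C f) = tgt D (f1 f)"
     "\<And>m. m \<in> Mu C \<Longrightarrow> g m \<in> Mu D" "\<And>m. m \<in> Mu C \<Longrightarrow> e1 D (g m) = f1 (e1 C m)"
     "\<And>m. m \<in> Mu C \<Longrightarrow> e2 D (g m) = f1 (e2 C m)" "\<And>m. m \<in> Mu C \<Longrightarrow> e3 D (g m) = f1 (e3 C m)"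
     "\<And>a b c d. tet C a b c d \<Longrightarrow> tet D (g a) (g b) (g c) (g d)"
    using F by (auto simp: sfun_def)
  have h0: "?h0 y \<in> Ob0 C" "f0 (?h0 y) = y" if "y \<in> Ob0 D" for y
    using that bij(1) by (auto simp: bij_betw_def inv_into_into f_inv_into_f)
  have h1: "?h1 y \<in> Ar1 C" "f1 (?h1 y) = y" if "y \<in> Ar1 D" for y
    using that bij(2) by (auto simp: bij_betw_def inv_into_into f_inv_into_f)
  have k: "?k y \<in> Mu C" "g (?k y) = y" if "y \<in> Mu D" for y
    using that bij(3) by (auto simp: bij_betw_def inv_into_into f_inv_into_f)
  have l0: "?h0 (f0 x) = x" if "x \<in> Ob0 C" for x using that bij(1) by (auto simp: bij_betw_def)
  have l1: "?h1 (f1 x) = x" if "x \<in> Ar1 C" for x using that bij(2) by (auto simp: bij_betw_def)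
  have lk: "?k (g x) = x" if "x \<in> Mu C" for x using that bij(3) by (auto simp: bij_betw_def)
  have st: "?h0 (src D f) = src C (?h1 f) \<and> ?h0 (tgt D f) = tgt C (?h1 f)" if "f \<in> Ar1 D" for f
    using f(3,4)[OF h1(1)[OF that]] h1(2)[OF that] l0 premu_ar[OF p h1(1)[OF that]] by metis
  have ed: "e1 C (?k m) = ?h1 (e1 D m)" "e2 C (?k m) = ?h1 (e2 D m)" "e3 C (?k m) = ?h1 (e3 D m)" if "m \<in> Mu D" for m
    using f(6-8)[OF k(1)[OF that]] k(2)[OF that] l1 premu_mu(1-3)[OF p k(1)[OF that]] by metis+
  have "tet C (?k a) (?k b) (?k c) (?k d)" if t: "tet D a b c d" for a b c d
  proof -
    note M = tet_mem[OF t]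
    have "e3 C (?k a) = e1 C (?k b)" using ed M by simp
    then obtain c' d' where t': "tet C (?k a) (?k b) c' d'" using tet_exists[OF C] k(1) M by metis
    have "tet D a b (g c') (g d')" using f(9)[OF t'] k(2) M by simp
    then have "g c' = c" "g d' = d" using tet_unique[OF t] by auto
    then show ?thesis using t' lk tet_mem[OF t'] by auto
  qed
  then show ?thesis unfolding sfun_def using h0(1) h1(1) k(1) st ed by blast
qed

lemma mkfun_inverse:
  assumes C: "is_musemicat C" and D: "is_musemicat D" and F: "sfun C D f0 f1 g"
    and bij: "bij_betw f0 (Ob0 C) (Ob0 D)" "bij_betw f1 (Ar1 C) (Ar1 D)" "bij_betw g (Mu C) (Mu D)"
  defines "H \<equiv> mkfun D (inv_into (Ob0 C) f0) (inv_into (Ar1 C) f1) (inv_into (Mu C) g)"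
  shows "H \<in> semifunctors D C" "mufun_comp C H (mkfun C f0 f1 g) = mufun_id C"
    "mufun_comp D (mkfun C f0 f1 g) H = mufun_id D"
proof -
  note p = musemicat_premu[OF C] and q = musemicat_premu[OF D] and S = sfun_inverse[OF C D F bij]
  show "H \<in> semifunctors D C" unfolding H_def by (rule mkfun_semifunctor[OF D C S])
  show "mufun_comp C H (mkfun C f0 f1 g) = mufun_id C"
    unfolding H_def mufun_id_mkfun mkfun_comp[OF p q F]
    using bij by (intro mkfun_cong p) (auto simp: bij_betw_def)
  show "mufun_comp D (mkfun C f0 f1 g) H = mufun_id D"
    unfolding H_def mufun_id_mkfun mkfun_comp[OF q p S]
    using bij by (intro mkfun_cong q) (auto simp: bij_betw_def f_inv_into_f)
qed

section \<open>Categories of presheaves\<close>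

lemma presheaf_cat_simps [simp]: "Ob (presheaf_cat \<Theta> \<X>) = \<X>" "Hom (presheaf_cat \<Theta> \<X>) = presheaf_hom \<Theta>"
  "Idm (presheaf_cat \<Theta> \<X>) X = (\<lambda>n. \<lambda>x\<in>simp X n. x)"
  "Cmp (presheaf_cat \<Theta> \<X>) X Y Z g f = (\<lambda>n. compose (simp X n) (g n) (f n))"
  by (simp_all add: presheaf_cat_def)

lemma presheaf_act: "is_presheaf \<Theta> X \<Longrightarrow> \<theta> \<in> \<Theta> m n \<Longrightarrow> x \<in> simp X n \<Longrightarrow> act X m n \<theta> x \<in> simp X m"
proof -
  assume a: "is_presheaf \<Theta> X" "\<theta> \<in> \<Theta> m n" "x \<in> simp X n"
  have "act X m n \<in> \<Theta> m n \<rightarrow>\<^sub>E (simp X n \<rightarrow>\<^sub>E simp X m)" using a(1) by (simp add: is_presheaf_def)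
  from PiE_mem[OF PiE_mem[OF this a(2)] a(3)] show ?thesis .
qed

lemma presheaf_homD:
  assumes "f \<in> presheaf_hom \<Theta> X Y"
  shows "x \<in> simp X n \<Longrightarrow> f n x \<in> simp Y n" "f n \<in> extensional (simp X n)"
    "\<theta> \<in> \<Theta> m n \<Longrightarrow> x \<in> simp X n \<Longrightarrow> f m (act X m n \<theta> x) = act Y m n \<theta> (f n x)"
  using assms by (auto simp: presheaf_hom_def PiE_def)

lemma presheaf_homI:
  assumes "\<And>n x. x \<in> simp X n \<Longrightarrow> f n x \<in> simp Y n" "\<And>n. f n \<in> extensional (simp X n)"
    "\<And>m n \<theta> x. \<theta> \<in> \<Theta> m n \<Longrightarrow> x \<in> simp X n \<Longrightarrow> f m (act X m n \<theta> x) = act Y m n \<theta> (f n x)"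
  shows "f \<in> presheaf_hom \<Theta> X Y"
  using assms by (auto simp: presheaf_hom_def PiE_def)

lemma presheaf_hom_comp:
  assumes "is_presheaf \<Theta> X" "f \<in> presheaf_hom \<Theta> X Y" "g \<in> presheaf_hom \<Theta> Y Z"
  shows "(\<lambda>n. compose (simp X n) (g n) (f n)) \<in> presheaf_hom \<Theta> X Z"
  by (rule presheaf_homI) (use assms in \<open>auto simp: compose_def presheaf_act presheaf_homD\<close>)

lemma presheaf_category:
  assumes "\<And>X. X \<in> \<X> \<Longrightarrow> is_presheaf \<Theta> X"
  shows "is_category (presheaf_cat \<Theta> \<X>)"
  unfolding is_category_def presheaf_cat_simps
proof (intro conjI ballI)
  fix X assume "X \<in> \<X>"
  then show "(\<lambda>n. \<lambda>x\<in>simp X n. x) \<in> presheaf_hom \<Theta> X X"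
    by (intro presheaf_homI) (auto simp: presheaf_act[OF assms])
next
  fix X Y Z f g assume "X \<in> \<X>" "f \<in> presheaf_hom \<Theta> X Y" "g \<in> presheaf_hom \<Theta> Y Z"
  then show "(\<lambda>n. compose (simp X n) (g n) (f n)) \<in> presheaf_hom \<Theta> X Z"
    using assms by (intro presheaf_hom_comp) auto
next
  fix X Y f assume f: "f \<in> presheaf_hom \<Theta> X Y"
  then have "\<And>n. f n \<in> extensional (simp X n)" "\<And>n x. x \<in> simp X n \<Longrightarrow> f n x \<in> simp Y n"
    by (auto simp: presheaf_homD)
  then show "(\<lambda>n. compose (simp X n) (f n) (\<lambda>x\<in>simp X n. x)) = f" "(\<lambda>n. compose (simp X n) (\<lambda>x\<in>simp Y n. x) (f n)) = f"
    by (auto simp: compose_def fun_eq_iff restrict_def extensional_def)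
next
  fix W X Y Z f g h assume "f \<in> presheaf_hom \<Theta> W X"
  then show "(\<lambda>n. compose (simp W n) (h n) (compose (simp W n) (g n) (f n))) =
      (\<lambda>n. compose (simp W n) (compose (simp X n) (h n) (g n)) (f n))"
    by (auto simp: compose_def fun_eq_iff presheaf_homD)
qed

lemma presheaf_hom_natural: "f \<in> presheaf_hom \<Theta> X Y \<Longrightarrow> (\<And>m n. Delta_inj m n \<subseteq> \<Theta> m n) \<Longrightarrow> natural_map X Y f"
  unfolding natural_map_def by (meson presheaf_homD(1,3) subsetD)

lemma presheaf_inverse:
  assumes X: "is_presheaf \<Theta> X" and Y: "is_presheaf \<Theta> Y" and f: "f \<in> presheaf_hom \<Theta> X Y"
    and bij: "\<And>n. bij_betw (f n) (simp X n) (simp Y n)"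
  defines "h \<equiv> \<lambda>n. restrict (inv_into (simp X n) (f n)) (simp Y n)"
  shows "h \<in> presheaf_hom \<Theta> Y X" "(\<lambda>n. compose (simp X n) (h n) (f n)) = (\<lambda>n. \<lambda>x\<in>simp X n. x)"
    "(\<lambda>n. compose (simp Y n) (f n) (h n)) = (\<lambda>n. \<lambda>x\<in>simp Y n. x)"
proof -
  have h: "h n y \<in> simp X n" "f n (h n y) = y" if "y \<in> simp Y n" for n y
    using that bij[of n] by (auto simp: h_def bij_betw_def inv_into_into f_inv_into_f)
  have hf: "h n (f n x) = x" if "x \<in> simp X n" for n x
    using that bij[of n] presheaf_homD(1)[OF f that] by (auto simp: h_def bij_betw_def)
  show "h \<in> presheaf_hom \<Theta> Y X"
  proof (rule presheaf_homI)
    fix n y assume "y \<in> simp Y n" then show "h n y \<in> simp X n" by (rule h)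
  next
    fix n show "h n \<in> extensional (simp Y n)" by (simp add: h_def)
  next
    fix m n \<theta> y assume a: "\<theta> \<in> \<Theta> m n" "y \<in> simp Y n"
    have "f m (act X m n \<theta> (h n y)) = act Y m n \<theta> y" using presheaf_homD(3)[OF f a(1) h(1)[OF a(2)]] h(2)[OF a(2)] by simp
    then show "h m (act Y m n \<theta> y) = act X m n \<theta> (h n y)" using hf presheaf_act[OF X a(1) h(1)[OF a(2)]] by metis
  qed
  show "(\<lambda>n. compose (simp X n) (h n) (f n)) = (\<lambda>n. \<lambda>x\<in>simp X n. x)"
    "(\<lambda>n. compose (simp Y n) (f n) (h n)) = (\<lambda>n. \<lambda>x\<in>simp Y n. x)"
    using h hf by (auto simp: compose_def fun_eq_iff)
qed

section \<open>The \<open>\<mu>\<close>-semicategory of a 2-Segal set\<close>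

text \<open>The further record fields are a parameter, so that the same construction serves
  \<mu>-semicategories with \<open>()\<close> and \<mu>-categories with \<open>unit_data\<close>.
  The arrow 01 has target 0 and source 1, in accordance with the convention that
  \<open>(f, g)\<close> is composable when \<open>src f = tgt g\<close>. \<open>assoc\<close> fills
  the faces 012 and 023 by a 3-simplex and returns 123 and 013.\<close>

definition mu_of :: "'u simp_data \<Rightarrow> 'b \<Rightarrow> ('u, 'b) musemicat_scheme" where
  "mu_of X r = \<lparr>Ob0 = simp X 0, Ar1 = simp X 1, src = (\<lambda>f\<in>simp X 1. face X 1 [1] f), tgt = (\<lambda>f\<in>simp X 1. face X 1 [0] f),
     mu = \<lparr>apex = simp X 2, lleg = (\<lambda>m\<in>simp X 2. (face X 2 [0, 1] m, face X 2 [1, 2] m)),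
           rleg = (\<lambda>m\<in>simp X 2. face X 2 [0, 2] m)\<rparr>,
     assoc = (\<lambda>((a, h), b) \<in> {((a, h), b). a \<in> simp X 2 \<and> b \<in> simp X 2 \<and> face X 2 [0, 2] a = face X 2 [0, 1] b \<and>
                                  h = face X 2 [1, 2] b}.
       let x = (THE x. x \<in> simp X 3 \<and> face X 3 [0, 1, 2] x = a \<and> face X 3 [0, 2, 3] x = b)
       in ((face X 3 [0, 1] x, face X 3 [1, 2, 3] x), face X 3 [0, 1, 3] x)),
     \<dots> = r\<rparr>"

lemma mu_of_simps [simp]:
  "Ob0 (mu_of X r) = simp X 0" "Ar1 (mu_of X r) = simp X 1" "Mu (mu_of X r) = simp X 2"
  "f \<in> simp X 1 \<Longrightarrow> src (mu_of X r) f = face X 1 [1] f" "f \<in> simp X 1 \<Longrightarrow> tgt (mu_of X r) f = face X 1 [0] f"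
  "m \<in> simp X 2 \<Longrightarrow> lleg (mu (mu_of X r)) m = (face X 2 [0, 1] m, face X 2 [1, 2] m)"
  "m \<in> simp X 2 \<Longrightarrow> rleg (mu (mu_of X r)) m = face X 2 [0, 2] m"
  by (simp_all add: mu_of_def)

lemma mu_of_premu:
  assumes X: "semisimp X"
  shows "premu (mu_of X r)"
proof -
  have in1: "face X 1 [i] f \<in> simp X 0" if "i \<le> 1" "f \<in> simp X 1" for i f using that X by (auto intro!: face_in)
  have in2: "face X 2 [i, j] m \<in> simp X 1" if "i < j" "j \<le> 2" "m \<in> simp X 2" for i j m using that X by (auto intro!: face_in)
  have "src (mu_of X r) \<in> simp X 1 \<rightarrow>\<^sub>E simp X 0" "tgt (mu_of X r) \<in> simp X 1 \<rightarrow>\<^sub>E simp X 0"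
    using in1 by (auto simp: mu_of_def)
  moreover have "is_span (composable (mu_of X r)) (simp X 1) (mu (mu_of X r))"
    unfolding is_span_def
  proof
    have "(face X 2 [0, 1] m, face X 2 [1, 2] m) \<in> composable (mu_of X r)" if "m \<in> simp X 2" for m
      using in2[of 0 1 m] in2[of 1 2 m] that by (simp add: composable_def face_face[OF X])
    then show "lleg (mu (mu_of X r)) \<in> apex (mu (mu_of X r)) \<rightarrow>\<^sub>E composable (mu_of X r)"
      by (auto simp: mu_of_def)
    show "rleg (mu (mu_of X r)) \<in> apex (mu (mu_of X r)) \<rightarrow>\<^sub>E simp X 1"
      using in2[of 0 2] by (auto simp: mu_of_def)
  qed
  ultimately show ?thesis unfolding premu_def using in2[of 0 2] in2[of 1 2] in2[of 0 1]
    by (simp add: face_face[OF X])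
qed

text \<open>The two triangulations of the quadrilateral, as ears at 1 and at 2; they give the two
  directions of \<open>\<alpha>\<close>.\<close>

lemma simplex3_unique:
  assumes X: "semisimp X" and E: "ears X" and a: "a \<in> simp X 2" "b \<in> simp X 2"
  shows "face X 2 [0, 2] a = face X 2 [0, 1] b \<Longrightarrow> \<exists>!x. x \<in> simp X 3 \<and> face X 3 [0, 1, 2] x = a \<and> face X 3 [0, 2, 3] x = b"
    and "face X 2 [0, 2] a = face X 2 [1, 2] b \<Longrightarrow> \<exists>!x. x \<in> simp X 3 \<and> face X 3 [1, 2, 3] x = a \<and> face X 3 [0, 1, 3] x = b"
proof -
  have s: "Suc 2 = 3" "[1 - 1, 1::nat] = [0, 1]" "[2 - 1, 2::nat] = [1, 2]" "[1 - 1, 1, Suc 1] = [0, 1, 2]" "[2 - 1, 2, Suc 2] = [1, 2, 3]"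
    by simp_all
  have E': "\<And>i a b. 1 \<le> i \<Longrightarrow> i \<le> 2 \<Longrightarrow> a \<in> simp X 2 \<Longrightarrow> b \<in> simp X 2 \<Longrightarrow>
     face X 2 [i - 1, i] a = face X 2 [0, 2] b \<Longrightarrow>
     (\<exists>!x. x \<in> simp X (Suc 2) \<and> bd X 2 i x = a \<and> face X (Suc 2) [i - 1, i, Suc i] x = b)"
    using E unfolding ears_def by blast
  show "\<exists>!x. x \<in> simp X 3 \<and> face X 3 [0, 1, 2] x = a \<and> face X 3 [0, 2, 3] x = b"
    if m: "face X 2 [0, 2] a = face X 2 [0, 1] b"
  proof -
    have "\<exists>!x. x \<in> simp X 3 \<and> bd X 2 1 x = b \<and> face X 3 [0, 1, 2] x = a"
      using E'[of 1 b a, unfolded s] m a by simp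
    moreover have "x \<in> simp X 3 \<and> bd X 2 1 x = b \<and> face X 3 [0, 1, 2] x = a \<longleftrightarrow>
        x \<in> simp X 3 \<and> face X 3 [0, 1, 2] x = a \<and> face X 3 [0, 2, 3] x = b" for x
      using bd_last_face(2)[OF X, of x] by metis
    ultimately show ?thesis by (simp only:)
  qed
  show "\<exists>!x. x \<in> simp X 3 \<and> face X 3 [1, 2, 3] x = a \<and> face X 3 [0, 1, 3] x = b"
    if m: "face X 2 [0, 2] a = face X 2 [1, 2] b"
  proof -
    have "\<exists>!x. x \<in> simp X 3 \<and> bd X 2 2 x = b \<and> face X 3 [1, 2, 3] x = a"
      using E'[of 2 b a, unfolded s] m a by simp
    moreover have "x \<in> simp X 3 \<and> bd X 2 2 x = b \<and> face X 3 [1, 2, 3] x = a \<longleftrightarrow>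
        x \<in> simp X 3 \<and> face X 3 [1, 2, 3] x = a \<and> face X 3 [0, 1, 3] x = b" for x
      using bd_last_face(3)[OF X, of x] by metis
    ultimately show ?thesis by (simp only:)
  qed
qed

definition tetra :: "'u simp_data \<Rightarrow> 'u \<Rightarrow> 'u \<Rightarrow> 'u \<Rightarrow> 'u \<Rightarrow> bool" where
  "tetra X a b c d \<longleftrightarrow> (\<exists>x\<in>simp X 3. face X 3 [0, 1, 2] x = a \<and> face X 3 [0, 2, 3] x = b \<and>
     face X 3 [1, 2, 3] x = c \<and> face X 3 [0, 1, 3] x = d)"

lemma tetra_facts:
  assumes X: "semisimp X" and E: "ears X" and t: "tetra X a b c d"
  shows "a \<in> simp X 2" "b \<in> simp X 2" "c \<in> simp X 2" "d \<in> simp X 2"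
    "face X 2 [0, 2] a = face X 2 [0, 1] b" "face X 2 [0, 2] c = face X 2 [1, 2] d"
    "face X 2 [0, 1] a = face X 2 [0, 1] d" "face X 2 [1, 2] a = face X 2 [0, 1] c"
    "face X 2 [1, 2] b = face X 2 [1, 2] c" "face X 2 [0, 2] b = face X 2 [0, 2] d"
    "assoc (mu_of X r) ((a, face X 2 [1, 2] b), b) = ((face X 2 [0, 1] d, c), d)"
proof -
  obtain x where x: "x \<in> simp X 3" "a = face X 3 [0, 1, 2] x" "b = face X 3 [0, 2, 3] x"
     "c = face X 3 [1, 2, 3] x" "d = face X 3 [0, 1, 3] x" using t by (auto simp: tetra_def)
  show abcd: "a \<in> simp X 2" "b \<in> simp X 2" "c \<in> simp X 2" "d \<in> simp X 2"
    unfolding x using x(1) X by (auto intro!: face_in)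
  show m: "face X 2 [0, 2] a = face X 2 [0, 1] b" and "face X 2 [0, 2] c = face X 2 [1, 2] d"
    "face X 2 [0, 1] a = face X 2 [0, 1] d" "face X 2 [1, 2] a = face X 2 [0, 1] c"
    "face X 2 [1, 2] b = face X 2 [1, 2] c" "face X 2 [0, 2] b = face X 2 [0, 2] d"
    unfolding x using x(1) by (simp_all add: face_face[OF X])
  have "(THE x. x \<in> simp X 3 \<and> face X 3 [0, 1, 2] x = a \<and> face X 3 [0, 2, 3] x = b) = x"
    using simplex3_unique(1)[OF X E abcd(1,2) m] x by (intro the1_equality) auto
  moreover have "face X 3 [0, 1] x = face X 2 [0, 1] d" unfolding x using x(1) by (simp add: face_face[OF X])
  ultimately show "assoc (mu_of X r) ((a, face X 2 [1, 2] b), b) = ((face X 2 [0, 1] d, c), d)"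
    using abcd m x(4,5) by (simp add: mu_of_def)
qed

text \<open>Gluing the triangle 012 as an ear to the 3-simplex 0234 yields a 4-simplex
  \<open>v\<close>. A 3-simplex is determined by its faces 012 and 023, so the other given
  tetrahedra are faces of \<open>v\<close>, and the face 1234 of \<open>v\<close> is the required
  one.\<close>

lemma tetra_pentagon:
  assumes X: "semisimp X" and E: "ears X"
    and t: "tetra X x012 x023 x123 x013" "tetra X x013 x034 x134 x014" "tetra X x023 x034 x234 x024"
      "tetra X x012 x024 x124 y014"
  shows "y014 = x014 \<and> tetra X x123 x134 x234 x124"
proof -
  obtain x where x: "x \<in> simp X 3" "face X 3 [0, 1, 2] x = x012" "face X 3 [0, 2, 3] x = x023"
     "face X 3 [1, 2, 3] x = x123" "face X 3 [0, 1, 3] x = x013" using t(1) by (auto simp: tetra_def)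
  obtain y where y: "y \<in> simp X 3" "face X 3 [0, 1, 2] y = x013" "face X 3 [0, 2, 3] y = x034"
     "face X 3 [1, 2, 3] y = x134" "face X 3 [0, 1, 3] y = x014" using t(2) by (auto simp: tetra_def)
  obtain z where z: "z \<in> simp X 3" "face X 3 [0, 1, 2] z = x023" "face X 3 [0, 2, 3] z = x034"
     "face X 3 [1, 2, 3] z = x234" "face X 3 [0, 1, 3] z = x024" using t(3) by (auto simp: tetra_def)
  obtain w where w: "w \<in> simp X 3" "face X 3 [0, 1, 2] w = x012" "face X 3 [0, 2, 3] w = x024"
     "face X 3 [1, 2, 3] w = x124" "face X 3 [0, 1, 3] w = y014" using t(4) by (auto simp: tetra_def)
  have unq: "u = v" if "u \<in> simp X 3" "v \<in> simp X 3" "face X 3 [0, 1, 2] u = face X 3 [0, 1, 2] v"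
    "face X 3 [0, 2, 3] u = face X 3 [0, 2, 3] v" for u v
  proof -
    have "face X 3 [0, 1, 2] u \<in> simp X 2" "face X 3 [0, 2, 3] u \<in> simp X 2" using that(1) X by (auto intro!: face_in)
    moreover have "face X 2 [0, 2] (face X 3 [0, 1, 2] u) = face X 2 [0, 1] (face X 3 [0, 2, 3] u)"
      using that(1) by (simp add: face_face[OF X])
    ultimately show ?thesis using simplex3_unique(1)[OF X E] that by metis
  qed
  have "face X 3 [0, 1] z = face X 2 [0, 1] x023" unfolding z(2)[symmetric] using z(1) by (simp add: face_face[OF X])
  also have "\<dots> = face X 2 [0, 2] x012" using tetra_facts(5)[OF X E t(1)] by simp
  finally have m: "face X 3 [1 - 1, 1] z = face X 2 [0, 2] x012" by simp
  have "\<exists>!v. v \<in> simp X (Suc 3) \<and> bd X 3 1 v = z \<and> face X (Suc 3) [1 - 1, 1, Suc 1] v = x012"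
    using E[unfolded ears_def, rule_format, OF _ z(1) tetra_facts(1)[OF X E t(1)] m] by simp
  moreover have "Suc 3 = 4" "[1 - 1, 1, Suc 1] = [0, 1, 2]" by simp_all
  ultimately obtain v where v: "v \<in> simp X 4" "bd X 3 1 v = z" "face X 4 [0, 1, 2] v = x012" by metis
  have bd: "bd X 3 1 v = face X 4 [0, 2, 3, 4] v"
    unfolding bd_def face_def by (auto intro!: ap_cong simp: skip_def numeral_3_eq_3 numeral_2_eq_2 le_Suc_eq eval_nat_numeral)
  have z': "z = face X 4 [0, 2, 3, 4] v" using v bd by simp
  note f3 = face_in[OF X _ _ v(1), of _ 3]
  have x': "face X 4 [0, 1, 2, 3] v = x"
    by (rule unq) (use x z(2) v z' f3 in \<open>simp_all add: face_face[OF X]\<close>)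
  have y': "face X 4 [0, 1, 3, 4] v = y"
    by (rule unq) (use x y z(3) v z' x' f3 in \<open>simp_all add: face_face[OF X] flip: x'\<close>)
  have w': "face X 4 [0, 1, 2, 4] v = w"
    by (rule unq) (use w z(5) v z' f3 in \<open>simp_all add: face_face[OF X]\<close>)
  have "y014 = x014" unfolding w(5)[symmetric] y(5)[symmetric] w'[symmetric] y'[symmetric]
    using v(1) by (simp add: face_face[OF X])
  moreover have "tetra X x123 x134 x234 x124"
    unfolding tetra_def
  proof (intro bexI conjI)
    show "face X 4 [1, 2, 3, 4] v \<in> simp X 3" using f3 by simp
    show "face X 3 [0, 1, 2] (face X 4 [1, 2, 3, 4] v) = x123" "face X 3 [0, 2, 3] (face X 4 [1, 2, 3, 4] v) = x134"
      "face X 3 [1, 2, 3] (face X 4 [1, 2, 3, 4] v) = x234" "face X 3 [0, 1, 3] (face X 4 [1, 2, 3, 4] v) = x124"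
      unfolding x(4)[symmetric] y(4)[symmetric] z(4)[symmetric] w(4)[symmetric] x'[symmetric] y'[symmetric] z' w'[symmetric]
      using v(1) by (simp_all add: face_face[OF X])
  qed
  ultimately show ?thesis by blast
qed

lemma tetra_exists:
  assumes X: "semisimp X" and E: "ears X"
  shows "a \<in> simp X 2 \<Longrightarrow> b \<in> simp X 2 \<Longrightarrow> face X 2 [0, 2] a = face X 2 [0, 1] b \<Longrightarrow> \<exists>c d. tetra X a b c d"
    and "c \<in> simp X 2 \<Longrightarrow> d \<in> simp X 2 \<Longrightarrow> face X 2 [0, 2] c = face X 2 [1, 2] d \<Longrightarrow> \<exists>a b. tetra X a b c d"
    and "tetra X a b c d \<Longrightarrow> tetra X a' b' c d \<Longrightarrow> a' = a \<and> b' = b"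
proof -
  show "\<exists>c d. tetra X a b c d" if "a \<in> simp X 2" "b \<in> simp X 2" "face X 2 [0, 2] a = face X 2 [0, 1] b"
    using simplex3_unique(1)[OF X E that] unfolding tetra_def by blast
  show "\<exists>a b. tetra X a b c d" if "c \<in> simp X 2" "d \<in> simp X 2" "face X 2 [0, 2] c = face X 2 [1, 2] d"
    using simplex3_unique(2)[OF X E that] unfolding tetra_def by blast
  show "a' = a \<and> b' = b" if t: "tetra X a b c d" "tetra X a' b' c d"
    using simplex3_unique(2)[OF X E tetra_facts(3,4,6)[OF X E t(1)]] t unfolding tetra_def by blast
qed

lemma mu_of_musemicat:
  assumes X: "semisimp X" and E: "ears X"
  shows "is_musemicat (mu_of X r)"
proof (rule musemicatI[where T = "tetra X", OF mu_of_premu[OF X]])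
  have "apex (mu_left (mu_of X r)) = {((a, h), b). a \<in> simp X 2 \<and> b \<in> simp X 2 \<and> face X 2 [0, 2] a = face X 2 [0, 1] b \<and>
      h = face X 2 [1, 2] b}"
    using mem_mu_left[OF mu_of_premu[OF X, of r]] by auto
  then show "assoc (mu_of X r) \<in> extensional (apex (mu_left (mu_of X r)))" by (simp add: mu_of_def)
next
  fix a b c d assume t: "tetra X a b c d"
  note F = tetra_facts[OF X E t]
  show "a \<in> Mu (mu_of X r) \<and> b \<in> Mu (mu_of X r) \<and> c \<in> Mu (mu_of X r) \<and> d \<in> Mu (mu_of X r) \<and>
      e3 (mu_of X r) a = e1 (mu_of X r) b \<and> e3 (mu_of X r) c = e2 (mu_of X r) d \<and>
      e1 (mu_of X r) a = e1 (mu_of X r) d \<and> e2 (mu_of X r) a = e1 (mu_of X r) c \<and>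
      e2 (mu_of X r) b = e2 (mu_of X r) c \<and> e3 (mu_of X r) b = e3 (mu_of X r) d \<and>
      assoc (mu_of X r) ((a, e2 (mu_of X r) b), b) = ((e1 (mu_of X r) d, c), d)"
    using F(1-10) F(11)[of r] by simp
next
  show "\<exists>c d. tetra X a b c d" if "a \<in> Mu (mu_of X r)" "b \<in> Mu (mu_of X r)" "e3 (mu_of X r) a = e1 (mu_of X r) b" for a b
    using tetra_exists(1)[OF X E, of a b] that by simp
  show "\<exists>a b. tetra X a b c d" if "c \<in> Mu (mu_of X r)" "d \<in> Mu (mu_of X r)" "e3 (mu_of X r) c = e2 (mu_of X r) d" for c d
    using tetra_exists(2)[OF X E, of c d] that by simp
  show "a' = a \<and> b' = b" if "tetra X a b c d" "tetra X a' b' c d" for a b c d a' b'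
    by (rule tetra_exists(3)[OF X E that])
qed (rule tetra_pentagon[OF X E])

text \<open>The direction from \<open>tet\<close> to \<open>tetra\<close> holds because some
  3-simplex has the faces \<open>a\<close> and \<open>b\<close>, and \<open>assoc\<close> is
  single-valued.\<close>

lemma tet_mu_of:
  assumes X: "semisimp X" and E: "ears X"
  shows "tet (mu_of X r) a b c d \<longleftrightarrow> tetra X a b c d"
proof
  assume "tetra X a b c d"
  from tetra_facts[OF X E this] show "tet (mu_of X r) a b c d" by (simp add: tet_def)
next
  assume t: "tet (mu_of X r) a b c d"
  then obtain c' d' where t': "tetra X a b c' d'" using tetra_exists(1)[OF X E, of a b] by (auto simp: tet_def)
  from tetra_facts[OF X E this] have "tet (mu_of X r) a b c' d'" by (simp add: tet_def)
  from tet_unique[OF t this] show "tetra X a b c d" using t' by simp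
qed

lemma sfun_mu_of:
  assumes X: "semisimp X" "ears X" and Y: "semisimp Y" "ears Y" and f: "natural_map X Y f"
  shows "sfun (mu_of X r) (mu_of Y s) (f 0) (f 1) (f 2)"
proof -
  have fin: "f n x \<in> simp Y n" if "x \<in> simp X n" for n x using f that by (auto simp: natural_map_def)
  note N = natural_map_face[OF f]
  have in2: "face X 2 [i, j] m \<in> simp X 1" if "i < j" "j \<le> 2" "m \<in> simp X 2" for i j m using that X by (auto intro!: face_in)
  have "tetra Y (f 2 a) (f 2 b) (f 2 c) (f 2 d)" if t: "tetra X a b c d" for a b c d
  proof -
    obtain x where x: "x \<in> simp X 3" "face X 3 [0, 1, 2] x = a" "face X 3 [0, 2, 3] x = b"
      "face X 3 [1, 2, 3] x = c" "face X 3 [0, 1, 3] x = d" using t by (auto simp: tetra_def)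
    show ?thesis unfolding tetra_def x(2-5)[symmetric]
      by (rule bexI[of _ "f 3 x"]) (use N[of 3 _ 2 x] x(1) fin in simp_all)
  qed
  then show ?thesis
    unfolding sfun_def tet_mu_of[OF X] tet_mu_of[OF Y] using fin[of _ 0] fin[of _ 1] fin[of _ 2] N[of 1 _ 0] N[of 2 _ 1] in2
    by simp
qed

definition skeleton :: "'u simp_data \<Rightarrow> nat \<Rightarrow> 'u \<Rightarrow> nat list \<Rightarrow> 'u" where
  "skeleton X n x = (\<lambda>l\<in>chains n. face X n l x)"

lemma skeleton_in:
  assumes X: "semisimp X" and E: "ears X" and x: "x \<in> simp X n"
  shows "skeleton X n x \<in> cosk (mu_of X r) n"
proof (rule coskI)
  note I = face_in[OF X _ _ x] and F = face_face[OF X _ _ _ x]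
  show "skeleton X n x \<in> extensional (chains n)" by (simp add: skeleton_def)
  show "skeleton X n x [i] \<in> Ob0 (mu_of X r)" if "i \<le> n" for i using that I[of "[i]"] by (simp add: skeleton_def)
  show "skeleton X n x [i, j] \<in> Ar1 (mu_of X r) \<and> tgt (mu_of X r) (skeleton X n x [i, j]) = skeleton X n x [i] \<and>
      src (mu_of X r) (skeleton X n x [i, j]) = skeleton X n x [j]" if "i < j" "j \<le> n" for i j
    using that I[of "[i, j]" 1] F[of "[i, j]" 1] by (simp add: skeleton_def)
  show "skeleton X n x [i, j, k] \<in> Mu (mu_of X r) \<and> e1 (mu_of X r) (skeleton X n x [i, j, k]) = skeleton X n x [i, j] \<and>
      e2 (mu_of X r) (skeleton X n x [i, j, k]) = skeleton X n x [j, k] \<and>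
      e3 (mu_of X r) (skeleton X n x [i, j, k]) = skeleton X n x [i, k]" if "i < j" "j < k" "k \<le> n" for i j k
    using that I[of "[i, j, k]" 2] F[of "[i, j, k]" 2] by (simp add: skeleton_def)
  show "tet (mu_of X r) (skeleton X n x [i, j, k]) (skeleton X n x [i, k, l]) (skeleton X n x [j, k, l])
      (skeleton X n x [i, j, l])" if "i < j" "j < k" "k < l" "l \<le> n" for i j k l
    unfolding tet_mu_of[OF X E] tetra_def
    by (rule bexI[of _ "face X n [i, j, k, l] x"])
      (use that I[of "[i, j, k, l]" 3] F[of "[i, j, k, l]" 3] in \<open>simp_all add: skeleton_def\<close>)
qed

lemma skeleton_act:
  assumes X: "semisimp X" and x: "x \<in> simp X n" and t: "smap m n g"
  shows "skeleton X m (ap X m n g x) = (\<lambda>l\<in>chains m. skeleton X n x (map g l))"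
  unfolding skeleton_def using map_chains[OF t] face_ap[OF X t _ x] by (auto simp: fun_eq_iff chains_def)

lemma skeleton_natural:
  assumes X: "semisimp X" and E: "ears X"
  shows "natural_map X (Cosk (mu_of X r)) (skeleton X)"
  unfolding natural_map_def using skeleton_in[OF assms] skeleton_act[OF X] by (auto simp: act_eq_ap Delta_inj_smap ap_Cosk)

text \<open>Up to dimension 2 the inverse is evaluation at the longest chain, whose face is the
  whole simplex. Higher dimensions follow from ears on both sides.\<close>

lemma skeleton_bij:
  assumes X: "semisimp X" and E: "ears X"
  shows "bij_betw (skeleton X n) (simp X n) (cosk (mu_of X r) n)"
proof -
  let ?C = "mu_of X r"
  have p: "premu ?C" using mu_of_premu[OF X] .
  have low: "bij_betw (skeleton X n) (simp X n) (cosk ?C n)" if n: "n \<le> 2" for n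
  proof -
    let ?l = "[0..<Suc n]"
    have l: "?l \<in> chains n" using n by (auto simp: chains_def incr_def simp del: upt_Suc)
    have top: "skeleton X n x ?l = x" if "x \<in> simp X n" for x
      using face_all[OF X that] l by (simp add: skeleton_def del: upt_Suc)
    have ex: "d ?l \<in> simp X n \<and> skeleton X n (d ?l) = d" if d: "d \<in> cosk ?C n" for d
    proof -
      note D = coskD[OF d]
      consider "n = 0" | "n = 1" | "n = 2" using n by linarith
      then show ?thesis
      proof cases
        case 1
        have in0: "d [0] \<in> simp X 0" using D(2)[of 0] 1 by simp
        have "skeleton X n (d [0]) l = d l" if "l \<in> chains n" for l
          using that in0 top[of "d [0]"] 1 by (cases rule: chains_cases) auto
        then show ?thesis using in0 1 cosk_ext[OF skeleton_in[OF X E] d] by simp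
      next
        case 2
        have in1: "d [0, 1] \<in> simp X 1" using D(3)[of 0 1] 2 by simp
        have l1: "?l = [0, 1]" using 2 by simp
        have "skeleton X n (d [0, 1]) l = d l" if "l \<in> chains n" for l
          using that
        proof (cases rule: chains_cases)
          case (1 i)
          then show ?thesis using D(4,5)[of 0 1] in1 2 by (cases "i = 0") (auto simp: skeleton_def le_Suc_eq)
        next
          case (2 i j)
          then have "i = 0" "j = 1" using \<open>n = 1\<close> by auto
          with 2 show ?thesis using top[of "d [0, 1]"] in1 l1 \<open>n = 1\<close> by simp
        qed (use 2 in auto)
        then show ?thesis using in1 l1 2 cosk_ext[OF skeleton_in[OF X E] d] by simp
      next
        case 3
        have l1: "?l = [0, 1, 2]" using 3 by (simp add: upt_rec numeral_2_eq_2)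
        have in2: "d [0, 1, 2] \<in> simp X 2" using D(6)[of 0 1 2] 3 by simp
        have "skeleton X n (d ?l) = d"
          using top[of "d ?l"] in2 l1 3 d skeleton_in[OF X E, of "d ?l" n r]
          by (intro cosk2_eqI[OF p]) auto
        then show ?thesis using in2 l1 3 by simp
      qed
    qed
    show ?thesis
      by (rule bij_betw_byWitness[where f' = "\<lambda>d. d ?l"]) (use top ex skeleton_in[OF X E] in \<open>auto simp del: upt_Suc\<close>)
  qed
  show ?thesis
    using natural_map_bij[OF X E Cosk_semisimp Cosk_ears[OF mu_of_musemicat[OF X E]] skeleton_natural[OF X E, of r],
        unfolded Cosk_simps, OF low] .
qed

section \<open>Encoding coskeletal data in an infinite universe\<close>

lemma inj_pair:
  assumes "infinite (UNIV :: 'u set)"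
  shows "\<exists>p :: 'u \<times> 'u \<Rightarrow> 'u. inj p"
proof -
  obtain p :: "'u \<times> 'u \<Rightarrow> 'u" where "bij_betw p (UNIV \<times> UNIV) UNIV"
    using card_of_Times_same_infinite[OF assms] unfolding card_of_ordIso[symmetric] by blast
  then show ?thesis by (auto simp: bij_betw_def)
qed

text \<open>Extensional functions on a finite set are finite tuples; each further element of the set
  costs one application of a pairing injection, which an infinite universe possesses.\<close>

lemma inj_extensional:
  assumes inf: "infinite (UNIV :: 'u set)" and S: "finite S"
  shows "\<exists>e :: ('a \<Rightarrow> 'u) \<Rightarrow> 'u. inj_on e (extensional S)"
  using S
proof (induction S)
  case empty
  then show ?case by simp
next
  case (insert a S)
  then obtain e :: "('a \<Rightarrow> 'u) \<Rightarrow> 'u" where e: "inj_on e (extensional S)" by blast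
  obtain p :: "'u \<times> 'u \<Rightarrow> 'u" where p: "inj p" using inj_pair[OF inf] by blast
  have "inj_on (\<lambda>d. p (d a, e (restrict d S))) (extensional (insert a S))"
  proof (rule inj_onI)
    fix d d' assume d: "d \<in> extensional (insert a S)" "d' \<in> extensional (insert a S)"
      and eq: "p (d a, e (restrict d S)) = p (d' a, e (restrict d' S))"
    from eq have "(d a, e (restrict d S)) = (d' a, e (restrict d' S))" by (rule injD[OF p])
    then have da: "d a = d' a" and "e (restrict d S) = e (restrict d' S)" by auto
    then have dS: "restrict d S = restrict d' S" using e by (auto dest: inj_onD)
    have "d x = d' x" if "x \<in> insert a S" for x
    proof (cases "x = a")
      case False
      then show ?thesis using that fun_cong[OF dS, of x] by simp
    qed (simp add: da)
    then show "d = d'" by (rule extensionalityI[OF d])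
  qed
  then show ?case by blast
qed

text \<open>One code for each dimension, chosen independently: simplices of different dimensions may
  be the same element of \<open>'u\<close>.\<close>

definition enc :: "nat \<Rightarrow> (nat list \<Rightarrow> 'u) \<Rightarrow> 'u" where
  "enc n = (SOME e. inj_on e (extensional (chains n)))"

definition dec :: "nat \<Rightarrow> 'u \<Rightarrow> nat list \<Rightarrow> 'u" where
  "dec n = inv_into (extensional (chains n)) (enc n)"

lemma dec_enc:
  assumes "infinite (UNIV :: 'u set)" "d \<in> extensional (chains n)"
  shows "dec n (enc n d :: 'u) = d"
proof -
  have "inj_on (enc n :: (nat list \<Rightarrow> 'u) \<Rightarrow> 'u) (extensional (chains n))"
    unfolding enc_def by (rule someI_ex[OF inj_extensional[OF assms(1) finite_chains]])
  then show ?thesis unfolding dec_def using assms(2) by simp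
qed

section \<open>The nerve of a \<open>\<mu>\<close>-semicategory\<close>

text \<open>Covers \<open>Delta_inj\<close> and \<open>Delta\<close> at once, so that the nerve and
  its functoriality are treated a single time.\<close>

definition site :: "(nat \<Rightarrow> nat \<Rightarrow> (nat \<Rightarrow> nat) set) \<Rightarrow> bool" where
  "site \<Theta> \<longleftrightarrow> (\<forall>m n. Delta_inj m n \<subseteq> \<Theta> m n) \<and> (\<forall>m n. \<Theta> m n \<subseteq> Delta m n) \<and>
     (\<forall>l m n. \<forall>\<theta>\<in>\<Theta> l m. \<forall>\<psi>\<in>\<Theta> m n. compose {..l} \<psi> \<theta> \<in> \<Theta> l n)"

lemma site_Delta: "site Delta"
  unfolding site_def
proof (intro conjI allI ballI)
  fix l m n \<theta> \<psi> assume a: "\<theta> \<in> Delta l m" "\<psi> \<in> Delta m n"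
  then have "\<theta> i \<le> m" if "i \<le> l" for i using that by (auto simp: Delta_def)
  then show "compose {..l} \<psi> \<theta> \<in> Delta l n"
    using a by (auto simp: Delta_def compose_def monotone_on_def)
qed (auto simp: Delta_inj_def)

lemma site_Delta_inj: "site Delta_inj"
  unfolding site_def
proof (intro conjI allI ballI)
  fix l m n \<theta> \<psi> assume a: "\<theta> \<in> Delta_inj l m" "\<psi> \<in> Delta_inj m n"
  have "compose {..l} \<psi> \<theta> = restrict (\<psi> \<circ> \<theta>) {..l}" by (auto simp: compose_def)
  then show "compose {..l} \<psi> \<theta> \<in> Delta_inj l n"
    using smap_comp a by (auto simp: restrict_in_Delta_inj dest!: Delta_inj_smap)
qed (auto simp: Delta_inj_def)

lemma site_id: "site \<Theta> \<Longrightarrow> (\<lambda>i\<in>{..n}. i) \<in> \<Theta> n n"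
  unfolding site_def using restrict_in_Delta_inj[of "\<lambda>i. i" n n] by (auto simp: smap_def)

lemma map_compose: "k \<in> chains l \<Longrightarrow> map (compose {..l} \<psi> \<theta>) k = map \<psi> (map \<theta> k)"
  by (auto simp: chains_def incr_def compose_def)

lemma map_id_chains: "k \<in> chains l \<Longrightarrow> map (\<lambda>i\<in>{..l}. i) k = k"
  by (auto simp: chains_def incr_def intro!: map_idI)

text \<open>The parameter \<open>w\<close> extends a family indexed by strictly increasing lists to one indexed by the
  lists to which a morphism of \<open>\<Theta>\<close> can send them: it is the identity for semi-simplicial sets,
  while for simplicial sets it inserts units.\<close>

definition extender :: "(nat \<Rightarrow> nat \<Rightarrow> (nat \<Rightarrow> nat) set) \<Rightarrow> ('u, 'b) musemicat_scheme \<Rightarrow>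
    ((nat list \<Rightarrow> 'u) \<Rightarrow> nat list \<Rightarrow> 'u) \<Rightarrow> bool" where
  "extender \<Theta> C w \<longleftrightarrow> (\<forall>n. \<forall>d\<in>cosk C n. \<forall>l\<in>chains n. w d l = d l) \<and>
     (\<forall>m n. \<forall>\<theta>\<in>\<Theta> m n. \<forall>d\<in>cosk C n. (\<lambda>l\<in>chains m. w d (map \<theta> l)) \<in> cosk C m) \<and>
     (\<forall>l m n. \<forall>\<theta>\<in>\<Theta> l m. \<forall>\<psi>\<in>\<Theta> m n. \<forall>d\<in>cosk C n. \<forall>k\<in>chains l.
        w (\<lambda>j\<in>chains m. w d (map \<psi> j)) (map \<theta> k) = w d (map \<psi> (map \<theta> k)))"

lemma extender_id: "extender Delta_inj C (\<lambda>d. d)"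
  unfolding extender_def
proof (intro conjI allI ballI)
  show "(\<lambda>l\<in>chains m. d (map \<theta> l)) \<in> cosk C m" if "\<theta> \<in> Delta_inj m n" "d \<in> cosk C n" for m n \<theta> d
    by (rule cosk_reindex[OF that(2) Delta_inj_smap[OF that(1)]])
  show "(\<lambda>j\<in>chains m. d (map \<psi> j)) (map \<theta> k) = d (map \<psi> (map \<theta> k))"
    if "\<theta> \<in> Delta_inj l m" "k \<in> chains l" for l m \<theta> \<psi> d k
    using map_chains[OF Delta_inj_smap[OF that(1)] that(2)] by simp
qed (rule refl)

definition nerve :: "(nat \<Rightarrow> nat \<Rightarrow> (nat \<Rightarrow> nat) set) \<Rightarrow> ((nat list \<Rightarrow> 'u) \<Rightarrow> nat list \<Rightarrow> 'u) \<Rightarrow>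
    ('u, 'b) musemicat_scheme \<Rightarrow> 'u simp_data" where
  "nerve \<Theta> w C = \<lparr>simp = (\<lambda>n. enc n ` cosk C n),
     act = (\<lambda>m n. \<lambda>\<theta>\<in>\<Theta> m n. \<lambda>y\<in>enc n ` cosk C n. enc m (\<lambda>l\<in>chains m. w (dec n y) (map \<theta> l)))\<rparr>"

lemma simp_nerve [simp]: "simp (nerve \<Theta> w C) n = enc n ` cosk C n"
  by (simp add: nerve_def)

lemma dec_enc_cosk: "infinite (UNIV :: 'u set) \<Longrightarrow> d \<in> cosk C n \<Longrightarrow> dec n (enc n d :: 'u) = d"
  by (simp add: dec_enc coskD(1))

lemma act_nerve:
  assumes "infinite (UNIV :: 'u set)" "\<theta> \<in> \<Theta> m n" "d \<in> cosk C n"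
  shows "act (nerve \<Theta> w C) m n \<theta> (enc n d :: 'u) = enc m (\<lambda>l\<in>chains m. w d (map \<theta> l))"
  using assms by (simp add: nerve_def dec_enc_cosk)

lemma nerve_presheaf:
  fixes C :: "('u, 'b) musemicat_scheme"
  assumes inf: "infinite (UNIV :: 'u set)" and \<Theta>: "site \<Theta>" and w: "extender \<Theta> C w"
  shows "is_presheaf \<Theta> (nerve \<Theta> w C)"
proof -
  have w1: "\<And>n d l. d \<in> cosk C n \<Longrightarrow> l \<in> chains n \<Longrightarrow> w d l = d l"
    and w2: "\<And>m n \<theta> d. \<theta> \<in> \<Theta> m n \<Longrightarrow> d \<in> cosk C n \<Longrightarrow> (\<lambda>l\<in>chains m. w d (map \<theta> l)) \<in> cosk C m"
    and w3: "\<And>l m n \<theta> \<psi> d k. \<theta> \<in> \<Theta> l m \<Longrightarrow> \<psi> \<in> \<Theta> m n \<Longrightarrow> d \<in> cosk C n \<Longrightarrow> k \<in> chains l \<Longrightarrow>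
        w (\<lambda>j\<in>chains m. w d (map \<psi> j)) (map \<theta> k) = w d (map \<psi> (map \<theta> k))"
    using w by (auto simp: extender_def)
  note A = act_nerve[OF inf, of _ \<Theta> _ _ _ C w]
  show ?thesis unfolding is_presheaf_def
  proof (intro conjI allI ballI)
    fix m n
    show "act (nerve \<Theta> w C) m n \<in> \<Theta> m n \<rightarrow>\<^sub>E (simp (nerve \<Theta> w C) n \<rightarrow>\<^sub>E simp (nerve \<Theta> w C) m)"
      using w2[of _ m n] by (auto simp: nerve_def dec_enc_cosk[OF inf])
  next
    fix n y assume "y \<in> simp (nerve \<Theta> w C) n"
    then obtain d where d: "y = enc n d" "d \<in> cosk C n" by auto
    have "(\<lambda>l\<in>chains n. w d (map (\<lambda>i\<in>{..n}. i) l)) = d"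
      using coskD(1)[OF d(2)] w1[OF d(2)] map_id_chains by (auto simp: fun_eq_iff extensional_def)
    then show "act (nerve \<Theta> w C) n n (\<lambda>i\<in>{..n}. i) y = y"
      using A[OF site_id[OF \<Theta>] d(2)] d(1) by simp
  next
    fix l m n \<theta> \<psi> y assume t: "\<theta> \<in> \<Theta> l m" "\<psi> \<in> \<Theta> m n" and "y \<in> simp (nerve \<Theta> w C) n"
    then obtain d where d: "y = enc n d" "d \<in> cosk C n" by auto
    have c: "compose {..l} \<psi> \<theta> \<in> \<Theta> l n" using \<Theta> t by (auto simp: site_def)
    have "(\<lambda>k\<in>chains l. w d (map (compose {..l} \<psi> \<theta>) k)) =
        (\<lambda>k\<in>chains l. w (\<lambda>j\<in>chains m. w d (map \<psi> j)) (map \<theta> k))"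
      by (rule restrict_ext) (simp only: map_compose w3[OF t d(2)])
    then show "act (nerve \<Theta> w C) l n (compose {..l} \<psi> \<theta>) y = act (nerve \<Theta> w C) l m \<theta> (act (nerve \<Theta> w C) m n \<psi> y)"
      unfolding d(1) A[OF c d(2)] A[OF t(2) d(2)] A[OF t(1) w2[OF t(2) d(2)]] by simp
  qed
qed

lemma site_inj: "site \<Theta> \<Longrightarrow> Delta_inj m n \<subseteq> \<Theta> m n"
  by (auto simp: site_def)

lemma nerve_semisimp:
  fixes C :: "('u, 'b) musemicat_scheme"
  assumes "infinite (UNIV :: 'u set)" "site \<Theta>" "extender \<Theta> C w"
  shows "semisimp (nerve \<Theta> w C)"
  by (rule presheaf_semisimp[OF nerve_presheaf[OF assms] site_inj[OF assms(2)]])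

text \<open>On strictly increasing maps the rule \<open>w\<close> changes nothing, hence coding is
  compatible with faces whatever the degeneracies are. This is how the nerve inherits ears from
  \<open>Cosk\<close>.\<close>

lemma enc_natural:
  fixes C :: "('u, 'b) musemicat_scheme"
  assumes inf: "infinite (UNIV :: 'u set)" and \<Theta>: "site \<Theta>" and w: "extender \<Theta> C w"
  shows "natural_map (Cosk C) (nerve \<Theta> w C) enc"
  unfolding natural_map_def
proof (intro conjI allI ballI)
  fix m n \<theta> d assume t: "\<theta> \<in> Delta_inj m n" and d: "d \<in> simp (Cosk C) n"
  have "(\<lambda>l\<in>chains m. w d (map \<theta> l)) = (\<lambda>l\<in>chains m. d (map \<theta> l))"
    using w d map_chains[OF Delta_inj_smap[OF t]] by (intro restrict_ext) (auto simp: extender_def)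
  moreover have "\<theta> \<in> \<Theta> m n" using t site_inj[OF \<Theta>] by blast
  ultimately show "enc m (act (Cosk C) m n \<theta> d) = act (nerve \<Theta> w C) m n \<theta> (enc n d)"
    using act_nerve[OF inf, of \<theta> \<Theta> m n d C w] d by simp
qed simp

lemma enc_bij:
  fixes C :: "('u, 'b) musemicat_scheme"
  assumes "infinite (UNIV :: 'u set)"
  shows "bij_betw (enc n) (cosk C n) (enc n ` cosk C n)"
  by (rule bij_betw_imageI[OF _ refl], rule inj_on_inverseI[of _ "dec n"]) (rule dec_enc_cosk[OF assms])

lemma nerve_ears:
  fixes C :: "('u, 'b) musemicat_scheme"
  assumes "infinite (UNIV :: 'u set)" "site \<Theta>" "extender \<Theta> C w" "is_musemicat C"
  shows "ears (nerve \<Theta> w C)"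
  by (rule natural_bij_ears[OF Cosk_semisimp Cosk_ears[OF assms(4)] nerve_semisimp[OF assms(1-3)] enc_natural[OF assms(1-3)]])
    (simp add: enc_bij assms)

lemma nerve_2_Segal:
  fixes C :: "('u, 'b) musemicat_scheme"
  assumes "infinite (UNIV :: 'u set)" "site \<Theta>" "extender \<Theta> C w" "is_musemicat C"
  shows "is_2_Segal (nerve \<Theta> w C)"
  by (rule ears_imp_2_Segal[OF nerve_semisimp[OF assms(1-3)] nerve_ears[OF assms]])

lemma face_nerve:
  fixes C :: "('u, 'b) musemicat_scheme"
  assumes "infinite (UNIV :: 'u set)" "site \<Theta>" "extender \<Theta> C w" "d \<in> cosk C n" "incr n l" "length l = Suc p"
  shows "face (nerve \<Theta> w C) n l (enc n d) = enc p (\<lambda>k\<in>chains p. d (map (nth l) k))"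
  using natural_map_face[OF enc_natural[OF assms(1-3)] assms(5,6), of d] assms(4,6) by (simp add: face_Cosk)

section \<open>Functoriality of the nerve\<close>

definition on_data :: "('u \<Rightarrow> 'u) \<Rightarrow> ('u \<Rightarrow> 'u) \<Rightarrow> ('u \<Rightarrow> 'u) \<Rightarrow> nat list \<Rightarrow> 'u \<Rightarrow> 'u" where
  "on_data f0 f1 g l = (if length l = 1 then f0 else if length l = 2 then f1 else g)"

definition nerve_map :: "('u, 'b) musemicat_scheme \<Rightarrow> 'u mufun \<Rightarrow> nat \<Rightarrow> 'u \<Rightarrow> 'u" where
  "nerve_map C F n = (\<lambda>y\<in>enc n ` cosk C n. enc n (\<lambda>l\<in>chains n. on_data (F0 F) (F1 F) (mu_action C F) l (dec n y l)))"

lemma on_data_simps [simp]: "on_data f0 f1 g [i] = f0" "on_data f0 f1 g [i, j] = f1" "on_data f0 f1 g [i, j, k] = g"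
  by (simp_all add: on_data_def)

lemma on_data_cosk:
  assumes F: "sfun C D f0 f1 g" and d: "d \<in> cosk C n"
  shows "(\<lambda>l\<in>chains n. on_data f0 f1 g l (d l)) \<in> cosk D n"
proof -
  note D = coskD[OF d]
  have f: "\<And>x. x \<in> Ob0 C \<Longrightarrow> f0 x \<in> Ob0 D" "\<And>f. f \<in> Ar1 C \<Longrightarrow> f1 f \<in> Ar1 D"
     "\<And>f. f \<in> Ar1 C \<Longrightarrow> src D (f1 f) = f0 (src C f)" "\<And>f. f \<in> Ar1 C \<Longrightarrow> tgt D (f1 f) = f0 (tgt C f)"
     "\<And>m. m \<in> Mu C \<Longrightarrow> g m \<in> Mu D" "\<And>m. m \<in> Mu C \<Longrightarrow> e1 D (g m) = f1 (e1 C m)"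
     "\<And>m. m \<in> Mu C \<Longrightarrow> e2 D (g m) = f1 (e2 C m)" "\<And>m. m \<in> Mu C \<Longrightarrow> e3 D (g m) = f1 (e3 C m)"
     "\<And>a b c d. tet C a b c d \<Longrightarrow> tet D (g a) (g b) (g c) (g d)"
    using F by (auto simp: sfun_def)
  show ?thesis by (rule coskI) (simp_all add: f D(2-10))
qed

lemma nerve_map_enc:
  assumes inf: "infinite (UNIV :: 'u set)" and d: "d \<in> cosk C n"
  shows "nerve_map C F n (enc n d :: 'u) = enc n (\<lambda>l\<in>chains n. on_data (F0 F) (F1 F) (mu_action C F) l (d l))"
  using d by (simp add: nerve_map_def dec_enc_cosk[OF inf])

lemma on_data_mkfun:
  assumes "premu C" "d \<in> cosk C n" "l \<in> chains n"
  shows "on_data (F0 (mkfun C f0 f1 g)) (F1 (mkfun C f0 f1 g)) (mu_action C (mkfun C f0 f1 g)) l (d l) = on_data f0 f1 g l (d l)"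
  using assms(3)
  by (cases rule: chains_cases) (simp_all add: mu_action_mkfun[OF assms(1)] coskD[OF assms(2)])

text \<open>The hypothesis \<open>nat\<close> asks that the functor respect the values on lists with
  repetitions; in the simplicial case it amounts to preserving units and the triangles supplied by
  \<lambda> and \<rho>.\<close>

lemma nerve_map_hom:
  fixes C :: "('u, 'b) musemicat_scheme"
  assumes inf: "infinite (UNIV :: 'u set)" and w: "extender \<Theta> C w" "extender \<Theta> D v"
    and C: "is_musemicat C" and D: "is_musemicat D" and F: "F \<in> semifunctors C D"
    and nat: "\<And>m n \<theta> d l. \<theta> \<in> \<Theta> m n \<Longrightarrow> d \<in> cosk C n \<Longrightarrow> l \<in> chains m \<Longrightarrow>
      v (\<lambda>l\<in>chains n. on_data (F0 F) (F1 F) (mu_action C F) l (d l)) (map \<theta> l) =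
      on_data (F0 F) (F1 F) (mu_action C F) l (w d (map \<theta> l))"
  shows "nerve_map C F \<in> presheaf_hom \<Theta> (nerve \<Theta> w C) (nerve \<Theta> v D)"
proof (rule presheaf_homI)
  note E = nerve_map_enc[OF inf, of _ C] and S = on_data_cosk[OF semifunctorD(2)[OF C D F]]
  fix n y assume "y \<in> simp (nerve \<Theta> w C) n"
  then show "nerve_map C F n y \<in> simp (nerve \<Theta> v D) n" using E S by auto
next
  fix n show "nerve_map C F n \<in> extensional (simp (nerve \<Theta> w C) n)" by (simp add: nerve_map_def)
next
  note E = nerve_map_enc[OF inf, of _ C] and S = on_data_cosk[OF semifunctorD(2)[OF C D F]]
  fix m n \<theta> y assume t: "\<theta> \<in> \<Theta> m n" and "y \<in> simp (nerve \<Theta> w C) n"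
  then obtain d where d: "y = enc n d" "d \<in> cosk C n" by auto
  have c: "(\<lambda>l\<in>chains m. w d (map \<theta> l)) \<in> cosk C m" using w(1) t d(2) by (simp add: extender_def)
  show "nerve_map C F m (act (nerve \<Theta> w C) m n \<theta> y) = act (nerve \<Theta> v D) m n \<theta> (nerve_map C F n y)"
    unfolding d(1) act_nerve[where \<Theta> = \<Theta>, OF inf t d(2)] E[OF d(2)] E[OF c] act_nerve[where \<Theta> = \<Theta>, OF inf t S[OF d(2)]]
    by (rule arg_cong[of _ _ "enc m"], rule restrict_ext) (simp add: nat[OF t d(2)])
qed

lemma nerve_map_id:
  assumes inf: "infinite (UNIV :: 'u set)" and C: "is_musemicat (C :: ('u, 'b) musemicat_scheme)"
  shows "nerve_map C (mufun_id C) = (\<lambda>n. \<lambda>x\<in>simp (nerve \<Theta> w C) n. x)"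
proof
  fix n
  have "nerve_map C (mufun_id C) n (enc n d) = enc n d" if d: "d \<in> cosk C n" for d
  proof -
    have "(\<lambda>l\<in>chains n. on_data (F0 (mufun_id C)) (F1 (mufun_id C)) (mu_action C (mufun_id C)) l (d l)) = d"
      unfolding mufun_id_mkfun using coskD(1)[OF d] on_data_mkfun[OF musemicat_premu[OF C] d]
      by (auto simp: fun_eq_iff extensional_def on_data_def)
    then show ?thesis by (simp add: nerve_map_enc[OF inf d])
  qed
  then show "nerve_map C (mufun_id C) n = (\<lambda>x\<in>simp (nerve \<Theta> w C) n. x)"
    by (auto simp: fun_eq_iff nerve_map_def)
qed

lemma nerve_map_comp:
  assumes inf: "infinite (UNIV :: 'u set)" and C: "is_musemicat (C :: ('u, 'b) musemicat_scheme)"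
    and D: "is_musemicat D" and E: "is_musemicat E" and F: "F \<in> semifunctors C D" and G: "G \<in> semifunctors D E"
  shows "nerve_map C (mufun_comp C G F) = (\<lambda>n. compose (simp (nerve \<Theta> w C) n) (nerve_map D G n) (nerve_map C F n))"
proof
  fix n
  note p = musemicat_premu[OF C] and q = musemicat_premu[OF D]
  obtain f0 f1 f2 where F': "F = mkfun C f0 f1 f2" "sfun C D f0 f1 f2" using semifunctorE[OF C D F] .
  obtain g0 g1 g2 where G': "G = mkfun D g0 g1 g2" "sfun D E g0 g1 g2" using semifunctorE[OF D E G] .
  have "nerve_map C (mufun_comp C G F) n (enc n d) = nerve_map D G n (nerve_map C F n (enc n d))" if d: "d \<in> cosk C n" for d
  proof -
    have c: "(\<lambda>l\<in>chains n. on_data f0 f1 f2 l (d l)) \<in> cosk D n" by (rule on_data_cosk[OF F'(2) d])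
    have 1: "(\<lambda>l\<in>chains n. on_data (F0 F) (F1 F) (mu_action C F) l (d l)) = (\<lambda>l\<in>chains n. on_data f0 f1 f2 l (d l))"
      unfolding F'(1) by (rule restrict_ext) (rule on_data_mkfun[OF p d])
    have 2: "(\<lambda>l\<in>chains n. on_data (F0 G) (F1 G) (mu_action D G) l ((\<lambda>l\<in>chains n. on_data f0 f1 f2 l (d l)) l)) =
       (\<lambda>l\<in>chains n. on_data g0 g1 g2 l (on_data f0 f1 f2 l (d l)))"
      unfolding G'(1) by (rule restrict_ext) (subst on_data_mkfun[OF q c], simp_all)
    have 3: "(\<lambda>l\<in>chains n. on_data (F0 (mufun_comp C G F)) (F1 (mufun_comp C G F)) (mu_action C (mufun_comp C G F)) l (d l)) =
       (\<lambda>l\<in>chains n. on_data g0 g1 g2 l (on_data f0 f1 f2 l (d l)))"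
      unfolding F'(1) G'(1) mkfun_comp[OF p q F'(2)]
      by (rule restrict_ext) (subst on_data_mkfun[OF p d], simp_all add: on_data_def)
    show ?thesis unfolding nerve_map_enc[OF inf d] 1 3 nerve_map_enc[OF inf c] 2 by simp
  qed
  then show "nerve_map C (mufun_comp C G F) n = compose (simp (nerve \<Theta> w C) n) (nerve_map D G n) (nerve_map C F n)"
    by (auto simp: fun_eq_iff nerve_map_def[of C "mufun_comp C G F"] compose_def)
qed

section \<open>Unit and counit\<close>

definition to_nerve :: "'u simp_data \<Rightarrow> nat \<Rightarrow> 'u \<Rightarrow> 'u" where
  "to_nerve X n = (\<lambda>x\<in>simp X n. enc n (skeleton X n x))"

text \<open>The hypothesis \<open>nat\<close> says that the values which \<open>w\<close> supplies
  on repeated vertices are the actual degenerate faces of \<open>X\<close>.\<close>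

lemma to_nerve_hom:
  fixes X :: "'u simp_data"
  assumes inf: "infinite (UNIV :: 'u set)" and P: "is_presheaf \<Theta> X" and X: "semisimp X" "ears X"
    and w: "extender \<Theta> (mu_of X r) w"
    and nat: "\<And>m n \<theta> x l. \<theta> \<in> \<Theta> m n \<Longrightarrow> x \<in> simp X n \<Longrightarrow> l \<in> chains m \<Longrightarrow>
      face X m l (act X m n \<theta> x) = w (skeleton X n x) (map \<theta> l)"
  shows "to_nerve X \<in> presheaf_hom \<Theta> X (nerve \<Theta> w (mu_of X r))"
    "bij_betw (to_nerve X n) (simp X n) (simp (nerve \<Theta> w (mu_of X r)) n)"
proof -
  note S = skeleton_in[OF X, of _ _ r]
  show "to_nerve X \<in> presheaf_hom \<Theta> X (nerve \<Theta> w (mu_of X r))"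
  proof (rule presheaf_homI)
    fix m n \<theta> x assume t: "\<theta> \<in> \<Theta> m n" and x: "x \<in> simp X n"
    show "to_nerve X m (act X m n \<theta> x) = act (nerve \<Theta> w (mu_of X r)) m n \<theta> (to_nerve X n x)"
      using presheaf_act[OF P t x] x nat[OF t x]
      by (simp add: to_nerve_def act_nerve[where \<Theta> = \<Theta>, OF inf t S[OF x]] skeleton_def[of X m] cong: restrict_cong)
  qed (auto simp: to_nerve_def S)
  have "bij_betw (enc n \<circ> skeleton X n) (simp X n) (enc n ` cosk (mu_of X r) n)"
    by (rule bij_betw_trans[OF skeleton_bij[OF X] enc_bij[OF inf]])
  then show "bij_betw (to_nerve X n) (simp X n) (simp (nerve \<Theta> w (mu_of X r)) n)"
    by (subst bij_betw_cong[of _ _ "enc n \<circ> skeleton X n"]) (auto simp: to_nerve_def)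
qed

lemma to_nerve_natural:
  fixes X :: "'u simp_data"
  assumes inf: "infinite (UNIV :: 'u set)" and X: "semisimp X" "ears X" and Y: "semisimp Y" "ears Y"
    and f: "natural_map X Y f" and x: "x \<in> simp X n"
  shows "to_nerve Y n (f n x) = nerve_map (mu_of X r) (mkfun (mu_of X r) (f 0) (f 1) (f 2)) n (to_nerve X n x)"
proof -
  note S = skeleton_in[OF X x, of r] and p = mu_of_premu[OF X(1), of r]
  have fx: "f n x \<in> simp Y n" using f x by (auto simp: natural_map_def)
  have "skeleton Y n (f n x) = (\<lambda>l\<in>chains n. on_data (f 0) (f 1) (f 2) l (skeleton X n x l))"
    unfolding skeleton_def
  proof (rule restrict_ext)
    fix l assume l: "l \<in> chains n"
    then show "face Y n l (f n x) = on_data (f 0) (f 1) (f 2) l ((\<lambda>l\<in>chains n. face X n l x) l)"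
      using natural_map_face[OF f _ _ x, of l] l
      by (cases rule: chains_cases) (auto simp: numeral_2_eq_2)
  qed
  also have "\<dots> = (\<lambda>l\<in>chains n. on_data (F0 (mkfun (mu_of X r) (f 0) (f 1) (f 2))) (F1 (mkfun (mu_of X r) (f 0) (f 1) (f 2)))
      (mu_action (mu_of X r) (mkfun (mu_of X r) (f 0) (f 1) (f 2))) l (skeleton X n x l))"
    by (rule restrict_ext) (rule on_data_mkfun[OF p S, symmetric])
  finally show ?thesis using x fx by (simp add: to_nerve_def nerve_map_enc[OF inf S])
qed

lemma mkfun_mu_of_id:
  assumes X: "semisimp X"
  shows "mkfun (mu_of X r) (\<lambda>x\<in>simp X 0. x) (\<lambda>x\<in>simp X 1. x) (\<lambda>x\<in>simp X 2. x) = mufun_id (mu_of X r)"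
  unfolding mufun_id_mkfun by (rule mkfun_cong[OF mu_of_premu[OF X]]) auto

lemma mkfun_mu_of_comp:
  fixes f g :: "nat \<Rightarrow> 'u \<Rightarrow> 'u" and r s :: 'b
  assumes X: "semisimp X" "ears X" and Y: "semisimp Y" "ears Y" and f: "natural_map X Y f"
  shows "mkfun (mu_of X r) (compose (simp X 0) (g 0) (f 0)) (compose (simp X 1) (g 1) (f 1)) (compose (simp X 2) (g 2) (f 2)) =
    mufun_comp (mu_of X r) (mkfun (mu_of Y s) (g 0) (g 1) (g 2)) (mkfun (mu_of X r) (f 0) (f 1) (f 2))"
  unfolding mkfun_comp[OF mu_of_premu[OF X(1)] mu_of_premu[OF Y(1)] sfun_mu_of[OF X Y f]]
  by (rule mkfun_cong[OF mu_of_premu[OF X(1)]]) (auto simp: compose_def)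

section \<open>Low-dimensional coskeletal simplices and the counit\<close>

lemma cosk0_exists: "x \<in> Ob0 C \<Longrightarrow> \<exists>d\<in>cosk C 0. d [0] = x"
  by (rule bexI[of _ "make 0 (\<lambda>i. x) undefined undefined"]) (auto intro!: coskI)

lemma cosk1_exists:
  assumes "premu C" "f \<in> Ar1 C"
  shows "\<exists>d\<in>cosk C 1. d [0, 1] = f"
  by (rule bexI[of _ "make 1 (\<lambda>i. if i = 0 then tgt C f else src C f) (\<lambda>i j. f) undefined"])
    (use assms premu_ar[OF assms] in \<open>auto intro!: coskI\<close>)

lemma cosk0_eqI:
  assumes "d \<in> cosk C 0" "d' \<in> cosk C 0" "d [0] = d' [0]"
  shows "d = d'"
proof (rule cosk_ext[OF assms(1,2)])
  fix l assume "l \<in> chains 0"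
  then show "d l = d' l" using assms(3) by (cases rule: chains_cases) auto
qed

lemma cosk1_eqI:
  assumes "d \<in> cosk C 1" "d' \<in> cosk C 1" "d [0, 1] = d' [0, 1]"
  shows "d = d'"
proof (rule cosk_ext[OF assms(1,2)])
  fix l assume "l \<in> chains 1"
  then show "d l = d' l"
  proof (cases rule: chains_cases)
    case (1 i)
    then show ?thesis
      using assms(3) coskD(4,5)[OF assms(1), of 0 1] coskD(4,5)[OF assms(2), of 0 1] by (cases "i = 0") (auto simp: le_Suc_eq)
  next
    case (2 i j)
    then have "i = 0" "j = 1" by auto
    with 2 show ?thesis using assms(3) by simp
  qed auto
qed

text \<open>\<open>C\<close> is the domain, that is, the structure obtained from a nerve. The
  codomain does not occur in the formula, which decodes a simplex and reads its entry at the longest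
  chain.\<close>

definition counit :: "('u, 'b) musemicat_scheme \<Rightarrow> 'u mufun" where
  "counit C = mkfun C (\<lambda>y. dec 0 y [0]) (\<lambda>y. dec 1 y [0, 1]) (\<lambda>y. dec 2 y [0, 1, 2])"

lemma counit_sfun:
  fixes C :: "('u, 'b) musemicat_scheme"
  assumes inf: "infinite (UNIV :: 'u set)" and \<Theta>: "site \<Theta>" and w: "extender \<Theta> C w" and C: "is_musemicat C"
  shows "sfun (mu_of (nerve \<Theta> w C) r) C (\<lambda>y. dec 0 y [0]) (\<lambda>y. dec 1 y [0, 1]) (\<lambda>y. dec 2 y [0, 1, 2])" (is "sfun ?N _ _ _ _")
proof -
  note de = dec_enc_cosk[OF inf] and F = face_nerve[OF inf \<Theta> w]
  note S = nerve_semisimp[OF inf \<Theta> w] and E = nerve_ears[OF inf \<Theta> w C]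
  have de': "dec p (enc p (\<lambda>k\<in>chains p. f k :: 'u)) = (\<lambda>k\<in>chains p. f k)" for p f by (rule dec_enc[OF inf]) simp
  have "src C (dec 1 y [0, 1]) = dec 0 (src ?N y) [0]" "tgt C (dec 1 y [0, 1]) = dec 0 (tgt ?N y) [0]"
      "dec 1 y [0, 1] \<in> Ar1 C"
    if y: "y \<in> enc 1 ` cosk C 1" for y
  proof -
    obtain d where d: "y = enc 1 d" "d \<in> cosk C 1" using y by auto
    show "src C (dec 1 y [0, 1]) = dec 0 (src ?N y) [0]" "tgt C (dec 1 y [0, 1]) = dec 0 (tgt ?N y) [0]"
      "dec 1 y [0, 1] \<in> Ar1 C"
      using d coskD(3-5)[OF d(2), of 0 1] F[OF d(2), of _ 0] by (simp_all add: de de' del: One_nat_def)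
  qed
  moreover have "dec 2 y [0, 1, 2] \<in> Mu C \<and> e1 C (dec 2 y [0, 1, 2]) = dec 1 (e1 ?N y) [0, 1] \<and>
      e2 C (dec 2 y [0, 1, 2]) = dec 1 (e2 ?N y) [0, 1] \<and> e3 C (dec 2 y [0, 1, 2]) = dec 1 (e3 ?N y) [0, 1]"
    if y: "y \<in> enc 2 ` cosk C 2" for y
  proof -
    obtain d where d: "y = enc 2 d" "d \<in> cosk C 2" using y by auto
    show ?thesis using d coskD(6-9)[OF d(2), of 0 1 2] F[OF d(2), of _ 1] by (simp add: de de' del: One_nat_def)
  qed
  moreover have "tet C (dec 2 a [0, 1, 2]) (dec 2 b [0, 1, 2]) (dec 2 c [0, 1, 2]) (dec 2 d [0, 1, 2])"
    if t: "tet ?N a b c d" for a b c d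
  proof -
    obtain y where y: "y \<in> enc 3 ` cosk C 3" "face (nerve \<Theta> w C) 3 [0, 1, 2] y = a" "face (nerve \<Theta> w C) 3 [0, 2, 3] y = b"
      "face (nerve \<Theta> w C) 3 [1, 2, 3] y = c" "face (nerve \<Theta> w C) 3 [0, 1, 3] y = d"
      using t unfolding tet_mu_of[OF S E] tetra_def by auto
    obtain x where x: "y = enc 3 x" "x \<in> cosk C 3" using y(1) by auto
    show ?thesis using coskD(10)[OF x(2), of 0 1 2 3] F[OF x(2), of _ 2] unfolding y(2-5)[symmetric] x(1)
      by (simp add: de' del: One_nat_def)
  qed
  moreover have "dec 0 y [0] \<in> Ob0 C" if y: "y \<in> enc 0 ` cosk C 0" for y
    using y coskD(2)[of _ C 0 0] by (auto simp: de)
  ultimately show ?thesis unfolding sfun_def mu_of_simps(1-3) simp_nerve by auto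
qed

lemma dec_bij:
  fixes C :: "('u, 'b) musemicat_scheme"
  assumes inf: "infinite (UNIV :: 'u set)" and h: "bij_betw h (cosk C n) B"
  shows "bij_betw (\<lambda>y. h (dec n y)) (enc n ` cosk C n) B"
proof -
  have "bij_betw (dec n) (enc n ` cosk C n) (cosk C n)"
    by (rule bij_betw_byWitness[where f' = "enc n"]) (auto simp: dec_enc_cosk[OF inf])
  from bij_betw_trans[OF this h] show ?thesis by (simp add: comp_def)
qed

text \<open>Below dimension 3 no condition \<open>tet\<close> arises, so a family is free apart from
  being determined by its entry at the longest chain.\<close>

lemma counit_bij:
  fixes C :: "('u, 'b) musemicat_scheme"
  assumes inf: "infinite (UNIV :: 'u set)" and p: "premu C"
  shows "bij_betw (\<lambda>y. dec 0 y [0]) (enc 0 ` cosk C 0) (Ob0 C)"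
    "bij_betw (\<lambda>y. dec 1 y [0, 1]) (enc 1 ` cosk C 1) (Ar1 C)"
    "bij_betw (\<lambda>y. dec 2 y [0, 1, 2]) (enc 2 ` cosk C 2) (Mu C)"
proof -
  have "bij_betw (\<lambda>d. d [0]) (cosk C 0) (Ob0 C)"
  proof (rule bij_betw_imageI)
    show "(\<lambda>d. d [0]) ` cosk C 0 = Ob0 C"
      using cosk0_exists[of _ C] coskD(2)[of _ C 0 0] by blast
  qed (rule inj_onI, rule cosk0_eqI)
  then show "bij_betw (\<lambda>y. dec 0 y [0]) (enc 0 ` cosk C 0) (Ob0 C)" by (rule dec_bij[OF inf])
  have "bij_betw (\<lambda>d. d [0, 1]) (cosk C 1) (Ar1 C)"
  proof (rule bij_betw_imageI)
    show "(\<lambda>d. d [0, 1]) ` cosk C 1 = Ar1 C"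
      using cosk1_exists[OF p] coskD(3)[of _ C 1 0 1] by auto
  qed (rule inj_onI, rule cosk1_eqI)
  then show "bij_betw (\<lambda>y. dec 1 y [0, 1]) (enc 1 ` cosk C 1) (Ar1 C)" by (rule dec_bij[OF inf])
  have "bij_betw (\<lambda>d. d [0, 1, 2]) (cosk C 2) (Mu C)"
  proof (rule bij_betw_imageI)
    show "(\<lambda>d. d [0, 1, 2]) ` cosk C 2 = Mu C"
      using cosk2_exists[OF p] coskD(6)[of _ C 2 0 1 2] by auto
  qed (rule inj_onI, rule cosk2_eqI[OF p])
  then show "bij_betw (\<lambda>y. dec 2 y [0, 1, 2]) (enc 2 ` cosk C 2) (Mu C)" by (rule dec_bij[OF inf])
qed

lemma counit_natural:
  fixes C D :: "('u, 'b) musemicat_scheme" and r s :: 'b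
  assumes inf: "infinite (UNIV :: 'u set)" and \<Theta>: "site \<Theta>" and w: "extender \<Theta> C w" and v: "extender \<Theta> D v"
    and C: "is_musemicat C" and D: "is_musemicat D" and F: "F \<in> semifunctors C D"
    and hom: "nerve_map C F \<in> presheaf_hom \<Theta> (nerve \<Theta> w C) (nerve \<Theta> v D)"
  defines "M \<equiv> mu_of (nerve \<Theta> w C) r" and "N \<equiv> mu_of (nerve \<Theta> v D) s"
  shows "mufun_comp M (counit N) (mkfun M (nerve_map C F 0) (nerve_map C F 1) (nerve_map C F 2)) =
    mufun_comp M F (counit M)"
proof -
  note S = nerve_semisimp[OF inf \<Theta> w] and E = nerve_ears[OF inf \<Theta> w C]
  note S' = nerve_semisimp[OF inf \<Theta> v] and E' = nerve_ears[OF inf \<Theta> v D]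
  note p = mu_of_premu[OF S, of r] and q = mu_of_premu[OF S', of s]
  obtain f0 f1 g where f: "F = mkfun C f0 f1 g" "sfun C D f0 f1 g" using semifunctorE[OF C D F] .
  have n: "sfun M N (nerve_map C F 0) (nerve_map C F 1) (nerve_map C F 2)"
    unfolding M_def N_def by (rule sfun_mu_of[OF S E S' E' presheaf_hom_natural[OF hom site_inj[OF \<Theta>]]])
  have key: "dec n (nerve_map C F n (enc n d)) l = on_data f0 f1 g l (d l)" if "d \<in> cosk C n" "l \<in> chains n" for n d l
    using that on_data_mkfun[OF musemicat_premu[OF C] that] by (simp add: nerve_map_enc[OF inf] dec_enc[OF inf] f(1))
  note de = dec_enc_cosk[OF inf]
  show ?thesis unfolding counit_def f(1)
    unfolding mkfun_comp[OF p[folded M_def] q[folded N_def] n[unfolded f(1)]]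
      mkfun_comp[OF p[folded M_def] musemicat_premu[OF C] counit_sfun[OF inf \<Theta> w C, of r, folded M_def]]
    by (rule mkfun_cong[OF p[folded M_def]]) (auto simp: M_def de key[unfolded f(1)] simp del: One_nat_def)
qed

section \<open>Equivalences of categories\<close>

text \<open>The unit is built from \<open>X\<close> to its nerve, whereas
  \<open>equivalent_categories\<close> asks for the opposite direction. Naturality of the inverses
  follows by cancelling on both sides.\<close>

lemma naturally_isomorphic_sym:
  assumes D: "is_category D" and F: "is_functor C D Fo Fm" and G: "is_functor C D Go Gm"
    and N: "naturally_isomorphic C D Fo Fm Go Gm"
  shows "naturally_isomorphic C D Go Gm Fo Fm"
proof -
  obtain \<eta> where \<eta>: "\<And>X. X \<in> Ob C \<Longrightarrow> is_iso D (Fo X) (Go X) (\<eta> X)"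
    and nat: "\<And>X Y f. X \<in> Ob C \<Longrightarrow> Y \<in> Ob C \<Longrightarrow> f \<in> Hom C X Y \<Longrightarrow>
      Cmp D (Fo X) (Fo Y) (Go Y) (\<eta> Y) (Fm X Y f) = Cmp D (Fo X) (Go X) (Go Y) (Gm X Y f) (\<eta> X)"
    using N unfolding naturally_isomorphic_def by blast
  have Fo: "\<And>X. X \<in> Ob C \<Longrightarrow> Fo X \<in> Ob D" and Go: "\<And>X. X \<in> Ob C \<Longrightarrow> Go X \<in> Ob D"
    and Fm: "\<And>X Y f. X \<in> Ob C \<Longrightarrow> Y \<in> Ob C \<Longrightarrow> f \<in> Hom C X Y \<Longrightarrow> Fm X Y f \<in> Hom D (Fo X) (Fo Y)"
    and Gm: "\<And>X Y f. X \<in> Ob C \<Longrightarrow> Y \<in> Ob C \<Longrightarrow> f \<in> Hom C X Y \<Longrightarrow> Gm X Y f \<in> Hom D (Go X) (Go Y)"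
    using F G unfolding is_functor_def by blast+
  have idl: "\<And>X Y f. X \<in> Ob D \<Longrightarrow> Y \<in> Ob D \<Longrightarrow> f \<in> Hom D X Y \<Longrightarrow> Cmp D X Y Y (Idm D Y) f = f"
    and idr: "\<And>X Y f. X \<in> Ob D \<Longrightarrow> Y \<in> Ob D \<Longrightarrow> f \<in> Hom D X Y \<Longrightarrow> Cmp D X X Y f (Idm D X) = f"
    and cmp: "\<And>X Y Z f g. X \<in> Ob D \<Longrightarrow> Y \<in> Ob D \<Longrightarrow> Z \<in> Ob D \<Longrightarrow> f \<in> Hom D X Y \<Longrightarrow> g \<in> Hom D Y Z \<Longrightarrow>
      Cmp D X Y Z g f \<in> Hom D X Z"
    and assoc: "\<And>W X Y Z f g h. W \<in> Ob D \<Longrightarrow> X \<in> Ob D \<Longrightarrow> Y \<in> Ob D \<Longrightarrow> Z \<in> Ob D \<Longrightarrow> f \<in> Hom D W X \<Longrightarrow>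
      g \<in> Hom D X Y \<Longrightarrow> h \<in> Hom D Y Z \<Longrightarrow> Cmp D W Y Z h (Cmp D W X Y g f) = Cmp D W X Z (Cmp D X Y Z h g) f"
    using D unfolding is_category_def by blast+
  have "\<exists>\<zeta>. \<forall>X\<in>Ob C. \<zeta> X \<in> Hom D (Go X) (Fo X) \<and> Cmp D (Fo X) (Go X) (Fo X) (\<zeta> X) (\<eta> X) = Idm D (Fo X) \<and>
      Cmp D (Go X) (Fo X) (Go X) (\<eta> X) (\<zeta> X) = Idm D (Go X)"
    using \<eta> unfolding is_iso_def by metis
  then obtain \<zeta> where \<zeta>: "\<And>X. X \<in> Ob C \<Longrightarrow> \<zeta> X \<in> Hom D (Go X) (Fo X)"
    "\<And>X. X \<in> Ob C \<Longrightarrow> Cmp D (Fo X) (Go X) (Fo X) (\<zeta> X) (\<eta> X) = Idm D (Fo X)"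
    "\<And>X. X \<in> Ob C \<Longrightarrow> Cmp D (Go X) (Fo X) (Go X) (\<eta> X) (\<zeta> X) = Idm D (Go X)" by blast
  have \<eta>h: "\<And>X. X \<in> Ob C \<Longrightarrow> \<eta> X \<in> Hom D (Fo X) (Go X)" using \<eta> by (auto simp: is_iso_def)
  have "Cmp D (Go X) (Go Y) (Fo Y) (\<zeta> Y) (Gm X Y f) = Cmp D (Go X) (Fo X) (Fo Y) (Fm X Y f) (\<zeta> X)"
    if X: "X \<in> Ob C" and Y: "Y \<in> Ob C" and f: "f \<in> Hom C X Y" for X Y f
  proof -
    note o = Fo[OF X] Fo[OF Y] Go[OF X] Go[OF Y] and h = Fm[OF X Y f] Gm[OF X Y f] \<eta>h[OF X] \<eta>h[OF Y] \<zeta>(1)[OF X] \<zeta>(1)[OF Y]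
    have "Cmp D (Go X) (Fo X) (Fo Y) (Fm X Y f) (\<zeta> X) =
        Cmp D (Go X) (Fo Y) (Fo Y) (Cmp D (Fo Y) (Go Y) (Fo Y) (\<zeta> Y) (\<eta> Y)) (Cmp D (Go X) (Fo X) (Fo Y) (Fm X Y f) (\<zeta> X))"
      using \<zeta>(2)[OF Y] idl[OF o(3,2) cmp[OF o(3,1,2) h(5,1)]] by simp
    also have "\<dots> = Cmp D (Go X) (Go Y) (Fo Y) (\<zeta> Y) (Cmp D (Go X) (Fo Y) (Go Y) (\<eta> Y) (Cmp D (Go X) (Fo X) (Fo Y) (Fm X Y f) (\<zeta> X)))"
      by (rule assoc[symmetric, OF o(3,2,4,2) cmp[OF o(3,1,2) h(5,1)] h(4,6)])
    also have "Cmp D (Go X) (Fo Y) (Go Y) (\<eta> Y) (Cmp D (Go X) (Fo X) (Fo Y) (Fm X Y f) (\<zeta> X)) =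
        Cmp D (Go X) (Fo X) (Go Y) (Cmp D (Fo X) (Fo Y) (Go Y) (\<eta> Y) (Fm X Y f)) (\<zeta> X)"
      by (rule assoc[OF o(3,1,2,4) h(5,1,4)])
    also have "\<dots> = Cmp D (Go X) (Fo X) (Go Y) (Cmp D (Fo X) (Go X) (Go Y) (Gm X Y f) (\<eta> X)) (\<zeta> X)"
      by (simp only: nat[OF X Y f])
    also have "\<dots> = Cmp D (Go X) (Go X) (Go Y) (Gm X Y f) (Cmp D (Go X) (Fo X) (Go X) (\<eta> X) (\<zeta> X))"
      by (rule assoc[symmetric, OF o(3,1,3,4) h(5,3,2)])
    also have "\<dots> = Gm X Y f" using \<zeta>(3)[OF X] idr[OF o(3,4) h(2)] by simp
    finally show ?thesis by simp
  qed
  moreover have "is_iso D (Go X) (Fo X) (\<zeta> X)" if "X \<in> Ob C" for X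
    unfolding is_iso_def using \<zeta>[OF that] \<eta>h[OF that] by blast
  ultimately show ?thesis unfolding naturally_isomorphic_def by blast
qed

lemma is_functor_id: "is_category C \<Longrightarrow> is_functor C C (\<lambda>X. X) (\<lambda>X Y f. f)"
  by (simp add: is_functor_def)

lemma is_functor_comp:
  "is_functor C D Fo Fm \<Longrightarrow> is_functor D E Go Gm \<Longrightarrow> is_functor C E (\<lambda>X. Go (Fo X)) (\<lambda>X Y f. Gm (Fo X) (Fo Y) (Fm X Y f))"
  by (simp add: is_functor_def)

lemma equivalent_categoriesI:
  assumes C: "is_category C" and D: "is_category D" and F: "is_functor C D Fo Fm" and G: "is_functor D C Go Gm"
    and unit: "naturally_isomorphic C C (\<lambda>X. X) (\<lambda>X Y f. f) (\<lambda>X. Go (Fo X)) (\<lambda>X Y f. Gm (Fo X) (Fo Y) (Fm X Y f))"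
    and counit: "naturally_isomorphic D D (\<lambda>X. Fo (Go X)) (\<lambda>X Y f. Fm (Go X) (Go Y) (Gm X Y f)) (\<lambda>X. X) (\<lambda>X Y f. f)"
  shows "equivalent_categories C D"
  unfolding equivalent_categories_def
  using C D F G counit naturally_isomorphic_sym[OF C is_functor_id[OF C] is_functor_comp[OF F G] unit] by blast

section \<open>Assembling the equivalence for \<mu>-semicategories\<close>

theorem semicategory_equivalence:
  assumes inf: "infinite (UNIV :: 'u set)"
  shows "equivalent_categories (two_Segal_semisimplicial_sets :: ('u simp_data, nat \<Rightarrow> 'u \<Rightarrow> 'u) cat)
    (muSCat :: ('u musemicat, 'u mufun) cat)"
proof -
  let ?S = "two_Segal_semisimplicial_sets :: ('u simp_data, nat \<Rightarrow> 'u \<Rightarrow> 'u) cat"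
  let ?M = "muSCat :: ('u musemicat, 'u mufun) cat"
  let ?N = "nerve Delta_inj (\<lambda>d. d) :: 'u musemicat \<Rightarrow> 'u simp_data"
  let ?F = "\<lambda>X :: 'u simp_data. mu_of X ()"
  let ?Fm = "\<lambda>(X :: 'u simp_data) (Y :: 'u simp_data) f. mkfun (?F X) (f 0) (f 1) (f 2)"
  let ?Gm = "\<lambda>(C :: 'u musemicat) (D :: 'u musemicat). nerve_map C"
  have O: "X \<in> Ob ?S \<longleftrightarrow> is_semisimplicial_set X \<and> is_2_Segal X" for X
    by (simp add: two_Segal_semisimplicial_sets_def)
  have Hom: "Hom ?S = presheaf_hom Delta_inj" and Idm: "\<And>X. Idm ?S X = (\<lambda>n. \<lambda>x\<in>simp X n. x)"
    and Cmp: "\<And>X Y Z g f. Cmp ?S X Y Z g f = (\<lambda>n. compose (simp X n) (g n) (f n))"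
    by (simp_all add: two_Segal_semisimplicial_sets_def)
  have X: "semisimp X" "ears X" "is_presheaf Delta_inj X" if "X \<in> Ob ?S" for X
    using that semisimplicial_semisimp[of X] two_Segal_imp_ears[of X] by (simp_all add: O)
  have FX: "is_musemicat (?F X)" if "X \<in> Ob ?S" for X by (rule mu_of_musemicat[OF X(1,2)[OF that]])
  have nm: "natural_map X Y f" if "f \<in> Hom ?S X Y" for X Y f
    using that presheaf_hom_natural[of f Delta_inj X Y] by (simp add: Hom)
  note ext = extender_id and site = site_Delta_inj
  have GX: "?N C \<in> Ob ?S" if "is_musemicat C" for C
    unfolding O using nerve_presheaf[OF inf site ext] nerve_2_Segal[OF inf site ext that] by simp
  have Gh: "nerve_map C F \<in> presheaf_hom Delta_inj (?N C) (?N D)"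
    if "is_musemicat C" "is_musemicat D" "F \<in> semifunctors C D" for C D F
    by (rule nerve_map_hom[OF inf ext ext that])
      (simp add: map_chains[OF Delta_inj_smap] on_data_def)
  have cat: "is_category ?S"
    unfolding two_Segal_semisimplicial_sets_def by (rule presheaf_category) simp
  show ?thesis
  proof (rule equivalent_categoriesI[of ?S ?M ?F ?Fm ?N ?Gm, OF cat muSCat_category])
    show "is_functor ?S ?M ?F ?Fm"
      unfolding is_functor_def muSCat_simps Idm Cmp
    proof (intro conjI ballI)
      show "?F X \<in> {C. is_musemicat C}" if "X \<in> Ob ?S" for X using FX[OF that] by simp
      show "?Fm X Y f \<in> semifunctors (?F X) (?F Y)" if "X \<in> Ob ?S" "Y \<in> Ob ?S" "f \<in> Hom ?S X Y" for X Y f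
        by (rule mkfun_semifunctor[OF FX[OF that(1)] FX[OF that(2)] sfun_mu_of[OF X(1,2)[OF that(1)] X(1,2)[OF that(2)] nm[OF that(3)]]])
      show "?Fm X X (\<lambda>n. \<lambda>x\<in>simp X n. x) = mufun_id (?F X)" if "X \<in> Ob ?S" for X
        by (rule mkfun_mu_of_id[OF X(1)[OF that]])
      show "?Fm X Z (\<lambda>n. compose (simp X n) (g n) (f n)) = mufun_comp (?F X) (?Fm Y Z g) (?Fm X Y f)"
        if "X \<in> Ob ?S" "Y \<in> Ob ?S" "f \<in> Hom ?S X Y" for X Y Z f g
        by (rule mkfun_mu_of_comp[OF X(1,2)[OF that(1)] X(1,2)[OF that(2)] nm[OF that(3)]])
    qed
    show "is_functor ?M ?S ?N ?Gm"
      unfolding is_functor_def muSCat_simps Idm Cmp Hom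
    proof (intro conjI ballI)
      show "?N C \<in> Ob ?S" if "C \<in> {C. is_musemicat C}" for C using GX that by simp
      show "nerve_map C F \<in> presheaf_hom Delta_inj (?N C) (?N D)"
        if "C \<in> {C. is_musemicat C}" "D \<in> {C. is_musemicat C}" "F \<in> semifunctors C D" for C D F using Gh that by simp
      show "nerve_map C (mufun_id C) = (\<lambda>n. \<lambda>x\<in>simp (?N C) n. x)" if "C \<in> {C. is_musemicat C}" for C
        using nerve_map_id[OF inf] that by simp
      show "nerve_map C (mufun_comp C G F) = (\<lambda>n. compose (simp (?N C) n) (nerve_map D G n) (nerve_map C F n))"
        if "C \<in> {C. is_musemicat C}" "D \<in> {C. is_musemicat C}" "E \<in> {C. is_musemicat C}"
          "F \<in> semifunctors C D" "G \<in> semifunctors D E" for C D E F G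
        using nerve_map_comp[OF inf] that by simp
    qed
    show "naturally_isomorphic ?S ?S (\<lambda>X. X) (\<lambda>X Y f. f) (\<lambda>X. ?N (?F X)) (\<lambda>X Y f. nerve_map (?F X) (?Fm X Y f))"
      unfolding naturally_isomorphic_def
    proof (intro exI[of _ to_nerve] conjI ballI)
      fix X assume XO: "X \<in> Ob ?S"
      have act: "face X m l (act X m n \<theta> x) = skeleton X n x (map \<theta> l)"
        if "\<theta> \<in> Delta_inj m n" "x \<in> simp X n" "l \<in> chains m" for m n \<theta> x l
        using that face_act[OF X(1)[OF XO] that(1) _ that(2), of l] map_chains[OF Delta_inj_smap[OF that(1)] that(3)]
        by (simp add: skeleton_def chains_def)
      have T: "to_nerve X \<in> presheaf_hom Delta_inj X (?N (?F X))"
        "\<And>n. bij_betw (to_nerve X n) (simp X n) (simp (?N (?F X)) n)"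
        by (rule to_nerve_hom[OF inf X(3,1,2)[OF XO] ext act]; assumption)+
      note I = presheaf_inverse[OF X(3)[OF XO] X(3)[OF GX[OF FX[OF XO]]] T]
      show "is_iso ?S X (?N (?F X)) (to_nerve X)"
        unfolding is_iso_def Hom Cmp Idm
        by (rule conjI[OF T(1)], rule bexI[OF _ I(1)], rule conjI[OF I(2) I(3)])
    next
      fix X Y f assume XY: "X \<in> Ob ?S" "Y \<in> Ob ?S" and f: "f \<in> Hom ?S X Y"
      have "to_nerve Y n (f n x) = nerve_map (?F X) (?Fm X Y f) n (to_nerve X n x)" if "x \<in> simp X n" for n x
        by (rule to_nerve_natural[OF inf X(1,2)[OF XY(1)] X(1,2)[OF XY(2)] nm[OF f] that])
      then show "Cmp ?S X Y (?N (?F Y)) (to_nerve Y) f =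
          Cmp ?S X (?N (?F X)) (?N (?F Y)) (nerve_map (?F X) (?Fm X Y f)) (to_nerve X)"
        by (auto simp: Cmp compose_def fun_eq_iff)
    qed
    show "naturally_isomorphic ?M ?M (\<lambda>C. ?F (?N C)) (\<lambda>C D F. ?Fm (?N C) (?N D) (nerve_map C F)) (\<lambda>C. C) (\<lambda>C D F. F)"
      unfolding naturally_isomorphic_def muSCat_simps
    proof (intro exI[of _ "\<lambda>C. counit (?F (?N C))"] conjI ballI)
      fix C :: "'u musemicat" assume "C \<in> {C. is_musemicat C}"
      then have C: "is_musemicat C" by simp
      note FG = FX[OF GX[OF C]]
      note S = counit_sfun[OF inf site ext C, of "()"] and B = counit_bij[OF inf musemicat_premu[OF C]]
      note I = mkfun_inverse[OF FG C S, unfolded mu_of_simps(1-3) simp_nerve, OF B]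
      show "is_iso ?M (?F (?N C)) C (counit (?F (?N C)))"
        unfolding is_iso_def muSCat_simps counit_def using mkfun_semifunctor[OF FG C S] I by blast
    next
      fix C D :: "'u musemicat" and F assume a: "C \<in> {C. is_musemicat C}" "D \<in> {C. is_musemicat C}" "F \<in> semifunctors C D"
      then have CD: "is_musemicat C" "is_musemicat D" by simp_all
      show "mufun_comp (?F (?N C)) (counit (?F (?N D))) (?Fm (?N C) (?N D) (nerve_map C F)) =
          mufun_comp (?F (?N C)) F (counit (?F (?N C)))"
        by (rule counit_natural[OF inf site ext ext CD a(3) Gh[OF CD a(3)]])
    qed
  qed
qed

section \<open>Units in a \<open>\<mu>\<close>-category\<close>

text \<open>The element given by the inverse of \<lambda>, playing the part of the degenerate
  triangle 001 on the edge \<open>f\<close>; \<open>rinv\<close> is the triangle 011 given by the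
  inverse of \<rho>.\<close>

definition linv :: "'u mucat \<Rightarrow> 'u \<Rightarrow> 'u" where
  "linv C f = (THE m. m \<in> Mu C \<and> e1 C m = unit C (tgt C f) \<and> e2 C m = f)"

definition rinv :: "'u mucat \<Rightarrow> 'u \<Rightarrow> 'u" where
  "rinv C f = (THE m. m \<in> Mu C \<and> e1 C m = f \<and> e2 C m = unit C (src C f))"

lemma mem_unit_left: "(f, m) \<in> apex (mu_unit_left C) \<longleftrightarrow> f \<in> Ar1 C \<and> m \<in> Mu C \<and> e1 C m = unit C (tgt C f) \<and> e2 C m = f"
  by (auto simp: mu_unit_left_def mem_span_comp map_span_def prod_eq_iff)

lemma mem_unit_right: "(f, m) \<in> apex (mu_unit_right C) \<longleftrightarrow> f \<in> Ar1 C \<and> m \<in> Mu C \<and> e1 C m = f \<and> e2 C m = unit C (src C f)"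
  by (auto simp: mu_unit_right_def mem_span_comp map_span_def prod_eq_iff)

lemma unit_span_legs:
  "lleg (mu_unit_left C) (f, m) = f" "rleg (mu_unit_left C) (f, m) = e3 C m"
  "lleg (mu_unit_right C) (f, m) = f" "rleg (mu_unit_right C) (f, m) = e3 C m"
  "apex (id_ar C) = Ar1 C" "lleg (id_ar C) g = g" "rleg (id_ar C) g = g"
  by (simp_all add: mu_unit_left_def mu_unit_right_def span_comp_def map_span_def)

lemma mucat_musemicat: "is_mucat C \<Longrightarrow> is_musemicat C"
  by (simp add: is_mucat_def)

lemma mucat_unit:
  assumes "is_mucat C" "x \<in> Ob0 C"
  shows "unit C x \<in> Ar1 C" "src C (unit C x) = x" "tgt C (unit C x) = x"
  using assms by (auto simp: is_mucat_def)

text \<open>Commuting with left legs forces \<open>\<phi>\<close> to be the left leg, here the first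
  projection. Bijectivity then means that each arrow has exactly one element of the apex above it,
  and the right legs force that element to have the same arrow as its composite.\<close>

lemma span_iso_id:
  assumes "span_iso \<sigma> (id_ar C) \<phi>" and legs: "\<And>w. w \<in> apex \<sigma> \<Longrightarrow> lleg \<sigma> w = fst w"
  shows "w \<in> apex \<sigma> \<Longrightarrow> \<phi> w = fst w" "w \<in> apex \<sigma> \<Longrightarrow> rleg \<sigma> w = fst w"
    "f \<in> Ar1 C \<Longrightarrow> \<exists>m. (f, m) \<in> apex \<sigma>" "(f, m) \<in> apex \<sigma> \<Longrightarrow> (f, m') \<in> apex \<sigma> \<Longrightarrow> m' = m"
proof -
  have hom: "span_hom \<sigma> (id_ar C) \<phi>" using assms(1) by (simp add: span_iso_def)
  obtain \<psi> where \<psi>: "span_hom (id_ar C) \<sigma> \<psi>" "\<forall>w\<in>apex \<sigma>. \<psi> (\<phi> w) = w" "\<forall>w\<in>apex (id_ar C). \<phi> (\<psi> w) = w"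
    using assms(1) by (auto simp: span_iso_def)
  show \<phi>: "\<phi> w = fst w" and "rleg \<sigma> w = fst w" if "w \<in> apex \<sigma>" for w
    using hom that legs[OF that] by (auto simp: span_hom_def map_span_def)
  show "\<exists>m. (f, m) \<in> apex \<sigma>" if f: "f \<in> Ar1 C"
  proof -
    have "\<psi> f \<in> apex \<sigma>" using \<psi>(1) f by (auto simp: span_hom_def map_span_def)
    moreover have "fst (\<psi> f) = f" using \<psi>(3) f \<phi>[OF calculation] by (simp add: map_span_def)
    ultimately show ?thesis by (metis prod.collapse)
  qed
  show "m' = m" if "(f, m) \<in> apex \<sigma>" "(f, m') \<in> apex \<sigma>"
  proof -
    have "(f, m) = (f, m')" using \<psi>(2) \<phi>[OF that(1)] \<phi>[OF that(2)] that by (metis fst_conv)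
    then show ?thesis by simp
  qed
qed

lemma mucat_lam:
  assumes C: "is_mucat C" and w: "(f, m) \<in> apex (mu_unit_left C)"
  shows "lam C (f, m) = f" "e3 C m = f"
proof -
  have "span_iso (mu_unit_left C) (id_ar C) (lam C)" using C by (simp add: is_mucat_def)
  note I = span_iso_id[OF this]
  show "lam C (f, m) = f" "e3 C m = f" using I(1,2)[OF _ w] by (auto simp: unit_span_legs)
qed

lemma mucat_rho:
  assumes C: "is_mucat C" and w: "(f, m) \<in> apex (mu_unit_right C)"
  shows "rho C (f, m) = f" "e3 C m = f"
proof -
  have "span_iso (mu_unit_right C) (id_ar C) (rho C)" using C by (simp add: is_mucat_def)
  note I = span_iso_id[OF this]
  show "rho C (f, m) = f" "e3 C m = f" using I(1,2)[OF _ w] by (auto simp: unit_span_legs)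
qed

lemma mucat_unitors:
  assumes C: "is_mucat C"
  shows "f \<in> Ar1 C \<Longrightarrow> \<exists>m. (f, m) \<in> apex (mu_unit_left C)"
    "(f, m) \<in> apex (mu_unit_left C) \<Longrightarrow> (f, m') \<in> apex (mu_unit_left C) \<Longrightarrow> m' = m"
    "f \<in> Ar1 C \<Longrightarrow> \<exists>m. (f, m) \<in> apex (mu_unit_right C)"
    "(f, m) \<in> apex (mu_unit_right C) \<Longrightarrow> (f, m') \<in> apex (mu_unit_right C) \<Longrightarrow> m' = m"
proof -
  have "span_iso (mu_unit_left C) (id_ar C) (lam C)" "span_iso (mu_unit_right C) (id_ar C) (rho C)"
    using C by (simp_all add: is_mucat_def)
  note I = span_iso_id[OF this(1)] span_iso_id[OF this(2)]
  show "f \<in> Ar1 C \<Longrightarrow> \<exists>m. (f, m) \<in> apex (mu_unit_left C)"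
    "(f, m) \<in> apex (mu_unit_left C) \<Longrightarrow> (f, m') \<in> apex (mu_unit_left C) \<Longrightarrow> m' = m"
    "f \<in> Ar1 C \<Longrightarrow> \<exists>m. (f, m) \<in> apex (mu_unit_right C)"
    "(f, m) \<in> apex (mu_unit_right C) \<Longrightarrow> (f, m') \<in> apex (mu_unit_right C) \<Longrightarrow> m' = m"
    by (rule I(3,4,7,8); auto simp: unit_span_legs)+
qed

lemma linv_unique:
  assumes C: "is_mucat C" and m: "m \<in> Mu C" "e1 C m = unit C (tgt C f)" "e2 C m = f"
  shows "linv C f = m"
proof -
  have f: "f \<in> Ar1 C" using premu_mu(2)[OF musemicat_premu[OF mucat_musemicat[OF C]] m(1)] m(3) by simp
  have fm: "(f, m) \<in> apex (mu_unit_left C)" using m f by (simp add: mem_unit_left)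
  show ?thesis unfolding linv_def
  proof (rule the_equality)
    fix m' assume "m' \<in> Mu C \<and> e1 C m' = unit C (tgt C f) \<and> e2 C m' = f"
    then have "(f, m') \<in> apex (mu_unit_left C)" using f by (simp add: mem_unit_left)
    then show "m' = m" by (rule mucat_unitors(2)[OF C fm])
  qed (use m in simp)
qed

lemma linv:
  assumes C: "is_mucat C" and f: "f \<in> Ar1 C"
  shows "linv C f \<in> Mu C" "e1 C (linv C f) = unit C (tgt C f)" "e2 C (linv C f) = f" "e3 C (linv C f) = f"
proof -
  obtain m where m: "(f, m) \<in> apex (mu_unit_left C)" using mucat_unitors(1)[OF C f] by blast
  then have "linv C f = m" by (intro linv_unique[OF C]) (auto simp: mem_unit_left)
  then show "linv C f \<in> Mu C" "e1 C (linv C f) = unit C (tgt C f)" "e2 C (linv C f) = f" "e3 C (linv C f) = f"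
    using m mucat_lam[OF C m] by (auto simp: mem_unit_left)
qed

lemma rinv_unique:
  assumes C: "is_mucat C" and m: "m \<in> Mu C" "e1 C m = f" "e2 C m = unit C (src C f)"
  shows "rinv C f = m"
proof -
  have f: "f \<in> Ar1 C" using premu_mu(1)[OF musemicat_premu[OF mucat_musemicat[OF C]] m(1)] m(2) by simp
  have fm: "(f, m) \<in> apex (mu_unit_right C)" using m f by (simp add: mem_unit_right)
  show ?thesis unfolding rinv_def
  proof (rule the_equality)
    fix m' assume "m' \<in> Mu C \<and> e1 C m' = f \<and> e2 C m' = unit C (src C f)"
    then have "(f, m') \<in> apex (mu_unit_right C)" using f by (simp add: mem_unit_right)
    then show "m' = m" by (rule mucat_unitors(4)[OF C fm])
  qed (use m in simp)
qed

lemma rinv: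
  assumes C: "is_mucat C" and f: "f \<in> Ar1 C"
  shows "rinv C f \<in> Mu C" "e1 C (rinv C f) = f" "e2 C (rinv C f) = unit C (src C f)" "e3 C (rinv C f) = f"
proof -
  obtain m where m: "(f, m) \<in> apex (mu_unit_right C)" using mucat_unitors(3)[OF C f] by blast
  then have "rinv C f = m" by (intro rinv_unique[OF C]) (auto simp: mem_unit_right)
  then show "rinv C f \<in> Mu C" "e1 C (rinv C f) = f" "e2 C (rinv C f) = unit C (src C f)" "e3 C (rinv C f) = f"
    using m mucat_rho[OF C m] by (auto simp: mem_unit_right)
qed

text \<open>The simplicial identity that the two degeneracies of a degenerate edge agree: both edges
  of \<open>linv\<close> at a unit are units.\<close>

lemma rinv_unit: "is_mucat C \<Longrightarrow> x \<in> Ob0 C \<Longrightarrow> rinv C (unit C x) = linv C (unit C x)"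
  using linv[of C "unit C x"] mucat_unit[of C x] by (intro rinv_unique) auto

lemma unit_triangle_iff:
  assumes S: "is_musemicat C" and w: "w = (((f, m), g), b)" and m: "(f, m) \<in> apex (mu_unit_right C)"
    and t: "tet C m b n d" and e: "e3 C m = f" and b: "e1 C b = f" "e2 C b = g"
  shows "w \<in> apex (span_comp (mu C) (ar_prod C (mu_unit_right C) (id_ar C)))" "unit_assoc C w = ((e1 C d, (g, n)), d)"
proof -
  note p = musemicat_premu[OF S]
  have "lleg (mu C) b = (f, g)" using b by (simp add: prod_eq_iff)
  then show "w \<in> apex (span_comp (mu C) (ar_prod C (mu_unit_right C) (id_ar C)))"
    using m e b tet_mem[OF t] premu_mu[OF p, of b] unfolding w mem_span_comp mem_span_prod
    by (simp add: unit_span_legs span_prod_def)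
  show "unit_assoc C w = ((e1 C d, (g, n)), d)"
    using tet_assoc[OF t] b by (simp add: unit_assoc_def w)
qed

text \<open>The unit coherence axiom, read as the degenerate tetrahedron 0112 over the triangle
  \<open>b\<close>.\<close>

lemma tet_triangle:
  assumes C: "is_mucat C" and b: "b \<in> Mu C"
  shows "tet C (rinv C (e1 C b)) b (linv C (e2 C b)) b"
proof -
  note S = mucat_musemicat[OF C] and p = musemicat_premu[OF mucat_musemicat[OF C]]
  note B = premu_mu[OF p b] and R = rinv[OF C premu_mu(1)[OF p b]]
  obtain n d where t: "tet C (rinv C (e1 C b)) b n d" using tet_exists[OF S R(1) b] R by auto
  note E = tet_edges[OF S t]
  have m: "(e1 C b, rinv C (e1 C b)) \<in> apex (mu_unit_right C)" using R B by (simp add: mem_unit_right)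
  let ?w = "(((e1 C b, rinv C (e1 C b)), e2 C b), b)"
  note U = unit_triangle_iff[OF S refl m t R(4) refl refl]
  have "map_prod (map_prod id (lam C)) id (unit_assoc C ?w) = map_prod (map_prod (rho C) id) id ?w"
    using C U(1) by (auto simp: is_mucat_def unit_triangle_def)
  then have "d = b" by (simp add: U(2))
  moreover have "linv C (e2 C b) = n"
    using tet_mem(3)[OF t] E R B by (intro linv_unique[OF C]) auto
  ultimately show ?thesis using t by simp
qed

text \<open>Kelly's argument: the coherence of \<open>\<lambda>\<close> with \<open>\<alpha>\<close> comes from the pentagon on the vertices
  \<open>0, 0, 0, 1, 2\<close>, that of \<open>\<rho>\<close> from the one on \<open>0, 1, 2, 2, 2\<close>.\<close>

lemma tet_linv:
  assumes C: "is_mucat C" and b: "b \<in> Mu C"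
  shows "tet C (linv C (e1 C b)) b b (linv C (e3 C b))"
proof -
  note S = mucat_musemicat[OF C] and p = musemicat_premu[OF mucat_musemicat[OF C]]
  note B = premu_mu[OF p b]
  let ?f = "e1 C b" let ?x = "tgt C ?f" let ?e = "unit C ?x" let ?m = "linv C ?f"
  note x = premu_ar(2)[OF p B(1)] and L = linv[OF C B(1)]
  note e = mucat_unit[OF C x]
  have t1: "tet C (rinv C ?e) ?m ?m ?m" using tet_triangle[OF C L(1)] L by simp
  \<comment> \<open>The tetrahedron 0012 with two faces still unknown: \<open>d\<close> on 002 is
    settled by its edges, and \<open>a\<close> on 012 has to be shown equal to
    \<open>b\<close>.\<close>
  obtain a d where t2: "tet C ?m b a d" using tet_exists[OF S L(1) b L(4)] by blast
  note E = tet_edges[OF S t2] and M = tet_mem[OF t2]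
  have d1: "e1 C d = ?e" using E L by simp
  have "linv C (e2 C d) = d"
    using M d1 premu_mu(4)[OF p M(4)] e by (intro linv_unique[OF C]) auto
  then have t4: "tet C (rinv C ?e) d d d" using tet_triangle[OF C M(4)] d1 by simp
  \<comment> \<open>The pentagon on 00012, in which \<open>t2\<close> occurs twice. The result
    differs from \<open>t2\<close> only in its second face, and the inverse of
    \<open>\<alpha>\<close> cancels the other two.\<close>
  have "tet C ?m a a d" using tet_pentagon(2)[OF S t1 t2 t2 t4] .
  then have "a = b" using tet_flip_unique(2)[OF S t2] by simp
  moreover have "e3 C b = e2 C d" using M calculation by simp
  ultimately show ?thesis using t2 \<open>linv C (e2 C d) = d\<close> by simp
qed

text \<open>The tetrahedron 0122 is produced from its faces 122 and 012 by the inverse of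
  \<open>\<alpha>\<close>, with first face \<open>z\<close>. The pentagon, where this tetrahedron
  occurs twice, shows that the one starting with \<open>b\<close> has the same last two faces;
  cancelling gives \<open>z = b\<close>.\<close>

lemma tet_rinv:
  assumes C: "is_mucat C" and b: "b \<in> Mu C"
  shows "tet C b (rinv C (e3 C b)) (rinv C (e2 C b)) b"
proof -
  note S = mucat_musemicat[OF C] and p = musemicat_premu[OF mucat_musemicat[OF C]]
  note B = premu_mu[OF p b]
  let ?g = "e2 C b" let ?x = "src C ?g" let ?e = "unit C ?x" let ?m = "rinv C ?g"
  note x = premu_ar(1)[OF p B(2)] and R = rinv[OF C B(2)]
  note e = mucat_unit[OF C x]
  obtain z y where t1: "tet C z y ?m b" using tet_flip_exists[OF S R(1) b R(4)] by blast
  note E = tet_edges[OF S t1] and M = tet_mem[OF t1]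
  have y2: "e2 C y = ?e" using E R by simp
  have y: "rinv C (e1 C y) = y"
    using M y2 premu_mu(4)[OF p M(2)] e by (intro rinv_unique[OF C]) auto
  have t3: "tet C y y (linv C ?e) y" using tet_triangle[OF C M(2)] y y2 by simp
  have y3: "e3 C y = e1 C y" using rinv(4)[OF C premu_mu(1)[OF p M(2)]] y by simp
  have "e3 C b = e1 C y" using E(4) y3 by simp
  then obtain c d where t2: "tet C b y c d" using tet_exists[OF S b M(2)] by blast
  have d: "d = b" using tet_pentagon(1)[OF S t1 t2 t3 t1] by simp
  have "rinv C ?g = c"
    using tet_edges[OF S t2] tet_mem[OF t2] d y2 by (intro rinv_unique[OF C]) auto
  then have t2': "tet C b y ?m b" using t2 d by simp
  then have "z = b" using tet_flip_unique(1)[OF S t1] by simp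
  then show ?thesis using t1 y \<open>e3 C b = e1 C y\<close> by simp
qed

text \<open>\<open>l\<close> and \<open>r\<close> are the prospective values of \<open>linv\<close>
  and \<open>rinv\<close>. With \<lambda> and \<rho> as first projections, only uniqueness of unit
  triangles and the tetrahedron 0112 are left to verify.\<close>

lemma mucatI:
  fixes C :: "'u mucat"
  assumes S: "is_musemicat C" and u: "unit C \<in> Ob0 C \<rightarrow>\<^sub>E Ar1 C"
    and st: "\<And>x. x \<in> Ob0 C \<Longrightarrow> src C (unit C x) = x" "\<And>x. x \<in> Ob0 C \<Longrightarrow> tgt C (unit C x) = x"
    and l: "\<And>f. f \<in> Ar1 C \<Longrightarrow> (f, l f) \<in> apex (mu_unit_left C)" "\<And>f. f \<in> Ar1 C \<Longrightarrow> e3 C (l f) = f"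
      "\<And>f m. (f, m) \<in> apex (mu_unit_left C) \<Longrightarrow> m = l f"
    and r: "\<And>f. f \<in> Ar1 C \<Longrightarrow> (f, r f) \<in> apex (mu_unit_right C)" "\<And>f. f \<in> Ar1 C \<Longrightarrow> e3 C (r f) = f"
      "\<And>f m. (f, m) \<in> apex (mu_unit_right C) \<Longrightarrow> m = r f"
    and lam: "lam C = restrict fst (apex (mu_unit_left C))" and rho: "rho C = restrict fst (apex (mu_unit_right C))"
    and tri: "\<And>b. b \<in> Mu C \<Longrightarrow> tet C (r (e1 C b)) b (l (e2 C b)) b"
  shows "is_mucat C"
proof -
  note p = musemicat_premu[OF S]
  have iso: "span_iso \<sigma> (id_ar C) (restrict fst (apex \<sigma>))"
    if "\<And>f m. (f, m) \<in> apex \<sigma> \<Longrightarrow> f \<in> Ar1 C \<and> m = k f \<and> lleg \<sigma> (f, m) = f \<and> rleg \<sigma> (f, m) = f"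
      "\<And>f. f \<in> Ar1 C \<Longrightarrow> (f, k f) \<in> apex \<sigma>" for \<sigma> :: "('u, 'u \<times> 'u, 'u) span" and k
    unfolding span_iso_def
  proof (intro conjI exI[of _ "\<lambda>f\<in>Ar1 C. (f, k f)"])
    show "span_hom \<sigma> (id_ar C) (restrict fst (apex \<sigma>))" "span_hom (id_ar C) \<sigma> (\<lambda>f\<in>Ar1 C. (f, k f))"
      using that by (auto simp: span_hom_def unit_span_legs map_span_def)
    show "\<forall>w\<in>apex \<sigma>. (\<lambda>f\<in>Ar1 C. (f, k f)) (restrict fst (apex \<sigma>) w) = w"
      "\<forall>w\<in>apex (id_ar C). restrict fst (apex \<sigma>) ((\<lambda>f\<in>Ar1 C. (f, k f)) w) = w"
      using that by (auto simp: map_span_def)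
  qed
  have "span_iso (mu_unit_left C) (id_ar C) (lam C)" unfolding lam
  proof (rule iso[of _ l])
    fix f m assume fm: "(f, m) \<in> apex (mu_unit_left C)"
    then have "f \<in> Ar1 C" by (simp add: mem_unit_left)
    then show "f \<in> Ar1 C \<and> m = l f \<and> lleg (mu_unit_left C) (f, m) = f \<and> rleg (mu_unit_left C) (f, m) = f"
      using l(3)[OF fm] l(2) by (simp add: unit_span_legs)
  qed (rule l(1))
  moreover have "span_iso (mu_unit_right C) (id_ar C) (rho C)" unfolding rho
  proof (rule iso[of _ r])
    fix f m assume fm: "(f, m) \<in> apex (mu_unit_right C)"
    then have "f \<in> Ar1 C" by (simp add: mem_unit_right)
    then show "f \<in> Ar1 C \<and> m = r f \<and> lleg (mu_unit_right C) (f, m) = f \<and> rleg (mu_unit_right C) (f, m) = f"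
      using r(3)[OF fm] r(2) by (simp add: unit_span_legs)
  qed (rule r(1))
  moreover have "unit_triangle C"
    unfolding unit_triangle_def
  proof
    fix w assume w: "w \<in> apex (span_comp (mu C) (ar_prod C (mu_unit_right C) (id_ar C)))"
    obtain f m g b where w': "w = (((f, m), g), b)" by (metis prod.exhaust)
    then have mg: "(f, m) \<in> apex (mu_unit_right C)" "g \<in> Ar1 C" "b \<in> Mu C" "(e3 C m, g) = lleg (mu C) b"
      using w by (auto simp: mem_span_comp mem_span_prod unit_span_legs span_prod_def[of _ _ "mu_unit_right C"])
    then have f: "f \<in> Ar1 C" "m = r f" by (auto simp: mem_unit_right r(3))
    then have e: "e3 C m = f" using r(2) by simp
    then have b: "e1 C b = f" "e2 C b = g" using mg(4) by (auto dest: arg_cong[of _ _ fst] arg_cong[of _ _ snd])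
    have t: "tet C m b (l g) b" using tri[OF mg(3)] b f by simp
    show "map_prod (map_prod id (lam C)) id (unit_assoc C w) = map_prod (map_prod (rho C) id) id w"
      unfolding w' unfolding unit_triangle_iff(2)[OF S refl mg(1) t e b] lam rho using l(1)[OF mg(2)] mg(1) b by simp
  qed
  ultimately show ?thesis using S u st by (auto simp: is_mucat_def)
qed

text \<open>On both sides \<lambda> and \<rho> are first projections, so they commute with every
  semifunctor that carries unit triangles to unit triangles.\<close>

lemma mufunctors_iff:
  assumes C: "is_mucat C" and D: "is_mucat D"
  shows "F \<in> mufunctors C D \<longleftrightarrow> F \<in> semifunctors C D \<and> (\<forall>x\<in>Ob0 C. F1 F (unit C x) = unit D (F0 F x))"
proof -
  note p = musemicat_premu[OF mucat_musemicat[OF C]]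
  show ?thesis
  proof
    assume F: "F \<in> semifunctors C D \<and> (\<forall>x\<in>Ob0 C. F1 F (unit C x) = unit D (F0 F x))"
    have s: "sfun C D (F0 F) (F1 F) (mu_action C F)"
      by (rule semifunctorD(2)[OF mucat_musemicat[OF C] mucat_musemicat[OF D]]) (use F in blast)
    have "lam D (map_prod (F1 F) (mu_action C F) w) = F1 F (lam C w)" if "w \<in> apex (mu_unit_left C)" for w
    proof (cases w)
      case (Pair f m)
      then have "(F1 F f, mu_action C F m) \<in> apex (mu_unit_left D)"
        using that s F premu_ar[OF p, of f] by (auto simp: mem_unit_left sfun_def)
      then show ?thesis using mucat_lam(1)[OF C] mucat_lam(1)[OF D] that Pair by simp
    qed
    moreover have "rho D (map_prod (F1 F) (mu_action C F) w) = F1 F (rho C w)" if "w \<in> apex (mu_unit_right C)" for w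
    proof (cases w)
      case (Pair f m)
      then have "(F1 F f, mu_action C F m) \<in> apex (mu_unit_right D)"
        using that s F premu_ar[OF p, of f] by (auto simp: mem_unit_right sfun_def)
      then show ?thesis using mucat_rho(1)[OF C] mucat_rho(1)[OF D] that Pair by simp
    qed
    ultimately show "F \<in> mufunctors C D" using F unfolding mufunctors_def by blast
  qed (simp add: mufunctors_def)
qed

section \<open>Simplicial sets in terms of weakly increasing lists\<close>

definition wmap :: "nat \<Rightarrow> nat \<Rightarrow> (nat \<Rightarrow> nat) \<Rightarrow> bool" where
  "wmap m n g \<longleftrightarrow> (\<forall>i\<le>m. g i \<le> n) \<and> (\<forall>i j. i \<le> j \<and> j \<le> m \<longrightarrow> g i \<le> g j)"

lemma restrict_in_Delta: "restrict g {..m} \<in> Delta m n \<longleftrightarrow> wmap m n g"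
  unfolding Delta_def wmap_def monotone_on_def
  by (auto intro: order_trans)

lemma Delta_wmap: "\<theta> \<in> Delta m n \<Longrightarrow> wmap m n \<theta>"
  unfolding Delta_def wmap_def monotone_on_def by auto

lemma Delta_restrict: "\<theta> \<in> Delta m n \<Longrightarrow> restrict \<theta> {..m} = \<theta>"
  by (auto simp: Delta_def PiE_def extensional_restrict)

lemma smap_wmap: "smap m n g \<Longrightarrow> wmap m n g"
  unfolding smap_def wmap_def by (metis le_neq_implies_less order.order_iff_strict)

lemma simplicial_ap_in: "is_simplicial_set X \<Longrightarrow> wmap m n g \<Longrightarrow> x \<in> simp X n \<Longrightarrow> ap X m n g x \<in> simp X m"
  unfolding ap_def by (intro presheaf_act) (auto simp: restrict_in_Delta)

lemma simplicial_ap_ap: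
  assumes "is_simplicial_set X" "wmap l m h" "wmap m n g" "x \<in> simp X n"
  shows "ap X l m h (ap X m n g x) = ap X l n (g \<circ> h) x"
proof -
  have "compose {..l} (restrict g {..m}) (restrict h {..l}) = restrict (g \<circ> h) {..l}"
    using assms(2) by (auto simp: compose_def wmap_def)
  moreover have "act X l n (compose {..l} (restrict g {..m}) (restrict h {..l})) x
      = act X l m (restrict h {..l}) (act X m n (restrict g {..m}) x)"
    using assms by (simp add: is_presheaf_def restrict_in_Delta)
  ultimately show ?thesis by (simp add: ap_def)
qed

lemma wmap_nth: "sorted l \<Longrightarrow> \<forall>i\<in>set l. i \<le> n \<Longrightarrow> length l = Suc p \<Longrightarrow> wmap p n (nth l)"
  unfolding wmap_def by (auto simp: sorted_iff_nth_mono)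

lemma simplicial_face_ap:
  assumes "is_simplicial_set X" "wmap m n g" "l \<noteq> []" "sorted l" "\<forall>i\<in>set l. i \<le> m" "x \<in> simp X n"
  shows "face X m l (ap X m n g x) = face X n (map g l) x"
proof -
  have l: "length l = Suc (length l - 1)" using assms(3) by (cases l) auto
  have "face X m l (ap X m n g x) = ap X (length l - 1) n (g \<circ> nth l) x"
    unfolding face_def by (rule simplicial_ap_ap[OF assms(1) wmap_nth[OF assms(4,5) l] assms(2,6)])
  also have "\<dots> = face X n (map g l) x"
    unfolding face_def using l by (auto intro!: ap_cong)
  finally show ?thesis .
qed

lemma simplicial_face_face:
  assumes "is_simplicial_set X" "sorted l" "\<forall>i\<in>set l. i \<le> n" "length l = Suc p" "k \<noteq> []" "sorted k" "\<forall>i\<in>set k. i \<le> p" "x \<in> simp X n"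
  shows "face X p k (face X n l x) = face X n (map (nth l) k) x"
proof -
  have "face X n l x = ap X p n (nth l) x" using assms(4) by (simp add: face_def)
  then show ?thesis using simplicial_face_ap[OF assms(1) wmap_nth[OF assms(2-4)] assms(5-8)] by simp
qed

lemma simplicial_face_in:
  "is_simplicial_set X \<Longrightarrow> sorted l \<Longrightarrow> \<forall>i\<in>set l. i \<le> n \<Longrightarrow> length l = Suc p \<Longrightarrow> x \<in> simp X n \<Longrightarrow> face X n l x \<in> simp X p"
  by (simp add: face_def simplicial_ap_in wmap_nth)

lemma simplicial_face_natural:
  assumes f: "f \<in> presheaf_hom Delta X Y" and l: "sorted l" "\<forall>i\<in>set l. i \<le> n" "length l = Suc p" and x: "x \<in> simp X n"
  shows "f p (face X n l x) = face Y n l (f n x)"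
  using presheaf_homD(3)[OF f _ x, of "restrict (nth l) {..p}" p] wmap_nth[OF l] l(3)
  by (simp add: face_def ap_def restrict_in_Delta)

section \<open>Unital 2-Segal sets\<close>

text \<open>Surjectivity in the Cartesian squares for \<open>n = 2\<close>. Injectivity holds in
  every simplicial set, since a face of a degenerate simplex recovers the simplex that was
  degenerated.\<close>

definition unital2 :: "'u simp_data \<Rightarrow> bool" where
  "unital2 X \<longleftrightarrow> (\<forall>c\<in>simp X 2. \<forall>b\<in>simp X 0.
     (face X 2 [0, 1] c = face X 0 [0, 0] b \<longrightarrow> (\<exists>a\<in>simp X 1. c = face X 1 [0, 0, 1] a)) \<and>
     (face X 2 [1, 2] c = face X 0 [0, 0] b \<longrightarrow> (\<exists>a\<in>simp X 1. c = face X 1 [0, 1, 1] a)))"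

lemma sigma_1_0: "act X 1 0 (sigma 1 0) b = face X 0 [0, 0] b"
proof -
  have "sigma 1 0 = restrict (nth [0, 0]) {..1}" by (auto simp: sigma_def fun_eq_iff restrict_def le_Suc_eq)
  then show ?thesis by (simp add: face_def ap_def)
qed

lemma unital_imp_unital2:
  assumes U: "is_unital X"
  shows "unital2 X"
  unfolding unital2_def
proof (intro ballI conjI impI)
  fix c b assume c: "c \<in> simp X 2" and b: "b \<in> simp X 0"
  have U': "(b, c) \<in> (\<lambda>a. (act X 0 1 (\<lambda>j\<in>{..0}. i) a, act X 2 1 (sigma 2 i) a)) ` simp X 1"
    if "i < 2" "act X 1 0 (sigma 1 0) b = act X 1 2 (\<lambda>j\<in>{..1}. i + j) c" for i
  proof -
    have "bij_betw (\<lambda>a. (act X 0 (2 - 1) (\<lambda>j\<in>{..0}. i) a, act X 2 (2 - 1) (sigma 2 i) a)) (simp X (2 - 1))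
      {(b, c). b \<in> simp X 0 \<and> c \<in> simp X 2 \<and> act X 1 0 (sigma 1 0) b = act X 1 2 (\<lambda>j\<in>{..1}. i + j) c}"
      using U[unfolded is_unital_def cartesian_square_def, rule_format, of 2 i] that(1) by simp
    from bij_betw_imp_surj_on[OF this] show ?thesis using that(2) b c by auto
  qed
  show "\<exists>a\<in>simp X 1. c = face X 1 [0, 0, 1] a" if m: "face X 2 [0, 1] c = face X 0 [0, 0] b"
  proof -
    have "(\<lambda>j\<in>{..1::nat}. 0 + j) = restrict (nth [0, 1]) {..1}" by (auto simp: fun_eq_iff restrict_def le_Suc_eq)
    then have "act X 1 2 (\<lambda>j\<in>{..1}. 0 + j) c = face X 2 [0, 1] c" by (simp add: face_def ap_def)
    moreover have "sigma 2 0 = restrict (nth [0, 0, 1]) {..2}"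
      by (auto simp: sigma_def fun_eq_iff restrict_def le_Suc_eq numeral_2_eq_2)
    then have "act X 2 1 (sigma 2 0) a = face X 1 [0, 0, 1] a" for a by (simp add: face_def ap_def numeral_2_eq_2)
    ultimately show ?thesis using U'[of 0] m by (auto simp: sigma_1_0[symmetric])
  qed
  show "\<exists>a\<in>simp X 1. c = face X 1 [0, 1, 1] a" if m: "face X 2 [1, 2] c = face X 0 [0, 0] b"
  proof -
    have "(\<lambda>j\<in>{..1::nat}. 1 + j) = restrict (nth [1, 2]) {..1}" by (auto simp: fun_eq_iff restrict_def le_Suc_eq)
    then have "act X 1 2 (\<lambda>j\<in>{..1}. 1 + j) c = face X 2 [1, 2] c" by (simp add: face_def ap_def)
    moreover have "sigma 2 1 = restrict (nth [0, 1, 1]) {..2}"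
      by (auto simp: sigma_def fun_eq_iff restrict_def le_Suc_eq numeral_2_eq_2)
    then have "act X 2 1 (sigma 2 1) a = face X 1 [0, 1, 1] a" for a by (simp add: face_def ap_def numeral_2_eq_2)
    ultimately show ?thesis using U'[of 1] m by (auto simp: sigma_1_0[symmetric])
  qed
qed

text \<open>By the simplicial identities the edge witnessing \<open>unital2\<close> is either of the
  two remaining edges of \<open>c\<close>.\<close>

lemma unital2D:
  assumes X: "is_simplicial_set X" and U: "unital2 X" and c: "c \<in> simp X 2" and b: "b \<in> simp X 0"
  shows "face X 2 [0, 1] c = face X 0 [0, 0] b \<Longrightarrow> c = face X 1 [0, 0, 1] (face X 2 [0, 2] c) \<and> c = face X 1 [0, 0, 1] (face X 2 [1, 2] c)"
    "face X 2 [1, 2] c = face X 0 [0, 0] b \<Longrightarrow> c = face X 1 [0, 1, 1] (face X 2 [0, 2] c) \<and> c = face X 1 [0, 1, 1] (face X 2 [0, 1] c)"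
proof -
  have id: "face X 1 [0, 1] a = a" if "a \<in> simp X 1" for a
    using face_all[OF simplicial_semisimp[OF X] that] by (simp add: upt_rec)
  note F = simplicial_face_face[OF X]
  show "c = face X 1 [0, 0, 1] (face X 2 [0, 2] c) \<and> c = face X 1 [0, 0, 1] (face X 2 [1, 2] c)"
    if m: "face X 2 [0, 1] c = face X 0 [0, 0] b"
  proof -
    obtain a where a: "a \<in> simp X 1" "c = face X 1 [0, 0, 1] a" using U c b m unfolding unital2_def by blast
    then have "face X 2 [0, 2] c = a" "face X 2 [1, 2] c = a" using id[OF a(1)] by (simp_all add: F)
    then show ?thesis using a by simp
  qed
  show "c = face X 1 [0, 1, 1] (face X 2 [0, 2] c) \<and> c = face X 1 [0, 1, 1] (face X 2 [0, 1] c)"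
    if m: "face X 2 [1, 2] c = face X 0 [0, 0] b"
  proof -
    obtain a where a: "a \<in> simp X 1" "c = face X 1 [0, 1, 1] a" using U c b m unfolding unital2_def by blast
    then have "face X 2 [0, 2] c = a" "face X 2 [0, 1] c = a" using id[OF a(1)] by (simp_all add: F)
    then show ?thesis using a by simp
  qed
qed

text \<open>An ear at an end point of the edge \<open>i, i+1\<close> reduces the general case to the triangles.\<close>

lemma unital2_imp_unital:
  assumes X: "is_simplicial_set X" and E: "ears X" and U: "unital2 X"
  shows "is_unital X"
  unfolding is_unital_def cartesian_square_def
proof (intro allI impI)
  fix n i :: nat assume "2 \<le> n" "i < n"
  then obtain m where n: "n = Suc m" and m: "1 \<le> m" and i: "i \<le> m" by (cases n) auto
  note S = simplicial_semisimp[OF X] and F = simplicial_face_face[OF X]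
  let ?s = "\<lambda>j. if j \<le> i then j else j - 1"
  have s: "wmap n m ?s" using i n by (auto simp: wmap_def)
  have sg: "act X n (n - 1) (sigma n i) a = ap X n m ?s a" for a by (simp add: ap_def sigma_def n)
  have v: "act X 0 (n - 1) (\<lambda>j\<in>{..0}. i) a = face X m [i] a" for a
  proof -
    have "(\<lambda>j\<in>{..0::nat}. i) = restrict (nth [i]) {..0}" by auto
    then show ?thesis by (simp add: face_def ap_def n)
  qed
  have ed: "act X 1 n (\<lambda>j\<in>{..1}. i + j) c = face X n [i, Suc i] c" for c
  proof -
    have "(\<lambda>j\<in>{..1}. i + j) = restrict (nth [i, Suc i]) {..1}" by (auto simp: fun_eq_iff restrict_def le_Suc_eq)
    then show ?thesis by (simp add: face_def ap_def)
  qed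
  \<comment> \<open>Both \<open>i\<close> and \<open>i + 1\<close> are sent to \<open>i\<close>, so
    omitting either gives a section of the degeneracy. The choice is made such that \<open>p\<close>
    is the tip of an ear, which excludes 0.\<close>
  define p where "p = (if i = 0 then 1 else i)"
  have p: "1 \<le> p" "p \<le> m" using m i by (auto simp: p_def)
  have sp: "?s (skip p j) = j" for j by (auto simp: p_def skip_def)
  have face_s: "face X n l (ap X n m ?s a) = face X m (map ?s l) a" if "a \<in> simp X m" "l \<noteq> []" "sorted l" "\<forall>i\<in>set l. i \<le> n" for a l
    by (rule simplicial_face_ap[OF X s that(2-4) that(1)])
  have bd_s: "bd X m p (ap X n m ?s a) = a" if a: "a \<in> simp X m" for a
  proof -
    have "bd X m p (ap X n m ?s a) = ap X m m (?s \<circ> skip p) a"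
      using simplicial_ap_ap[OF X _ s a, of m "skip p"] smap_wmap[OF smap_skip, of p m] p
      by (simp add: bd_def n)
    also have "\<dots> = a" using sp by (intro ap_id[OF S a]) simp
    finally show ?thesis .
  qed
  \<comment> \<open>\<open>c\<close> and its putative degenerate form have the same face opposite to
    \<open>p\<close>. By uniqueness for ears it suffices to compare them on the triangle
    \<open>p - 1, p, p + 1\<close>, one of whose sides is the degenerate edge
    \<open>i, i + 1\<close>.\<close>
  have sur: "ap X n m ?s (bd X m p c) = c"
    if c: "c \<in> simp X n" and b: "b \<in> simp X 0" and eq: "face X 0 [0, 0] b = face X n [i, Suc i] c" for b c
  proof -
    have y: "bd X m p c \<in> simp X m" using bd_in[OF S, of p m c] c p n by simp
    let ?t = "[p - 1, p, Suc p]"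
    let ?c = "face X n ?t c"
    have c': "?c \<in> simp X 2" using c p n by (intro face_in[OF S]) auto
    have bf: "face X m l (bd X m p c) = face X n (map (skip p) l) c" if "incr m l" for l
      using face_bd[OF S, of p m l c] that c p n by simp
    have "face X n ?t (ap X n m ?s (bd X m p c)) = ?c"
    proof (cases "i = 0")
      case True
      then have p1: "p = 1" by (simp add: p_def)
      have "face X 2 [0, 1] ?c = face X 0 [0, 0] b" using eq c n m by (simp add: F p1 True)
      then have "?c = face X 1 [0, 0, 1] (face X 2 [0, 2] ?c)" using unital2D(1)[OF X U c' b] by blast
      also have "face X 2 [0, 2] ?c = face X m [0, 1] (bd X m p c)" using c n m bf[of "[0, 1]"] by (simp add: F p1 skip_def)
      also have "face X 1 [0, 0, 1] \<dots> = face X m [0, 0, 1] (bd X m p c)" using y m by (simp add: F)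
      also have "\<dots> = face X n ?t (ap X n m ?s (bd X m p c))" using n m True p1 by (subst face_s[OF y]) auto
      finally show ?thesis by simp
    next
      case False
      then have p1: "p = i" by (simp add: p_def)
      have "face X 2 [1, 2] ?c = face X 0 [0, 0] b" using eq c n i by (simp add: F p1)
      then have "?c = face X 1 [0, 1, 1] (face X 2 [0, 2] ?c)" using unital2D(2)[OF X U c' b] by blast
      also have "face X 2 [0, 2] ?c = face X m [i - 1, i] (bd X m p c)"
        using c n i False bf[of "[i - 1, i]"] by (simp add: F p1 skip_def)
      also have "face X 1 [0, 1, 1] \<dots> = face X m [i - 1, i, i] (bd X m p c)" using y i by (simp add: F)
      also have "\<dots> = face X n ?t (ap X n m ?s (bd X m p c))" using n i False p1 by (subst face_s[OF y]) auto
      finally show ?thesis by simp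
    qed
    then show ?thesis
      using ears_unique[OF E S p, of "ap X n m ?s (bd X m p c)" c] bd_s[OF y] simplicial_ap_in[OF X s y] c n by simp
  qed
  show "bij_betw (\<lambda>a. (act X 0 (n - 1) (\<lambda>j\<in>{..0}. i) a, act X n (n - 1) (sigma n i) a)) (simp X (n - 1))
      {(b, c). b \<in> simp X 0 \<and> c \<in> simp X n \<and> act X 1 0 (sigma 1 0) b = act X 1 n (\<lambda>j\<in>{..1}. i + j) c}"
    unfolding sg v ed sigma_1_0
  proof (rule bij_betw_byWitness[where f' = "\<lambda>(b, c). bd X m p c"])
    show "\<forall>a\<in>simp X (n - 1). (case (face X m [i] a, ap X n m ?s a) of (b, c) \<Rightarrow> bd X m p c) = a"
      using bd_s n by simp
    show "(\<lambda>a. (face X m [i] a, ap X n m ?s a)) ` simp X (n - 1) \<subseteq>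
        {(b, c). b \<in> simp X 0 \<and> c \<in> simp X n \<and> face X 0 [0, 0] b = face X n [i, Suc i] c}"
    proof clarify
      fix a assume "a \<in> simp X (n - 1)"
      then have a: "a \<in> simp X m" using n by simp
      show "face X m [i] a \<in> simp X 0 \<and> ap X n m ?s a \<in> simp X n \<and>
          face X 0 [0, 0] (face X m [i] a) = face X n [i, Suc i] (ap X n m ?s a)"
        using a i n simplicial_ap_in[OF X s a] simplicial_face_in[OF X _ _ _ a, of "[i]" 0]
          face_s[OF a, of "[i, Suc i]"]
        by (simp add: F)
    qed
    have in_n: "bd X m p c \<in> simp X m" if "c \<in> simp X n" for c
      using bd_in[OF S, of p m c] that p n by simp
    then show "(\<lambda>(b, c). bd X m p c) ` {(b, c). b \<in> simp X 0 \<and> c \<in> simp X n \<and> face X 0 [0, 0] b = face X n [i, Suc i] c}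
        \<subseteq> simp X (n - 1)" using n by auto
    show "\<forall>bc\<in>{(b, c). b \<in> simp X 0 \<and> c \<in> simp X n \<and> face X 0 [0, 0] b = face X n [i, Suc i] c}.
        (face X m [i] (case bc of (b, c) \<Rightarrow> bd X m p c), ap X n m ?s (case bc of (b, c) \<Rightarrow> bd X m p c)) = bc"
    proof clarify
      fix b c assume bc: "b \<in> simp X 0" "c \<in> simp X n" "face X 0 [0, 0] b = face X n [i, Suc i] c"
      note y = in_n[OF bc(2)] and sr = sur[OF bc(2,1,3)]
      have "face X m [i] (bd X m p c) = face X n [i] (ap X n m ?s (bd X m p c))"
        using i n by (subst face_s[OF y]) auto
      also have "\<dots> = face X 1 [0] (face X 0 [0, 0] b)" unfolding sr bc(3) using bc(2) i n by (simp add: F)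
      also have "\<dots> = b" using bc(1) face_all[OF S bc(1)] by (simp add: F)
      finally show "face X m [i] (bd X m p c) = b \<and> ap X n m ?s (bd X m p c) = c" using sr by simp
    qed
  qed
qed

section \<open>The \<open>\<mu>\<close>-category of a unital 2-Segal set\<close>

text \<open>The two sets are the apices of \<open>mu_unit_left\<close> and
  \<open>mu_unit_right\<close> written out in faces of \<open>X\<close>, as the record they belong
  to is only being built.\<close>

definition unit_data :: "'u simp_data \<Rightarrow> ('u, unit) mucat_ext" where
  "unit_data X = mucat.fields (\<lambda>x\<in>simp X 0. face X 0 [0, 0] x)
     (restrict fst {(f, m). f \<in> simp X 1 \<and> m \<in> simp X 2 \<and> face X 2 [0, 1] m = face X 0 [0, 0] (face X 1 [0] f) \<and> face X 2 [1, 2] m = f})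
     (restrict fst {(f, m). f \<in> simp X 1 \<and> m \<in> simp X 2 \<and> face X 2 [0, 1] m = f \<and> face X 2 [1, 2] m = face X 0 [0, 0] (face X 1 [1] f)})"

definition mucat_of :: "'u simp_data \<Rightarrow> 'u mucat" where
  "mucat_of X = mu_of X (unit_data X)"

lemma mucat_of_sets: "Ob0 (mucat_of X) = simp X 0" "Ar1 (mucat_of X) = simp X 1" "Mu (mucat_of X) = simp X 2"
  by (simp_all add: mucat_of_def)

lemma mucat_of_unit: "unit (mucat_of X) = (\<lambda>x\<in>simp X 0. face X 0 [0, 0] x)"
  by (simp add: mucat_of_def mu_of_def unit_data_def mucat.defs)

lemma mucat_of_lam:
  "lam (mucat_of X) = restrict fst {(f, m). f \<in> simp X 1 \<and> m \<in> simp X 2 \<and>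
     face X 2 [0, 1] m = face X 0 [0, 0] (face X 1 [0] f) \<and> face X 2 [1, 2] m = f}"
  "rho (mucat_of X) = restrict fst {(f, m). f \<in> simp X 1 \<and> m \<in> simp X 2 \<and>
     face X 2 [0, 1] m = f \<and> face X 2 [1, 2] m = face X 0 [0, 0] (face X 1 [1] f)}"
  by (simp_all add: mucat_of_def mu_of_def unit_data_def mucat.defs)

lemma mucat_of_mucat:
  assumes X: "is_simplicial_set X" and E: "ears X" and U: "unital2 X"
  shows "is_mucat (mucat_of X)"
    "f \<in> simp X 1 \<Longrightarrow> linv (mucat_of X) f = face X 1 [0, 0, 1] f"
    "f \<in> simp X 1 \<Longrightarrow> rinv (mucat_of X) f = face X 1 [0, 1, 1] f"
proof -
  note S = simplicial_semisimp[OF X] and F = simplicial_face_face[OF X] and I = simplicial_face_in[OF X]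
  let ?C = "mucat_of X"
  note simps = mu_of_simps[where X = X and r = "unit_data X", folded mucat_of_def]
  have M: "is_musemicat ?C" unfolding mucat_of_def by (rule mu_of_musemicat[OF S E])
  have id1: "face X 1 [0, 1] a = a" if "a \<in> simp X 1" for a
    using face_all[OF S that] by (simp add: upt_rec)
  have id2: "face X 2 [0, 1, 2] a = a" if "a \<in> simp X 2" for a
    using face_all[OF S that] by (simp add: upt_rec numeral_2_eq_2)
  have id0: "face X 0 [0] a = a" if "a \<in> simp X 0" for a
    using face_all[OF S that] by simp
  have u: "unit ?C x = face X 0 [0, 0] x" "face X 0 [0, 0] x \<in> simp X 1" if "x \<in> simp X 0" for x
    using that I[of "[0, 0]" 0 1 x] by (simp_all add: mucat_of_unit)
  have v: "face X 1 [i] f \<in> simp X 0" if "i \<le> 1" "f \<in> simp X 1" for i f using that by (intro I) auto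
  have e: "face X 2 [i, j] f \<in> simp X 1" if "i \<le> j" "j \<le> 2" "f \<in> simp X 2" for i j f using that by (intro I) auto
  have ul: "(f, m) \<in> apex (mu_unit_left ?C) \<longleftrightarrow> f \<in> simp X 1 \<and> m \<in> simp X 2 \<and>
      face X 2 [0, 1] m = face X 0 [0, 0] (face X 1 [0] f) \<and> face X 2 [1, 2] m = f" for f m
    using u(1)[OF v[of 0 f]] by (auto simp: mem_unit_left simps)
  have ur: "(f, m) \<in> apex (mu_unit_right ?C) \<longleftrightarrow> f \<in> simp X 1 \<and> m \<in> simp X 2 \<and>
      face X 2 [0, 1] m = f \<and> face X 2 [1, 2] m = face X 0 [0, 0] (face X 1 [1] f)" for f m
    using u(1)[OF v[of 1 f]] by (auto simp: mem_unit_right simps)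
  let ?l = "face X 1 [0, 0, 1]" and ?r = "face X 1 [0, 1, 1]"
  have lr: "?l f \<in> simp X 2" "?r f \<in> simp X 2" if "f \<in> simp X 1" for f using that by (auto intro!: I)
  have l1: "(f, ?l f) \<in> apex (mu_unit_left ?C)" and r1: "(f, ?r f) \<in> apex (mu_unit_right ?C)" if "f \<in> simp X 1" for f
    unfolding ul ur using that lr[OF that] id1[OF that] by (simp_all add: F)
  have l2: "e3 ?C (?l f) = f" and r2: "e3 ?C (?r f) = f" if "f \<in> simp X 1" for f
    using that lr[OF that] id1[OF that] by (simp_all add: F simps)
  have l3: "m = ?l f" if "(f, m) \<in> apex (mu_unit_left ?C)" for f m
    using that unital2D(1)[OF X U, of m "face X 1 [0] f"] v[of 0 f] unfolding ul by auto
  have r3: "m = ?r f" if "(f, m) \<in> apex (mu_unit_right ?C)" for f m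
    using that unital2D(2)[OF X U, of m "face X 1 [1] f"] v[of 1 f] unfolding ur by auto
  show C: "is_mucat ?C"
  proof (rule mucatI[OF M _ _ _ l1 l2 l3 r1 r2 r3])
    show "unit ?C \<in> Ob0 ?C \<rightarrow>\<^sub>E Ar1 ?C" using u by (auto simp: simps mucat_of_unit)
    show "src ?C (unit ?C x) = x" "tgt ?C (unit ?C x) = x" if "x \<in> Ob0 ?C" for x
      using u[of x] id0[of x] that by (simp_all add: simps F)
    show "lam ?C = restrict fst (apex (mu_unit_left ?C))"
      unfolding mucat_of_lam by (rule arg_cong[of _ _ "restrict fst"]) (auto simp: ul)
    show "rho ?C = restrict fst (apex (mu_unit_right ?C))"
      unfolding mucat_of_lam by (rule arg_cong[of _ _ "restrict fst"]) (auto simp: ur)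
    fix b assume "b \<in> Mu ?C"
    then have b: "b \<in> simp X 2" by (simp add: simps)
    have "tetra X (?r (face X 2 [0, 1] b)) b (?l (face X 2 [1, 2] b)) b"
      unfolding tetra_def
      \<comment> \<open>The unit triangle is witnessed by the degenerate 3-simplex over
        \<open>b\<close> that repeats its middle vertex.\<close>
      by (rule bexI[of _ "face X 2 [0, 1, 1, 2] b"]) (use b id2[OF b] I[of "[0, 1, 1, 2]" 2 3 b] in \<open>simp_all add: F\<close>)
    then show "tet ?C (?r (e1 ?C b)) b (?l (e2 ?C b)) b"
      using b unfolding mucat_of_def tet_mu_of[OF S E] by simp
  qed (simp_all add: simps)
  show "linv ?C f = ?l f" if "f \<in> simp X 1"
    using l1[OF that] by (intro linv_unique[OF C]) (auto simp: mem_unit_left)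
  show "rinv ?C f = ?r f" if "f \<in> simp X 1"
    using r1[OF that] by (intro rinv_unique[OF C]) (auto simp: mem_unit_right)
qed

section \<open>The nerve of a \<open>\<mu>\<close>-category\<close>

definition edge2 :: "'u mucat \<Rightarrow> (nat list \<Rightarrow> 'u) \<Rightarrow> nat \<Rightarrow> nat \<Rightarrow> 'u" where
  "edge2 C d i j = (if i = j then unit C (d [i]) else d [i, j])"

text \<open>The degeneracies of the nerve, inserted as units, \<open>linv\<close> and
  \<open>rinv\<close>. On a list \<open>[i, i, i]\<close> the first alternative wins;
  \<open>weak_rinv\<close> shows that the second would give the same.\<close>

definition weak :: "'u mucat \<Rightarrow> (nat list \<Rightarrow> 'u) \<Rightarrow> nat list \<Rightarrow> 'u" where
  "weak C d l = (case l of [i, j] \<Rightarrow> edge2 C d i j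
     | [i, j, k] \<Rightarrow> if i = j then linv C (edge2 C d j k) else if j = k then rinv C (edge2 C d i j) else d l
     | _ \<Rightarrow> d l)"

lemma weak_simps [simp]:
  "weak C d [i] = d [i]" "weak C d [i, j] = edge2 C d i j"
  "weak C d [i, j, k] = (if i = j then linv C (edge2 C d j k) else if j = k then rinv C (edge2 C d i j) else d [i, j, k])"
  "edge2 C d i i = unit C (d [i])" "i \<noteq> j \<Longrightarrow> edge2 C d i j = d [i, j]"
  by (simp_all add: weak_def edge2_def)

lemma weak_chains: "l \<in> chains n \<Longrightarrow> weak C d l = d l"
  by (erule chains_cases) auto

lemma weak_edge:
  assumes C: "is_mucat C" and d: "d \<in> cosk C n" and ij: "i \<le> j" "j \<le> n"
  shows "edge2 C d i j \<in> Ar1 C" "tgt C (edge2 C d i j) = d [i]" "src C (edge2 C d i j) = d [j]"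
proof -
  note D = coskD[OF d]
  have "edge2 C d i j \<in> Ar1 C \<and> tgt C (edge2 C d i j) = d [i] \<and> src C (edge2 C d i j) = d [j]"
    using D(2)[of j] D(3-5)[of i j] mucat_unit[OF C, of "d [j]"] ij by (cases "i = j") auto
  then show "edge2 C d i j \<in> Ar1 C" "tgt C (edge2 C d i j) = d [i]" "src C (edge2 C d i j) = d [j]" by auto
qed

lemma weak_rinv:
  assumes C: "is_mucat C" and d: "d \<in> cosk C n" and ij: "i \<le> j" "j \<le> n"
  shows "weak C d [i, j, j] = rinv C (edge2 C d i j)"
  using rinv_unit[OF C coskD(2)[OF d]] ij by simp

lemma weak_triangle:
  assumes C: "is_mucat C" and d: "d \<in> cosk C n" and ijk: "i \<le> j" "j \<le> k" "k \<le> n"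
  shows "weak C d [i, j, k] \<in> Mu C \<and> e1 C (weak C d [i, j, k]) = edge2 C d i j \<and>
    e2 C (weak C d [i, j, k]) = edge2 C d j k \<and> e3 C (weak C d [i, j, k]) = edge2 C d i k"
proof -
  consider "i = j" | "i \<noteq> j" "j = k" | "i < j" "j < k" using ijk by linarith
  then show ?thesis
  proof cases
    case 1
    then show ?thesis using weak_edge[OF C d ijk(2,3)] linv[OF C weak_edge(1)[OF C d ijk(2,3)]] by simp
  next
    case 2
    then show ?thesis using weak_edge[OF C d ijk(1), of] rinv[OF C weak_edge(1)[OF C d ijk(1)]] ijk by simp
  next
    case 3
    then show ?thesis using coskD(6-9)[OF d 3 ijk(3)] by simp
  qed
qed

text \<open>The three places where consecutive vertices can coincide correspond to the tetrahedra
  0012, 0112 and 0122, that is, to Kelly's two coherences and the unit axiom. Further coincidences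
  are absorbed by allowing \<open>edge2\<close> to be a unit.\<close>

lemma weak_tet:
  assumes C: "is_mucat C" and d: "d \<in> cosk C n" and ijkl: "i \<le> j" "j \<le> k" "k \<le> l" "l \<le> n"
  shows "tet C (weak C d [i, j, k]) (weak C d [i, k, l]) (weak C d [j, k, l]) (weak C d [i, j, l])"
proof -
  note W = weak_triangle[OF C d] and R = weak_rinv[OF C d]
  consider "i = j" | "j = k" | "k = l" | "i < j" "j < k" "k < l" using ijkl by linarith
  then show ?thesis
  proof cases
    case 1
    have w: "weak C d [j, k, l] \<in> Mu C" "e1 C (weak C d [j, k, l]) = edge2 C d j k" "e3 C (weak C d [j, k, l]) = edge2 C d j l"
      using W[of j k l] ijkl by auto
    show ?thesis using tet_linv[OF C w(1)] unfolding w(2,3) unfolding 1 by (simp del: weak_simps(4,5))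
  next
    case 2
    have w: "weak C d [i, k, l] \<in> Mu C" "e1 C (weak C d [i, k, l]) = edge2 C d i k" "e2 C (weak C d [i, k, l]) = edge2 C d k l"
      using W[of i k l] ijkl by auto
    have "weak C d [k, k, l] = linv C (edge2 C d k l)" by simp
    then show ?thesis using tet_triangle[OF C w(1)] R[of i k] ijkl unfolding w(2,3) unfolding 2 by simp
  next
    case 3
    have w: "weak C d [i, j, l] \<in> Mu C" "e2 C (weak C d [i, j, l]) = edge2 C d j l" "e3 C (weak C d [i, j, l]) = edge2 C d i l"
      using W[of i j l] ijkl by auto
    show ?thesis using tet_rinv[OF C w(1)] R[of i l] R[of j l] ijkl unfolding w(2,3) unfolding 3 by simp
  next
    case 4
    then show ?thesis using coskD(10)[OF d 4 ijkl(4)] by simp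
  qed
qed

lemma extender_weak:
  assumes C: "is_mucat C"
  shows "extender Delta C (weak C)"
  unfolding extender_def
proof (intro conjI allI ballI)
  show "weak C d l = d l" if "l \<in> chains n" for n d l using weak_chains[OF that] .
next
  fix m n \<theta> d assume t: "\<theta> \<in> Delta m n" and d: "d \<in> cosk C n"
  have \<theta>: "\<And>i. i \<le> m \<Longrightarrow> \<theta> i \<le> n" "\<And>i j. i \<le> j \<Longrightarrow> j \<le> m \<Longrightarrow> \<theta> i \<le> \<theta> j"
    using Delta_wmap[OF t] by (auto simp: wmap_def)
  let ?R = "\<lambda>l\<in>chains m. weak C d (map \<theta> l)"
  show "?R \<in> cosk C m"
  proof (rule coskI)
    show "?R [i] \<in> Ob0 C" if "i \<le> m" for i using that \<theta> coskD(2)[OF d] by simp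
    show "?R [i, j] \<in> Ar1 C \<and>
       tgt C (?R [i, j]) = ?R [i] \<and>
       src C (?R [i, j]) = ?R [j]"
      if "i < j" "j \<le> m" for i j using that \<theta> weak_edge[OF C d, of "\<theta> i" "\<theta> j"] by simp
    show "?R [i, j, k] \<in> Mu C \<and>
       e1 C (?R [i, j, k]) = ?R [i, j] \<and>
       e2 C (?R [i, j, k]) = ?R [j, k] \<and>
       e3 C (?R [i, j, k]) = ?R [i, k]"
      if "i < j" "j < k" "k \<le> m" for i j k
      using that \<theta> weak_triangle[OF C d, of "\<theta> i" "\<theta> j" "\<theta> k"] by (simp del: weak_simps(3-5))
    show "tet C (?R [i, j, k]) (?R [i, k, l])
       (?R [j, k, l]) (?R [i, j, l])"
      if "i < j" "j < k" "k < l" "l \<le> m" for i j k l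
      using that \<theta> weak_tet[OF C d, of "\<theta> i" "\<theta> j" "\<theta> k" "\<theta> l"] by (simp del: weak_simps(3-5))
  qed simp
next
  fix l m n \<theta> \<psi> d k assume t: "\<theta> \<in> Delta l m" "\<psi> \<in> Delta m n" and d: "d \<in> cosk C n" and k: "k \<in> chains l"
  let ?D = "\<lambda>j\<in>chains m. weak C d (map \<psi> j)"
  have \<theta>: "\<And>i. i \<le> l \<Longrightarrow> \<theta> i \<le> m" "\<And>i j. i < j \<Longrightarrow> j \<le> l \<Longrightarrow> \<theta> i \<le> \<theta> j"
    using Delta_wmap[OF t(1)] by (auto simp: wmap_def)
  have \<psi>: "\<And>i. i \<le> m \<Longrightarrow> \<psi> i \<le> n" "\<And>i j. i \<le> j \<Longrightarrow> j \<le> m \<Longrightarrow> \<psi> i \<le> \<psi> j"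
    using Delta_wmap[OF t(2)] by (auto simp: wmap_def)
  have e: "edge2 C ?D a b = edge2 C d (\<psi> a) (\<psi> b)" if "a \<le> b" "b \<le> m" for a b
    using that by (cases "a = b") auto
  show "weak C ?D (map \<theta> k) = weak C d (map \<psi> (map \<theta> k))"
    using k
  proof (cases rule: chains_cases)
    case (1 i) then show ?thesis using \<theta> by simp
  next
    case (2 i j) then show ?thesis using \<theta> e by simp
  next
    case (3 i j k')
    let ?a = "\<theta> i" and ?b = "\<theta> j" and ?c = "\<theta> k'"
    have abc: "?a \<le> ?b" "?b \<le> ?c" "?c \<le> m" using 3 \<theta> by auto
    consider "?a = ?b" | "?a < ?b" "?b = ?c" | "?a < ?b" "?b < ?c" using abc by linarith
    then show ?thesis
    proof cases
      case 1 then show ?thesis using 3(1) abc e[of ?b ?c] by simp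
    next
      \<comment> \<open>If \<open>\<psi>\<close> also identifies \<open>?a\<close> and
        \<open>?c\<close>, the right-hand side is computed by \<open>linv\<close> and the left by
        \<open>rinv\<close> of a unit; \<open>weak_rinv\<close> reconciles them.\<close>
      case 2
      then show ?thesis using 3(1) abc e[of ?a ?c] \<psi> weak_rinv[OF C d, of "\<psi> ?a" "\<psi> ?c"] by (simp del: weak_simps(5))
    next
      case 3
      then show ?thesis using \<open>k = [i, j, k']\<close> abc by simp
    qed
  qed
qed

abbreviation unerve :: "'u mucat \<Rightarrow> 'u simp_data" where
  "unerve C \<equiv> nerve Delta (weak C) C"

lemma face_unerve:
  fixes C :: "'u mucat"
  assumes inf: "infinite (UNIV :: 'u set)" and d: "d \<in> cosk C n" and l: "sorted l" "\<forall>i\<in>set l. i \<le> n" "length l = Suc p"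
  shows "face (unerve C) n l (enc n d) = enc p (\<lambda>k\<in>chains p. weak C d (map (nth l) k))"
proof -
  have t: "restrict (nth l) {..p} \<in> Delta p n" unfolding restrict_in_Delta by (rule wmap_nth[OF l])
  have "map (restrict (nth l) {..p}) k = map (nth l) k" if "k \<in> chains p" for k
    using that by (auto simp: chains_def incr_def)
  then have "(\<lambda>k\<in>chains p. weak C d (map (restrict (nth l) {..p}) k)) = (\<lambda>k\<in>chains p. weak C d (map (nth l) k))"
    by (intro restrict_ext) (simp only:)
  then show ?thesis using act_nerve[where \<Theta> = Delta, OF inf t d, of "weak C"] l(3) by (simp add: face_def ap_def)
qed

lemma unerve_unital2:
  fixes C :: "'u mucat"
  assumes inf: "infinite (UNIV :: 'u set)" and C: "is_mucat C"
  shows "unital2 (unerve C)"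
  unfolding unital2_def
proof (intro ballI conjI impI)
  fix c b assume "c \<in> simp (unerve C) 2" "b \<in> simp (unerve C) 0"
  then obtain d d0 where d: "c = enc 2 d" "d \<in> cosk C 2" and d0: "b = enc 0 d0" "d0 \<in> cosk C 0" by auto
  note F = face_unerve[OF inf] and S = mucat_musemicat[OF C] and W = extender_weak[OF C]
  note P = nerve_presheaf[OF inf site_Delta W]
  note p = musemicat_premu[OF S] and M = coskD(6-9)[OF d(2), of 0 1 2]
  have de: "dec p (enc p (\<lambda>k\<in>chains p. f k :: 'u)) = (\<lambda>k\<in>chains p. f k)" for p f by (rule dec_enc[OF inf]) simp
  \<comment> \<open>The edge to be degenerated is an edge \<open>i, j\<close> of \<open>d\<close>
    itself: 12 when the edge 01 is a unit, and 01 when the edge 12 is. A 2-simplex of the nerve is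
    then compared through its triangle only.\<close>
  have key: "\<exists>a\<in>simp (unerve C) 1. c = face (unerve C) 1 l a"
    if l: "sorted l" "\<forall>i\<in>set l. i \<le> 1" "length l = 3" and lk: "i < j" "j \<le> 2" and eq: "weak C (\<lambda>k\<in>chains 1. d (map (nth [i, j]) k)) l = d [0, 1, 2]" for l i j
  proof -
    let ?a = "\<lambda>k\<in>chains 1. d (map (nth [i, j]) k)"
    have a: "?a \<in> cosk C 1" by (rule cosk_reindex[OF d(2) smap_nth]) (use lk in auto)
    have t: "restrict (nth l) {..2} \<in> Delta 2 1" unfolding restrict_in_Delta by (rule wmap_nth[OF l(1,2)]) (simp add: l(3))
    have m: "map (restrict (nth l) {..2}) [0, 1, 2] = l" using l(3) by (cases l; simp; rename_tac x l'; case_tac l'; simp; rename_tac y l''; case_tac l''; simp)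
    have "face (unerve C) 1 l (enc 1 ?a) = enc 2 (\<lambda>k\<in>chains 2. weak C ?a (map (nth l) k))"
      by (rule F[OF a l(1,2)]) (simp add: l(3))
    moreover have "(\<lambda>k\<in>chains 2. weak C ?a (map (nth l) k)) = d"
    proof (rule cosk2_eqI[OF p _ d(2)])
      have "(\<lambda>k\<in>chains 2. weak C ?a (map (nth l) k)) = (\<lambda>k\<in>chains 2. weak C ?a (map (restrict (nth l) {..2}) k))"
        by (intro restrict_ext arg_cong[of _ _ "weak C ?a"]) (auto simp: chains_def incr_def)
      then show "(\<lambda>k\<in>chains 2. weak C ?a (map (nth l) k)) \<in> cosk C 2"
        using W t a unfolding extender_def by metis
      show "(\<lambda>k\<in>chains 2. weak C ?a (map (nth l) k)) [0, 1, 2] = d [0, 1, 2]" using eq m by simp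
    qed
    ultimately have "c = face (unerve C) 1 l (enc 1 ?a)" using d(1) by simp
    moreover have "enc 1 ?a \<in> simp (unerve C) 1" using a by simp
    ultimately show ?thesis by blast
  qed
  have u: "dec 1 (face (unerve C) 0 [0, 0] b) [0, 1] = unit C (d0 [0])"
    using F[OF d0(2), of "[0, 0]" 1] de[of 1] by (simp add: d0(1) del: One_nat_def)
  note U = mucat_unit[OF C coskD(2)[OF d0(2), of 0]]
  show "\<exists>a\<in>simp (unerve C) 1. c = face (unerve C) 1 [0, 0, 1] a" if m: "face (unerve C) 2 [0, 1] c = face (unerve C) 0 [0, 0] b"
  proof (rule key[of _ 1 2])
    have "dec 1 (face (unerve C) 2 [0, 1] c) [0, 1] = d [0, 1]"
      using F[OF d(2), of "[0, 1]" 1] de[of 1] by (simp add: d(1) del: One_nat_def)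
    then have "e1 C (d [0, 1, 2]) = unit C (d0 [0])" using u m M by simp
    then have "linv C (d [1, 2]) = d [0, 1, 2]"
      using M U premu_mu(4)[OF p M(1)] by (intro linv_unique[OF C]) auto
    then show "weak C (\<lambda>k\<in>chains 1. d (map (nth [1, 2]) k)) [0, 0, 1] = d [0, 1, 2]" by simp
  qed auto
  show "\<exists>a\<in>simp (unerve C) 1. c = face (unerve C) 1 [0, 1, 1] a" if m: "face (unerve C) 2 [1, 2] c = face (unerve C) 0 [0, 0] b"
  proof (rule key[of _ 0 1])
    have "dec 1 (face (unerve C) 2 [1, 2] c) [0, 1] = d [1, 2]"
      using F[OF d(2), of "[1, 2]" 1] de[of 1] by (simp add: d(1) del: One_nat_def)
    then have "e2 C (d [0, 1, 2]) = unit C (d0 [0])" using u m M by simp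
    then have "rinv C (d [0, 1]) = d [0, 1, 2]"
      using M U premu_mu(4)[OF p M(1)] by (intro rinv_unique[OF C]) auto
    then show "weak C (\<lambda>k\<in>chains 1. d (map (nth [0, 1]) k)) [0, 1, 1] = d [0, 1, 2]" by simp
  qed auto
qed

section \<open>Degenerate triangles under functors and in skeleta\<close>

lemma mufunctor_linv:
  assumes C: "is_mucat C" and D: "is_mucat D" and F: "F \<in> mufunctors C D" and f: "f \<in> Ar1 C"
  shows "linv D (F1 F f) = mu_action C F (linv C f)" "rinv D (F1 F f) = mu_action C F (rinv C f)"
proof -
  have F': "F \<in> semifunctors C D" "\<forall>x\<in>Ob0 C. F1 F (unit C x) = unit D (F0 F x)" using F mufunctors_iff[OF C D] by auto
  note s = semifunctorD(2)[OF mucat_musemicat[OF C] mucat_musemicat[OF D] F'(1)]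
  note L = linv[OF C f] and R = rinv[OF C f] and o = premu_ar[OF musemicat_premu[OF mucat_musemicat[OF C]] f]
  show "linv D (F1 F f) = mu_action C F (linv C f)"
    using s L o F'(2) f by (intro linv_unique[OF D]) (auto simp: sfun_def)
  show "rinv D (F1 F f) = mu_action C F (rinv C f)"
    using s R o F'(2) f by (intro rinv_unique[OF D]) (auto simp: sfun_def)
qed

lemma weak_on_data:
  assumes C: "is_mucat C" and D: "is_mucat D" and F: "F \<in> mufunctors C D" and t: "\<theta> \<in> Delta m n"
    and d: "d \<in> cosk C n" and l: "l \<in> chains m"
  shows "weak D (\<lambda>l\<in>chains n. on_data (F0 F) (F1 F) (mu_action C F) l (d l)) (map \<theta> l) =
      on_data (F0 F) (F1 F) (mu_action C F) l (weak C d (map \<theta> l))"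
proof -
  let ?D = "\<lambda>l\<in>chains n. on_data (F0 F) (F1 F) (mu_action C F) l (d l)"
  have u: "F1 F (unit C x) = unit D (F0 F x)" if "x \<in> Ob0 C" for x using F that mufunctors_iff[OF C D] by auto
  have \<theta>: "\<And>i. i \<le> m \<Longrightarrow> \<theta> i \<le> n" "\<And>i j. i < j \<Longrightarrow> j \<le> m \<Longrightarrow> \<theta> i \<le> \<theta> j"
    using Delta_wmap[OF t] by (auto simp: wmap_def)
  have e: "edge2 D ?D a b = F1 F (edge2 C d a b)" if "a \<le> b" "b \<le> n" for a b
    using that u[OF coskD(2)[OF d, of a]] by (cases "a = b") auto
  note LR = mufunctor_linv[OF C D F weak_edge(1)[OF C d]]
  show ?thesis
    using l
  proof (cases rule: chains_cases)
    case (1 i) then show ?thesis using \<theta> by simp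
  next
    case (2 i j) then show ?thesis using \<theta> e by simp
  next
    case (3 i j k)
    let ?a = "\<theta> i" and ?b = "\<theta> j" and ?c = "\<theta> k"
    have abc: "?a \<le> ?b" "?b \<le> ?c" "?c \<le> n" using 3 \<theta> by auto
    consider "?a = ?b" | "?a < ?b" "?b = ?c" | "?a < ?b" "?b < ?c" using abc by linarith
    then show ?thesis
    proof cases
      case 1 then show ?thesis using 3(1) abc e[of ?b ?c] LR[of ?b ?c] by simp
    next
      case 2 then show ?thesis using 3(1) abc e[of ?a ?c] LR[of ?a ?c] by (simp del: weak_simps(5))
    next
      case 3 then show ?thesis using \<open>l = [i, j, k]\<close> abc by simp
    qed
  qed
qed

text \<open>In \<open>mucat_of X\<close> the triangles \<open>linv\<close> and \<open>rinv\<close>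
  are the degenerate simplices 001 and 011, so the degeneracies that \<open>weak\<close> inserts are
  those of \<open>X\<close>.\<close>

lemma weak_skeleton:
  assumes X: "is_simplicial_set X" and E: "ears X" and U: "unital2 X" and t: "\<theta> \<in> Delta m n"
    and x: "x \<in> simp X n" and l: "l \<in> chains m"
  shows "face X m l (act X m n \<theta> x) = weak (mucat_of X) (skeleton X n x) (map \<theta> l)"
proof -
  note F = simplicial_face_face[OF X _ _ _ _ _ _ x] and I = simplicial_face_in[OF X _ _ _ x]
  note LR = mucat_of_mucat(2,3)[OF X E U]
  have \<theta>: "\<And>i. i \<le> m \<Longrightarrow> \<theta> i \<le> n" "\<And>i j. i < j \<Longrightarrow> j \<le> m \<Longrightarrow> \<theta> i \<le> \<theta> j"
    using Delta_wmap[OF t] by (auto simp: wmap_def)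
  have act: "act X m n \<theta> x = ap X m n \<theta> x" by (simp add: ap_def Delta_restrict[OF t])
  have "face X m l (act X m n \<theta> x) = face X n (map \<theta> l) x"
    unfolding act using l
    by (intro simplicial_face_ap[OF X Delta_wmap[OF t] _ _ _ x]) (auto simp: chains_def incr_def strict_sorted_imp_sorted)
  also have "\<dots> = weak (mucat_of X) (skeleton X n x) (map \<theta> l)"
  proof -
    have e: "edge2 (mucat_of X) (skeleton X n x) a b = face X n [a, b] x" if "a \<le> b" "b \<le> n" for a b
      using that I[of "[a]" 0] F[of "[a]" 0 "[0, 0]"]
      by (cases "a = b") (auto simp: skeleton_def mucat_of_unit)
    have ein: "face X n [a, b] x \<in> simp X 1" if "a \<le> b" "b \<le> n" for a b using that by (intro I) auto
    show ?thesis
      using l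
    proof (cases rule: chains_cases)
      case (1 i) then show ?thesis using \<theta> by (simp add: skeleton_def)
    next
      case (2 i j) then show ?thesis using \<theta> e by simp
    next
      case (3 i j k)
      let ?a = "\<theta> i" and ?b = "\<theta> j" and ?c = "\<theta> k"
      have abc: "?a \<le> ?b" "?b \<le> ?c" "?c \<le> n" using 3 \<theta> by auto
      consider "?a = ?b" | "?a < ?b" "?b = ?c" | "?a < ?b" "?b < ?c" using abc by linarith
      then show ?thesis
      proof cases
        case 1 then show ?thesis using 3(1) abc e[of ?b ?c] ein[of ?b ?c] F[of "[?b, ?c]" 1 "[0, 0, 1]"] LR(1) by simp
      next
        case 2 then show ?thesis using 3(1) abc e[of ?a ?c] ein[of ?a ?c] F[of "[?a, ?c]" 1 "[0, 1, 1]"] LR(2)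
          by (simp del: weak_simps(5))
      next
        case 3 then show ?thesis using \<open>l = [i, j, k]\<close> abc by (simp add: skeleton_def)
      qed
    qed
  qed
  finally show ?thesis .
qed

section \<open>The equivalence for \<open>\<mu>\<close>-categories\<close>

lemma muCat_simps [simp]: "Ob muCat = {C. is_mucat C}" "Hom muCat = mufunctors" "Idm muCat = mufun_id"
  "Cmp muCat X Y Z = mufun_comp X"
  by (simp_all add: muCat_def)

lemma mufunctor_semifunctor: "F \<in> mufunctors C D \<Longrightarrow> F \<in> semifunctors C D"
  by (simp add: mufunctors_def)

lemma mufunctor_id: "is_mucat C \<Longrightarrow> mufun_id C \<in> mufunctors C C"
  by (simp add: mufunctors_iff semifunctor_id[OF mucat_musemicat]) (simp add: mufun_id_def mucat_unit(1))

lemma mufunctor_comp: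
  assumes C: "is_mucat C" and D: "is_mucat D" and E: "is_mucat E" and F: "F \<in> mufunctors C D" and G: "G \<in> mufunctors D E"
  shows "mufun_comp C G F \<in> mufunctors C E"
  unfolding mufunctors_iff[OF C E]
proof
  show "mufun_comp C G F \<in> semifunctors C E"
    using assms by (intro semifunctor_comp[of C D E]) (auto simp: mucat_musemicat mufunctor_semifunctor)
  have "F0 F x \<in> Ob0 D" if "x \<in> Ob0 C" for x using mufunctor_semifunctor[OF F] that by (auto simp: semifunctors_def)
  then show "\<forall>x\<in>Ob0 C. F1 (mufun_comp C G F) (unit C x) = unit E (F0 (mufun_comp C G F) x)"
    using F G mucat_unit(1)[OF C] unfolding mufunctors_iff[OF C D] mufunctors_iff[OF D E]
    by (simp add: mufun_comp_def compose_def)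
qed

lemma muCat_category: "is_category muCat"
  unfolding is_category_def muCat_simps
  by (auto intro: mufunctor_id mufunctor_comp mufun_comp_id mufun_comp_assoc mucat_musemicat mufunctor_semifunctor)

text \<open>Preservation of units passes to the inverse: a unit of \<open>D\<close> is the image
  under \<open>F\<close> of the unit at the corresponding object of \<open>C\<close>, and
  \<open>H\<close> undoes \<open>F\<close>.\<close>

lemma mufunctor_inverse:
  assumes C: "is_mucat C" and D: "is_mucat D" and F: "F \<in> mufunctors C D" and H: "H \<in> semifunctors D C"
    and HF: "mufun_comp C H F = mufun_id C" and FH: "mufun_comp D F H = mufun_id D"
  shows "H \<in> mufunctors D C"
  unfolding mufunctors_iff[OF D C]
proof (intro conjI H ballI)
  fix x assume x: "x \<in> Ob0 D"
  have hx: "F0 H x \<in> Ob0 C" using H x by (auto simp: semifunctors_def)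
  have "F0 F (F0 H x) = x" using arg_cong[OF FH, of F0] x by (auto simp: mufun_comp_def mufun_id_def compose_def fun_eq_iff split: if_splits)
  then have "unit D x = F1 F (unit C (F0 H x))" using F hx by (auto simp: mufunctors_iff[OF C D])
  moreover have "F1 H (F1 F (unit C (F0 H x))) = unit C (F0 H x)"
    using fun_cong[OF arg_cong[OF HF, of F1], of "unit C (F0 H x)"] mucat_unit(1)[OF C hx]
    by (simp add: mufun_comp_def mufun_id_def compose_def)
  ultimately show "F1 H (unit D x) = unit C (F0 H x)" by simp
qed

theorem category_equivalence:
  assumes inf: "infinite (UNIV :: 'u set)"
  shows "equivalent_categories (unital_two_Segal_simplicial_sets :: ('u simp_data, nat \<Rightarrow> 'u \<Rightarrow> 'u) cat)
    (muCat :: ('u mucat, 'u mufun) cat)"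
proof -
  let ?S = "unital_two_Segal_simplicial_sets :: ('u simp_data, nat \<Rightarrow> 'u \<Rightarrow> 'u) cat"
  let ?M = "muCat :: ('u mucat, 'u mufun) cat"
  let ?N = "unerve :: 'u mucat \<Rightarrow> 'u simp_data"
  let ?F = "mucat_of :: 'u simp_data \<Rightarrow> 'u mucat"
  let ?Fm = "\<lambda>(X :: 'u simp_data) (Y :: 'u simp_data) f. mkfun (?F X) (f 0) (f 1) (f 2)"
  let ?Gm = "\<lambda>(C :: 'u mucat) (D :: 'u mucat). nerve_map C"
  have O: "X \<in> Ob ?S \<longleftrightarrow> is_simplicial_set X \<and> is_2_Segal X \<and> is_unital X" for X
    by (simp add: unital_two_Segal_simplicial_sets_def)
  have Hom: "Hom ?S = presheaf_hom Delta" and Idm: "\<And>X. Idm ?S X = (\<lambda>n. \<lambda>x\<in>simp X n. x)"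
    and Cmp: "\<And>X Y Z g f. Cmp ?S X Y Z g f = (\<lambda>n. compose (simp X n) (g n) (f n))"
    by (simp_all add: unital_two_Segal_simplicial_sets_def)
  have X: "semisimp X" "ears X" "is_simplicial_set X" "unital2 X" if "X \<in> Ob ?S" for X
    using that simplicial_semisimp[of X] two_Segal_imp_ears[of X] unital_imp_unital2[of X] by (simp_all add: O)
  have FX: "is_mucat (?F X)" if "X \<in> Ob ?S" for X by (rule mucat_of_mucat(1)[OF X(3,2,4)[OF that]])
  note site = site_Delta and ms = mucat_musemicat
  have nm: "natural_map X Y f" if "f \<in> Hom ?S X Y" for X Y f
    using that presheaf_hom_natural[of f Delta X Y] site_inj[OF site] by (simp add: Hom)
  note ext = extender_weak
  have GX: "?N C \<in> Ob ?S" if C: "is_mucat C" for C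
    unfolding O using nerve_presheaf[OF inf site ext[OF C]] nerve_2_Segal[OF inf site ext[OF C] ms[OF C]]
      unital2_imp_unital[OF _ nerve_ears[OF inf site ext[OF C] ms[OF C]] unerve_unital2[OF inf C]] by simp
  have Gh: "nerve_map C F \<in> presheaf_hom Delta (?N C) (?N D)"
    if "is_mucat C" "is_mucat D" "F \<in> mufunctors C D" for C D F
    by (rule nerve_map_hom[OF inf ext[OF that(1)] ext[OF that(2)] ms[OF that(1)] ms[OF that(2)] mufunctor_semifunctor[OF that(3)]])
      (rule weak_on_data[OF that])
  have cat: "is_category ?S"
    unfolding unital_two_Segal_simplicial_sets_def by (rule presheaf_category) simp
  \<comment> \<open>The unit of the structure read off from the nerve is the degenerate edge
    \<open>[0, 0]\<close>, to which \<open>weak\<close> has assigned the unit of \<open>C\<close>;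
    decoding returns it.\<close>
  have cu: "counit (?F (?N C)) \<in> mufunctors (?F (?N C)) C" if C: "is_mucat C" for C
  proof -
    note FG = FX[OF GX[OF C]]
    have "F1 (counit (?F (?N C))) (unit (?F (?N C)) x) = unit C (F0 (counit (?F (?N C))) x)" if xO: "x \<in> Ob0 (?F (?N C))" for x
    proof -
      obtain d where d: "x = enc 0 d" "d \<in> cosk C 0" using xO by (auto simp: mucat_of_def)
      have x: "x \<in> simp (?N C) 0" using d by simp
      have "dec 1 (face (?N C) 0 [0, 0] x) [0, 1] = unit C (d [0])"
        unfolding d(1) using face_unerve[OF inf d(2), of "[0, 0]" 1] by (simp add: dec_enc[OF inf] del: One_nat_def)
      moreover have "face (?N C) 0 [0, 0] x \<in> simp (?N C) 1"
        using simplicial_face_in[OF X(3)[OF GX[OF C]] _ _ _ x, of "[0, 0]" 1] by simp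
      ultimately show ?thesis
        using x d by (simp add: counit_def mucat_of_unit dec_enc_cosk[OF inf]) (simp add: mucat_of_def dec_enc_cosk[OF inf])
    qed
    then show ?thesis
      unfolding mufunctors_iff[OF FG C] unfolding counit_def mucat_of_def
      using mkfun_semifunctor[OF ms[OF FG] ms[OF C], unfolded mucat_of_def, OF counit_sfun[OF inf site ext[OF C] ms[OF C]]] by simp
  qed
  show ?thesis
  proof (rule equivalent_categoriesI[of ?S ?M ?F ?Fm ?N ?Gm, OF cat muCat_category])
    show "is_functor ?S ?M ?F ?Fm"
      unfolding is_functor_def muCat_simps Idm Cmp
    proof (intro conjI ballI)
      show "?F X \<in> {C. is_mucat C}" if "X \<in> Ob ?S" for X using FX[OF that] by simp
      show "?Fm X Y f \<in> mufunctors (?F X) (?F Y)" if XY: "X \<in> Ob ?S" "Y \<in> Ob ?S" and f: "f \<in> Hom ?S X Y" for X Y f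
        unfolding mufunctors_iff[OF FX[OF XY(1)] FX[OF XY(2)]]
      proof (intro conjI ballI)
        show "?Fm X Y f \<in> semifunctors (?F X) (?F Y)"
          by (rule mkfun_semifunctor[OF ms[OF FX[OF XY(1)]] ms[OF FX[OF XY(2)]]], unfold mucat_of_def,
              rule sfun_mu_of[OF X(1,2)[OF XY(1)] X(1,2)[OF XY(2)] nm[OF f]])
        fix x assume "x \<in> Ob0 (?F X)"
        then have x: "x \<in> simp X 0" by (simp add: mucat_of_def)
        have "f 1 (face X 0 [0, 0] x) = face Y 0 [0, 0] (f 0 x)"
          using f by (intro simplicial_face_natural[OF _ _ _ _ x]) (auto simp: Hom)
        moreover have "face X 0 [0, 0] x \<in> simp X 1"
          using simplicial_face_in[OF X(3)[OF XY(1)] _ _ _ x, of "[0, 0]" 1] by simp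
        moreover have "f 0 x \<in> simp Y 0" using f x by (auto simp: Hom presheaf_homD)
        ultimately show "F1 (?Fm X Y f) (unit (?F X) x) = unit (?F Y) (F0 (?Fm X Y f) x)"
          using x by (simp add: mucat_of_unit) (simp add: mucat_of_def)
      qed
      show "?Fm X X (\<lambda>n. \<lambda>x\<in>simp X n. x) = mufun_id (?F X)" if "X \<in> Ob ?S" for X
        unfolding mucat_of_def by (rule mkfun_mu_of_id[OF X(1)[OF that]])
      show "?Fm X Z (\<lambda>n. compose (simp X n) (g n) (f n)) = mufun_comp (?F X) (?Fm Y Z g) (?Fm X Y f)"
        if "X \<in> Ob ?S" "Y \<in> Ob ?S" "f \<in> Hom ?S X Y" for X Y Z f g
        unfolding mucat_of_def by (rule mkfun_mu_of_comp[OF X(1,2)[OF that(1)] X(1,2)[OF that(2)] nm[OF that(3)]])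
    qed
    show "is_functor ?M ?S ?N ?Gm"
      unfolding is_functor_def muCat_simps Idm Cmp Hom
    proof (intro conjI ballI)
      show "?N C \<in> Ob ?S" if "C \<in> {C. is_mucat C}" for C using GX that by simp
      show "nerve_map C F \<in> presheaf_hom Delta (?N C) (?N D)"
        if "C \<in> {C. is_mucat C}" "D \<in> {C. is_mucat C}" "F \<in> mufunctors C D" for C D F using Gh that by simp
      show "nerve_map C (mufun_id C) = (\<lambda>n. \<lambda>x\<in>simp (?N C) n. x)" if "C \<in> {C. is_mucat C}" for C
        using nerve_map_id[OF inf ms] that by simp
      show "nerve_map C (mufun_comp C G F) = (\<lambda>n. compose (simp (?N C) n) (nerve_map D G n) (nerve_map C F n))"
        if "C \<in> {C. is_mucat C}" "D \<in> {C. is_mucat C}" "E \<in> {C. is_mucat C}"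
          "F \<in> mufunctors C D" "G \<in> mufunctors D E" for C D E F G
        using nerve_map_comp[OF inf ms ms ms mufunctor_semifunctor mufunctor_semifunctor, of C D E F G] that by simp
    qed
    show "naturally_isomorphic ?S ?S (\<lambda>X. X) (\<lambda>X Y f. f) (\<lambda>X. ?N (?F X)) (\<lambda>X Y f. nerve_map (?F X) (?Fm X Y f))"
      unfolding naturally_isomorphic_def
    proof (intro exI[of _ to_nerve] conjI ballI)
      fix X assume XO: "X \<in> Ob ?S"
      note act = weak_skeleton[OF X(3,2,4)[OF XO]]
      have T: "to_nerve X \<in> presheaf_hom Delta X (?N (?F X))"
        "\<And>n. bij_betw (to_nerve X n) (simp X n) (simp (?N (?F X)) n)"
        unfolding mucat_of_def
        by (rule to_nerve_hom[OF inf X(3,1,2)[OF XO] ext[OF FX[OF XO], unfolded mucat_of_def] act[unfolded mucat_of_def]]; assumption)+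
      note I = presheaf_inverse[OF X(3)[OF XO] X(3)[OF GX[OF FX[OF XO]]] T]
      show "is_iso ?S X (?N (?F X)) (to_nerve X)"
        unfolding is_iso_def Hom Cmp Idm
        by (rule conjI[OF T(1)], rule bexI[OF _ I(1)], rule conjI[OF I(2) I(3)])
    next
      fix X Y f assume XY: "X \<in> Ob ?S" "Y \<in> Ob ?S" and f: "f \<in> Hom ?S X Y"
      have "to_nerve Y n (f n x) = nerve_map (?F X) (?Fm X Y f) n (to_nerve X n x)" if "x \<in> simp X n" for n x
        unfolding mucat_of_def
        by (rule to_nerve_natural[OF inf X(1,2)[OF XY(1)] X(1,2)[OF XY(2)] nm[OF f] that])
      then show "Cmp ?S X Y (?N (?F Y)) (to_nerve Y) f =
          Cmp ?S X (?N (?F X)) (?N (?F Y)) (nerve_map (?F X) (?Fm X Y f)) (to_nerve X)"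
        by (auto simp: Cmp compose_def fun_eq_iff)
    qed
    show "naturally_isomorphic ?M ?M (\<lambda>C. ?F (?N C)) (\<lambda>C D F. ?Fm (?N C) (?N D) (nerve_map C F)) (\<lambda>C. C) (\<lambda>C D F. F)"
      unfolding naturally_isomorphic_def muCat_simps
    proof (intro exI[of _ "\<lambda>C. counit (?F (?N C))"] conjI ballI)
      fix C :: "'u mucat" assume "C \<in> {C. is_mucat C}"
      then have C: "is_mucat C" by simp
      note FG = FX[OF GX[OF C]]
      note S = counit_sfun[OF inf site ext[OF C] ms[OF C], of "unit_data (?N C)", folded mucat_of_def]
        and B = counit_bij[OF inf musemicat_premu[OF ms[OF C]]]
      note I = mkfun_inverse[OF ms[OF FG] ms[OF C] S, unfolded mucat_of_sets simp_nerve, OF B, folded counit_def]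
      show "is_iso ?M (?F (?N C)) C (counit (?F (?N C)))"
        unfolding is_iso_def muCat_simps
        using cu[OF C] mufunctor_inverse[OF FG C cu[OF C] I] I by blast
    next
      fix C D :: "'u mucat" and F assume a: "C \<in> {C. is_mucat C}" "D \<in> {C. is_mucat C}" "F \<in> mufunctors C D"
      then have CD: "is_mucat C" "is_mucat D" by simp_all
      show "mufun_comp (?F (?N C)) (counit (?F (?N D))) (?Fm (?N C) (?N D) (nerve_map C F)) =
          mufun_comp (?F (?N C)) F (counit (?F (?N C)))"
        unfolding mucat_of_def
        by (rule counit_natural[OF inf site ext[OF CD(1)] ext[OF CD(2)] ms[OF CD(1)] ms[OF CD(2)] mufunctor_semifunctor[OF a(3)] Gh[OF CD a(3)]])
    qed
  qed
qed

theorem theorem3p3p6: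
  assumes "infinite (UNIV :: 'u set)"
  shows "equivalent_categories
           (two_Segal_semisimplicial_sets :: ('u simp_data, nat \<Rightarrow> 'u \<Rightarrow> 'u) cat)
           (muSCat :: ('u musemicat, 'u mufun) cat) \<and>
         equivalent_categories
           (unital_two_Segal_simplicial_sets :: ('u simp_data, nat \<Rightarrow> 'u \<Rightarrow> 'u) cat)
           (muCat :: ('u mucat, 'u mufun) cat)"
  using semicategory_equivalence[OF assms] category_equivalence[OF assms] by (rule conjI)

end
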